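(* Let $\nu$ be a positive integer and $H$ a finite $\mathbb Z/\nu\mathbb Z$-module. Then $$\#\operatorname{Sym}^2H=\mathbb E\bigl(\#\operatorname{Surj}(\mathrm{Sel}^{\mathrm{BKLPR}}_\nu,H)\bigr)=\mathbb E\bigl(\#\operatorname{Surj}(\mathrm{Sel}^{\mathrm{BKLPR},0}_\nu,H)\bigr)=\mathbb E\bigl(\#\operatorname{Surj}(\mathrm{Sel}^{\mathrm{BKLPR},1}_\nu,H)\bigr).$$
   Context: $\operatorname{Surj}(X,Y)$ is the set of surjective homomorphisms, and for a random variable valued in finite abelian groups $\mathbb E$ denotes expectation. For a prime $\ell$ and integers $m,r\ge0$ with $m-r\in2\mathbb Z_{\ge0}$, let $\mathscr T_{m,r,\ell}$ be the distribution of $(\operatorname{coker}M)_{\mathrm{tors}}$, where $M$ is drawn from the Haar (natural $\ell$-adic) probability measure on the set of alternating $m\times m$ matrices over $\mathbb Z_\ell$ of rank $m-r$ (obtained by normalizing $S\mapsto\lim_e \ell^{-de}\#(S\bmod\ell^e)$, $d$ the dimension of the corresponding variety). As $m\to\infty$ through integers with $m-r\in2\mathbb Z_{\ge0}$, these converge to a distribution $\mathscr T_{r,\ell}$ on finite abelian $\ell$-groups. For $\nu=\prod_{\ell\mid\nu}\ell^{a_\ell}$, $\mathscr T_{r,\mathbb Z/\nu\mathbb Z}$ is the distribution of $\bigoplus_{\ell\mid\nu}T_\ell[\nu]$ with $T_\ell$ drawn independently from $\mathscr T_{r,\ell}$. Let $\mathscr T_{1,\mathbb Z/\nu\mathbb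 Z}\oplus\mathbb Z/\nu\mathbb Z$ be the law of $G\oplus\mathbb Z/\nu\mathbb Z$ with $G$ drawn from $\mathscr T_{1,\mathbb Z/\nu\mathbb Z}$. Define $\mathrm{Sel}^{\mathrm{BKLPR},0}_\nu:=\mathscr T_{0,\mathbb Z/\nu\mathbb Z}$, $\mathrm{Sel}^{\mathrm{BKLPR},1}_\nu:=\mathscr T_{1,\mathbb Z/\nu\mathbb Z}\oplus\mathbb Z/\nu\mathbb Z$, and $\mathrm{Sel}^{\mathrm{BKLPR}}_\nu:=\frac12\mathrm{Sel}^{\mathrm{BKLPR},0}_\nu+\frac12\mathrm{Sel}^{\mathrm{BKLPR},1}_\nu$ (mixture of probability distributions). *)

theory Defs
  imports
    "HOL-Algebra.IntRing"
    "HOL-Algebra.Module"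
    "HOL-Algebra.Product_Groups"
    "HOL-Algebra.Elementary_Groups"
    "HOL-Algebra.Generated_Groups"
    "HOL-Algebra.Free_Abelian_Groups"
    "HOL-Probability.Product_PMF"
    "HOL-Computational_Algebra.Primes"
begin

section \<open>Finite abelian groups up to isomorphism\<close>

text \<open>
  A random finite abelian group is a random element of the set of values of \<open>iso_rep\<close>, which
  picks one group with carrier in \<^typ>\<open>nat\<close> from each isomorphism class: for finite abelian
  groups, \<open>iso_rep G = iso_rep G'\<close> holds iff \<open>G \<cong> G'\<close>.
\<close>

definition iso_rep :: "('a, 'b) monoid_scheme \<Rightarrow> nat monoid" where
  "iso_rep G = (SOME K :: nat monoid. comm_group K \<and> G \<cong> K)"

definition tors :: "('a, 'b) monoid_scheme \<Rightarrow> ('a, 'b) monoid_scheme" where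
  "tors G = G\<lparr>carrier := {x \<in> carrier G. \<exists>n::nat. n > 0 \<and> x [^]\<^bsub>G\<^esub> n = \<one>\<^bsub>G\<^esub>}\<rparr>"

definition ntors :: "nat \<Rightarrow> ('a, 'b) monoid_scheme \<Rightarrow> ('a, 'b) monoid_scheme" where
  "ntors n G = G\<lparr>carrier := {x \<in> carrier G. x [^]\<^bsub>G\<^esub> n = \<one>\<^bsub>G\<^esub>}\<rparr>"

text \<open>
  The library's \<^const>\<open>epi\<close> does not constrain a map outside the carrier, so the maps are
  made extensional in order to be counted.
\<close>

definition Surj :: "('a, 'c) monoid_scheme \<Rightarrow> ('b, 'd) monoid_scheme \<Rightarrow> ('a \<Rightarrow> 'b) set" where
  "Surj G H = epi G H \<inter> extensional (carrier G)"

text \<open>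
  The symmetric square of an abelian group, written multiplicatively: generators are the symbols
  \<open>(x, y)\<close>, subject to biadditivity and symmetry. On a \<open>\<int>/\<nu>\<int>\<close>-module the relations
  \<open>(a x, y) = a (x, y) = (x, a y)\<close> follow from biadditivity, so this is also the symmetric square
  over \<open>\<int>/\<nu>\<int>\<close>.
\<close>

definition Sym2_rels :: "('a, 'b) monoid_scheme \<Rightarrow> (('a \<times> 'a) \<Rightarrow>\<^sub>0 int) set" where
  "Sym2_rels H =
     {frag_of (x \<otimes>\<^bsub>H\<^esub> y, z) - frag_of (x, z) - frag_of (y, z) | x y z.
        x \<in> carrier H \<and> y \<in> carrier H \<and> z \<in> carrier H} \<union>
     {frag_of (z, x \<otimes>\<^bsub>H\<^esub> y) - frag_of (z, x) - frag_of (z, y) | x y z.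
        x \<in> carrier H \<and> y \<in> carrier H \<and> z \<in> carrier H} \<union>
     {frag_of (x, y) - frag_of (y, x) | x y. x \<in> carrier H \<and> y \<in> carrier H}"

definition Sym2 :: "('a, 'b) monoid_scheme \<Rightarrow> (('a \<times> 'a) \<Rightarrow>\<^sub>0 int) set monoid" where
  "Sym2 H = (let F = free_Abelian_group (carrier H \<times> carrier H)
             in F Mod generate F (Sym2_rels H))"


section \<open>Alternating matrices over the l-adic integers\<close>

text \<open>
  \<open>\<int>\<^sub>\<ell>\<close> is the inverse limit of the rings \<open>\<int>/\<ell>\<^sup>e\<close>: an element \<open>x\<close> is the
  compatible sequence of its reduced residues, \<open>x e\<close> being \<open>x mod \<ell>\<^sup>e\<close>.
\<close>

definition Zl :: "nat \<Rightarrow> (nat \<Rightarrow> int) ring" where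
  "Zl l = \<lparr>carrier = {x. \<forall>e. x e \<in> {0..<int l ^ e} \<and> x (Suc e) mod int l ^ e = x e},
           monoid.mult = (\<lambda>x y e. (x e * y e) mod int l ^ e),
           one = (\<lambda>e. 1 mod int l ^ e),
           ring.zero = (\<lambda>e. 0),
           ring.add = (\<lambda>x y e. (x e + y e) mod int l ^ e)\<rparr>"

type_synonym lmat = "nat \<times> nat \<Rightarrow> nat \<Rightarrow> int"

definition alt_mats :: "nat \<Rightarrow> nat \<Rightarrow> lmat set" where
  "alt_mats l m = {M \<in> ({..<m} \<times> {..<m}) \<rightarrow>\<^sub>E carrier (Zl l).
     (\<forall>i<m. M (i, i) = \<zero>\<^bsub>Zl l\<^esub>) \<and> (\<forall>i<m. \<forall>j<m. M (i, j) = \<ominus>\<^bsub>Zl l\<^esub> M (j, i))}"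

text \<open>
  The rank is that over the fraction field \<open>\<rat>\<^sub>\<ell>\<close>; columns are linearly independent over
  \<open>\<rat>\<^sub>\<ell>\<close> iff they are so over \<open>\<int>\<^sub>\<ell>\<close>, by clearing denominators.
\<close>

definition indep_cols :: "nat \<Rightarrow> nat \<Rightarrow> lmat \<Rightarrow> nat set \<Rightarrow> bool" where
  "indep_cols l m M J \<longleftrightarrow>
     (\<forall>c \<in> J \<rightarrow> carrier (Zl l).
        (\<forall>i<m. (\<Oplus>\<^bsub>Zl l\<^esub>j\<in>J. M (i, j) \<otimes>\<^bsub>Zl l\<^esub> c j) = \<zero>\<^bsub>Zl l\<^esub>)
        \<longrightarrow> (\<forall>j\<in>J. c j = \<zero>\<^bsub>Zl l\<^esub>))"

definition mat_rank :: "nat \<Rightarrow> nat \<Rightarrow> lmat \<Rightarrow> nat" where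
  "mat_rank l m M = Max {card J | J. J \<subseteq> {..<m} \<and> indep_cols l m M J}"

definition alt_mats_corank :: "nat \<Rightarrow> nat \<Rightarrow> nat \<Rightarrow> lmat set" where
  "alt_mats_corank l m r = {M \<in> alt_mats l m. mat_rank l m M = m - r}"

definition Zl_vecs :: "nat \<Rightarrow> nat \<Rightarrow> (nat \<Rightarrow> nat \<Rightarrow> int) monoid" where
  "Zl_vecs l m = product_group {..<m} (\<lambda>_. add_monoid (Zl l))"

definition mat_image :: "nat \<Rightarrow> nat \<Rightarrow> lmat \<Rightarrow> (nat \<Rightarrow> nat \<Rightarrow> int) set" where
  "mat_image l m M =
     (\<lambda>x. \<lambda>i\<in>{..<m}. \<Oplus>\<^bsub>Zl l\<^esub>j\<in>{..<m}. M (i, j) \<otimes>\<^bsub>Zl l\<^esub> x j) ` carrier (Zl_vecs l m)"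

definition coker :: "nat \<Rightarrow> nat \<Rightarrow> lmat \<Rightarrow> (nat \<Rightarrow> nat \<Rightarrow> int) set monoid" where
  "coker l m M = Zl_vecs l m Mod mat_image l m M"


section \<open>The distributions\<close>

definition mat_mod :: "nat \<Rightarrow> lmat set \<Rightarrow> (nat \<times> nat \<Rightarrow> int) set" where
  "mat_mod e S = (\<lambda>M ij. M ij e) ` S"

text \<open>
  The dimension of the variety of alternating \<open>m \<times> m\<close> matrices of rank \<open>n = m - r\<close>:
  the radical is a point of the Grassmannian of \<open>r\<close>-planes in \<open>m\<close>-space, of dimension
  \<open>n r\<close>, and the induced form on the quotient adds \<open>n (n - 1) / 2\<close>.
\<close>

definition alt_dim :: "nat \<Rightarrow> nat \<Rightarrow> nat" where
  "alt_dim m r = (m - r) * r + (m - r) * (m - r - 1) div 2"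

definition alt_vol :: "nat \<Rightarrow> nat \<Rightarrow> nat \<Rightarrow> lmat set \<Rightarrow> real" where
  "alt_vol l m r S = lim (\<lambda>e. real (card (mat_mod e S)) / real l ^ (alt_dim m r * e))"

text \<open>
  The probability of \<open>S\<close> under the natural probability measure on the alternating \<open>m \<times> m\<close>
  matrices of rank \<open>m - r\<close>. The limit formula gives the measure only of sufficiently regular sets;
  below it is evaluated only where the torsion of the cokernel has a given isomorphism class
  (a single orbit of \<open>GL\<^sub>m(\<int>\<^sub>\<ell>)\<close>, or empty) and on the whole space.
\<close>

definition alt_prob :: "nat \<Rightarrow> nat \<Rightarrow> nat \<Rightarrow> lmat set \<Rightarrow> real" where
  "alt_prob l m r S = alt_vol l m r S / alt_vol l m r (alt_mats_corank l m r)"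

definition T_mat :: "nat \<Rightarrow> nat \<Rightarrow> nat \<Rightarrow> nat monoid pmf" where
  "T_mat m r l = embed_pmf (\<lambda>K.
     alt_prob l m r {M \<in> alt_mats_corank l m r. iso_rep (tors (coker l m M)) = K})"

definition T_lim :: "nat \<Rightarrow> nat \<Rightarrow> nat monoid pmf" where
  "T_lim r l = embed_pmf (\<lambda>K. lim (\<lambda>k. pmf (T_mat (r + 2 * k) r l) K))"

definition T_mod :: "nat \<Rightarrow> nat \<Rightarrow> nat monoid pmf" where
  "T_mod r \<nu> =
     map_pmf (\<lambda>T. iso_rep (product_group {l. prime l \<and> l dvd \<nu>} (\<lambda>l. ntors \<nu> (T l))))
       (Pi_pmf {l. prime l \<and> l dvd \<nu>} undefined (\<lambda>l. T_lim r l))"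

definition Sel0 :: "nat \<Rightarrow> nat monoid pmf" where
  "Sel0 \<nu> = T_mod 0 \<nu>"

definition Sel1 :: "nat \<Rightarrow> nat monoid pmf" where
  "Sel1 \<nu> = map_pmf (\<lambda>G. iso_rep (G \<times>\<times> integer_mod_group \<nu>)) (T_mod 1 \<nu>)"

definition Sel :: "nat \<Rightarrow> nat monoid pmf" where
  "Sel \<nu> = bind_pmf (bernoulli_pmf (1 / 2)) (\<lambda>b. if b then Sel1 \<nu> else Sel0 \<nu>)"

end

theory Submission
  imports Defs "HOL-Number_Theory.Cong" "HOL-Real_Asymp.Real_Asymp"
begin

text \<open>
  A surjection from \<open>coker M\<close> onto \<open>H\<close> is a generating tuple \<open>h\<close> of \<open>H\<close> satisfying the relations given by the
  columns of \<open>M\<close>. For a uniform alternating \<open>m \<times> m\<close> matrix \<open>M\<close> modulo the exponent of \<open>H\<close>, the values of these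
  relations are uniform in the image of the alternating matrices in \<open>H^m\<close>, which has order
  \<open>|H|^m / |Sym\<^sup>2 H|\<close>; hence the expected number of surjections is \<open>|Sym\<^sup>2 H|\<close> times the proportion of
  generating tuples in \<open>H^m\<close>.

  For \<open>r \<le> 1\<close> corank \<open>r\<close> is the generic corank, so the measure on the matrices is ordinary Haar measure.
  Symplectic elimination identifies the torsion of the cokernel with a diagonal group, which is read off
  \<open>M mod l^e\<close> unless one of the elementary divisors is divisible by \<open>l^e\<close>; in that exceptional case
  there are at least \<open>l^((r + 2) e)\<close> solutions in \<open>\<int>/l^e\<close>, so by Markov's inequality and the moment formula for
  cyclic groups its probability tends to \<open>0\<close>. For \<open>r = 1\<close> the free part of the cokernel supplies the summand
  \<open>\<int>/\<nu>\<int>\<close>.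

  To let \<open>m\<close> tend to infinity, eliminate with a unit pivot in the last row, which exists with probability
  \<open>1 - l^(-(m + 1))\<close> for size \<open>m + 2\<close> and leaves a uniform matrix of size \<open>m\<close> with the same cokernel torsion.
  So the probabilities of each group, divided by a convergent product, increase with \<open>m\<close>, and monotone
  convergence passes both the total mass and the moments to the limit. Finally, surjections and symmetric
  squares are multiplicative over the primary decomposition.
\<close>

section \<open>Compatible sequences of residues\<close>

text \<open>The given distributions are limits of counts, so no measure on l-adic matrices is
  constructed: every probability is a limit over \<open>e\<close> of a proportion of residue
  matrices modulo \<open>l^e\<close>. The obstacle is loss of mass, in the limit over
  \<open>e\<close> and again in the limit over the size. \<open>embed_pmf\<close> has the intended
  values only if the weights have total mass 1, and pointwise convergence of the weights gives
  neither this nor the moments. Each limit is therefore made monotone: a type visible at one level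
  persists at all higher ones, and the factors lost in growing the matrix have partial products
  above 1/4. Total mass is then the same computation with weight 1. The exceptional matrices are
  rare because the subgroups of the cyclic group of order \<open>l^e\<close> form a chain of
  \<open>e + 1\<close> members, which bounds the mean number of solutions by
  \<open>(e + 1) l^e\<close>, against at least \<open>l^((r + 2) e)\<close> solutions of an
  exceptional matrix. The symmetric square enters through the map from \<open>H^m\<close> to it that
  sends \<open>(g_j)\<close> to the sum of the \<open>h_j g_j\<close>: for a generating tuple
  \<open>h\<close> it is onto, and its kernel is the image of the alternating matrices.\<close>

text \<open>
  \<open>l\<close>-adic integers are handled as unreduced compatible sequences of integers, with pointwise arithmetic
  and with congruence modulo \<open>l^e\<close> at every level \<open>e\<close> in place of equality.
\<close>

definition compat :: "nat \<Rightarrow> (nat \<Rightarrow> int) \<Rightarrow> bool" where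
  "compat l x \<longleftrightarrow> (\<forall>e. [x (Suc e) = x e] (mod int l ^ e))"

definition zeq :: "nat \<Rightarrow> (nat \<Rightarrow> int) \<Rightarrow> (nat \<Rightarrow> int) \<Rightarrow> bool" where
  "zeq l x y \<longleftrightarrow> (\<forall>e. [x e = y e] (mod int l ^ e))"

text \<open>The valuation is exactly \<open>a\<close>. Two levels occur because the entry at level
  \<open>a\<close> is determined only modulo \<open>l^a\<close>: divisibility by \<open>l^a\<close>
  is read there, but non-divisibility by \<open>l^(a + 1)\<close> needs level
  \<open>a + 1\<close>.\<close>

definition val_eq :: "nat \<Rightarrow> (nat \<Rightarrow> int) \<Rightarrow> nat \<Rightarrow> bool" where
  "val_eq l d a \<longleftrightarrow> int l ^ a dvd d a \<and> \<not> int l ^ Suc a dvd d (Suc a)"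

lemma compat_cong:
  assumes "compat l x" "a \<le> b"
  shows "[x b = x a] (mod int l ^ a)"
  using assms(2)
proof (induction b rule: dec_induct)
  case base
  then show ?case by simp
next
  case (step n)
  have "[x (Suc n) = x n] (mod int l ^ a)"
    using assms(1) step(1) unfolding compat_def
    by (meson cong_dvd_modulus le_imp_power_dvd)
  then show ?case using step.IH by (rule cong_trans)
qed

lemma compat_dvd_iff:
  assumes "compat l x" "c \<le> a" "a \<le> b"
  shows "int l ^ c dvd x b \<longleftrightarrow> int l ^ c dvd x a"
proof -
  have "[x b = x a] (mod int l ^ c)"
    using compat_cong[OF assms(1,3)] assms(2) by (meson cong_dvd_modulus le_imp_power_dvd)
  then show ?thesis by (rule cong_dvd_iff)
qed

lemma compat_const [simp]: "compat l (\<lambda>e. k)"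
  by (simp add: compat_def)

lemma compat_add [intro]: "compat l x \<Longrightarrow> compat l y \<Longrightarrow> compat l (\<lambda>e. x e + y e)"
  by (simp add: compat_def cong_add)

lemma compat_diff [intro]: "compat l x \<Longrightarrow> compat l y \<Longrightarrow> compat l (\<lambda>e. x e - y e)"
  by (simp add: compat_def cong_diff)

lemma compat_uminus [intro]: "compat l x \<Longrightarrow> compat l (\<lambda>e. - x e)"
  by (simp add: compat_def cong_minus_minus_iff)

lemma compat_mult [intro]: "compat l x \<Longrightarrow> compat l y \<Longrightarrow> compat l (\<lambda>e. x e * y e)"
  by (simp add: compat_def cong_mult)

lemma compat_sum [intro]:
  "(\<And>i. i \<in> I \<Longrightarrow> compat l (x i)) \<Longrightarrow> compat l (\<lambda>e. \<Sum>i\<in>I. x i e)"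
  by (simp add: compat_def cong_sum)

text \<open>The \<open>l\<close>-part of \<open>d\<close> is at most \<open>l^a\<close>, so
  cancelling \<open>d\<close> costs at most \<open>a\<close> digits of precision. This explains the
  shifts by \<open>a\<close> between levels below.\<close>

lemma prime_power_dvd_cancel:
  fixes l :: nat and q d :: int
  assumes "prime l" "\<not> int l ^ Suc a dvd d" "int l ^ (a + e) dvd q * d"
  shows "int l ^ e dvd q"
proof -
  have pl: "prime (int l)" using assms(1) by simp
  have "d \<noteq> 0" using assms(2) by auto
  then obtain u where u: "d = int l ^ multiplicity (int l) d * u" "\<not> int l dvd u"
    using multiplicity_decompose'[of d "int l"] pl
    by (metis not_prime_unit)
  define b where "b = multiplicity (int l) d"
  have "b \<le> a" using assms(2) u(1) unfolding b_def
    by (metis dvd_triv_left le_imp_power_dvd dvd_trans not_less_eq_eq)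
  have co: "coprime (int l ^ (a + e)) u"
    using u(2) pl by (simp add: coprime_power_left_iff prime_imp_coprime)
  have "int l ^ (a + e) dvd (q * int l ^ b) * u"
    using assms(3) u(1) unfolding b_def by (simp add: ac_simps)
  then have "int l ^ (a + e) dvd q * int l ^ b"
    using co by (simp add: coprime_dvd_mult_left_iff)
  then have "int l ^ (e + b) dvd q * int l ^ b"
    using \<open>b \<le> a\<close> by (intro dvd_trans[OF le_imp_power_dvd[of "e + b" "a + e"]]) auto
  then have "int l ^ e * int l ^ b dvd q * int l ^ b" by (simp add: power_add)
  moreover have "int l ^ b \<noteq> 0" using assms(1) by (auto simp: prime_gt_0_nat)
  ultimately show ?thesis by (metis dvd_mult_cancel_right)
qed

lemma val_eq_dvd:
  assumes "compat l d" "val_eq l d a" "a \<le> e"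
  shows "int l ^ a dvd d e"
  using assms compat_dvd_iff[of l d a a e] by (auto simp: val_eq_def)

lemma val_eq_not_dvd:
  assumes "compat l d" "val_eq l d a" "Suc a \<le> e"
  shows "\<not> int l ^ Suc a dvd d e"
  using assms compat_dvd_iff[of l d "Suc a" "Suc a" e] by (auto simp: val_eq_def)

text \<open>The l-adic integers have no zero divisors: vanishing of the product at level
  \<open>a + e\<close> leaves \<open>z\<close> divisible by \<open>l^e\<close> after the loss of
  \<open>a\<close> digits.\<close>

lemma zeq_cancel:
  assumes "prime l" "compat l d" "val_eq l d a" "compat l z" "zeq l (\<lambda>e. d e * z e) (\<lambda>e. 0)"
  shows "zeq l z (\<lambda>e. 0)"
  unfolding zeq_def
proof
  fix e
  show "[z e = 0] (mod int l ^ e)"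
  proof (cases "e = 0")
    case False
    have "int l ^ (a + e) dvd z (a + e) * d (a + e)"
      using assms(5) by (simp add: zeq_def cong_0_iff mult.commute)
    moreover have "\<not> int l ^ Suc a dvd d (a + e)"
      using False by (intro val_eq_not_dvd[OF assms(2,3)]) simp
    ultimately have "int l ^ e dvd z (a + e)"
      using prime_power_dvd_cancel[OF assms(1)] by blast
    then show ?thesis using compat_dvd_iff[OF assms(4), of e e "a + e"] by (simp add: cong_0_iff)
  qed simp
qed

text \<open>The first level at which \<open>d\<close> is nonzero is positive, since
  \<open>l^0\<close> divides everything; the valuation is its predecessor.\<close>

lemma nonzero_val_eq:
  assumes "compat l d" "\<not> zeq l d (\<lambda>e. 0)"
  obtains a where "val_eq l d a"
proof -
  obtain e where "\<not> int l ^ e dvd d e" using assms(2) by (auto simp: zeq_def cong_0_iff)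
  define b where "b = (LEAST e. \<not> int l ^ e dvd d e)"
  have b: "\<not> int l ^ b dvd d b" unfolding b_def by (rule LeastI) fact
  then obtain a where "b = Suc a" by (cases b) auto
  moreover have "int l ^ a dvd d a"
    using not_less_Least[of a "\<lambda>e. \<not> int l ^ e dvd d e"] \<open>b = Suc a\<close> by (auto simp: b_def)
  ultimately show ?thesis using that b by (auto simp: val_eq_def)
qed

text \<open>Exact division by an element that need not be a unit. The residues at level
  \<open>e\<close> do not determine the quotient modulo \<open>l^e\<close>, so \<open>q e\<close> is
  taken from level \<open>e + a\<close>; cancelling the valuation \<open>a\<close> there shows that
  the choices are compatible.\<close>

lemma compat_quotient:
  assumes l: "prime l" and d: "compat l d" "val_eq l d a" and x: "compat l x" "int l ^ a dvd x a"
  obtains q where "compat l q" "\<And>e. [q e * d e = x e] (mod int l ^ e)"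
proof -
  have "\<exists>q. [q * d (e + a) = x (e + a)] (mod int l ^ (e + a))" for e
  proof -
    have dv: "int l ^ a dvd d (e + a)" "int l ^ a dvd x (e + a)"
      using val_eq_dvd[OF d] compat_dvd_iff[OF x(1), of a a "e + a"] x(2) by auto
    then obtain u x' where u: "d (e + a) = int l ^ a * u" and x': "x (e + a) = int l ^ a * x'"
      by (auto elim!: dvdE)
    show ?thesis
    \<comment> \<open>At level \<open>a\<close> itself the non-divisibility of \<open>d\<close> by
      \<open>l^(a + 1)\<close> is not visible, but there both sides vanish modulo
      \<open>l^a\<close>.\<close>
    proof (cases "e = 0")
      case True
      then show ?thesis using dv by (intro exI[of _ 0]) (simp add: cong_def)
    next
      case False
      then have "\<not> int l ^ Suc a dvd d (e + a)" by (intro val_eq_not_dvd[OF d]) simp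
      then have "\<not> int l dvd u" using u by (auto simp: mult.commute)
      then have "coprime u (int l ^ e)"
        using l prime_imp_coprime[of "int l" u] by (simp add: coprime_commute)
      then obtain v where "[u * v = 1] (mod int l ^ e)"
        using cong_solve_coprime_int by blast
      then have "[u * v * x' = 1 * x'] (mod int l ^ e)" by (rule cong_scalar_right)
      then have "[int l ^ a * (u * v * x') = int l ^ a * x'] (mod int l ^ a * int l ^ e)"
        by (simp add: cong_iff_dvd_diff flip: right_diff_distrib)
      then have "[(x' * v) * (int l ^ a * u) = int l ^ a * x'] (mod int l ^ e * int l ^ a)"
        by (simp add: ac_simps)
      then have "[(x' * v) * d (e + a) = x (e + a)] (mod int l ^ (e + a))"
        by (simp only: u x' power_add)
      then show ?thesis by blast
    qed
  qed
  then obtain q where q: "\<And>e. [q e * d (e + a) = x (e + a)] (mod int l ^ (e + a))" by metis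
  have "compat l q"
    unfolding compat_def
  proof
    fix e
    show "[q (Suc e) = q e] (mod int l ^ e)"
    proof (cases "e = 0")
      case False
      have dv: "int l ^ (e + a) dvd int l ^ (Suc e + a)" by (intro le_imp_power_dvd) simp
      have "[q (Suc e) * d (Suc e + a) = x (Suc e + a)] (mod int l ^ (e + a))"
        using q[of "Suc e"] dv by (rule cong_dvd_modulus)
      moreover have "[d (Suc e + a) = d (e + a)] (mod int l ^ (e + a))"
        "[x (Suc e + a) = x (e + a)] (mod int l ^ (e + a))"
        using d(1) x(1) by (auto simp: compat_def)
      ultimately have "[q (Suc e) * d (e + a) = q e * d (e + a)] (mod int l ^ (e + a))"
        using q[of e] by (meson cong_scalar_left cong_sym cong_trans)
      then have "int l ^ (a + e) dvd (q (Suc e) - q e) * d (e + a)"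
        by (simp add: cong_iff_dvd_diff left_diff_distrib add.commute)
      moreover have "\<not> int l ^ Suc a dvd d (e + a)"
        using False by (intro val_eq_not_dvd[OF d]) simp
      ultimately have "int l ^ e dvd q (Suc e) - q e"
        using prime_power_dvd_cancel[OF l] by blast
      then show ?thesis by (simp add: cong_iff_dvd_diff)
    qed simp
  qed
  moreover have "[q e * d e = x e] (mod int l ^ e)" for e
  proof -
    have dv: "int l ^ e dvd int l ^ (e + a)" by (intro le_imp_power_dvd) simp
    have "[q e * d (e + a) = x (e + a)] (mod int l ^ e)"
      using q[of e] dv by (rule cong_dvd_modulus)
    moreover have "[d (e + a) = d e] (mod int l ^ e)" "[x (e + a) = x e] (mod int l ^ e)"
      using compat_cong d(1) x(1) by auto
    ultimately show ?thesis by (meson cong_scalar_left cong_sym cong_trans)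
  qed
  ultimately show thesis by (rule that)
qed

section \<open>Symplectic elimination\<close>

definition alt_seq :: "nat \<Rightarrow> nat set \<Rightarrow> (nat \<Rightarrow> nat \<Rightarrow> nat \<Rightarrow> int) \<Rightarrow> bool" where
  "alt_seq l I M \<longleftrightarrow> (\<forall>i\<in>I. \<forall>j\<in>I. compat l (M i j)) \<and> (\<forall>i\<in>I. \<forall>e. [M i i e = 0] (mod int l ^ e)) \<and>
     (\<forall>i\<in>I. \<forall>j\<in>I. \<forall>e. [M i j e = - M j i e] (mod int l ^ e))"

text \<open>\<open>\<alpha> p\<close> and \<open>\<beta> p\<close> are the quotients of
  \<open>M p j\<close> and \<open>M p i\<close> by the pivot \<open>M i j\<close>. They are carried
  along as sequences because they cannot be computed from the residues of a single level; their
  existence says that the pivot divides the columns \<open>i\<close> and \<open>j\<close> on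
  \<open>I\<close>.\<close>

definition pivot :: "nat \<Rightarrow> nat set \<Rightarrow> (nat \<Rightarrow> nat \<Rightarrow> nat \<Rightarrow> int) \<Rightarrow> nat \<Rightarrow> nat \<Rightarrow> nat \<Rightarrow>
    (nat \<Rightarrow> nat \<Rightarrow> int) \<Rightarrow> (nat \<Rightarrow> nat \<Rightarrow> int) \<Rightarrow> bool" where
  "pivot l I M i j a \<alpha> \<beta> \<longleftrightarrow> val_eq l (M i j) a \<and>
     (\<forall>p\<in>I. compat l (\<alpha> p) \<and> compat l (\<beta> p) \<and>
        (\<forall>e. [\<alpha> p e * M i j e = M p j e] (mod int l ^ e)) \<and>
        (\<forall>e. [\<beta> p e * M i j e = M p i e] (mod int l ^ e)))"

text \<open>The Schur complement of the block with entries \<open>0, d, -d, 0\<close> in the rows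
  and columns \<open>i, j\<close>, where \<open>d\<close> is the pivot. The division by
  \<open>d\<close> is absorbed in \<open>\<alpha>\<close> and \<open>\<beta>\<close>, so
  \<open>d\<close> need not be a unit.\<close>

definition schur where
  "schur M i j \<alpha> \<beta> = (\<lambda>p q e. M p q e - \<alpha> p e * M i q e + \<beta> p e * M j q e :: int)"

text \<open>
  \<open>sympl l I R M \<kappa>\<close>: elimination with pivots dividing all remaining entries reduces \<open>M\<close> to \<open>2 \<times> 2\<close> blocks in
  the pairs \<open>i, j\<close>, with entries of valuation \<open>\<kappa> i = \<kappa> j\<close>, and a zero block on \<open>R\<close>, where \<open>card R \<le> 1\<close>. A chain
  exists only if the remaining entries do not all vanish before the last step.
\<close>

inductive sympl :: "nat \<Rightarrow> nat set \<Rightarrow> nat set \<Rightarrow> (nat \<Rightarrow> nat \<Rightarrow> nat \<Rightarrow> int) \<Rightarrow> (nat \<Rightarrow> nat) \<Rightarrow> bool"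
  for l :: nat where
  base: "finite I \<Longrightarrow> card I \<le> 1 \<Longrightarrow> sympl l I I M \<kappa>"
| step: "finite I \<Longrightarrow> i \<notin> I \<Longrightarrow> j \<notin> I \<Longrightarrow> i \<noteq> j \<Longrightarrow> \<kappa> i = a \<Longrightarrow> \<kappa> j = a \<Longrightarrow> pivot l I M i j a \<alpha> \<beta> \<Longrightarrow>
    sympl l I R (schur M i j \<alpha> \<beta>) \<kappa> \<Longrightarrow> sympl l (insert i (insert j I)) R M \<kappa>"

text \<open>Modulo \<open>N\<close> the entries \<open>A i q\<close> and \<open>A j q\<close> are
  \<open>- b q * d\<close> and \<open>- a q * d\<close>; the expression becomes
  \<open>A p q + (a p * b q - b p * a q) * d\<close>, which changes sign when \<open>p\<close> and
  \<open>q\<close> are exchanged.\<close>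

lemma schur_alternating:
  fixes N d :: int
  assumes "[A i i = 0] (mod N)" "[A j j = 0] (mod N)" "[A p q = - A q p] (mod N)"
    "[A i q = - A q i] (mod N)" "[A j q = - A q j] (mod N)" "[A i p = - A p i] (mod N)" "[A j p = - A p j] (mod N)"
    "[a p * d = A p j] (mod N)" "[b p * d = A p i] (mod N)" "[a q * d = A q j] (mod N)" "[b q * d = A q i] (mod N)"
  shows "[A p q - a p * A i q + b p * A j q = - (A q p - a q * A i p + b q * A j p)] (mod N)"
proof -
  have "[A p q - a p * A i q + b p * A j q = - A q p + a p * (b q * d) - b p * (a q * d)] (mod N)"
  proof -
    have "[a p * A i q = a p * (- (b q * d))] (mod N)"
      using assms by (meson cong_minus_minus_iff cong_scalar_left cong_sym cong_trans)
    moreover have "[b p * A j q = b p * (- (a q * d))] (mod N)"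
      using assms by (meson cong_minus_minus_iff cong_scalar_left cong_sym cong_trans)
    ultimately have "[A p q - a p * A i q + b p * A j q
       = - A q p - a p * (- (b q * d)) + b p * (- (a q * d))] (mod N)"
      using assms(3) by (intro cong_add cong_diff)
    then show ?thesis by (simp add: algebra_simps)
  qed
  moreover have "[- (A q p - a q * A i p + b q * A j p) = - (A q p - a q * (- (b p * d)) + b q * (- (a p * d)))] (mod N)"
  proof -
    have "[a q * A i p = a q * (- (b p * d))] (mod N)"
      using assms by (meson cong_minus_minus_iff cong_scalar_left cong_sym cong_trans)
    moreover have "[b q * A j p = b q * (- (a p * d))] (mod N)"
      using assms by (meson cong_minus_minus_iff cong_scalar_left cong_sym cong_trans)
    ultimately show ?thesis
      by (simp only: cong_minus_minus_iff) (intro cong_add cong_diff cong_refl)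
  qed
  ultimately show ?thesis by (simp add: cong_def algebra_simps)
qed

lemma alt_seq_schur:
  assumes A: "alt_seq l (insert i (insert j I)) M" and P: "pivot l I M i j a \<alpha> \<beta>"
  shows "alt_seq l I (schur M i j \<alpha> \<beta>)"
proof -
  have anti: "[schur M i j \<alpha> \<beta> p q e = - schur M i j \<alpha> \<beta> q p e] (mod int l ^ e)"
    if "p \<in> I" "q \<in> I" for p q e
    unfolding schur_def
    using A P that unfolding alt_seq_def pivot_def
    by (intro schur_alternating[where d = "M i j e" and A = "\<lambda>p q. M p q e"
          and a = "\<lambda>p. \<alpha> p e" and b = "\<lambda>p. \<beta> p e"]) auto
  \<comment> \<open>Antisymmetry yields only that twice the diagonal entry vanishes; here the two
    correction terms cancel each other.\<close>
  have diag: "[schur M i j \<alpha> \<beta> p p e = 0] (mod int l ^ e)" if p: "p \<in> I" for p e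
  proof -
    let ?N = "int l ^ e" and ?d = "M i j e"
    have "[M i p e = - (\<beta> p e * ?d)] (mod ?N)" "[M j p e = - (\<alpha> p e * ?d)] (mod ?N)"
      using A P p unfolding alt_seq_def pivot_def
      by (meson cong_minus_minus_iff cong_sym cong_trans insertCI)+
    then have "[M p p e - \<alpha> p e * M i p e + \<beta> p e * M j p e
       = 0 - \<alpha> p e * (- (\<beta> p e * ?d)) + \<beta> p e * (- (\<alpha> p e * ?d))] (mod ?N)"
      using A p unfolding alt_seq_def by (intro cong_add cong_diff cong_scalar_left) auto
    then show ?thesis by (simp add: schur_def)
  qed
  have "compat l (schur M i j \<alpha> \<beta> p q)" if "p \<in> I" "q \<in> I" for p q
    unfolding schur_def using A P that unfolding alt_seq_def pivot_def
    by (intro compat_add compat_diff compat_mult) auto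
  then show ?thesis using anti diag by (auto simp: alt_seq_def)
qed

lemma sympl_finite: "sympl l I R M \<kappa> \<Longrightarrow> finite I \<and> R \<subseteq> I \<and> card R \<le> 1 \<and> (\<exists>k. card I = card R + 2 * k)"
proof (induction rule: sympl.induct)
  case (step I i j \<kappa> a M \<alpha> \<beta> R)
  then obtain k where "card I = card R + 2 * k" by blast
  then have "card (insert i (insert j I)) = card R + 2 * Suc k" using step by simp
  then show ?case using step by blast
qed (use le_Suc_eq in auto)

text \<open>Makes the type a property of the residues modulo \<open>l^e\<close>, hence something
  that can be counted. The pivot positions of \<open>M\<close> are kept: their valuations lie below
  \<open>e\<close> and are visible in \<open>N\<close> as well. The point of the induction is that
  the two Schur complements agree modulo the full \<open>l^e\<close>, without loss of
  precision.\<close>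

lemma sympl_cong:
  assumes "sympl l I R M \<kappa>" "prime l" "alt_seq l I M" "alt_seq l I N"
    "\<And>s. s \<in> I - R \<Longrightarrow> \<kappa> s < e" "\<And>p q. p \<in> I \<Longrightarrow> q \<in> I \<Longrightarrow> [M p q e = N p q e] (mod int l ^ e)"
  shows "sympl l I R N \<kappa>"
  using assms
proof (induction arbitrary: N rule: sympl.induct)
  case (base I M \<kappa>)
  then show ?case by (simp add: sympl.base)
next
  case (step I i j \<kappa> a M \<alpha> \<beta> R)
  let ?I = "insert i (insert j I)"
  have RI: "R \<subseteq> I" using sympl_finite[OF step.hyps(8)] by auto
  have ae: "a < e" using step.prems(4)[of i] step.hyps RI by auto
  have P: "pivot l I M i j a \<alpha> \<beta>" by fact
  have cN: "compat l (N p q)" and cM: "compat l (M p q)" if "p \<in> ?I" "q \<in> ?I" for p q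
    using step.prems(2,3) that by (auto simp: alt_seq_def)
  have low: "[M p q e' = N p q e'] (mod int l ^ e')" if "p \<in> ?I" "q \<in> ?I" "e' \<le> e" for p q e'
  proof -
    have "[M p q e = N p q e] (mod int l ^ e')"
      using step.prems(5)[of p q] that by (meson cong_dvd_modulus le_imp_power_dvd)
    then show ?thesis
      using compat_cong[OF cM, of p q e' e] compat_cong[OF cN, of p q e' e] that
      by (meson cong_sym cong_trans)
  qed
  have vN: "val_eq l (N i j) a"
    using P low[of i j a] low[of i j "Suc a"] ae
    unfolding val_eq_def pivot_def by (metis Suc_leI cong_dvd_iff insertI1 insertI2 less_imp_le)
  have Mdv: "int l ^ a dvd M p q e" if "p \<in> I" "q \<in> {i, j}" for p q
  proof -
    have "int l ^ a dvd M i j e" using val_eq_dvd[of l "M i j" a e] P cM ae by (auto simp: pivot_def)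
    moreover have "[\<alpha> p e * M i j e = M p j e] (mod int l ^ a)" "[\<beta> p e * M i j e = M p i e] (mod int l ^ a)"
      using P that ae unfolding pivot_def
      by (meson cong_dvd_modulus le_imp_power_dvd less_imp_le)+
    ultimately have "int l ^ a dvd M p j e" "int l ^ a dvd M p i e"
      using cong_dvd_iff dvd_mult by blast+
    then show ?thesis using that by auto
  qed
  have Ndv: "int l ^ a dvd N p q a" if "p \<in> I" "q \<in> {i, j}" for p q
  proof -
    have "int l ^ a dvd M p q a"
      using Mdv[OF that] compat_dvd_iff[OF cM, of p q a a e] ae that by auto
    then show ?thesis using low[of p q a] ae that cong_dvd_iff by auto
  qed
  have "\<exists>f. compat l f \<and> (\<forall>e. [f e * N i j e = N p j e] (mod int l ^ e))" if "p \<in> I" for p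
    by (rule compat_quotient[OF \<open>prime l\<close> _ vN, of "N p j"]) (use cN Ndv that in auto)
  then obtain \<alpha>' where a': "\<And>p. p \<in> I \<Longrightarrow> compat l (\<alpha>' p) \<and> (\<forall>e. [\<alpha>' p e * N i j e = N p j e] (mod int l ^ e))"
    by metis
  have "\<exists>f. compat l f \<and> (\<forall>e. [f e * N i j e = N p i e] (mod int l ^ e))" if "p \<in> I" for p
    by (rule compat_quotient[OF \<open>prime l\<close> _ vN, of "N p i"]) (use cN Ndv that in auto)
  then obtain \<beta>' where b': "\<And>p. p \<in> I \<Longrightarrow> compat l (\<beta>' p) \<and> (\<forall>e. [\<beta>' p e * N i j e = N p i e] (mod int l ^ e))"
    by metis
  have P': "pivot l I N i j a \<alpha>' \<beta>'" using a' b' vN by (auto simp: pivot_def)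
  text \<open>The quotients agree only modulo \<open>l^(e - a)\<close>, but they are multiplied by entries divisible by \<open>l^a\<close>.\<close>
  have quot: "[x * m = x' * m'] (mod int l ^ e)"
    if "[x * M i j e = y] (mod int l ^ e)" "[x' * N i j e = y'] (mod int l ^ e)" "[y = y'] (mod int l ^ e)"
      "[m = m'] (mod int l ^ e)" "int l ^ a dvd m" for x x' y y' m m' :: int
  proof -
    have "[x' * N i j e = x' * M i j e] (mod int l ^ e)"
      using low[of i j e] by (auto intro: cong_scalar_left cong_sym)
    then have "[x * M i j e = x' * M i j e] (mod int l ^ e)"
      using that(1-3) by (meson cong_sym cong_trans)
    then have "int l ^ (a + (e - a)) dvd (x - x') * M i j e"
      using ae by (simp add: cong_iff_dvd_diff left_diff_distrib)
    moreover have "\<not> int l ^ Suc a dvd M i j e"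
      using val_eq_not_dvd[of l "M i j" a e] P cM ae by (auto simp: pivot_def)
    ultimately have "int l ^ (e - a) dvd x - x'" using prime_power_dvd_cancel[OF \<open>prime l\<close>] by blast
    then have "int l ^ (e - a) * int l ^ a dvd (x - x') * m" using that(5) by (rule mult_dvd_mono)
    then have "[x * m = x' * m] (mod int l ^ e)"
      using ae by (simp add: cong_iff_dvd_diff left_diff_distrib flip: power_add)
    then show ?thesis using that(4) by (meson cong_scalar_left cong_trans)
  qed
  have Mdv': "int l ^ a dvd M q p e" if "p \<in> I" "q \<in> {i, j}" for p q
  proof -
    have "[M q p e = - M p q e] (mod int l ^ a)"
    proof (rule cong_dvd_modulus)
      show "[M q p e = - M p q e] (mod int l ^ e)"
        using step.prems(2) that unfolding alt_seq_def by blast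
    qed (use ae in \<open>auto intro: le_imp_power_dvd\<close>)
    then show ?thesis using Mdv[OF that] cong_dvd_iff dvd_minus_iff by blast
  qed
  have "sympl l I R (schur N i j \<alpha>' \<beta>') \<kappa>"
  proof (rule step.IH)
    show "alt_seq l I (schur M i j \<alpha> \<beta>)" "alt_seq l I (schur N i j \<alpha>' \<beta>')"
      using alt_seq_schur step.prems(2,3) P P' by auto
    show "[schur M i j \<alpha> \<beta> p q e = schur N i j \<alpha>' \<beta>' p q e] (mod int l ^ e)" if "p \<in> I" "q \<in> I" for p q
      unfolding schur_def
    proof (intro cong_add cong_diff)
      show "[M p q e = N p q e] (mod int l ^ e)" using low that by auto
      show "[\<alpha> p e * M i q e = \<alpha>' p e * N i q e] (mod int l ^ e)"
        by (rule quot[of _ "M p j e" _ "N p j e"]) (use P P' low that Mdv' in \<open>auto simp: pivot_def\<close>)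
      show "[\<beta> p e * M j q e = \<beta>' p e * N j q e] (mod int l ^ e)"
        by (rule quot[of _ "M p i e" _ "N p i e"]) (use P P' low that Mdv' in \<open>auto simp: pivot_def\<close>)
    qed
  qed (use step in auto)
  then show ?case using step.hyps P' by (intro sympl.step[where a = a]) auto
qed

section \<open>Integer combinations in an abelian group\<close>

definition lc :: "('a, 'b) monoid_scheme \<Rightarrow> ('i \<Rightarrow> 'a) \<Rightarrow> ('i \<Rightarrow> int) \<Rightarrow> 'i set \<Rightarrow> 'a" where
  "lc G h x I = finprod G (\<lambda>p. h p [^]\<^bsub>G\<^esub> x p) I"

text \<open>\<open>h\<close> lists the images of the standard basis under a homomorphism from the
  free abelian group on \<open>I\<close>. The condition says that the columns of \<open>A\<close>
  are killed, so such tuples correspond to homomorphisms from the cokernel of \<open>A\<close> to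
  \<open>G\<close>.\<close>

definition rel :: "('a, 'b) monoid_scheme \<Rightarrow> nat set \<Rightarrow> (nat \<Rightarrow> nat \<Rightarrow> int) \<Rightarrow> (nat \<Rightarrow> 'a) \<Rightarrow> bool" where
  "rel G I A h \<longleftrightarrow> (\<forall>q\<in>I. lc G h (\<lambda>p. A p q) I = \<one>\<^bsub>G\<^esub>)"

definition expo :: "('a, 'b) monoid_scheme \<Rightarrow> int \<Rightarrow> bool" where
  "expo G N \<longleftrightarrow> (\<forall>g\<in>carrier G. g [^]\<^bsub>G\<^esub> N = \<one>\<^bsub>G\<^esub>)"

context comm_group
begin

lemma expo_cong:
  assumes "expo G N" "g \<in> carrier G" "[a = b] (mod N)"
  shows "g [^] a = g [^] b"
proof -
  obtain k where "b = a + N * k" using assms(3) by (auto simp: cong_iff_lin)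
  moreover have "g [^] (N * k) = \<one>"
    using assms(1,2) by (simp add: expo_def flip: int_pow_pow)
  ultimately show ?thesis using assms(2) by (simp add: int_pow_mult)
qed

lemma lc_closed [simp, intro]: "h \<in> I \<rightarrow> carrier G \<Longrightarrow> lc G h x I \<in> carrier G"
  unfolding lc_def by (intro finprod_closed) auto

lemma lc_empty [simp]: "lc G h x {} = \<one>"
  by (simp add: lc_def)

lemma lc_insert:
  "finite I \<Longrightarrow> i \<notin> I \<Longrightarrow> h \<in> insert i I \<rightarrow> carrier G \<Longrightarrow>
    lc G h x (insert i I) = h i [^] x i \<otimes> lc G h x I"
  unfolding lc_def by (intro finprod_insert) auto

lemma lc_add:
  assumes "h \<in> I \<rightarrow> carrier G"
  shows "lc G h (\<lambda>p. x p + y p) I = lc G h x I \<otimes> lc G h y I"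
proof -
  have "lc G h (\<lambda>p. x p + y p) I = finprod G (\<lambda>p. h p [^] x p \<otimes> h p [^] y p) I"
    unfolding lc_def using assms by (intro finprod_cong') (auto simp: Pi_iff int_pow_mult)
  also have "\<dots> = lc G h x I \<otimes> lc G h y I"
    unfolding lc_def using assms by (intro finprod_multf) auto
  finally show ?thesis .
qed

lemma lc_scale: "finite I \<Longrightarrow> h \<in> I \<rightarrow> carrier G \<Longrightarrow> lc G h (\<lambda>p. k * x p) I = lc G h x I [^] (k::int)"
proof (induction I rule: finite_induct)
  case (insert i I)
  then have "h \<in> I \<rightarrow> carrier G" "h i \<in> carrier G" by auto
  then show ?case using insert
    by (simp add: lc_insert int_pow_distrib int_pow_pow mult.commute)
qed simp

lemma lc_cong: "expo G N \<Longrightarrow> h \<in> I \<rightarrow> carrier G \<Longrightarrow> (\<And>p. p \<in> I \<Longrightarrow> [x p = y p] (mod N)) \<Longrightarrow>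
    lc G h x I = lc G h y I"
  unfolding lc_def by (intro finprod_cong') (auto intro!: expo_cong simp: Pi_iff)

lemma lc_cong': "h \<in> I \<rightarrow> carrier G \<Longrightarrow> (\<And>p. p \<in> I \<Longrightarrow> x p = y p) \<Longrightarrow> (\<And>p. p \<in> I \<Longrightarrow> h p = h' p) \<Longrightarrow>
    lc G h x I = lc G h' y I"
  unfolding lc_def by (intro finprod_cong') (auto simp: Pi_iff)

lemma lc_zero: "h \<in> I \<rightarrow> carrier G \<Longrightarrow> lc G h (\<lambda>p. 0) I = \<one>"
  unfolding lc_def by (rule finprod_one_eqI) auto

lemma lc_in_subgroup:
  assumes "finite I" "subgroup B G" "h ` I \<subseteq> B"
  shows "lc G h x I \<in> B"
  using assms(1,3)
proof (induction I rule: finite_induct)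
  case empty
  then show ?case using assms(2) by (simp add: subgroup.one_closed)
next
  case (insert i I)
  then have "h \<in> insert i I \<rightarrow> carrier G" using subgroup.subset[OF assms(2)] by auto
  then show ?case
    using insert assms(2) by (simp add: lc_insert subgroup.m_closed subgroup_int_pow_closed)
qed

text \<open>\<open>hi\<close> and \<open>hj\<close> replace \<open>h i\<close> and
  \<open>h j\<close> as coordinates. With \<open>d = A i j\<close>, column \<open>j\<close> says
  that \<open>d\<close> kills \<open>hi\<close> and column \<open>i\<close> that \<open>d\<close>
  kills \<open>hj\<close>. In every other column the coefficients of \<open>hi\<close> and
  \<open>hj\<close> are multiples of \<open>d\<close> modulo \<open>N\<close>, so these terms drop
  out and the Schur complement on \<open>I\<close> remains.\<close>

lemma pivot_rel:
  fixes A :: "nat \<Rightarrow> nat \<Rightarrow> int" and a b :: "nat \<Rightarrow> int"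
  assumes fin: "finite I" and ij: "i \<notin> I" "j \<notin> I" "i \<noteq> j"
    and h: "h \<in> insert i (insert j I) \<rightarrow> carrier G" and N: "expo G N"
    and A: "[A i i = 0] (mod N)" "[A j j = 0] (mod N)" "[A j i = - A i j] (mod N)"
      "\<And>q. q \<in> I \<Longrightarrow> [A i q = - A q i] (mod N)" "\<And>q. q \<in> I \<Longrightarrow> [A j q = - A q j] (mod N)"
    and ab: "\<And>p. p \<in> I \<Longrightarrow> [a p * A i j = A p j] (mod N)" "\<And>p. p \<in> I \<Longrightarrow> [b p * A i j = A p i] (mod N)"
  defines "hi \<equiv> h i \<otimes> lc G h a I" and "hj \<equiv> h j \<otimes> inv (lc G h b I)"
  shows "rel G (insert i (insert j I)) A h \<longleftrightarrow> hi [^] A i j = \<one> \<and> hj [^] A i j = \<one> \<and>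
    rel G I (\<lambda>p q. A p q - a p * A i q + b p * A j q) h"
proof -
  let ?K = "insert i (insert j I)" and ?d = "A i j" and ?la = "lc G h a I" and ?lb = "lc G h b I"
  let ?S = "\<lambda>p q. A p q - a p * A i q + b p * A j q"
  have hI: "h \<in> I \<rightarrow> carrier G" and [simp]: "h i \<in> carrier G" "h j \<in> carrier G"
    using h by auto
  have la [simp]: "?la \<in> carrier G" "?lb \<in> carrier G" using hI by auto
  have hij [simp]: "hi \<in> carrier G" "hj \<in> carrier G" unfolding hi_def hj_def by auto
  have col: "lc G h (\<lambda>p. A p q) ?K = h i [^] A i q \<otimes> (h j [^] A j q \<otimes> lc G h (\<lambda>p. A p q) I)" for q
    using fin ij h by (simp add: lc_insert)
  have colj: "lc G h (\<lambda>p. A p j) ?K = hi [^] ?d"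
  proof -
    have "h j [^] A j j = h j [^] (0::int)" using N A(2) by (intro expo_cong) auto
    moreover have "lc G h (\<lambda>p. A p j) I = lc G h (\<lambda>p. ?d * a p) I"
      using ab(1) by (intro lc_cong[OF N hI]) (auto intro: cong_sym simp: mult.commute)
    ultimately show ?thesis
      using fin hI by (simp add: col lc_scale hi_def int_pow_distrib)
  qed
  have coli: "lc G h (\<lambda>p. A p i) ?K = inv (hj [^] ?d)"
  proof -
    have 1: "h i [^] A i i = h i [^] (0::int)" using N A(1) by (intro expo_cong) auto
    have 2: "h j [^] A j i = h j [^] (- ?d)" using N A(3) by (intro expo_cong) auto
    have 3: "lc G h (\<lambda>p. A p i) I = lc G h (\<lambda>p. ?d * b p) I"
      using ab(2) by (intro lc_cong[OF N hI]) (auto intro: cong_sym simp: mult.commute)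
    have "lc G h (\<lambda>p. A p i) ?K = inv (h j [^] ?d) \<otimes> ?lb [^] ?d"
      using fin hI by (simp add: col 1 2 3 lc_scale int_pow_neg)
    moreover have "inv (hj [^] ?d) = inv (h j [^] ?d) \<otimes> ?lb [^] ?d"
      by (simp add: hj_def int_pow_distrib inv_mult int_pow_inv)
    ultimately show ?thesis by simp
  qed
  have colq: "lc G h (\<lambda>p. A p q) ?K = hi [^] A i q \<otimes> (hj [^] A j q \<otimes> lc G h (\<lambda>p. ?S p q) I)" for q
  proof -
    have "lc G h (\<lambda>p. A p q) I = lc G h (\<lambda>p. (?S p q + A i q * a p) + (- A j q) * b p) I"
      by (intro lc_cong' hI) (auto simp: algebra_simps)
    also have "\<dots> = lc G h (\<lambda>p. ?S p q) I \<otimes> ?la [^] A i q \<otimes> ?lb [^] (- A j q)"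
      using hI fin by (simp only: lc_add lc_scale)
    finally have "lc G h (\<lambda>p. A p q) I = lc G h (\<lambda>p. ?S p q) I \<otimes> ?la [^] A i q \<otimes> inv (?lb [^] A j q)"
      by (simp add: int_pow_neg)
    then show ?thesis
      using hI by (simp add: col hi_def hj_def int_pow_distrib int_pow_inv m_ac)
  qed
  have triv: "hi [^] A i q = \<one>" "hj [^] A j q = \<one>"
    if "q \<in> I" "hi [^] ?d = \<one>" "hj [^] ?d = \<one>" for q
  proof -
    have "[A i q = ?d * (- b q)] (mod N)" "[A j q = ?d * (- a q)] (mod N)"
      using A(4,5)[OF that(1)] ab[OF that(1)]
      by (metis cong_minus_minus_iff cong_sym cong_trans minus_mult_right mult.commute)+
    then have "hi [^] A i q = hi [^] (?d * (- b q))" "hj [^] A j q = hj [^] (?d * (- a q))"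
      using N by (auto intro!: expo_cong)
    then show "hi [^] A i q = \<one>" "hj [^] A j q = \<one>"
      using that by (simp_all only: int_pow_pow[symmetric] hij int_pow_one)
  qed
  have "lc G h (\<lambda>p. A p q) ?K = lc G h (\<lambda>p. ?S p q) I"
    if "q \<in> I" "hi [^] ?d = \<one>" "hj [^] ?d = \<one>" for q
    using colq[of q] triv[OF that] hI by simp
  moreover have "inv (hj [^] ?d) = \<one> \<longleftrightarrow> hj [^] ?d = \<one>"
    by (metis hij(2) int_pow_closed inv_inv inv_one)
  ultimately show ?thesis
    unfolding rel_def using colj coli by auto
qed

text \<open>Modulo \<open>l^e\<close> the number \<open>d e\<close> is \<open>l^a\<close> times a
  unit, and a unit exponent does not change which elements are killed. For \<open>e \<le> a\<close>
  both powers are trivial.\<close>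

lemma val_pow_iff:
  assumes "prime l" "compat l d" "val_eq l d a" "expo G (int l ^ e)" "g \<in> carrier G"
  shows "g [^] d e = \<one> \<longleftrightarrow> g [^] (int l ^ a) = \<one>"
proof (cases "e \<le> a")
  case True
  have "int l ^ e dvd d a" using assms(3) True by (meson dvd_trans le_imp_power_dvd val_eq_def)
  then have "int l ^ e dvd d e" using compat_dvd_iff[OF assms(2), of e e a] True by simp
  then have "[d e = 0] (mod int l ^ e)" "[int l ^ a = 0] (mod int l ^ e)"
    using True by (auto simp: cong_0_iff le_imp_power_dvd)
  then show ?thesis using expo_cong[OF assms(4,5)] by (metis int_pow_0)
next
  case False
  then obtain u where u: "d e = int l ^ a * u" using val_eq_dvd[OF assms(2,3), of e] by (auto elim: dvdE)
  have "\<not> int l ^ Suc a dvd d e" using False by (intro val_eq_not_dvd[OF assms(2,3)]) simp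
  then have "\<not> int l dvd u" using u by (auto simp: mult.commute)
  then have "coprime u (int l ^ e)"
    using assms(1) prime_imp_coprime[of "int l" u] by (simp add: coprime_commute)
  then obtain v where v: "[u * v = 1] (mod int l ^ e)" using cong_solve_coprime_int by blast
  have "[int l ^ a * (u * v) = int l ^ a * 1] (mod int l ^ e)" using v by (rule cong_scalar_left)
  then have "g [^] (int l ^ a) = g [^] (d e * v)"
    using assms(4,5) by (intro expo_cong) (auto simp: u ac_simps cong_sym_eq)
  then have "g [^] (int l ^ a) = (g [^] d e) [^] v" using assms(5) by (simp add: int_pow_pow)
  moreover have "g [^] d e = (g [^] (int l ^ a)) [^] u" using assms(5) by (simp add: int_pow_pow u)
  ultimately show ?thesis by (metis int_pow_one)
qed

text \<open>The change of variables of one elimination step.\<close>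

lemma pivot_rel_seq:
  assumes fin: "finite I" and ij: "i \<notin> I" "j \<notin> I" "i \<noteq> j" and l: "prime l"
    and M: "alt_seq l (insert i (insert j I)) M" and P: "pivot l I M i j a \<alpha> \<beta>"
    and h: "h \<in> insert i (insert j I) \<rightarrow> carrier G" and N: "expo G (int l ^ e)"
  shows "rel G (insert i (insert j I)) (\<lambda>p q. M p q e) h \<longleftrightarrow>
    (h i \<otimes> lc G h (\<lambda>p. \<alpha> p e) I) [^] (int l ^ a) = \<one> \<and>
    (h j \<otimes> inv (lc G h (\<lambda>p. \<beta> p e) I)) [^] (int l ^ a) = \<one> \<and>
    rel G I (\<lambda>p q. schur M i j \<alpha> \<beta> p q e) h"
proof -
  have hI: "h \<in> I \<rightarrow> carrier G" and [simp]: "h i \<in> carrier G" "h j \<in> carrier G"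
    using h by auto
  have d: "compat l (M i j)" "val_eq l (M i j) a" using M P by (auto simp: alt_seq_def pivot_def)
  have "rel G (insert i (insert j I)) (\<lambda>p q. M p q e) h \<longleftrightarrow>
    (h i \<otimes> lc G h (\<lambda>p. \<alpha> p e) I) [^] M i j e = \<one> \<and>
    (h j \<otimes> inv (lc G h (\<lambda>p. \<beta> p e) I)) [^] M i j e = \<one> \<and>
    rel G I (\<lambda>p q. schur M i j \<alpha> \<beta> p q e) h"
    unfolding schur_def
    by (rule pivot_rel[OF fin ij h N]) (use M P in \<open>auto simp: alt_seq_def pivot_def\<close>)
  then show ?thesis using hI by (simp add: val_pow_iff[OF l d N])
qed

text \<open>Composes the coordinate changes of the single elimination steps. The clause on subgroups
  is what makes \<open>\<tau>\<close> preserve generating tuples; it is stated for every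
  \<open>B\<close> because generation of the whole group does not pass to the shorter tuple on
  \<open>I\<close> in the induction.\<close>

lemma sympl_rel:
  assumes "sympl l I R M \<kappa>" "alt_seq l I M" "prime l" "finite (carrier G)" "expo G (int l ^ e)"
  shows "\<exists>\<tau>. bij_betw \<tau> (I \<rightarrow>\<^sub>E carrier G) (I \<rightarrow>\<^sub>E carrier G) \<and>
    (\<forall>h\<in>I \<rightarrow>\<^sub>E carrier G. (\<forall>B. subgroup B G \<longrightarrow> h ` I \<subseteq> B \<longleftrightarrow> \<tau> h ` I \<subseteq> B) \<and>
      (rel G I (\<lambda>p q. M p q e) h \<longleftrightarrow> (\<forall>s\<in>I - R. \<tau> h s [^] (int l ^ \<kappa> s) = \<one>)))"
  using assms(1,2)
proof (induction rule: sympl.induct)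
  case (base I M \<kappa>)
  have "rel G I (\<lambda>p q. M p q e) h" if h: "h \<in> I \<rightarrow>\<^sub>E carrier G" for h
  proof -
    have "lc G h (\<lambda>p. M p q e) I = lc G h (\<lambda>p. 0) I" if "q \<in> I" for q
    proof (rule lc_cong[OF assms(5)])
      fix p assume "p \<in> I"
      then have "p = q" using base that by (metis card_le_Suc0_iff_eq One_nat_def)
      then show "[M p q e = 0] (mod int l ^ e)" using base that by (auto simp: alt_seq_def)
    qed (use h in auto)
    then show ?thesis using h lc_zero[of h I] by (auto simp: rel_def)
  qed
  then show ?case by (intro exI[of _ id]) (auto simp: bij_betw_def)
next
  case (step I i j \<kappa> a M \<alpha> \<beta> R)
  let ?K = "insert i (insert j I)"
  note ij = step.hyps(2-4)
  have RI: "R \<subseteq> I" using sympl_finite[OF step.hyps(8)] by auto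
  have "alt_seq l I (schur M i j \<alpha> \<beta>)" using alt_seq_schur step.prems step.hyps(7) by blast
  from step.IH[OF this] obtain \<tau> where
    bij: "bij_betw \<tau> (I \<rightarrow>\<^sub>E carrier G) (I \<rightarrow>\<^sub>E carrier G)" and
    sub: "\<And>h B. h \<in> I \<rightarrow>\<^sub>E carrier G \<Longrightarrow> subgroup B G \<Longrightarrow> h ` I \<subseteq> B \<longleftrightarrow> \<tau> h ` I \<subseteq> B" and
    relI: "\<And>h. h \<in> I \<rightarrow>\<^sub>E carrier G \<Longrightarrow> rel G I (\<lambda>p q. schur M i j \<alpha> \<beta> p q e) h \<longleftrightarrow>
        (\<forall>s\<in>I - R. \<tau> h s [^] (int l ^ \<kappa> s) = \<one>)"
    by metis
  define hi where "hi = (\<lambda>h. h i \<otimes> lc G h (\<lambda>p. \<alpha> p e) I)"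
  define hj where "hj = (\<lambda>h. h j \<otimes> inv (lc G h (\<lambda>p. \<beta> p e) I))"
  define \<sigma> where "\<sigma> h = (\<lambda>s\<in>?K. if s = i then hi h else if s = j then hj h else \<tau> (restrict h I) s)" for h
  have rI: "restrict h I \<in> I \<rightarrow>\<^sub>E carrier G" if "h \<in> ?K \<rightarrow>\<^sub>E carrier G" for h
    using that by auto
  have \<tau>I: "\<tau> (restrict h I) \<in> I \<rightarrow>\<^sub>E carrier G" if "h \<in> ?K \<rightarrow>\<^sub>E carrier G" for h
    using bij_betwE[OF bij] rI[OF that] by blast
  have hc: "h i \<in> carrier G" "h j \<in> carrier G" "h \<in> I \<rightarrow> carrier G" if "h \<in> ?K \<rightarrow>\<^sub>E carrier G" for h
    using that by auto
  have hijc: "hi h \<in> carrier G" "hj h \<in> carrier G" if "h \<in> ?K \<rightarrow>\<^sub>E carrier G" for h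
    using hc[OF that] by (auto simp: hi_def hj_def)
  have \<sigma>I: "\<sigma> h s = \<tau> (restrict h I) s" if "s \<in> I" for h s
    using that ij by (auto simp: \<sigma>_def)
  have \<sigma>ij: "\<sigma> h i = hi h" "\<sigma> h j = hj h" for h using ij by (auto simp: \<sigma>_def)
  have maps: "\<sigma> h \<in> ?K \<rightarrow>\<^sub>E carrier G" if "h \<in> ?K \<rightarrow>\<^sub>E carrier G" for h
  proof
    fix s assume "s \<in> ?K"
    then show "\<sigma> h s \<in> carrier G"
      using \<tau>I[OF that] hijc[OF that] \<sigma>I[of s h] \<sigma>ij[of h] by auto
  qed (simp add: \<sigma>_def)
  \<comment> \<open>The set of tuples is finite and \<open>\<sigma>\<close> maps it to itself, so
    injectivity suffices and the inverse change of variables is never written down.\<close>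
  have "inj_on \<sigma> (?K \<rightarrow>\<^sub>E carrier G)"
  proof (rule inj_onI)
    fix g h assume gh: "g \<in> ?K \<rightarrow>\<^sub>E carrier G" "h \<in> ?K \<rightarrow>\<^sub>E carrier G" "\<sigma> g = \<sigma> h"
    have "\<tau> (restrict g I) = \<tau> (restrict h I)"
    proof (rule PiE_ext[OF \<tau>I[OF gh(1)] \<tau>I[OF gh(2)]])
      show "\<tau> (restrict g I) s = \<tau> (restrict h I) s" if "s \<in> I" for s
        using \<sigma>I[OF that, of g] \<sigma>I[OF that, of h] gh(3) by simp
    qed
    then have "restrict g I = restrict h I"
      by (rule inj_onD[OF bij_betw_imp_inj_on[OF bij] _ rI[OF gh(1)] rI[OF gh(2)]])
    then have eqI: "g s = h s" if "s \<in> I" for s using that by (metis restrict_apply')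
    then have lcs: "lc G g x I = lc G h x I" for x using hc[OF gh(1)] by (intro lc_cong') auto
    have "hi g = hi h" "hj g = hj h" using gh(3) \<sigma>ij by metis+
    then have "g i = h i" "g j = h j"
      unfolding hi_def hj_def lcs using hc[OF gh(1)] hc[OF gh(2)] by (simp_all add: right_cancel)
    then show "g = h" using eqI gh(1,2) by (intro PiE_ext[OF gh(1,2)]) auto
  qed
  then have "bij_betw \<sigma> (?K \<rightarrow>\<^sub>E carrier G) (?K \<rightarrow>\<^sub>E carrier G)"
    unfolding bij_betw_def
  proof (intro conjI endo_inj_surj)
    show "finite (?K \<rightarrow>\<^sub>E carrier G)" using assms(4) step.hyps(1) by (simp add: finite_PiE)
    show "\<sigma> ` (?K \<rightarrow>\<^sub>E carrier G) \<subseteq> ?K \<rightarrow>\<^sub>E carrier G" using maps by blast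
  qed
  moreover have "h ` ?K \<subseteq> B \<longleftrightarrow> \<sigma> h ` ?K \<subseteq> B" if h: "h \<in> ?K \<rightarrow>\<^sub>E carrier G" and B: "subgroup B G" for h B
  proof -
    have 1: "\<sigma> h ` I \<subseteq> B \<longleftrightarrow> h ` I \<subseteq> B"
      using sub[OF rI[OF h] B] \<sigma>I by (auto simp: image_subset_iff)
    have 2: "hi h \<in> B \<longleftrightarrow> h i \<in> B" "hj h \<in> B \<longleftrightarrow> h j \<in> B" if "h ` I \<subseteq> B"
    proof -
      have lB: "lc G h x I \<in> B" for x using lc_in_subgroup[OF step.hyps(1) B that] .
      have "h i = hi h \<otimes> inv (lc G h (\<lambda>p. \<alpha> p e) I)" "h j = hj h \<otimes> lc G h (\<lambda>p. \<beta> p e) I"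
        using hc[OF h] by (simp_all add: hi_def hj_def m_assoc)
      then show "hi h \<in> B \<longleftrightarrow> h i \<in> B" "hj h \<in> B \<longleftrightarrow> h j \<in> B"
        using lB B by (metis hi_def subgroup.m_closed subgroup.m_inv_closed,
            metis hj_def subgroup.m_closed subgroup.m_inv_closed)
    qed
    show ?thesis using 1 2 \<sigma>ij[of h] by auto
  qed
  moreover have "rel G ?K (\<lambda>p q. M p q e) h \<longleftrightarrow> (\<forall>s\<in>?K - R. \<sigma> h s [^] (int l ^ \<kappa> s) = \<one>)"
    if h: "h \<in> ?K \<rightarrow>\<^sub>E carrier G" for h
  proof -
    have "rel G ?K (\<lambda>p q. M p q e) h \<longleftrightarrow> hi h [^] (int l ^ a) = \<one> \<and> hj h [^] (int l ^ a) = \<one> \<and>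
        rel G I (\<lambda>p q. schur M i j \<alpha> \<beta> p q e) h"
      unfolding hi_def hj_def
      by (rule pivot_rel_seq[OF step.hyps(1) ij assms(3) step.prems step.hyps(7) _ assms(5)]) (use h in auto)
    moreover have "rel G I (\<lambda>p q. schur M i j \<alpha> \<beta> p q e) h \<longleftrightarrow>
        rel G I (\<lambda>p q. schur M i j \<alpha> \<beta> p q e) (restrict h I)"
    proof -
      have "lc G h x I = lc G (restrict h I) x I" for x using hc[OF h] by (intro lc_cong') auto
      then show ?thesis by (simp add: rel_def)
    qed
    moreover have "?K - R = insert i (insert j (I - R))" using RI ij by auto
    ultimately show ?thesis
      using relI[OF rI[OF h]] \<sigma>I \<sigma>ij step.hyps(5,6) by auto
  qed
  ultimately show ?case by blast
qed

end

lemma sympl_kappa_cong: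
  assumes "sympl l I R M \<kappa>" "\<And>s. s \<in> I \<Longrightarrow> \<kappa> s = \<kappa>' s"
  shows "sympl l I R M \<kappa>'"
  using assms
proof (induction rule: sympl.induct)
  case (step I i j \<kappa> a M \<alpha> \<beta> R)
  then show ?case by (intro sympl.step[where a = a]) auto
qed (simp add: sympl.base)

text \<open>An entry of minimal valuation divides all others, hence has the required quotients. The
  vanishing diagonal forces \<open>i \<noteq> j\<close>, and the entry not divisible by
  \<open>l^e\<close> forces \<open>a < e\<close>.\<close>

lemma alt_seq_pivot_exists:
  assumes "prime l" "alt_seq l I M" "i \<in> I" "j \<in> I" "\<not> int l ^ e dvd M i j e"
  obtains i j a \<alpha> \<beta> where "i \<in> I" "j \<in> I" "i \<noteq> j" "a < e" "pivot l (I - {i, j}) M i j a \<alpha> \<beta>"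
proof -
  have cM: "compat l (M p q)" if "p \<in> I" "q \<in> I" for p q
    using assms(2) that by (auto simp: alt_seq_def)
  let ?P = "\<lambda>a. \<exists>i\<in>I. \<exists>j\<in>I. \<not> int l ^ Suc a dvd M i j (Suc a)"
  define a where "a = (LEAST a. ?P a)"
  have "e \<noteq> 0" using assms(5) by (intro notI) simp
  then obtain e' where e': "e = Suc e'" by (cases e) auto
  have Pe': "?P e'" using assms(3-5) e' by auto
  then have "?P a" unfolding a_def by (rule LeastI)
  then obtain i j where ij: "i \<in> I" "j \<in> I" "\<not> int l ^ Suc a dvd M i j (Suc a)" by blast
  have "a < e" using Least_le[of ?P, OF Pe'] e' by (simp add: a_def)
  have dv: "int l ^ a dvd M p q a" if "p \<in> I" "q \<in> I" for p q
  proof (cases a)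
    case (Suc b)
    then have "\<not> ?P b" using not_less_Least[of b ?P] by (simp add: a_def)
    then show ?thesis using that Suc by auto
  qed simp
  have v: "val_eq l (M i j) a" using dv ij by (auto simp: val_eq_def)
  have "int l ^ Suc a dvd M i i (Suc a)" using ij(1) assms(2) unfolding alt_seq_def by (metis cong_0_iff)
  then have "i \<noteq> j" using ij(3) by auto
  have "\<exists>f. compat l f \<and> (\<forall>e. [f e * M i j e = M p q e] (mod int l ^ e))" if "p \<in> I" "q \<in> I" for p q
    by (rule compat_quotient[OF assms(1) _ v, of "M p q"]) (use cM dv that ij in auto)
  then obtain f where "\<And>p q. p \<in> I \<Longrightarrow> q \<in> I \<Longrightarrow> compat l (f p q) \<and> (\<forall>e. [f p q e * M i j e = M p q e] (mod int l ^ e))"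
    by metis
  then have "pivot l (I - {i, j}) M i j a (\<lambda>p. f p j) (\<lambda>p. f p i)"
    using v ij by (auto simp: pivot_def)
  then show thesis using that ij \<open>i \<noteq> j\<close> \<open>a < e\<close> by blast
qed

text \<open>Eliminate while some entry is not divisible by \<open>l^e\<close>. Each step removes two
  indices, so a premature stop leaves at least \<open>r + 2\<close> of them carrying the zero matrix
  modulo \<open>l^e\<close>. There every tuple is a solution, and each solution extends back over
  the eliminated indices.\<close>

lemma (in comm_group) sympl_or_many_solutions:
  assumes "prime l" "alt_seq l I M" "finite I" "card I = r + 2 * k" "r \<le> 1"
    and "finite (carrier G)" "expo G (int l ^ e)"
  shows "(\<exists>R \<kappa>. sympl l I R M \<kappa> \<and> (\<forall>s\<in>I - R. \<kappa> s < e)) \<or>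
    card (carrier G) ^ (r + 2) \<le> card {h \<in> I \<rightarrow>\<^sub>E carrier G. rel G I (\<lambda>p q. M p q e) h}"
  using assms(2-4)
proof (induction k arbitrary: I M)
  case 0
  then have "sympl l I I M (\<lambda>_. 0)" using assms(5) by (intro sympl.base) auto
  then show ?case by auto
next
  case (Suc k)
  show ?case
  proof (cases "\<forall>p\<in>I. \<forall>q\<in>I. int l ^ e dvd M p q e")
    case True
    have "rel G I (\<lambda>p q. M p q e) h" if h: "h \<in> I \<rightarrow>\<^sub>E carrier G" for h
      unfolding rel_def
    proof
      fix q assume q: "q \<in> I"
      have "lc G h (\<lambda>p. M p q e) I = lc G h (\<lambda>p. 0) I"
        using True q h by (intro lc_cong[OF assms(7)]) (auto simp: cong_0_iff)
      then show "lc G h (\<lambda>p. M p q e) I = \<one>" using lc_zero[of h I] h by auto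
    qed
    then have "{h \<in> I \<rightarrow>\<^sub>E carrier G. rel G I (\<lambda>p q. M p q e) h} = (I \<rightarrow>\<^sub>E carrier G)" by auto
    then have "card {h \<in> I \<rightarrow>\<^sub>E carrier G. rel G I (\<lambda>p q. M p q e) h} = card (carrier G) ^ (r + 2 * Suc k)"
      using Suc.prems by (simp add: card_PiE)
    moreover have "card (carrier G) \<ge> 1" using assms(6) by (simp add: Suc_leI card_gt_0_iff carrier_not_empty)
    ultimately show ?thesis by (intro disjI2) (simp add: power_increasing)
  next
    case False
    then obtain i j a \<alpha> \<beta> where ij: "i \<in> I" "j \<in> I" "i \<noteq> j" "a < e" and P: "pivot l (I - {i, j}) M i j a \<alpha> \<beta>"
      using alt_seq_pivot_exists[OF assms(1) Suc.prems(1)] by metis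
    let ?J = "I - {i, j}"
    have I: "I = insert i (insert j ?J)" using ij by auto
    have M: "alt_seq l (insert i (insert j ?J)) M" using Suc.prems(1) I by simp
    have fJ: "finite ?J" "card ?J = r + 2 * k" using Suc.prems ij by (auto simp: card_Diff_subset)
    have "(\<exists>R \<kappa>. sympl l ?J R (schur M i j \<alpha> \<beta>) \<kappa> \<and> (\<forall>s\<in>?J - R. \<kappa> s < e)) \<or>
      card (carrier G) ^ (r + 2) \<le> card {h \<in> ?J \<rightarrow>\<^sub>E carrier G. rel G ?J (\<lambda>p q. schur M i j \<alpha> \<beta> p q e) h}"
      by (rule Suc.IH[OF alt_seq_schur[OF M P] fJ])
    then show ?thesis
    proof (elim disjE exE conjE)
      fix R \<kappa> assume R: "sympl l ?J R (schur M i j \<alpha> \<beta>) \<kappa>" "\<forall>s\<in>?J - R. \<kappa> s < e"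
      have "sympl l ?J R (schur M i j \<alpha> \<beta>) (\<kappa>(i := a, j := a))"
        by (rule sympl_kappa_cong[OF R(1)]) auto
      then have "sympl l (insert i (insert j ?J)) R M (\<kappa>(i := a, j := a))"
        by (intro sympl.step[OF fJ(1) _ _ ij(3) _ _ P]) auto
      then have "sympl l I R M (\<kappa>(i := a, j := a))" using I by simp
      moreover have "\<forall>s\<in>I - R. (\<kappa>(i := a, j := a)) s < e" using R(2) ij by auto
      ultimately show ?thesis by blast
    next
      assume le: "card (carrier G) ^ (r + 2) \<le> card {h \<in> ?J \<rightarrow>\<^sub>E carrier G. rel G ?J (\<lambda>p q. schur M i j \<alpha> \<beta> p q e) h}"
      \<comment> \<open>The eliminated entries get the values for which both new coordinates of the
        change of variables equal \<open>\<one>\<close>, so the two pivot relations hold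
        trivially.\<close>
      define ext where "ext h = (\<lambda>s\<in>I. if s = i then inv (lc G h (\<lambda>p. \<alpha> p e) ?J)
        else if s = j then lc G h (\<lambda>p. \<beta> p e) ?J else h s)" for h
      have ext: "ext h s = h s" if "s \<in> ?J" for h s using that by (auto simp: ext_def)
      have "card {h \<in> ?J \<rightarrow>\<^sub>E carrier G. rel G ?J (\<lambda>p q. schur M i j \<alpha> \<beta> p q e) h}
          \<le> card {h \<in> I \<rightarrow>\<^sub>E carrier G. rel G I (\<lambda>p q. M p q e) h}"
      proof (rule card_inj_on_le[of ext])
        show "inj_on ext {h \<in> ?J \<rightarrow>\<^sub>E carrier G. rel G ?J (\<lambda>p q. schur M i j \<alpha> \<beta> p q e) h}"
        proof (rule inj_onI, clarify)
          fix g h assume gh: "g \<in> ?J \<rightarrow>\<^sub>E carrier G" "h \<in> ?J \<rightarrow>\<^sub>E carrier G" "ext g = ext h"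
          show "g = h"
            by (rule PiE_ext[OF gh(1,2)]) (metis ext gh(3))
        qed
        show "finite {h \<in> I \<rightarrow>\<^sub>E carrier G. rel G I (\<lambda>p q. M p q e) h}"
          using Suc.prems(2) assms(6) by (simp add: finite_PiE)
        show "ext ` {h \<in> ?J \<rightarrow>\<^sub>E carrier G. rel G ?J (\<lambda>p q. schur M i j \<alpha> \<beta> p q e) h}
          \<subseteq> {h \<in> I \<rightarrow>\<^sub>E carrier G. rel G I (\<lambda>p q. M p q e) h}"
        proof clarify
          fix h assume h: "h \<in> ?J \<rightarrow>\<^sub>E carrier G" and r: "rel G ?J (\<lambda>p q. schur M i j \<alpha> \<beta> p q e) h"
          have hJ: "h \<in> ?J \<rightarrow> carrier G" using h by auto
          have lcs: "lc G (ext h) x ?J = lc G h x ?J" for x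
            by (rule lc_cong'[symmetric, OF hJ]) (auto simp: ext)
          have eI: "ext h \<in> I \<rightarrow>\<^sub>E carrier G"
            using hJ by (auto simp: ext_def Pi_iff intro!: inv_closed lc_closed)
          have "rel G (insert i (insert j ?J)) (\<lambda>p q. M p q e) (ext h)"
          proof (subst pivot_rel_seq[OF fJ(1) _ _ ij(3) assms(1) M P _ assms(7)])
            show "ext h \<in> insert i (insert j ?J) \<rightarrow> carrier G" using eI I by auto
            have e1: "ext h i = inv (lc G h (\<lambda>p. \<alpha> p e) ?J)" "ext h j = lc G h (\<lambda>p. \<beta> p e) ?J"
              using ij by (auto simp: ext_def)
            have cl: "lc G h x ?J \<in> carrier G" for x using hJ by auto
            show "(ext h i \<otimes> lc G (ext h) (\<lambda>p. \<alpha> p e) ?J) [^] (int l ^ a) = \<one> \<and>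
              (ext h j \<otimes> inv (lc G (ext h) (\<lambda>p. \<beta> p e) ?J)) [^] (int l ^ a) = \<one> \<and>
              rel G ?J (\<lambda>p q. schur M i j \<alpha> \<beta> p q e) (ext h)"
              using r cl by (simp add: e1 lcs rel_def)
          qed auto
          then show "ext h \<in> I \<rightarrow>\<^sub>E carrier G \<and> rel G I (\<lambda>p q. M p q e) (ext h)"
            using eI I by simp
        qed
      qed
      then show ?thesis using le by linarith
    qed
  qed
qed

section \<open>Image and kernel\<close>

definition compat_vec :: "nat \<Rightarrow> nat set \<Rightarrow> (nat \<Rightarrow> nat \<Rightarrow> int) \<Rightarrow> bool" where
  "compat_vec l I x \<longleftrightarrow> (\<forall>p\<in>I. compat l (x p))"

definition mat_vec :: "nat set \<Rightarrow> (nat \<Rightarrow> nat \<Rightarrow> nat \<Rightarrow> int) \<Rightarrow> (nat \<Rightarrow> nat \<Rightarrow> int) \<Rightarrow> nat \<Rightarrow> nat \<Rightarrow> int" where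
  "mat_vec I M y = (\<lambda>p e. \<Sum>q\<in>I. M p q e * y q e)"

definition in_image :: "nat \<Rightarrow> nat set \<Rightarrow> (nat \<Rightarrow> nat \<Rightarrow> nat \<Rightarrow> int) \<Rightarrow> (nat \<Rightarrow> nat \<Rightarrow> int) \<Rightarrow> bool" where
  "in_image l I M x \<longleftrightarrow> (\<exists>y. compat_vec l I y \<and> (\<forall>p\<in>I. zeq l (x p) (mat_vec I M y p)))"

definition in_kernel :: "nat \<Rightarrow> nat set \<Rightarrow> (nat \<Rightarrow> nat \<Rightarrow> nat \<Rightarrow> int) \<Rightarrow> (nat \<Rightarrow> nat \<Rightarrow> int) \<Rightarrow> bool" where
  "in_kernel l I M y \<longleftrightarrow> (\<forall>p\<in>I. zeq l (mat_vec I M y p) (\<lambda>e. 0))"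

text \<open>The elimination step for products of \<open>A\<close> with a vector instead of
  relations: row \<open>i\<close> sees only a shift of \<open>y j\<close>, row \<open>j\<close> only
  a shift of \<open>y i\<close>, and combining rows clears both from the others.\<close>

lemma pivot_rows:
  fixes A :: "nat \<Rightarrow> nat \<Rightarrow> int" and a b y :: "nat \<Rightarrow> int"
  assumes fin: "finite I" and ij: "i \<notin> I" "j \<notin> I" "i \<noteq> j"
    and A: "[A i i = 0] (mod N)" "[A j j = 0] (mod N)" "[A j i = - A i j] (mod N)"
      "\<And>q. q \<in> I \<Longrightarrow> [A i q = - A q i] (mod N)" "\<And>q. q \<in> I \<Longrightarrow> [A j q = - A q j] (mod N)"
    and ab: "\<And>p. p \<in> I \<Longrightarrow> [a p * A i j = A p j] (mod N)" "\<And>p. p \<in> I \<Longrightarrow> [b p * A i j = A p i] (mod N)"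
  defines "S \<equiv> \<lambda>p. \<Sum>q\<in>insert i (insert j I). A p q * y q"
  shows "[S i = A i j * (y j - (\<Sum>q\<in>I. b q * y q))] (mod N)"
    and "[S j = - A i j * (y i + (\<Sum>q\<in>I. a q * y q))] (mod N)"
    and "p \<in> I \<Longrightarrow> [S p - a p * S i + b p * S j = (\<Sum>q\<in>I. (A p q - a p * A i q + b p * A j q) * y q)] (mod N)"
proof -
  let ?d = "A i j"
  have S: "S p = A p i * y i + (A p j * y j + (\<Sum>q\<in>I. A p q * y q))" for p
    unfolding S_def using fin ij by simp
  have Aq: "[A i q = - (b q * ?d)] (mod N)" "[A j q = - (a q * ?d)] (mod N)" if "q \<in> I" for q
    using A(4,5)[OF that] ab[OF that] by (meson cong_minus_minus_iff cong_sym cong_trans)+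
  have "[S i = 0 * y i + (?d * y j + (\<Sum>q\<in>I. - (b q * ?d) * y q))] (mod N)"
    unfolding S using A(1) Aq(1) by (intro cong_add cong_sum cong_mult cong_refl) auto
  also have "0 * y i + (?d * y j + (\<Sum>q\<in>I. - (b q * ?d) * y q)) = ?d * (y j - (\<Sum>q\<in>I. b q * y q))"
    by (simp add: algebra_simps sum_distrib_left sum_negf)
  finally show "[S i = ?d * (y j - (\<Sum>q\<in>I. b q * y q))] (mod N)" .
  have "[S j = - ?d * y i + (0 * y j + (\<Sum>q\<in>I. - (a q * ?d) * y q))] (mod N)"
    unfolding S using A(2,3) Aq(2) by (intro cong_add cong_sum cong_mult cong_refl) auto
  also have "- ?d * y i + (0 * y j + (\<Sum>q\<in>I. - (a q * ?d) * y q)) = - ?d * (y i + (\<Sum>q\<in>I. a q * y q))"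
    by (simp add: algebra_simps sum_distrib_left sum_negf)
  finally show "[S j = - ?d * (y i + (\<Sum>q\<in>I. a q * y q))] (mod N)" .
  show "[S p - a p * S i + b p * S j = (\<Sum>q\<in>I. (A p q - a p * A i q + b p * A j q) * y q)] (mod N)"
    if p: "p \<in> I"
  proof -
    have S3: "S p - a p * S i + b p * S j = (A p i - a p * A i i + b p * A j i) * y i
      + (A p j - a p * ?d + b p * A j j) * y j + (\<Sum>q\<in>I. (A p q - a p * A i q + b p * A j q) * y q)"
      unfolding S by (simp add: algebra_simps sum_distrib_left sum.distrib sum_subtractf)
    have "[A p i - a p * A i i + b p * A j i = A p i - a p * 0 + b p * (- ?d)] (mod N)"
      by (intro cong_add cong_diff cong_scalar_left cong_refl A)
    moreover have "[A p i - a p * 0 + b p * (- ?d) = 0] (mod N)"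
      using ab(2)[OF p] by (simp add: cong_iff_dvd_diff dvd_diff_commute)
    ultimately have z1: "[A p i - a p * A i i + b p * A j i = 0] (mod N)" by (rule cong_trans)
    have "[A p j - a p * ?d + b p * A j j = A p j - a p * ?d + b p * 0] (mod N)"
      by (intro cong_add cong_diff cong_scalar_left cong_refl A)
    moreover have "[A p j - a p * ?d + b p * 0 = 0] (mod N)"
      using ab(1)[OF p] by (simp add: cong_iff_dvd_diff dvd_diff_commute)
    ultimately have z2: "[A p j - a p * ?d + b p * A j j = 0] (mod N)" by (rule cong_trans)
    have "[S p - a p * S i + b p * S j
        = 0 * y i + 0 * y j + (\<Sum>q\<in>I. (A p q - a p * A i q + b p * A j q) * y q)] (mod N)"
      unfolding S3 by (intro cong_add cong_scalar_right z1 z2 cong_refl)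
    then show ?thesis by simp
  qed
qed

lemma pivot_rows_seq:
  fixes y :: "nat \<Rightarrow> nat \<Rightarrow> int"
  assumes fin: "finite I" and ij: "i \<notin> I" "j \<notin> I" "i \<noteq> j"
    and M: "alt_seq l (insert i (insert j I)) M" and P: "pivot l I M i j a \<alpha> \<beta>"
  defines "S \<equiv> mat_vec (insert i (insert j I)) M y"
  shows "[S i e = M i j e * (y j e - (\<Sum>q\<in>I. \<beta> q e * y q e))] (mod int l ^ e)"
    and "[S j e = - M i j e * (y i e + (\<Sum>q\<in>I. \<alpha> q e * y q e))] (mod int l ^ e)"
    and "p \<in> I \<Longrightarrow> [S p e - \<alpha> p e * S i e + \<beta> p e * S j e = mat_vec I (schur M i j \<alpha> \<beta>) y p e] (mod int l ^ e)"
  unfolding S_def mat_vec_def schur_def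
  by (intro pivot_rows[OF fin ij, where A = "\<lambda>p q. M p q e" and y = "\<lambda>q. y q e"
        and a = "\<lambda>q. \<alpha> q e" and b = "\<lambda>q. \<beta> q e"];
      (use M P in \<open>auto simp: alt_seq_def pivot_def\<close>))+

lemma compat_vec_mat_vec:
  "alt_seq l I M \<Longrightarrow> compat_vec l I y \<Longrightarrow> p \<in> I \<Longrightarrow> compat l (mat_vec I M y p)"
  unfolding mat_vec_def by (intro compat_sum compat_mult) (auto simp: alt_seq_def compat_vec_def)

text \<open>Rows \<open>i\<close> and \<open>j\<close> express \<open>x i\<close> and
  \<open>x j\<close> as plus or minus the pivot times quantities that \<open>y j\<close> and
  \<open>y i\<close> can adjust freely, so they demand divisibility by \<open>l^a\<close> and
  nothing else. The other rows, once cleared, form the equation for the Schur complement.\<close>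

lemma in_image_pivot:
  assumes fin: "finite I" and ij: "i \<notin> I" "j \<notin> I" "i \<noteq> j" and l: "prime l"
    and M: "alt_seq l (insert i (insert j I)) M" and P: "pivot l I M i j a \<alpha> \<beta>"
    and x: "compat_vec l (insert i (insert j I)) x"
  shows "in_image l (insert i (insert j I)) M x \<longleftrightarrow> int l ^ a dvd x i a \<and> int l ^ a dvd x j a \<and>
    in_image l I (schur M i j \<alpha> \<beta>) (\<lambda>p e. x p e - \<alpha> p e * x i e + \<beta> p e * x j e)"
    (is "?L \<longleftrightarrow> ?R")
proof
  let ?K = "insert i (insert j I)"
  note rows = pivot_rows_seq[OF fin ij M P]
  have d: "compat l (M i j)" "val_eq l (M i j) a" using M P by (auto simp: alt_seq_def pivot_def)
  {
    assume ?L
    then obtain y where y: "compat_vec l ?K y" "\<And>p e. p \<in> ?K \<Longrightarrow> [x p e = mat_vec ?K M y p e] (mod int l ^ e)"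
      unfolding in_image_def zeq_def by blast
    have da: "int l ^ a dvd M i j a" using d by (simp add: val_eq_def)
    have "[x i a = M i j a * (y j a - (\<Sum>q\<in>I. \<beta> q a * y q a))] (mod int l ^ a)"
      by (rule cong_trans[OF y(2) rows(1)]) simp
    then have 1: "int l ^ a dvd x i a" using da cong_dvd_iff dvd_mult2 by blast
    have "[x j a = - M i j a * (y i a + (\<Sum>q\<in>I. \<alpha> q a * y q a))] (mod int l ^ a)"
      by (rule cong_trans[OF y(2) rows(2)]) simp
    then have 2: "int l ^ a dvd x j a" using da cong_dvd_iff dvd_mult2 dvd_minus_iff by metis
    have "zeq l (\<lambda>e. x p e - \<alpha> p e * x i e + \<beta> p e * x j e) (mat_vec I (schur M i j \<alpha> \<beta>) y p)" if p: "p \<in> I" for p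
      unfolding zeq_def
    proof
      fix e
      have "[x p e - \<alpha> p e * x i e + \<beta> p e * x j e = mat_vec ?K M y p e - \<alpha> p e * mat_vec ?K M y i e
         + \<beta> p e * mat_vec ?K M y j e] (mod int l ^ e)"
        using p by (intro cong_add cong_diff cong_scalar_left y(2)) auto
      then show "[x p e - \<alpha> p e * x i e + \<beta> p e * x j e = mat_vec I (schur M i j \<alpha> \<beta>) y p e] (mod int l ^ e)"
        using rows(3)[OF p] by (rule cong_trans)
    qed
    moreover have "compat_vec l I y" using y(1) by (auto simp: compat_vec_def)
    ultimately show ?R using 1 2 by (auto simp: in_image_def)
  next
    assume R: ?R
    then obtain y' where y': "compat_vec l I y'"
      "\<And>p e. p \<in> I \<Longrightarrow> [x p e - \<alpha> p e * x i e + \<beta> p e * x j e = mat_vec I (schur M i j \<alpha> \<beta>) y' p e] (mod int l ^ e)"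
      unfolding in_image_def zeq_def by blast
    obtain s where s: "compat l s" "\<And>e. [s e * M i j e = x i e] (mod int l ^ e)"
      using compat_quotient[OF l d, of "x i"] x R by (auto simp: compat_vec_def)
    obtain t where t: "compat l t" "\<And>e. [t e * M i j e = x j e] (mod int l ^ e)"
      using compat_quotient[OF l d, of "x j"] x R by (auto simp: compat_vec_def)
    \<comment> \<open>The entries at \<open>i\<close> and \<open>j\<close> solve the rows
      \<open>j\<close> and \<open>i\<close>; \<open>s\<close> and \<open>t\<close> are the quotients
      of \<open>x i\<close> and \<open>x j\<close> by the pivot.\<close>
    define y where "y = (\<lambda>q. if q = i then (\<lambda>e. - (t e + (\<Sum>q\<in>I. \<alpha> q e * y' q e)))
       else if q = j then (\<lambda>e. s e + (\<Sum>q\<in>I. \<beta> q e * y' q e)) else y' q)"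
    have yI: "y q = y' q" if "q \<in> I" for q using that ij by (auto simp: y_def)
    have yi: "y i = (\<lambda>e. - (t e + (\<Sum>q\<in>I. \<alpha> q e * y' q e)))" by (simp add: y_def)
    have yj: "y j = (\<lambda>e. s e + (\<Sum>q\<in>I. \<beta> q e * y' q e))" using ij by (simp add: y_def)
    have "compat_vec l ?K y"
      using y'(1) s(1) t(1) P yI yi yj
      by (auto simp: compat_vec_def pivot_def intro!: compat_uminus compat_add compat_sum compat_mult)
    moreover have mi: "[x i e = mat_vec ?K M y i e] (mod int l ^ e)" for e
    proof -
      have "y j e - (\<Sum>q\<in>I. \<beta> q e * y q e) = s e" using yI by (simp add: yj)
      then have "[mat_vec ?K M y i e = s e * M i j e] (mod int l ^ e)" using rows(1)[of y e] by (simp add: mult.commute)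
      then show ?thesis using s(2)[of e] by (meson cong_sym cong_trans)
    qed
    moreover have mj: "[x j e = mat_vec ?K M y j e] (mod int l ^ e)" for e
    proof -
      have "y i e + (\<Sum>q\<in>I. \<alpha> q e * y q e) = - t e" using yI by (simp add: yi)
      then have "[mat_vec ?K M y j e = t e * M i j e] (mod int l ^ e)" using rows(2)[of y e] by (simp add: mult.commute)
      then show ?thesis using t(2)[of e] by (meson cong_sym cong_trans)
    qed
    moreover have "[x p e = mat_vec ?K M y p e] (mod int l ^ e)" if p: "p \<in> I" for p e
    proof -
      have eq: "mat_vec I (schur M i j \<alpha> \<beta>) y' p e = mat_vec I (schur M i j \<alpha> \<beta>) y p e"
        using yI by (auto simp: mat_vec_def intro: sum.cong)
      have "[x p e - \<alpha> p e * x i e + \<beta> p e * x j e = mat_vec ?K M y p e - \<alpha> p e * mat_vec ?K M y i e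
         + \<beta> p e * mat_vec ?K M y j e] (mod int l ^ e)"
        by (intro cong_trans[OF y'(2)[OF p, of e, unfolded eq] cong_sym[OF rows(3)[OF p, of y e]]])
      moreover have "[\<alpha> p e * x i e - \<beta> p e * x j e = \<alpha> p e * mat_vec ?K M y i e - \<beta> p e * mat_vec ?K M y j e] (mod int l ^ e)"
        by (intro cong_diff cong_scalar_left mi mj)
      ultimately have "[(x p e - \<alpha> p e * x i e + \<beta> p e * x j e) + (\<alpha> p e * x i e - \<beta> p e * x j e)
         = (mat_vec ?K M y p e - \<alpha> p e * mat_vec ?K M y i e + \<beta> p e * mat_vec ?K M y j e)
           + (\<alpha> p e * mat_vec ?K M y i e - \<beta> p e * mat_vec ?K M y j e)] (mod int l ^ e)"
        by (rule cong_add)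
      then show ?thesis by simp
    qed
    ultimately show ?L unfolding in_image_def zeq_def by blast
  }
qed

text \<open>Coordinates of the lattice in which the image of \<open>M\<close> is a diagonal sublattice.\<close>

definition image_coords :: "nat \<Rightarrow> nat set \<Rightarrow> nat set \<Rightarrow> (nat \<Rightarrow> nat \<Rightarrow> nat \<Rightarrow> int) \<Rightarrow> (nat \<Rightarrow> nat) \<Rightarrow>
    ((nat \<Rightarrow> nat \<Rightarrow> int) \<Rightarrow> nat \<Rightarrow> nat \<Rightarrow> int) \<Rightarrow> bool" where
  "image_coords l I R M \<kappa> c \<longleftrightarrow>
     (\<forall>x. compat_vec l I x \<longrightarrow> compat_vec l I (c x)) \<and>
     (\<forall>x y k e. \<forall>p\<in>I. c (\<lambda>p e. k * x p e + y p e) p e = k * c x p e + c y p e) \<and>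
     (\<forall>x y e. (\<forall>p\<in>I. [x p e = y p e] (mod int l ^ e)) \<longrightarrow> (\<forall>p\<in>I. [c x p e = c y p e] (mod int l ^ e))) \<and>
     (\<forall>z. compat_vec l I z \<longrightarrow> (\<exists>x. compat_vec l I x \<and> (\<forall>p\<in>I. zeq l (c x p) (z p)))) \<and>
     (\<forall>x. compat_vec l I x \<longrightarrow> (in_image l I M x \<longleftrightarrow>
        (\<forall>s\<in>I - R. int l ^ \<kappa> s dvd c x s (\<kappa> s)) \<and> (\<forall>s\<in>R. zeq l (c x s) (\<lambda>e. 0))))"

lemma alt_seq_small:
  assumes "finite I" "card I \<le> 1" "alt_seq l I M" "p \<in> I" "q \<in> I"
  shows "[M p q e = 0] (mod int l ^ e)"
proof -
  have "p = q" using assms by (metis card_le_Suc0_iff_eq One_nat_def)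
  then show ?thesis using assms by (auto simp: alt_seq_def)
qed

lemma mat_vec_small:
  assumes "finite I" "card I \<le> 1" "alt_seq l I M" "p \<in> I"
  shows "[mat_vec I M y p e = 0] (mod int l ^ e)"
proof -
  have "[mat_vec I M y p e = (\<Sum>q\<in>I. 0 * y q e)] (mod int l ^ e)"
    unfolding mat_vec_def using alt_seq_small[OF assms(1-3) assms(4)]
    by (intro cong_sum cong_scalar_right)
  then show ?thesis by simp
qed

text \<open>One step keeps the coordinates \<open>i\<close> and \<open>j\<close> and passes to the
  cleared vector on \<open>I\<close>, on which the coordinates belonging to the Schur complement are
  used. At the end the block on \<open>R\<close> is zero, so nothing but zero is in the image
  there.\<close>

lemma sympl_image_coords:
  assumes "sympl l I R M \<kappa>" "alt_seq l I M" "prime l"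
  shows "\<exists>c. image_coords l I R M \<kappa> c"
  using assms(1,2)
proof (induction rule: sympl.induct)
  case (base I M \<kappa>)
  have "in_image l I M x \<longleftrightarrow> (\<forall>s\<in>I. zeq l (x s) (\<lambda>e. 0))" for x
  proof
    show "\<forall>s\<in>I. zeq l (x s) (\<lambda>e. 0)" if "in_image l I M x"
      using that mat_vec_small[OF base] unfolding in_image_def zeq_def by (meson cong_trans)
    show "in_image l I M x" if "\<forall>s\<in>I. zeq l (x s) (\<lambda>e. 0)"
      using that mat_vec_small[OF base] unfolding in_image_def zeq_def compat_vec_def
      by (intro exI[of _ "\<lambda>q e. 0"]) (simp add: mat_vec_def)
  qed
  moreover have "zeq l z z" for z by (simp add: zeq_def)
  ultimately show ?case by (intro exI[of _ "\<lambda>x. x"]) (auto simp: image_coords_def)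
next
  case (step I i j \<kappa> a M \<alpha> \<beta> R)
  let ?K = "insert i (insert j I)"
  note ij = step.hyps(2-4)
  have RI: "R \<subseteq> I" using sympl_finite[OF step.hyps(8)] by auto
  have "alt_seq l I (schur M i j \<alpha> \<beta>)" using alt_seq_schur step.prems step.hyps(7) by blast
  from step.IH[OF this] obtain c where c: "image_coords l I R (schur M i j \<alpha> \<beta>) \<kappa> c" by blast
  define red where "red x = (\<lambda>p e. x p e - \<alpha> p e * x i e + \<beta> p e * x j e :: int)" for x
  define c' where "c' x s = (if s = i \<or> s = j then x s else c (red x) s)" for x s
  have c'I: "c' x s = c (red x) s" if "s \<in> I" for x s using that ij by (auto simp: c'_def)
  have c'ij: "c' x i = x i" "c' x j = x j" for x by (auto simp: c'_def)
  have \<alpha>\<beta>: "compat l (\<alpha> p)" "compat l (\<beta> p)" if "p \<in> I" for p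
    using step.hyps(7) that by (auto simp: pivot_def)
  have redc: "compat_vec l I (red x)" if "compat_vec l ?K x" for x
    using that \<alpha>\<beta> by (auto simp: compat_vec_def red_def intro!: compat_add compat_diff compat_mult)
  have 1: "compat_vec l ?K (c' x)" if x: "compat_vec l ?K x" for x
  proof -
    have "compat_vec l I (c (red x))" using c redc[OF x] by (simp add: image_coords_def)
    then show ?thesis using x c'I c'ij by (auto simp: compat_vec_def)
  qed
  have 2: "c' (\<lambda>p e. k * x p e + y p e) p e = k * c' x p e + c' y p e" if "p \<in> ?K" for k x y p e
  proof -
    have "red (\<lambda>p e. k * x p e + y p e) = (\<lambda>p e. k * red x p e + red y p e)"
      by (simp add: red_def algebra_simps)
    moreover have "c (\<lambda>p e. k * red x p e + red y p e) p e = k * c (red x) p e + c (red y) p e" if "p \<in> I"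
      using c that by (simp add: image_coords_def)
    ultimately show ?thesis using that c'I c'ij by auto
  qed
  have 3: "[c' x p e = c' y p e] (mod int l ^ e)"
    if "\<forall>p\<in>?K. [x p e = y p e] (mod int l ^ e)" "p \<in> ?K" for x y p e
  proof -
    have "\<forall>p\<in>I. [red x p e = red y p e] (mod int l ^ e)"
      unfolding red_def using that(1) by (auto intro!: cong_add cong_diff cong_scalar_left)
    then have "\<forall>p\<in>I. [c (red x) p e = c (red y) p e] (mod int l ^ e)"
      using c by (simp add: image_coords_def)
    then show ?thesis using that c'I c'ij by auto
  qed
  have 4: "\<exists>x. compat_vec l ?K x \<and> (\<forall>p\<in>?K. zeq l (c' x p) (z p))" if z: "compat_vec l ?K z" for z
  proof -
    have "compat_vec l I z" using z by (auto simp: compat_vec_def)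
    then obtain x' where x': "compat_vec l I x'" "\<And>p. p \<in> I \<Longrightarrow> zeq l (c x' p) (z p)"
      using c by (auto simp: image_coords_def)
    \<comment> \<open>Undoes the clearing: adding back the multiples of \<open>z i\<close> and
      \<open>z j\<close> makes \<open>red x\<close> equal to \<open>x'\<close> on
      \<open>I\<close>.\<close>
    define x where "x p = (if p = i \<or> p = j then z p else (\<lambda>e. x' p e + \<alpha> p e * z i e - \<beta> p e * z j e))" for p
    have xij: "x i = z i" "x j = z j" by (auto simp: x_def)
    have xI: "x p = (\<lambda>e. x' p e + \<alpha> p e * z i e - \<beta> p e * z j e)" if "p \<in> I" for p
      using that ij by (auto simp: x_def)
    have cx: "compat_vec l ?K x"
      unfolding compat_vec_def
    proof
      fix p assume "p \<in> ?K"
      then consider "p = i" | "p = j" | "p \<in> I" by blast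
      then show "compat l (x p)"
        using z x'(1) xij xI \<alpha>\<beta>
        by cases (auto simp: compat_vec_def intro!: compat_add compat_diff compat_mult)
    qed
    have "red x p = x' p" if "p \<in> I" for p
      using xI[OF that] xij by (auto simp: red_def fun_eq_iff)
    then have "\<forall>p\<in>I. [c (red x) p e = c x' p e] (mod int l ^ e)" for e
      using c by (simp add: image_coords_def)
    then have "zeq l (c' x p) (z p)" if "p \<in> I" for p
      using x'(2)[OF that] c'I[OF that] that unfolding zeq_def by (metis cong_trans)
    moreover have "zeq l (c' x i) (z i)" "zeq l (c' x j) (z j)"
      by (simp_all add: c'ij xij zeq_def)
    ultimately show ?thesis using cx by blast
  qed
  have 5: "in_image l ?K M x \<longleftrightarrow> (\<forall>s\<in>?K - R. int l ^ \<kappa> s dvd c' x s (\<kappa> s)) \<and> (\<forall>s\<in>R. zeq l (c' x s) (\<lambda>e. 0))"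
    if x: "compat_vec l ?K x" for x
  proof -
    have "?K - R = insert i (insert j (I - R))" using RI ij by auto
    moreover have "in_image l I (schur M i j \<alpha> \<beta>) (red x) \<longleftrightarrow>
        (\<forall>s\<in>I - R. int l ^ \<kappa> s dvd c (red x) s (\<kappa> s)) \<and> (\<forall>s\<in>R. zeq l (c (red x) s) (\<lambda>e. 0))"
      using c redc[OF x] by (simp add: image_coords_def)
    moreover have "\<forall>s\<in>R. c' x s = c (red x) s" using RI c'I by blast
    ultimately show ?thesis
      using in_image_pivot[OF step.hyps(1) ij assms(3) step.prems step.hyps(7) x] c'I c'ij step.hyps(5,6)
      by (auto simp: red_def)
  qed
  have "image_coords l ?K R M \<kappa> c'"
    unfolding image_coords_def using 1 2 3 4 5 by blast
  then show ?case by blast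
qed


text \<open>A nonzero pivot determines \<open>y i\<close> and \<open>y j\<close> from the rest of a
  kernel vector, so the kernel is that of the zero block on \<open>R\<close>: trivial, or spanned by
  one nonzero vector \<open>v\<close>. The rank is deduced from this.\<close>

lemma sympl_kernel:
  assumes "sympl l I R M \<kappa>" "alt_seq l I M" "prime l"
  shows "\<exists>v. compat_vec l I v \<and> in_kernel l I M v \<and> (R = {} \<longrightarrow> (\<forall>q\<in>I. zeq l (v q) (\<lambda>e. 0))) \<and>
    (R \<noteq> {} \<longrightarrow> (\<exists>q\<in>I. \<not> zeq l (v q) (\<lambda>e. 0))) \<and>
    (\<forall>y. compat_vec l I y \<and> in_kernel l I M y \<longrightarrow>
      (\<exists>t. compat l t \<and> (\<forall>q\<in>I. zeq l (y q) (\<lambda>e. t e * v q e))))"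
  using assms(1,2)
proof (induction rule: sympl.induct)
  case (base I M \<kappa>)
  show ?case
  proof (cases "I = {}")
    case True
    then show ?thesis
      by (intro exI[of _ "\<lambda>q e. 0"]) (auto simp: compat_vec_def in_kernel_def zeq_def intro: compat_const)
  next
    case False
    then obtain \<rho> where \<rho>: "I = {\<rho>}"
      using base by (metis One_nat_def card_0_eq card_1_singletonE le_Suc_eq le_zero_eq)
    have "1 \<noteq> (0::int)" by simp
    have nz: "\<not> zeq l (\<lambda>e. 1) (\<lambda>e. 0)"
      using assms(3) by (auto simp: zeq_def cong_0_iff prime_nat_iff intro!: exI[of _ 1])
    have "in_kernel l I M (\<lambda>q e. 1)"
      using mat_vec_small[OF base] by (simp add: in_kernel_def zeq_def)
    then show ?thesis
      using \<rho> nz by (intro exI[of _ "\<lambda>q e. 1"]) (auto simp: compat_vec_def zeq_def)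
  qed
next
  case (step I i j \<kappa> a M \<alpha> \<beta> R)
  let ?K = "insert i (insert j I)"
  note ij = step.hyps(2-4)
  note rows = pivot_rows_seq[OF step.hyps(1) ij step.prems step.hyps(7)]
  have d: "compat l (M i j)" "val_eq l (M i j) a"
    using step.prems step.hyps(7) by (auto simp: alt_seq_def pivot_def)
  have \<alpha>\<beta>: "compat l (\<alpha> p)" "compat l (\<beta> p)" if "p \<in> I" for p
    using step.hyps(7) that by (auto simp: pivot_def)
  have "alt_seq l I (schur M i j \<alpha> \<beta>)" using alt_seq_schur step.prems step.hyps(7) by blast
  from step.IH[OF this] obtain v where v: "compat_vec l I v" "in_kernel l I (schur M i j \<alpha> \<beta>) v"
    "R = {} \<longrightarrow> (\<forall>q\<in>I. zeq l (v q) (\<lambda>e. 0))" "R \<noteq> {} \<longrightarrow> (\<exists>q\<in>I. \<not> zeq l (v q) (\<lambda>e. 0))"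
    "\<And>y. compat_vec l I y \<Longrightarrow> in_kernel l I (schur M i j \<alpha> \<beta>) y \<Longrightarrow>
      \<exists>t. compat l t \<and> (\<forall>q\<in>I. zeq l (y q) (\<lambda>e. t e * v q e))" by blast
  \<comment> \<open>The generator for the Schur complement, completed by the entries that make the
    rows \<open>i\<close> and \<open>j\<close> vanish.\<close>
  define w where "w q = (if q = i then (\<lambda>e. - (\<Sum>q\<in>I. \<alpha> q e * v q e))
      else if q = j then (\<lambda>e. \<Sum>q\<in>I. \<beta> q e * v q e) else v q)" for q
  have wI: "w q = v q" if "q \<in> I" for q using that ij by (auto simp: w_def)
  have wi: "w i = (\<lambda>e. - (\<Sum>q\<in>I. \<alpha> q e * v q e))" by (simp add: w_def)
  have wj: "w j = (\<lambda>e. \<Sum>q\<in>I. \<beta> q e * v q e)" using ij by (simp add: w_def)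
  have cw: "compat_vec l ?K w"
    using v(1) \<alpha>\<beta> wI wi wj
    by (auto simp: compat_vec_def intro!: compat_uminus compat_sum compat_mult)
  have ker: "in_kernel l ?K M y \<longleftrightarrow> (\<forall>e. [M i j e * (y j e - (\<Sum>q\<in>I. \<beta> q e * y q e)) = 0] (mod int l ^ e)) \<and>
      (\<forall>e. [M i j e * (y i e + (\<Sum>q\<in>I. \<alpha> q e * y q e)) = 0] (mod int l ^ e)) \<and>
      in_kernel l I (schur M i j \<alpha> \<beta>) y" for y
  proof -
    have i: "[mat_vec ?K M y i e = 0] (mod int l ^ e) \<longleftrightarrow>
        [M i j e * (y j e - (\<Sum>q\<in>I. \<beta> q e * y q e)) = 0] (mod int l ^ e)" for e
      using rows(1)[of y e] by (meson cong_sym cong_trans)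
    have j: "[mat_vec ?K M y j e = 0] (mod int l ^ e) \<longleftrightarrow>
        [M i j e * (y i e + (\<Sum>q\<in>I. \<alpha> q e * y q e)) = 0] (mod int l ^ e)" for e
    proof -
      have "[mat_vec ?K M y j e = 0] (mod int l ^ e) \<longleftrightarrow>
        [- M i j e * (y i e + (\<Sum>q\<in>I. \<alpha> q e * y q e)) = 0] (mod int l ^ e)"
        using rows(2)[of y e] by (meson cong_sym cong_trans)
      then show ?thesis by (simp add: cong_0_iff)
    qed
    have p: "[mat_vec ?K M y p e = 0] (mod int l ^ e) \<longleftrightarrow> [mat_vec I (schur M i j \<alpha> \<beta>) y p e = 0] (mod int l ^ e)"
      if "p \<in> I" "[mat_vec ?K M y i e = 0] (mod int l ^ e)" "[mat_vec ?K M y j e = 0] (mod int l ^ e)" for p e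
    proof -
      have "int l ^ e dvd - \<alpha> p e * mat_vec ?K M y i e + \<beta> p e * mat_vec ?K M y j e"
        using that(2,3) by (simp add: cong_0_iff)
      then have "[mat_vec ?K M y p e - \<alpha> p e * mat_vec ?K M y i e + \<beta> p e * mat_vec ?K M y j e
         = mat_vec ?K M y p e] (mod int l ^ e)"
        by (simp add: cong_iff_dvd_diff)
      then show ?thesis using rows(3)[OF that(1), of y e] by (meson cong_sym cong_trans)
    qed
    show ?thesis unfolding in_kernel_def zeq_def using i j p by blast
  qed
  have kI: "in_kernel l I N w \<longleftrightarrow> in_kernel l I N v" for N
    unfolding in_kernel_def mat_vec_def using wI by (intro ball_cong refl) (simp cong: sum.cong)
  have "in_kernel l ?K M w"
    unfolding ker kI using v(2) wI wi wj by (simp cong: sum.cong)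
  moreover have "\<forall>q\<in>?K. zeq l (w q) (\<lambda>e. 0)" if "R = {}"
  proof -
    have vz: "\<And>q e. q \<in> I \<Longrightarrow> [v q e = 0] (mod int l ^ e)" using v(3) that by (simp add: zeq_def)
    have s: "[(\<Sum>q\<in>I. f q e * v q e) = (\<Sum>q\<in>I. f q e * 0)] (mod int l ^ e)" for f :: "nat \<Rightarrow> nat \<Rightarrow> int" and e
      using vz by (intro cong_sum cong_scalar_left)
    have "zeq l (w i) (\<lambda>e. 0)" "zeq l (w j) (\<lambda>e. 0)"
      using s[of \<alpha>] s[of \<beta>] by (simp_all add: wi wj zeq_def cong_0_iff)
    then show ?thesis using v(3) that wI by auto
  qed
  moreover have "\<exists>q\<in>?K. \<not> zeq l (w q) (\<lambda>e. 0)" if "R \<noteq> {}"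
    using v(4) that wI by (metis insertCI)
  moreover have "\<exists>t. compat l t \<and> (\<forall>q\<in>?K. zeq l (y q) (\<lambda>e. t e * w q e))"
    if y: "compat_vec l ?K y" "in_kernel l ?K M y" for y
  proof -
    have cy: "compat_vec l I y" "compat l (y i)" "compat l (y j)" using y(1) by (auto simp: compat_vec_def)
    have "in_kernel l I (schur M i j \<alpha> \<beta>) y" using y(2) unfolding ker by blast
    then obtain t where t: "compat l t" "\<And>q. q \<in> I \<Longrightarrow> zeq l (y q) (\<lambda>e. t e * v q e)"
      using v(5)[OF cy(1)] by blast
    have cs: "compat l (\<lambda>e. \<Sum>q\<in>I. \<beta> q e * y q e)" "compat l (\<lambda>e. \<Sum>q\<in>I. \<alpha> q e * y q e)"
      using cy(1) \<alpha>\<beta> by (auto simp: compat_vec_def intro!: compat_sum compat_mult)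
    have "zeq l (\<lambda>e. y j e - (\<Sum>q\<in>I. \<beta> q e * y q e)) (\<lambda>e. 0)"
      by (rule zeq_cancel[OF assms(3) d compat_diff[OF cy(3) cs(1)]]) (use y(2) ker in \<open>auto simp: zeq_def\<close>)
    moreover have "zeq l (\<lambda>e. y i e + (\<Sum>q\<in>I. \<alpha> q e * y q e)) (\<lambda>e. 0)"
      by (rule zeq_cancel[OF assms(3) d compat_add[OF cy(2) cs(2)]]) (use y(2) ker in \<open>auto simp: zeq_def\<close>)
    moreover have s: "[(\<Sum>q\<in>I. f q e * y q e) = t e * (\<Sum>q\<in>I. f q e * v q e)] (mod int l ^ e)"
      for f :: "nat \<Rightarrow> nat \<Rightarrow> int" and e
    proof -
      have "[(\<Sum>q\<in>I. f q e * y q e) = (\<Sum>q\<in>I. f q e * (t e * v q e))] (mod int l ^ e)"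
        using t(2) by (intro cong_sum cong_scalar_left) (simp add: zeq_def)
      then show ?thesis by (simp add: sum_distrib_left ac_simps)
    qed
    ultimately have "zeq l (y j) (\<lambda>e. t e * w j e)" "zeq l (y i) (\<lambda>e. t e * w i e)"
      unfolding wi wj zeq_def
      by (metis cong_diff_iff_cong_0 cong_trans,
        metis (no_types, lifting) cong_diff_iff_cong_0 cong_minus_minus_iff cong_trans diff_minus_eq_add mult_minus_right)
    then show ?thesis using t wI by (intro exI[of _ t]) auto
  qed
  ultimately show ?case using cw by blast
qed

section \<open>The ring of l-adic integers\<close>

definition red :: "nat \<Rightarrow> (nat \<Rightarrow> int) \<Rightarrow> nat \<Rightarrow> int" where
  "red l x = (\<lambda>e. x e mod int l ^ e)"

lemma Zl_simps [simp]:
  "x \<otimes>\<^bsub>Zl l\<^esub> y = red l (\<lambda>e. x e * y e)" "x \<oplus>\<^bsub>Zl l\<^esub> y = red l (\<lambda>e. x e + y e)"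
  "\<zero>\<^bsub>Zl l\<^esub> = (\<lambda>e. 0)"
  by (simp_all add: Zl_def red_def)

lemma carrier_Zl: "x \<in> carrier (Zl l) \<longleftrightarrow> (\<forall>e. x e \<in> {0..<int l ^ e}) \<and> compat l x"
  unfolding Zl_def compat_def by (auto simp: cong_def)

lemma zeq_red: "zeq l (red l x) x" "zeq l x (red l x)"
  by (simp_all add: zeq_def red_def)

lemma zeq_sym: "zeq l x y \<Longrightarrow> zeq l y x"
  by (simp add: zeq_def cong_sym)

lemma zeq_trans: "zeq l x y \<Longrightarrow> zeq l y z \<Longrightarrow> zeq l x z"
  unfolding zeq_def by (meson cong_trans)

lemma compat_zeq:
  assumes "zeq l x y" "compat l x"
  shows "compat l y"
  unfolding compat_def
proof
  fix e
  have "[x (Suc e) = y (Suc e)] (mod int l ^ Suc e)" "[x e = y e] (mod int l ^ e)"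
    using assms(1) unfolding zeq_def by blast+
  moreover have "int l ^ e dvd int l ^ Suc e" by simp
  ultimately have "[y (Suc e) = x (Suc e)] (mod int l ^ e)" "[x e = y e] (mod int l ^ e)"
    using cong_dvd_modulus cong_sym by blast+
  moreover have "[x (Suc e) = x e] (mod int l ^ e)" using assms(2) by (simp add: compat_def)
  ultimately show "[y (Suc e) = y e] (mod int l ^ e)" using cong_trans by blast
qed

lemma red_carrier [simp]: "l > 0 \<Longrightarrow> red l x \<in> carrier (Zl l) \<longleftrightarrow> compat l x"
proof -
  assume "l > 0"
  then have "\<forall>e. red l x e \<in> {0..<int l ^ e}" by (simp add: red_def)
  then show ?thesis using compat_zeq[OF zeq_red(1)] compat_zeq[OF zeq_red(2)] carrier_Zl by blast
qed

lemma red_eq_iff: "red l x = red l y \<longleftrightarrow> zeq l x y"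
  by (simp add: red_def zeq_def cong_def fun_eq_iff)

lemma red_id: "x \<in> carrier (Zl l) \<Longrightarrow> red l x = x"
  by (auto simp: carrier_Zl red_def fun_eq_iff)

lemma Zl_compat: "x \<in> carrier (Zl l) \<Longrightarrow> compat l x"
  by (simp add: carrier_Zl)

lemma red_add_red: "red l (\<lambda>e. red l x e + y e) = red l (\<lambda>e. x e + y e)"
  "red l (\<lambda>e. y e + red l x e) = red l (\<lambda>e. y e + x e)"
  by (simp_all add: red_def mod_simps)

lemma abelian_group_Zl: "l > 0 \<Longrightarrow> abelian_group (Zl l)"
proof (rule abelian_groupI)
  assume l: "l > 0"
  show "\<zero>\<^bsub>Zl l\<^esub> \<in> carrier (Zl l)" using l by (simp add: carrier_Zl)
  fix x y z assume xyz: "x \<in> carrier (Zl l)" "y \<in> carrier (Zl l)"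
  then have c: "compat l x" "compat l y" by (simp_all add: Zl_compat)
  show "x \<oplus>\<^bsub>Zl l\<^esub> y \<in> carrier (Zl l)" using l c by (simp add: compat_add)
  show "(x \<oplus>\<^bsub>Zl l\<^esub> y) \<oplus>\<^bsub>Zl l\<^esub> z = x \<oplus>\<^bsub>Zl l\<^esub> (y \<oplus>\<^bsub>Zl l\<^esub> z)"
    by (simp add: red_add_red ac_simps)
  show "x \<oplus>\<^bsub>Zl l\<^esub> y = y \<oplus>\<^bsub>Zl l\<^esub> x" by (simp add: ac_simps)
  show "\<zero>\<^bsub>Zl l\<^esub> \<oplus>\<^bsub>Zl l\<^esub> x = x" using xyz by (simp add: red_id)
  show "\<exists>y\<in>carrier (Zl l). y \<oplus>\<^bsub>Zl l\<^esub> x = \<zero>\<^bsub>Zl l\<^esub>"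
    using l c by (intro bexI[of _ "red l (\<lambda>e. - x e)"])
      (simp add: red_add_red, simp add: red_def, simp add: compat_uminus)
qed

lemma Zl_minus: "l > 0 \<Longrightarrow> x \<in> carrier (Zl l) \<Longrightarrow> \<ominus>\<^bsub>Zl l\<^esub> x = red l (\<lambda>e. - x e)"
proof -
  assume l: "l > 0" and x: "x \<in> carrier (Zl l)"
  interpret abelian_group "Zl l" using abelian_group_Zl[OF l] .
  have "red l (\<lambda>e. - x e) \<oplus>\<^bsub>Zl l\<^esub> x = \<zero>\<^bsub>Zl l\<^esub>"
    by (simp add: red_add_red, simp add: red_def)
  then show ?thesis using l x Zl_compat[OF x] minus_equality[of "red l (\<lambda>e. - x e)" x] by (simp add: compat_uminus)
qed

lemma Zl_finsum:
  assumes "l > 0" "finite A" "\<And>j. j \<in> A \<Longrightarrow> f j \<in> carrier (Zl l)"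
  shows "finsum (Zl l) f A = red l (\<lambda>e. \<Sum>j\<in>A. f j e)"
proof -
  interpret abelian_group "Zl l" using abelian_group_Zl[OF assms(1)] .
  show ?thesis using assms(2,3)
  proof (induction A rule: finite_induct)
    case empty
    then show ?case by (simp add: red_def)
  next
    case (insert a A)
    then have "f \<in> A \<rightarrow> carrier (Zl l)" "f a \<in> carrier (Zl l)" by auto
    then show ?case using insert by (simp add: finsum_insert red_add_red del: Zl_simps(1))
  qed
qed

lemma Zl_mat_vec:
  assumes "l > 0" "finite A" "\<And>j. j \<in> A \<Longrightarrow> M (i, j) \<in> carrier (Zl l)" "\<And>j. j \<in> A \<Longrightarrow> x j \<in> carrier (Zl l)"
  shows "(\<Oplus>\<^bsub>Zl l\<^esub>j\<in>A. M (i, j) \<otimes>\<^bsub>Zl l\<^esub> x j) = red l (mat_vec A (\<lambda>i j. M (i, j)) x i)"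
proof -
  have "(\<Oplus>\<^bsub>Zl l\<^esub>j\<in>A. M (i, j) \<otimes>\<^bsub>Zl l\<^esub> x j) = red l (\<lambda>e. \<Sum>j\<in>A. (M (i, j) \<otimes>\<^bsub>Zl l\<^esub> x j) e)"
    using assms by (intro Zl_finsum) (auto simp: Zl_compat compat_mult)
  also have "\<dots> = red l (mat_vec A (\<lambda>i j. M (i, j)) x i)"
    unfolding red_eq_iff zeq_def mat_vec_def by (intro allI cong_sum) (simp add: red_def)
  finally show ?thesis .
qed

lemma alt_mats_carrier:
  assumes "M \<in> alt_mats l m" "i < m" "j < m"
  shows "M (i, j) \<in> carrier (Zl l)"
proof -
  have "M \<in> ({..<m} \<times> {..<m}) \<rightarrow>\<^sub>E carrier (Zl l)" using assms(1) by (simp add: alt_mats_def)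
  then show ?thesis using assms(2,3) by (auto dest: PiE_mem)
qed

lemma alt_mats_alt_seq:
  assumes "l > 0" "M \<in> alt_mats l m"
  shows "alt_seq l {..<m} (\<lambda>i j. M (i, j))"
proof -
  have A: "(\<forall>i<m. M (i, i) = \<zero>\<^bsub>Zl l\<^esub>) \<and> (\<forall>i<m. \<forall>j<m. M (i, j) = \<ominus>\<^bsub>Zl l\<^esub> M (j, i))"
    using assms(2) unfolding alt_mats_def by blast
  have M: "M (i, j) \<in> carrier (Zl l)" "M (i, i) = \<zero>\<^bsub>Zl l\<^esub>" "M (i, j) = \<ominus>\<^bsub>Zl l\<^esub> M (j, i)" if "i < m" "j < m" for i j
    using alt_mats_carrier[OF assms(2) that] A that by blast+
  have "zeq l (M (i, j)) (\<lambda>e. - M (j, i) e)" if "i < m" "j < m" for i j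
  proof -
    have "M (i, j) = red l (\<lambda>e. - M (j, i) e)"
      using M(3)[OF that] Zl_minus[OF assms(1) M(1)[OF that(2,1)]] by (rule trans)
    then show ?thesis by (rule ssubst) (rule zeq_red(1))
  qed
  then show ?thesis using M(1,2) by (simp add: alt_seq_def zeq_def Zl_compat)
qed

section \<open>Rank and cokernel\<close>

text \<open>Coefficients on \<open>J\<close> are extended by zero and reduced residues are exchanged
  for arbitrary compatible sequences, so that independence speaks of kernel vectors supported on
  \<open>J\<close>.\<close>

lemma indep_cols_iff:
  assumes "l > 0" "M \<in> alt_mats l m" "J \<subseteq> {..<m}"
  shows "indep_cols l m M J \<longleftrightarrow> (\<forall>y. compat_vec l {..<m} y \<and> (\<forall>q\<in>{..<m} - J. zeq l (y q) (\<lambda>e. 0)) \<and>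
    in_kernel l {..<m} (\<lambda>i j. M (i, j)) y \<longrightarrow> (\<forall>q\<in>J. zeq l (y q) (\<lambda>e. 0)))"
    (is "?L \<longleftrightarrow> ?R")
proof -
  let ?M = "\<lambda>i j. M (i, j)"
  have MZ: "M (i, j) \<in> carrier (Zl l)" if "i < m" "j < m" for i j
    using alt_mats_carrier[OF assms(2) that] .
  have fJ: "finite J" using assms(3) finite_subset by blast
  have z0: "red l y = (\<lambda>e. 0) \<longleftrightarrow> zeq l y (\<lambda>e. 0)" for y
    using red_eq_iff[of l y "\<lambda>e. 0"] by (simp add: red_def)
  have eq: "(\<Oplus>\<^bsub>Zl l\<^esub>j\<in>J. M (i, j) \<otimes>\<^bsub>Zl l\<^esub> c j) = \<zero>\<^bsub>Zl l\<^esub> \<longleftrightarrow> zeq l (mat_vec J ?M c i) (\<lambda>e. 0)"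
    if "i < m" "c \<in> J \<rightarrow> carrier (Zl l)" for i c
  proof -
    have "(\<Oplus>\<^bsub>Zl l\<^esub>j\<in>J. M (i, j) \<otimes>\<^bsub>Zl l\<^esub> c j) = red l (mat_vec J ?M c i)"
      using that assms(3) MZ by (intro Zl_mat_vec assms(1) fJ) auto
    then show ?thesis using z0 by simp
  qed
  show ?thesis
  proof
    assume L: ?L
    show ?R
    proof (intro allI impI, elim conjE)
      fix y assume y: "compat_vec l {..<m} y" "\<forall>q\<in>{..<m} - J. zeq l (y q) (\<lambda>e. 0)"
        "in_kernel l {..<m} ?M y"
      define c where "c j = red l (y j)" for j
      have c: "c \<in> J \<rightarrow> carrier (Zl l)" using y(1) assms by (auto simp: c_def compat_vec_def)
      have "zeq l (mat_vec J ?M c i) (\<lambda>e. 0)" if "i < m" for i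
        unfolding zeq_def
      proof
        fix e
        have "mat_vec {..<m} ?M y i e = mat_vec J ?M y i e + (\<Sum>q\<in>{..<m} - J. M (i, q) e * y q e)"
          unfolding mat_vec_def using assms(3) by (subst sum.subset_diff[of J]) auto
        moreover have "[(\<Sum>q\<in>{..<m} - J. M (i, q) e * y q e) = (\<Sum>q\<in>{..<m} - J. M (i, q) e * 0)] (mod int l ^ e)"
          using y(2) by (intro cong_sum cong_scalar_left) (auto simp: zeq_def)
        ultimately have "[mat_vec {..<m} ?M y i e = mat_vec J ?M y i e + 0] (mod int l ^ e)"
          by (simp add: cong_iff_dvd_diff)
        moreover have "[mat_vec J ?M c i e = mat_vec J ?M y i e] (mod int l ^ e)"
          unfolding mat_vec_def c_def by (intro cong_sum cong_scalar_left) (simp add: red_def)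
        moreover have "[mat_vec {..<m} ?M y i e = 0] (mod int l ^ e)"
          using y(3) that by (simp add: in_kernel_def zeq_def)
        ultimately show "[mat_vec J ?M c i e = 0] (mod int l ^ e)" by (simp add: cong_def)
      qed
      then have "\<forall>i<m. (\<Oplus>\<^bsub>Zl l\<^esub>j\<in>J. M (i, j) \<otimes>\<^bsub>Zl l\<^esub> c j) = \<zero>\<^bsub>Zl l\<^esub>"
        using eq[OF _ c] by blast
      then have "\<forall>j\<in>J. c j = \<zero>\<^bsub>Zl l\<^esub>"
        using L c unfolding indep_cols_def by blast
      then show "\<forall>q\<in>J. zeq l (y q) (\<lambda>e. 0)" using z0 by (simp add: c_def)
    qed
  next
    assume R: ?R
    show ?L
      unfolding indep_cols_def
    proof (intro ballI impI)
      fix c j assume c: "c \<in> J \<rightarrow> carrier (Zl l)" and j: "j \<in> J"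
        and z: "\<forall>i<m. (\<Oplus>\<^bsub>Zl l\<^esub>j\<in>J. M (i, j) \<otimes>\<^bsub>Zl l\<^esub> c j) = \<zero>\<^bsub>Zl l\<^esub>"
      define y where "y q = (if q \<in> J then c q else (\<lambda>e. 0))" for q
      have "mat_vec {..<m} ?M y i = mat_vec J ?M c i" for i
        unfolding mat_vec_def y_def using assms(3)
        by (intro ext sum.mono_neutral_cong_right) auto
      moreover have "zeq l (mat_vec J ?M c i) (\<lambda>e. 0)" if "i < m" for i
        using z eq[OF that c] that by blast
      ultimately have "in_kernel l {..<m} ?M y" by (simp add: in_kernel_def)
      moreover have "compat_vec l {..<m} y" using c by (auto simp: compat_vec_def y_def Zl_compat Pi_iff)
      moreover have "\<forall>q\<in>{..<m} - J. zeq l (y q) (\<lambda>e. 0)" by (simp add: y_def zeq_def)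
      ultimately have "zeq l (y j) (\<lambda>e. 0)" using R j by blast
      moreover have "red l (c j) = c j" using c j by (intro red_id) auto
      ultimately show "c j = \<zero>\<^bsub>Zl l\<^esub>" using z0[of "c j"] j by (simp add: y_def)
    qed
  qed
qed

text \<open>If the kernel is zero, all columns are independent. Otherwise it is spanned by
  \<open>v\<close>, which makes the full set of columns dependent; after removing a column
  \<open>q0\<close> with \<open>v q0\<close> nonzero, a kernel vector supported on the rest is a
  multiple of \<open>v\<close> that vanishes at \<open>q0\<close>, hence zero.\<close>

lemma sympl_mat_rank:
  assumes l: "prime l" and M: "M \<in> alt_mats l m" and S: "sympl l {..<m} R (\<lambda>i j. M (i, j)) \<kappa>"
  shows "mat_rank l m M = m - card R"
proof -
  let ?M = "\<lambda>i j. M (i, j)" and ?C = "{card J | J. J \<subseteq> {..<m} \<and> indep_cols l m M J}"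
  have l0: "l > 0" using l by (simp add: prime_gt_0_nat)
  note ind = indep_cols_iff[OF l0 M]
  obtain v where v: "compat_vec l {..<m} v" "in_kernel l {..<m} ?M v"
    "R = {} \<longrightarrow> (\<forall>q\<in>{..<m}. zeq l (v q) (\<lambda>e. 0))" "R \<noteq> {} \<longrightarrow> (\<exists>q\<in>{..<m}. \<not> zeq l (v q) (\<lambda>e. 0))"
    "\<And>y. compat_vec l {..<m} y \<Longrightarrow> in_kernel l {..<m} ?M y \<Longrightarrow>
      \<exists>t. compat l t \<and> (\<forall>q\<in>{..<m}. zeq l (y q) (\<lambda>e. t e * v q e))"
    using sympl_kernel[OF S alt_mats_alt_seq[OF l0 M] l] by blast
  have cR: "finite R" "card R \<le> 1" using sympl_finite[OF S] finite_subset by auto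
  have fin: "finite ?C"
    by (rule finite_subset[of _ "card ` Pow {..<m}"]) auto
  show ?thesis
  proof (cases "R = {}")
    case True
    have "indep_cols l m M {..<m}"
      unfolding ind[OF subset_refl]
    proof (intro allI impI, elim conjE)
      fix y assume y: "compat_vec l {..<m} y" "in_kernel l {..<m} ?M y"
      then obtain t where t: "\<forall>q\<in>{..<m}. zeq l (y q) (\<lambda>e. t e * v q e)" using v(5) by blast
      show "\<forall>q\<in>{..<m}. zeq l (y q) (\<lambda>e. 0)"
      proof
        fix q assume q: "q \<in> {..<m}"
        have "zeq l (\<lambda>e. t e * v q e) (\<lambda>e. 0)"
          using v(3) True q unfolding zeq_def cong_0_iff by (meson dvd_mult)
        then show "zeq l (y q) (\<lambda>e. 0)" using t q zeq_trans by blast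
      qed
    qed
    then have "m \<in> ?C" by force
    moreover have "c \<le> m" if "c \<in> ?C" for c
      using that card_mono[of "{..<m}"] by fastforce
    ultimately have "Max ?C = m" using fin by (intro Max_eqI) auto
    then show ?thesis using True by (simp add: mat_rank_def)
  next
    case False
    then have R1: "card R = 1" using cR by (metis One_nat_def card_0_eq le_antisym not_less_eq_eq le_zero_eq)
    obtain q0 where q0: "q0 < m" "\<not> zeq l (v q0) (\<lambda>e. 0)" using v(4) False by auto
    have cv0: "compat l (v q0)" using v(1) q0 by (simp add: compat_vec_def)
    obtain a where a: "val_eq l (v q0) a" using nonzero_val_eq[OF cv0 q0(2)] .
    have "indep_cols l m M ({..<m} - {q0})"
    proof (subst ind, blast, intro allI impI, elim conjE)
      fix y assume y: "compat_vec l {..<m} y" "in_kernel l {..<m} ?M y"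
        "\<forall>q\<in>{..<m} - ({..<m} - {q0}). zeq l (y q) (\<lambda>e. 0)"
      then obtain t where t: "compat l t" "\<forall>q\<in>{..<m}. zeq l (y q) (\<lambda>e. t e * v q e)" using v(5) by blast
      have "zeq l (\<lambda>e. t e * v q0 e) (\<lambda>e. 0)"
        using t(2) y(3) q0(1) zeq_sym zeq_trans by (metis Diff_iff lessThan_iff singletonI)
      then have "zeq l (\<lambda>e. v q0 e * t e) (\<lambda>e. 0)" by (simp add: mult.commute)
      then have "zeq l t (\<lambda>e. 0)" using zeq_cancel[OF l cv0 a t(1)] by blast
      then have "zeq l (\<lambda>e. t e * v q e) (\<lambda>e. 0)" for q
        unfolding zeq_def cong_0_iff by (meson dvd_mult2)
      then show "\<forall>q\<in>{..<m} - {q0}. zeq l (y q) (\<lambda>e. 0)" using t(2) zeq_trans by (metis DiffE)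
    qed
    then have "m - 1 \<in> ?C" using q0(1)
      by (intro CollectI exI[of _ "{..<m} - {q0}"]) (auto simp: card_Diff_subset)
    moreover have "c \<le> m - 1" if cC: "c \<in> ?C" for c
    proof -
      obtain J where J: "c = card J" "J \<subseteq> {..<m}" "indep_cols l m M J" using cC by blast
      have "J \<noteq> {..<m}"
      proof
        assume "J = {..<m}"
        then have "zeq l (v q0) (\<lambda>e. 0)" using J(3) ind[OF J(2)] v(1,2) q0(1) by auto
        then show False using q0(2) by simp
      qed
      then have "card J < card {..<m}" using J(2) by (intro psubset_card_mono) auto
      then show ?thesis using J(1) by simp
    qed
    ultimately have "Max ?C = m - 1" using fin by (intro Max_eqI) auto
    then show ?thesis using R1 by (simp add: mat_rank_def)
  qed
qed

definition diag_group :: "nat \<Rightarrow> nat set \<Rightarrow> (nat \<Rightarrow> nat) \<Rightarrow> (nat \<Rightarrow> int) monoid" where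
  "diag_group l J \<kappa> = product_group J (\<lambda>s. integer_mod_group (l ^ \<kappa> s))"

lemma comm_group_product_group:
  assumes "\<And>i. i \<in> I \<Longrightarrow> comm_group (G i)"
  shows "comm_group (product_group I G)"
proof (rule group.group_comm_groupI)
  show "group (product_group I G)" using assms by (simp add: comm_group.axioms(2))
  show "x \<otimes>\<^bsub>product_group I G\<^esub> y = y \<otimes>\<^bsub>product_group I G\<^esub> x"
    if "x \<in> carrier (product_group I G)" "y \<in> carrier (product_group I G)" for x y
    using that assms by (auto simp: PiE_iff intro!: restrict_ext comm_groupE(4))
qed

lemma product_group_nat_pow:
  assumes "x \<in> carrier (product_group I G)"
  shows "x [^]\<^bsub>product_group I G\<^esub> (n::nat) = (\<lambda>i\<in>I. x i [^]\<^bsub>G i\<^esub> n)"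
  by (induction n) (auto simp: fun_eq_iff)

lemma Zl_nat_pow:
  "l > 0 \<Longrightarrow> x \<in> carrier (Zl l) \<Longrightarrow> x [^]\<^bsub>add_monoid (Zl l)\<^esub> (n::nat) = red l (\<lambda>e. int n * x e)"
  by (induction n) (simp_all add: red_add_red algebra_simps, simp add: red_def)

text \<open>A positive integer is nonzero as an l-adic number because \<open>n < l^n\<close>; so it
  has a valuation and can be cancelled.\<close>

lemma zeq_torsion_free:
  assumes "prime l" "compat l x" "n > 0" "zeq l (\<lambda>e. int n * x e) (\<lambda>e. 0)"
  shows "zeq l x (\<lambda>e. 0)"
proof -
  have nz: "\<not> zeq l (\<lambda>e. int n) (\<lambda>e. 0)"
  proof
    assume "zeq l (\<lambda>e. int n) (\<lambda>e. 0)"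
    then have "int l ^ n dvd int n" by (simp add: zeq_def cong_0_iff)
    then have "l ^ n dvd n" by (simp flip: of_nat_power)
    then have "l ^ n \<le> n" using assms(3) by (rule dvd_imp_le)
    moreover have "n < l ^ n" using prime_gt_1_nat[OF assms(1)] by (intro power_gt_expt) simp
    ultimately show False by simp
  qed
  obtain a where "val_eq l (\<lambda>e. int n) a" using nonzero_val_eq[OF compat_const nz] .
  then show ?thesis using zeq_cancel[OF assms(1) compat_const _ assms(2,4)] by blast
qed

text \<open>A vector has a torsion class iff its coordinates on \<open>R\<close> vanish. Reading the
  other coordinates modulo \<open>l^(\<kappa> s)\<close> maps these vectors onto the diagonal group,
  with the image of \<open>M\<close> as kernel. The second conclusion is recorded because
  \<open>iso_rep_cong\<close> asks for a group.\<close>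

lemma tors_coker_iso:
  assumes l: "prime l" and M: "M \<in> alt_mats l m" and S: "sympl l {..<m} R (\<lambda>i j. M (i, j)) \<kappa>"
  shows "tors (coker l m M) \<cong> diag_group l ({..<m} - R) \<kappa>" "group (tors (coker l m M))"
proof -
  let ?I = "{..<m}" and ?M = "\<lambda>i j. M (i, j)" and ?G = "Zl_vecs l m" and ?B = "mat_image l m M"
  let ?A = "diag_group l (?I - R) \<kappa>"
  have l0: "l > 0" using l by (simp add: prime_gt_0_nat)
  have RI: "R \<subseteq> ?I" using sympl_finite[OF S] by auto
  have MZ: "M (i, j) \<in> carrier (Zl l)" if "i < m" "j < m" for i j
    using alt_mats_carrier[OF M that] .
  have cgZ: "comm_group (add_monoid (Zl l))"
    using abelian_group_Zl[OF l0] by (rule abelian_group.a_comm_group)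
  interpret G: comm_group ?G
    unfolding Zl_vecs_def using cgZ by (intro comm_group_product_group)
  have carG: "carrier ?G = ?I \<rightarrow>\<^sub>E carrier (Zl l)" by (simp add: Zl_vecs_def)
  have multG: "x \<otimes>\<^bsub>?G\<^esub> y = (\<lambda>i\<in>?I. red l (\<lambda>e. x i e + y i e))" for x y by (simp add: Zl_vecs_def)
  have oneG: "\<one>\<^bsub>?G\<^esub> = (\<lambda>i\<in>?I. \<lambda>e. 0)" by (simp add: Zl_vecs_def)
  have powG: "x [^]\<^bsub>?G\<^esub> (n::nat) = (\<lambda>i\<in>?I. red l (\<lambda>e. int n * x i e))" if "x \<in> carrier ?G" for x n
  proof -
    have "x [^]\<^bsub>?G\<^esub> n = (\<lambda>i\<in>?I. x i [^]\<^bsub>add_monoid (Zl l)\<^esub> n)"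
      using that unfolding Zl_vecs_def by (rule product_group_nat_pow)
    also have "\<dots> = (\<lambda>i\<in>?I. red l (\<lambda>e. int n * x i e))"
      using that l0 carG by (intro restrict_ext Zl_nat_pow) auto
    finally show ?thesis .
  qed
  have cvG: "compat_vec l ?I x" if "x \<in> carrier ?G" for x
    unfolding compat_vec_def
  proof
    fix p assume "p \<in> ?I"
    then have "x p \<in> carrier (Zl l)" using that unfolding carG by (rule PiE_mem[rotated])
    then show "compat l (x p)" by (rule Zl_compat)
  qed
  interpret A: comm_group ?A
    unfolding diag_group_def by (intro comm_group_product_group) simp
  obtain c where c: "image_coords l ?I R ?M \<kappa> c"
    using sympl_image_coords[OF S alt_mats_alt_seq[OF l0 M] l] by blast
  have c1: "compat_vec l ?I (c x)" if "compat_vec l ?I x" for x using c that by (simp add: image_coords_def)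
  have c2: "c (\<lambda>p e. k * x p e + y p e) p e = k * c x p e + c y p e" if "p < m" for k x y p e
    using c that by (simp add: image_coords_def)
  have c3: "[c x p e = c y p e] (mod int l ^ e)" if "\<And>p. p < m \<Longrightarrow> [x p e = y p e] (mod int l ^ e)" "p < m" for x y p e
    using c that by (simp add: image_coords_def)
  have c4: "\<exists>x. compat_vec l ?I x \<and> (\<forall>p\<in>?I. zeq l (c x p) (z p))" if "compat_vec l ?I z" for z
    using c that by (simp add: image_coords_def)
  have c5: "in_image l ?I ?M x \<longleftrightarrow>
        (\<forall>s\<in>?I - R. int l ^ \<kappa> s dvd c x s (\<kappa> s)) \<and> (\<forall>s\<in>R. zeq l (c x s) (\<lambda>e. 0))" if "compat_vec l ?I x" for x
    using c that by (simp add: image_coords_def)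
  have cadd: "[c (x \<otimes>\<^bsub>?G\<^esub> y) p e = c x p e + c y p e] (mod int l ^ e)" if "p < m" for x y p e
  proof -
    have "[c (x \<otimes>\<^bsub>?G\<^esub> y) p e = c (\<lambda>p e. 1 * x p e + y p e) p e] (mod int l ^ e)"
      by (rule c3[OF _ that]) (simp add: multG red_def)
    then show ?thesis using c2[OF that, of 1 x y e] by simp
  qed
  have c0: "c (\<lambda>p e. 0) p e = 0" if "p < m" for p e
    using c2[OF that, of 0 "\<lambda>p e. 0" "\<lambda>p e. 0" e] c2[OF that, of 1 "\<lambda>p e. 0" "\<lambda>p e. 0" e] by simp
  have cpow: "[c (x [^]\<^bsub>?G\<^esub> (n::nat)) p e = int n * c x p e] (mod int l ^ e)"
    if "p < m" "x \<in> carrier ?G" for x n p e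
  proof -
    have "[c (x [^]\<^bsub>?G\<^esub> n) p e = c (\<lambda>p e. int n * x p e + 0) p e] (mod int l ^ e)"
      by (rule c3[OF _ that(1)]) (simp add: powG[OF that(2)] red_def)
    then show ?thesis using c2[OF that(1), of "int n" x "\<lambda>p e. 0" e] c0[OF that(1)] by simp
  qed
  have mv: "(\<Oplus>\<^bsub>Zl l\<^esub>j\<in>?I. M (p, j) \<otimes>\<^bsub>Zl l\<^esub> y j) = red l (mat_vec ?I ?M y p)"
    if "p < m" "y \<in> carrier ?G" for p y
  proof (rule Zl_mat_vec[OF l0])
    show "y j \<in> carrier (Zl l)" if "j \<in> ?I" for j
      using \<open>y \<in> carrier ?G\<close> that unfolding carG by (rule PiE_mem)
  qed (use MZ that in auto)
  have image_iff: "x \<in> ?B \<longleftrightarrow> in_image l ?I ?M x" if x: "x \<in> carrier ?G" for x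
  proof
    assume "x \<in> ?B"
    then obtain y where y: "y \<in> carrier ?G" "x = (\<lambda>i\<in>?I. \<Oplus>\<^bsub>Zl l\<^esub>j\<in>?I. M (i, j) \<otimes>\<^bsub>Zl l\<^esub> y j)"
      by (auto simp: mat_image_def)
    have "zeq l (x p) (mat_vec ?I ?M y p)" if "p < m" for p
    proof -
      have "x p = red l (mat_vec ?I ?M y p)"
        using mv[OF that y(1)] that unfolding y(2) by (simp only: restrict_apply' lessThan_iff)
      then show ?thesis by (simp add: zeq_red)
    qed
    then show "in_image l ?I ?M x" using cvG[OF y(1)] by (auto simp: in_image_def)
  next
    assume "in_image l ?I ?M x"
    then obtain y where y: "compat_vec l ?I y" "\<And>p. p < m \<Longrightarrow> zeq l (x p) (mat_vec ?I ?M y p)"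
      by (auto simp: in_image_def)
    define y' where "y' = (\<lambda>i\<in>?I. red l (y i))"
    have y'G: "y' \<in> carrier ?G" using y(1) l0 by (auto simp: carG y'_def compat_vec_def)
    have "x p = (\<lambda>i\<in>?I. \<Oplus>\<^bsub>Zl l\<^esub>j\<in>?I. M (i, j) \<otimes>\<^bsub>Zl l\<^esub> y' j) p" for p
    proof (cases "p < m")
      case True
      have "(\<Oplus>\<^bsub>Zl l\<^esub>j\<in>?I. M (p, j) \<otimes>\<^bsub>Zl l\<^esub> y' j) = red l (mat_vec ?I ?M y' p)"
        by (rule mv[OF True y'G])
      also have "\<dots> = red l (x p)"
      proof -
        have "zeq l (mat_vec ?I ?M y p) (mat_vec ?I ?M y' p)"
          unfolding zeq_def mat_vec_def
          by (intro allI cong_sum cong_scalar_left) (simp add: y'_def red_def)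
        then show ?thesis unfolding red_eq_iff using y(2)[OF True] zeq_trans zeq_sym by blast
      qed
      also have "\<dots> = x p" using x True carG by (intro red_id) auto
      finally show ?thesis using True by simp
    next
      case False
      then show ?thesis using x carG by (auto simp: PiE_iff extensional_def)
    qed
    then have "x = (\<lambda>i\<in>?I. \<Oplus>\<^bsub>Zl l\<^esub>j\<in>?I. M (i, j) \<otimes>\<^bsub>Zl l\<^esub> y' j)" by blast
    then show "x \<in> ?B" using y'G unfolding mat_image_def by blast
  qed
  have BG: "?B \<subseteq> carrier ?G"
  proof
    fix x assume "x \<in> ?B"
    then obtain y where y: "y \<in> carrier ?G" "x = (\<lambda>i\<in>?I. \<Oplus>\<^bsub>Zl l\<^esub>j\<in>?I. M (i, j) \<otimes>\<^bsub>Zl l\<^esub> y j)"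
      by (auto simp: mat_image_def)
    have "x p \<in> carrier (Zl l)" if "p < m" for p
    proof -
      have "x p = red l (mat_vec ?I ?M y p)"
        using mv[OF that y(1)] that unfolding y(2) by (simp only: restrict_apply' lessThan_iff)
      then show ?thesis
        using l0 compat_vec_mat_vec[OF alt_mats_alt_seq[OF l0 M] cvG[OF y(1)]] that by simp
    qed
    then show "x \<in> carrier ?G" using y(2) by (auto simp: carG)
  qed
  \<comment> \<open>The preimage of the torsion subgroup. That its classes are exactly the torsion
    classes is shown at the end, from the torsion-freeness of the l-adic integers.\<close>
  define W where "W = {x \<in> carrier ?G. \<forall>\<rho>\<in>R. zeq l (c x \<rho>) (\<lambda>e. 0)}"
  define \<psi> where "\<psi> x = (\<lambda>s\<in>?I - R. c x s (\<kappa> s) mod int l ^ \<kappa> s)" for x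
  have addz: "zeq l (c (x \<otimes>\<^bsub>?G\<^esub> y) \<rho>) (\<lambda>e. c x \<rho> e + c y \<rho> e)" if "\<rho> \<in> R" for x y \<rho>
    using cadd RI that by (auto simp: zeq_def)
  have W: "subgroup W ?G"
  proof (rule G.subgroupI)
    show "W \<subseteq> carrier ?G" by (auto simp: W_def)
    have "\<one>\<^bsub>?G\<^esub> \<in> W"
    proof -
      have "[c \<one>\<^bsub>?G\<^esub> p e = c (\<lambda>p e. 0) p e] (mod int l ^ e)" if "p < m" for p e
        by (rule c3[OF _ that]) (simp add: oneG)
      then show ?thesis using c0 RI by (auto simp: W_def zeq_def)
    qed
    then show "W \<noteq> {}" by blast
    show "x \<otimes>\<^bsub>?G\<^esub> y \<in> W" if "x \<in> W" "y \<in> W" for x y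
    proof -
      have "zeq l (c (x \<otimes>\<^bsub>?G\<^esub> y) \<rho>) (\<lambda>e. 0)" if \<rho>: "\<rho> \<in> R" for \<rho>
      proof -
        have "zeq l (\<lambda>e. c x \<rho> e + c y \<rho> e) (\<lambda>e. 0)"
          using \<open>x \<in> W\<close> \<open>y \<in> W\<close> \<rho> by (auto simp: W_def zeq_def cong_0_iff)
        then show ?thesis using addz[OF \<rho>] zeq_trans by blast
      qed
      then show ?thesis using that by (auto simp: W_def)
    qed
    show "inv\<^bsub>?G\<^esub> x \<in> W" if x: "x \<in> W" for x
    proof -
      have xG: "x \<in> carrier ?G" using x by (simp add: W_def)
      have "zeq l (c (inv\<^bsub>?G\<^esub> x) \<rho>) (\<lambda>e. 0)" if \<rho>: "\<rho> \<in> R" for \<rho>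
        unfolding zeq_def
      proof
        fix e
        have pm: "\<rho> < m" using \<rho> RI by auto
        have "[c (inv\<^bsub>?G\<^esub> x \<otimes>\<^bsub>?G\<^esub> x) \<rho> e = c (inv\<^bsub>?G\<^esub> x) \<rho> e + c x \<rho> e] (mod int l ^ e)"
          by (rule cadd[OF pm])
        moreover have "[c \<one>\<^bsub>?G\<^esub> \<rho> e = c (\<lambda>p e. 0) \<rho> e] (mod int l ^ e)"
          by (rule c3[OF _ pm]) (simp add: oneG)
        ultimately have "[c (inv\<^bsub>?G\<^esub> x) \<rho> e + c x \<rho> e = 0] (mod int l ^ e)"
          using xG c0[OF pm] by (simp add: cong_def)
        moreover have "[c x \<rho> e = 0] (mod int l ^ e)" using x \<rho> by (simp add: W_def zeq_def)
        ultimately show "[c (inv\<^bsub>?G\<^esub> x) \<rho> e = 0] (mod int l ^ e)"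
          by (metis cong_0_iff dvd_add_left_iff)
      qed
      then show ?thesis using xG by (auto simp: W_def)
    qed
  qed
  have BW: "?B \<subseteq> W"
    using BG image_iff c5 cvG by (auto simp: W_def)
  have carA: "carrier ?A = (\<Pi>\<^sub>E s\<in>?I - R. {0..<int l ^ \<kappa> s})"
    using l0 by (simp add: diag_group_def carrier_integer_mod_group)
  have multA: "x \<otimes>\<^bsub>?A\<^esub> y = (\<lambda>s\<in>?I - R. (x s + y s) mod int l ^ \<kappa> s)" for x y
    by (simp add: diag_group_def)
  have oneA: "\<one>\<^bsub>?A\<^esub> = (\<lambda>s\<in>?I - R. 0)" by (simp add: diag_group_def)
  let ?W = "?G\<lparr>carrier := W\<rparr>"
  have grW: "group ?W" using W G.subgroup_imp_group by blast
  have hom: "\<psi> \<in> hom ?W ?A"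
  proof (rule homI)
    show "\<psi> x \<in> carrier ?A" for x
      using l0 by (auto simp: carA \<psi>_def)
    show "\<psi> (x \<otimes>\<^bsub>?W\<^esub> y) = \<psi> x \<otimes>\<^bsub>?A\<^esub> \<psi> y" for x y
      using cadd[of _ x y] by (auto simp: \<psi>_def multA cong_def mod_simps intro!: restrict_ext)
  qed
  interpret \<psi>: group_hom ?W ?A \<psi>
    using grW hom A.is_group by (simp add: group_hom_def group_hom_axioms_def)
  have ker: "kernel ?W ?A \<psi> = ?B"
  proof -
    have "\<psi> x = \<one>\<^bsub>?A\<^esub> \<longleftrightarrow> (\<forall>s\<in>?I - R. int l ^ \<kappa> s dvd c x s (\<kappa> s))" for x
      by (auto simp: \<psi>_def oneA fun_eq_iff restrict_def dvd_eq_mod_eq_0)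
    then show ?thesis using BW image_iff c5 cvG by (auto simp: kernel_def W_def)
  qed
  have "\<psi> ` carrier ?W = carrier ?A"
  proof (rule antisym)
    show "\<psi> ` carrier ?W \<subseteq> carrier ?A" using hom by (auto simp: hom_def)
    show "carrier ?A \<subseteq> \<psi> ` carrier ?W"
    proof
      fix t assume t: "t \<in> carrier ?A"
      define z where "z s = (\<lambda>e::nat. if s \<in> ?I - R then t s else 0)" for s
      have "compat_vec l ?I z" by (simp add: compat_vec_def z_def)
      then obtain x where x: "compat_vec l ?I x" "\<And>p. p < m \<Longrightarrow> zeq l (c x p) (z p)" using c4 by blast
      define x' where "x' = (\<lambda>p\<in>?I. red l (x p))"
      have xG: "x' \<in> carrier ?G" using x(1) l0 by (auto simp: carG x'_def compat_vec_def)
      have cx': "[c x' p e = z p e] (mod int l ^ e)" if "p < m" for p e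
      proof -
        have "[c x' p e = c x p e] (mod int l ^ e)"
          by (rule c3[OF _ that]) (simp add: x'_def red_def)
        then show ?thesis using x(2)[OF that] by (auto simp: zeq_def intro: cong_trans)
      qed
      have "zeq l (c x' \<rho>) (\<lambda>e. 0)" if "\<rho> \<in> R" for \<rho>
      proof -
        have "\<rho> < m" using RI that by auto
        then show ?thesis using cx'[of \<rho>] that by (simp add: zeq_def z_def)
      qed
      then have "x' \<in> W" using xG by (simp add: W_def)
      moreover have "\<psi> x' = t"
      proof (rule PiE_ext[of _ "?I - R" "\<lambda>s. {0..<int l ^ \<kappa> s}"])
        show "t \<in> (\<Pi>\<^sub>E s\<in>?I - R. {0..<int l ^ \<kappa> s})" using t carA by simp
        show "\<psi> x' \<in> (\<Pi>\<^sub>E s\<in>?I - R. {0..<int l ^ \<kappa> s})" using l0 by (auto simp: \<psi>_def)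
        show "\<psi> x' s = t s" if "s \<in> ?I - R" for s
        proof -
          have "\<psi> x' s = t s mod int l ^ \<kappa> s"
            using cx'[of s "\<kappa> s"] that by (auto simp: \<psi>_def z_def cong_def)
          moreover have "t s \<in> {0..<int l ^ \<kappa> s}" using t that carA by auto
          ultimately show ?thesis by simp
        qed
      qed
      ultimately show "t \<in> \<psi> ` carrier ?W" by force
    qed
  qed
  then have iso: "?W Mod ?B \<cong> ?A" using \<psi>.FactGroup_iso ker by simp
  have subB: "subgroup ?B ?G"
  proof -
    have "subgroup ?B ?W" using \<psi>.subgroup_kernel ker by simp
    then show ?thesis using W G.incl_subgroup by blast
  qed
  then have nB: "?B \<lhd> ?G" using G.normal_iff_subgroup by blast
  interpret Q: group "?G Mod ?B" using nB by (rule normal.factorgroup_is_group)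
  have "tors (coker l m M) = ?W Mod ?B"
  proof -
    have "{X \<in> carrier (?G Mod ?B). \<exists>n::nat. n > 0 \<and> X [^]\<^bsub>?G Mod ?B\<^esub> n = \<one>\<^bsub>?G Mod ?B\<^esub>}
        = (\<lambda>x. ?B #>\<^bsub>?G\<^esub> x) ` W"
    proof -
      have hq: "(\<lambda>x. ?B #>\<^bsub>?G\<^esub> x) \<in> hom ?G (?G Mod ?B)" using nB by (rule normal.r_coset_hom_Mod)
      have "(\<exists>n::nat. n > 0 \<and> (?B #>\<^bsub>?G\<^esub> x) [^]\<^bsub>?G Mod ?B\<^esub> n = \<one>\<^bsub>?G Mod ?B\<^esub>) \<longleftrightarrow> x \<in> W"
        if x: "x \<in> carrier ?G" for x
      proof -
        have "(?B #>\<^bsub>?G\<^esub> x) [^]\<^bsub>?G Mod ?B\<^esub> n = \<one>\<^bsub>?G Mod ?B\<^esub> \<longleftrightarrow> x [^]\<^bsub>?G\<^esub> n \<in> ?B" for n :: nat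
        proof -
          have "(?B #>\<^bsub>?G\<^esub> x) [^]\<^bsub>?G Mod ?B\<^esub> n = ?B #>\<^bsub>?G\<^esub> (x [^]\<^bsub>?G\<^esub> n)"
            using hom_nat_pow[OF hq x G.is_group Q.is_group, of n] by simp
          then show ?thesis using x subB G.coset_join1 G.coset_join2 by (auto simp: FactGroup_def)
        qed
        moreover have "(\<exists>n::nat. n > 0 \<and> x [^]\<^bsub>?G\<^esub> n \<in> ?B) \<longleftrightarrow> x \<in> W"
        proof
          assume "\<exists>n::nat. n > 0 \<and> x [^]\<^bsub>?G\<^esub> n \<in> ?B"
          then obtain n :: nat where n: "n > 0" "x [^]\<^bsub>?G\<^esub> n \<in> ?B" by blast
          have "zeq l (c x \<rho>) (\<lambda>e. 0)" if \<rho>: "\<rho> \<in> R" for \<rho>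
          proof (rule zeq_torsion_free[OF l _ n(1)])
            show "compat l (c x \<rho>)" using c1[OF cvG[OF x]] \<rho> RI by (auto simp: compat_vec_def)
            have "zeq l (c (x [^]\<^bsub>?G\<^esub> n) \<rho>) (\<lambda>e. 0)" using n(2) BW \<rho> by (auto simp: W_def)
            moreover have "zeq l (c (x [^]\<^bsub>?G\<^esub> n) \<rho>) (\<lambda>e. int n * c x \<rho> e)"
              using cpow[OF _ x, of \<rho> n] \<rho> RI by (auto simp: zeq_def)
            ultimately show "zeq l (\<lambda>e. int n * c x \<rho> e) (\<lambda>e. 0)" using zeq_sym zeq_trans by blast
          qed
          then show "x \<in> W" using x by (simp add: W_def)
        next
          assume xW: "x \<in> W"
          \<comment> \<open>A common multiple of all the moduli \<open>l^(\<kappa> s)\<close>, so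
            that the \<open>n\<close>-th power of a vector of \<open>W\<close> meets every
            divisibility condition.\<close>
          define n where "n = l ^ (\<Sum>s\<in>?I - R. \<kappa> s)"
          have dv: "int l ^ \<kappa> s dvd int n" if "s \<in> ?I - R" for s
            unfolding n_def using member_le_sum[OF that, of \<kappa>] by (simp add: le_imp_power_dvd)
          have "x [^]\<^bsub>?G\<^esub> n \<in> W" using xW W G.subgroup_imp_group
            by (metis G.subgroup_int_pow_closed int_pow_int)
          moreover have "int l ^ \<kappa> s dvd c (x [^]\<^bsub>?G\<^esub> n) s (\<kappa> s)" if s: "s \<in> ?I - R" for s
          proof -
            have "[c (x [^]\<^bsub>?G\<^esub> n) s (\<kappa> s) = int n * c x s (\<kappa> s)] (mod int l ^ \<kappa> s)"
              using cpow[OF _ x, of s n] s by auto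
            then show ?thesis using dv[OF s] cong_dvd_iff dvd_mult2 by blast
          qed
          ultimately have "x [^]\<^bsub>?G\<^esub> n \<in> ?B"
            using image_iff[of "x [^]\<^bsub>?G\<^esub> n"] c5[OF cvG[of "x [^]\<^bsub>?G\<^esub> n"]] x by (auto simp: W_def)
          moreover have "n > 0" using l0 by (simp add: n_def)
          ultimately show "\<exists>n::nat. n > 0 \<and> x [^]\<^bsub>?G\<^esub> n \<in> ?B" by blast
        qed
        ultimately show ?thesis by simp
      qed
      moreover have "W \<subseteq> carrier ?G" by (auto simp: W_def)
      ultimately show ?thesis by (auto simp: FactGroup_def RCOSETS_def)
    qed
    \<comment> \<open>Both sides multiply cosets in the same way and have the same unit, so the
      equality of records reduces to that of the carriers.\<close>
    then show ?thesis
      unfolding tors_def coker_def by (auto simp: FactGroup_def RCOSETS_def r_coset_def set_mult_def fun_eq_iff)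
  qed
  moreover have "group (?W Mod ?B)" using normal.factorgroup_is_group[OF \<psi>.normal_kernel] ker by simp
  ultimately show "tors (coker l m M) \<cong> ?A" "group (tors (coker l m M))" using iso by simp_all
qed

section \<open>The symmetric square\<close>

definition alt_int :: "nat set \<Rightarrow> (nat \<Rightarrow> nat \<Rightarrow> int) \<Rightarrow> bool" where
  "alt_int I A \<longleftrightarrow> (\<forall>i\<in>I. A i i = 0) \<and> (\<forall>i\<in>I. \<forall>j\<in>I. A i j + A j i = 0)"

definition rel_vec :: "('a, 'b) monoid_scheme \<Rightarrow> nat set \<Rightarrow> (nat \<Rightarrow> 'a) \<Rightarrow> (nat \<Rightarrow> nat \<Rightarrow> int) \<Rightarrow> nat \<Rightarrow> 'a" where
  "rel_vec G I h A = (\<lambda>q\<in>I. lc G h (\<lambda>p. A p q) I)"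

definition alt_image :: "('a, 'b) monoid_scheme \<Rightarrow> nat set \<Rightarrow> (nat \<Rightarrow> 'a) \<Rightarrow> (nat \<Rightarrow> 'a) set" where
  "alt_image G I h = rel_vec G I h ` {A. alt_int I A}"

lemma rel_iff_rel_vec: "rel G I A h \<longleftrightarrow> rel_vec G I h A = \<one>\<^bsub>product_group I (\<lambda>_. G)\<^esub>"
  by (auto simp: rel_def rel_vec_def fun_eq_iff restrict_def)

context comm_group
begin

lemma lc_single:
  assumes "finite I" "i \<in> I" "h \<in> I \<rightarrow> carrier G"
  shows "lc G h (\<lambda>p. if p = i then k else 0) I = h i [^] (k::int)"
proof -
  have hi: "h i \<in> carrier G" using assms by auto
  have "lc G h (\<lambda>p. if p = i then k else 0) I = finprod G (\<lambda>p. if i = p then h p [^] k else \<one>) I"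
    unfolding lc_def using assms by (intro finprod_cong') (auto simp: Pi_iff)
  also have "\<dots> = h i [^] k" using assms by (intro finprod_singleton) auto
  finally show ?thesis .
qed

lemma lc_uminus:
  assumes "finite I" "h \<in> I \<rightarrow> carrier G"
  shows "lc G h (\<lambda>p. - x p) I = inv (lc G h x I)"
proof -
  have "lc G h (\<lambda>p. (- 1) * x p) I = lc G h x I [^] (- 1 :: int)" using assms by (rule lc_scale)
  also have "\<dots> = inv (lc G h x I)"
    using lc_closed[OF assms(2)] int_pow_neg[of "lc G h x I" 1] int_pow_1[of "lc G h x I"] by simp
  finally show ?thesis by simp
qed

lemma generate_eq_lc:
  assumes "finite I" "h \<in> I \<rightarrow> carrier G"
  shows "generate G (h ` I) = range (\<lambda>x. lc G h x I)"
proof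
  have sub: "subgroup (range (\<lambda>x. lc G h x I)) G"
  proof (rule subgroupI)
    show "range (\<lambda>x. lc G h x I) \<subseteq> carrier G" using assms by auto
    show "range (\<lambda>x. lc G h x I) \<noteq> {}" by simp
    show "inv a \<in> range (\<lambda>x. lc G h x I)" if a: "a \<in> range (\<lambda>x. lc G h x I)" for a
    proof -
      obtain x where "a = lc G h x I" using a by blast
      then have "inv a = lc G h (\<lambda>p. - x p) I" using assms by (simp add: lc_uminus)
      then show ?thesis by blast
    qed
    show "a \<otimes> b \<in> range (\<lambda>x. lc G h x I)"
      if ab: "a \<in> range (\<lambda>x. lc G h x I)" "b \<in> range (\<lambda>x. lc G h x I)" for a b
    proof -
      obtain x y where "a = lc G h x I" "b = lc G h y I" using ab by blast
      then have "a \<otimes> b = lc G h (\<lambda>p. x p + y p) I" using lc_add[OF assms(2)] by simp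
      then show ?thesis by blast
    qed
  qed
  have "h i \<in> range (\<lambda>x. lc G h x I)" if "i \<in> I" for i
  proof -
    have "h i = lc G h (\<lambda>p. if p = i then 1 else 0) I"
      using lc_single[OF assms(1) that assms(2), of 1] int_pow_1[OF funcset_mem[OF assms(2) that]] by simp
    then show ?thesis by blast
  qed
  then show "generate G (h ` I) \<subseteq> range (\<lambda>x. lc G h x I)"
    using sub by (intro generate_subgroup_incl) auto
  have "h ` I \<subseteq> carrier G" using assms(2) by auto
  then have "subgroup (generate G (h ` I)) G" by (rule generate_is_subgroup)
  then show "range (\<lambda>x. lc G h x I) \<subseteq> generate G (h ` I)"
    using lc_in_subgroup[OF assms(1)] generate.incl by (metis image_subsetI subsetI)
qed

text \<open>The terms at \<open>(p, q)\<close> and \<open>(q, p)\<close> are inverse to each other,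
  because \<open>s\<close> is symmetric and \<open>A\<close> antisymmetric, and the diagonal
  exponents are zero. The induction cancels the row and the column of the new index against each
  other.\<close>

lemma alternating_double_product:
  assumes "finite I" "\<And>p q. p \<in> I \<Longrightarrow> q \<in> I \<Longrightarrow> s p q \<in> carrier G"
    "\<And>p q. p \<in> I \<Longrightarrow> q \<in> I \<Longrightarrow> s p q = s q p" "alt_int I A"
  shows "finprod G (\<lambda>q. finprod G (\<lambda>p. s q p [^] A p q) I) I = \<one>"
  using assms
proof (induction I rule: finite_induct)
  case (insert i I)
  have IH: "finprod G (\<lambda>q. finprod G (\<lambda>p. s q p [^] A p q) I) I = \<one>"
  proof (rule insert.IH)
    show "s p q \<in> carrier G" if "p \<in> I" "q \<in> I" for p q using insert.prems(1) that by blast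
    show "s p q = s q p" if "p \<in> I" "q \<in> I" for p q using insert.prems(2) that by blast
    show "alt_int I A" using insert.prems(3) by (simp add: alt_int_def)
  qed
  have c: "s p q \<in> carrier G" if "p \<in> insert i I" "q \<in> insert i I" for p q using insert.prems(1) that .
  have Pi1: "(\<lambda>p. s q p [^] A p q) \<in> I \<rightarrow> carrier G" if "q \<in> insert i I" for q using c that by auto
  have Pi2: "(\<lambda>q. finprod G (\<lambda>p. s q p [^] A p q) I) \<in> I \<rightarrow> carrier G" using c by (auto intro!: finprod_closed)
  have inner: "finprod G (\<lambda>p. s q p [^] A p q) (insert i I) = s q i [^] A i q \<otimes> finprod G (\<lambda>p. s q p [^] A p q) I"
    if "q \<in> insert i I" for q
    using insert.hyps c that by (intro finprod_insert) auto
  have "finprod G (\<lambda>q. finprod G (\<lambda>p. s q p [^] A p q) (insert i I)) (insert i I)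
      = finprod G (\<lambda>q. s q i [^] A i q \<otimes> finprod G (\<lambda>p. s q p [^] A p q) I) (insert i I)"
    using c Pi1 by (intro finprod_cong' refl inner) (auto intro!: finprod_closed)
  also have "\<dots> = (s i i [^] A i i \<otimes> finprod G (\<lambda>p. s i p [^] A p i) I) \<otimes>
      finprod G (\<lambda>q. s q i [^] A i q \<otimes> finprod G (\<lambda>p. s q p [^] A p q) I) I"
    using c Pi1 insert.hyps by (intro finprod_insert) (auto intro!: finprod_closed)
  also have "finprod G (\<lambda>q. s q i [^] A i q \<otimes> finprod G (\<lambda>p. s q p [^] A p q) I) I
      = finprod G (\<lambda>q. s q i [^] A i q) I \<otimes> finprod G (\<lambda>q. finprod G (\<lambda>p. s q p [^] A p q) I) I"
    using c Pi2 by (intro finprod_multf) auto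
  also have "\<dots> = finprod G (\<lambda>q. s q i [^] A i q) I"
    using IH c by (auto intro!: r_one finprod_closed)
  also have "s i i [^] A i i = \<one>" using insert.prems(3) by (simp add: alt_int_def)
  finally have "finprod G (\<lambda>q. finprod G (\<lambda>p. s q p [^] A p q) (insert i I)) (insert i I)
      = (\<one> \<otimes> finprod G (\<lambda>p. s i p [^] A p i) I) \<otimes> finprod G (\<lambda>q. s q i [^] A i q) I" .
  also have "\<dots> = finprod G (\<lambda>p. s i p [^] A p i) I \<otimes> finprod G (\<lambda>q. s q i [^] A i q) I"
    using c by (simp add: Pi_iff)
  also have "\<dots> = finprod G (\<lambda>p. s i p [^] A p i \<otimes> s p i [^] A i p) I"
    using c by (intro finprod_multf[symmetric]) auto
  also have "\<dots> = \<one>"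
  proof (rule finprod_one_eqI)
    fix p assume p: "p \<in> I"
    have "s p i = s i p" using insert.prems(2) p by blast
    moreover have "A i p + A p i = 0" using insert.prems(3) p by (simp add: alt_int_def)
    then have "A i p = - A p i" by simp
    ultimately show "s i p [^] A p i \<otimes> s p i [^] A i p = \<one>" using c p by (simp add: int_pow_neg)
  qed
  finally show ?case .
qed simp

lemma nat_finprod_hom:
  assumes "comm_group K" "f \<in> hom G K" "finite I" "g \<in> I \<rightarrow> carrier G"
  shows "f (finprod G g I) = finprod K (\<lambda>i. f (g i)) I"
  using assms(3,4)
proof (induction I rule: finite_induct)
  interpret K: comm_group K by fact
  case empty
  then show ?case using assms(2) by (simp add: hom_one K.is_group is_group)
next
  interpret K: comm_group K by fact
  case (insert i I)
  then have "f (g i) \<in> carrier K" "(\<lambda>i. f (g i)) \<in> I \<rightarrow> carrier K" "g \<in> I \<rightarrow> carrier G" "g i \<in> carrier G"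
    using assms(2) by (auto simp: hom_def)
  then show ?case using insert hom_mult[OF assms(2)] by simp
qed

text \<open>The map \<open>\<theta>\<close> sends \<open>g\<close> to the product of the symbols
  \<open>(h j, g j)\<close>; it is onto because \<open>h\<close> generates. Alternating matrices
  land in its kernel by \<open>alternating_double_product\<close>. For the converse a map back from
  the symmetric square to \<open>?Q\<close> is built by universal properties. Lagrange's theorem
  then turns the isomorphism into the count.\<close>

lemma card_Sym2:
  assumes fin: "finite (carrier G)" and I: "finite I" and h: "h \<in> I \<rightarrow> carrier G"
    and gen: "generate G (h ` I) = carrier G"
  shows "card (carrier (Sym2 G)) * card (alt_image G I h) = card (carrier G) ^ card I"
proof -
  let ?P = "product_group I (\<lambda>_. G)" and ?Im = "alt_image G I h"
  let ?F = "free_Abelian_group (carrier G \<times> carrier G)" and ?N = "generate (free_Abelian_group (carrier G \<times> carrier G)) (Sym2_rels G)"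
  interpret P: comm_group ?P by (intro comm_group_product_group) unfold_locales
  interpret F: comm_group ?F by (rule abelian_free_Abelian_group)
  have carP: "carrier ?P = I \<rightarrow>\<^sub>E carrier G" by simp
  have multP: "u \<otimes>\<^bsub>?P\<^esub> v = (\<lambda>i\<in>I. u i \<otimes> v i)" for u v by simp
  have invP: "inv\<^bsub>?P\<^esub> u = (\<lambda>i\<in>I. inv (u i))" if "u \<in> carrier ?P" for u
    using that by (simp add: is_group)
  have hp: "h p \<in> carrier G" if "p \<in> I" for p using h that by auto
  have rvP: "rel_vec G I h A \<in> carrier ?P" for A using h by (auto simp: rel_vec_def)
  have Im: "subgroup ?Im ?P"
  proof (rule P.subgroupI)
    show "?Im \<subseteq> carrier ?P" using rvP by (auto simp: alt_image_def)
    have "alt_int I (\<lambda>_ _. 0)" by (simp add: alt_int_def)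
    then show "?Im \<noteq> {}" by (auto simp: alt_image_def)
    show "inv\<^bsub>?P\<^esub> a \<in> ?Im" if a: "a \<in> ?Im" for a
    proof -
      obtain A where A: "alt_int I A" "a = rel_vec G I h A" using a by (auto simp: alt_image_def)
      have "inv\<^bsub>?P\<^esub> a = rel_vec G I h (\<lambda>p q. - A p q)"
        unfolding invP[OF rvP, folded A(2)] using A(2) I h
        by (auto simp: rel_vec_def lc_uminus intro!: restrict_ext)
      moreover have "- a + - b = 0" if "a + b = 0" for a b :: int using that by simp
      then have "alt_int I (\<lambda>p q. - A p q)" using A(1) unfolding alt_int_def by (metis neg_0_equal_iff_equal)
      ultimately show ?thesis unfolding alt_image_def by blast
    qed
    show "a \<otimes>\<^bsub>?P\<^esub> b \<in> ?Im" if ab: "a \<in> ?Im" "b \<in> ?Im" for a b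
    proof -
      obtain A B where A: "alt_int I A" "a = rel_vec G I h A" "alt_int I B" "b = rel_vec G I h B"
        using ab by (auto simp: alt_image_def)
      have "a \<otimes>\<^bsub>?P\<^esub> b = rel_vec G I h (\<lambda>p q. A p q + B p q)"
        unfolding A multP using h by (auto simp: rel_vec_def lc_add intro!: restrict_ext)
      moreover have "(a + b) + (c + d) = 0" if "a + c = 0" "b + d = 0" for a b c d :: int using that by simp
      then have "alt_int I (\<lambda>p q. A p q + B p q)" using A(1,3) unfolding alt_int_def by (metis add_0)
      ultimately show ?thesis unfolding alt_image_def by blast
    qed
  qed
  let ?Q = "?P Mod ?Im"
  interpret Q: comm_group ?Q using Im by (rule P.abelian_FactGroup)
  have nIm: "?Im \<lhd> ?P" using Im P.normal_iff_subgroup by blast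
  define \<pi> where "\<pi> = (\<lambda>u. ?Im #>\<^bsub>?P\<^esub> u)"
  have \<pi>hom: "\<pi> \<in> hom ?P ?Q" unfolding \<pi>_def using nIm by (rule normal.r_coset_hom_Mod)
  have \<pi>eq: "\<pi> u = \<pi> v" if "u \<in> carrier ?P" "v \<in> carrier ?P" "u \<otimes>\<^bsub>?P\<^esub> inv\<^bsub>?P\<^esub> v \<in> ?Im" for u v
  proof -
    have "u \<in> ?Im #>\<^bsub>?P\<^esub> v"
      by (rule subgroup.rcos_module_rev[OF Im P.is_group that(2,1,3)])
    then show ?thesis unfolding \<pi>_def using P.repr_independence[OF _ that(2) Im] by metis
  qed
  have \<pi>1: "\<pi> u = \<one>\<^bsub>?Q\<^esub> \<longleftrightarrow> u \<in> ?Im" if "u \<in> carrier ?P" for u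
    using that Im P.coset_join1 P.coset_join2 by (auto simp: \<pi>_def FactGroup_def)
  define vec where "vec y z = (\<lambda>q\<in>I. y [^] (z q :: int))" for y z
  have vecP: "vec y z \<in> carrier ?P" if "y \<in> carrier G" for y z using that by (auto simp: vec_def)
  have vec_mult: "vec (x \<otimes> y) z = vec x z \<otimes>\<^bsub>?P\<^esub> vec y z" if "x \<in> carrier G" "y \<in> carrier G" for x y z
    using that by (auto simp: vec_def int_pow_distrib intro!: restrict_ext)
  have vec_add: "vec y (\<lambda>q. z q + w q) = vec y z \<otimes>\<^bsub>?P\<^esub> vec y w" if "y \<in> carrier G" for y z w
    using that by (auto simp: vec_def int_pow_mult intro!: restrict_ext)
  \<comment> \<open>The two vectors differ by the value at \<open>h\<close> of the alternating
    matrix with entries \<open>z q * y p - y q * z p\<close>. This one identity yields both the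
    symmetry of the pairing and its independence of the chosen coefficients.\<close>
  have swap: "\<pi> (vec (lc G h y I) z) = \<pi> (vec (lc G h z I) y)" for y z
  proof (rule \<pi>eq)
    have "vec (lc G h y I) z \<otimes>\<^bsub>?P\<^esub> inv\<^bsub>?P\<^esub> vec (lc G h z I) y = rel_vec G I h (\<lambda>p q. z q * y p + (- y q) * z p)"
      unfolding invP[OF vecP[OF lc_closed[OF h]]] multP
      using h I by (auto simp: vec_def rel_vec_def lc_add lc_scale int_pow_neg simp del: mult_minus_left intro!: restrict_ext)
    moreover have "alt_int I (\<lambda>p q. z q * y p + (- y q) * z p)" by (simp add: alt_int_def)
    ultimately show "vec (lc G h y I) z \<otimes>\<^bsub>?P\<^esub> inv\<^bsub>?P\<^esub> vec (lc G h z I) y \<in> ?Im"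
      unfolding alt_image_def by blast
  qed (use vecP h in auto)
  have "\<exists>x. lc G h x I = g" if "g \<in> carrier G" for g
    using that generate_eq_lc[OF I h] gen by (metis image_iff)
  \<comment> \<open>Coefficients of each group element in terms of \<open>h\<close>. This choice
    need not be additive; only the class of the resulting vector is, by
    \<open>indep\<close>.\<close>
  then obtain \<xi> where \<xi>: "\<And>g. g \<in> carrier G \<Longrightarrow> lc G h (\<xi> g) I = g" by metis
  have indep: "\<pi> (vec y z) = \<pi> (vec y w)" if "y \<in> carrier G" "lc G h z I = lc G h w I" for y z w
    using swap[of "\<xi> y" z] swap[of "\<xi> y" w] \<xi>[OF that(1)] that(2) by simp
  define \<psi> where "\<psi> = (\<lambda>(x, y). \<pi> (vec y (\<xi> x)))"
  have \<pi>Q: "\<pi> u \<in> carrier ?Q" if "u \<in> carrier ?P" for u using hom_in_carrier[OF \<pi>hom that] .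
  have "\<psi> ` (carrier G \<times> carrier G) \<subseteq> carrier ?Q" using \<pi>Q vecP by (auto simp: \<psi>_def)
  from Q.free_Abelian_group_universal[OF this] obtain \<Psi> where
    \<Psi>: "\<Psi> \<in> hom ?F ?Q" "\<And>x. x \<in> carrier G \<times> carrier G \<Longrightarrow> \<Psi> (frag_of x) = \<psi> x" by blast
  interpret \<Psi>: group_hom ?F ?Q \<Psi> using \<Psi>(1) by unfold_locales
  have \<Psi>diff: "\<Psi> (a - b) = \<Psi> a \<otimes>\<^bsub>?Q\<^esub> inv\<^bsub>?Q\<^esub> \<Psi> b" if "a \<in> carrier ?F" "b \<in> carrier ?F" for a b
  proof -
    have "a - b = a \<otimes>\<^bsub>?F\<^esub> inv\<^bsub>?F\<^esub> b" using that by simp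
    then show ?thesis using that by (simp only: \<Psi>.hom_mult \<Psi>.hom_inv F.inv_closed)
  qed
  have fragF: "frag_of (x, y) \<in> carrier ?F" if "x \<in> carrier G" "y \<in> carrier G" for x y using that by simp
  have \<psi>1: "\<psi> (x \<otimes> y, z) = \<psi> (x, z) \<otimes>\<^bsub>?Q\<^esub> \<psi> (y, z)" if "x \<in> carrier G" "y \<in> carrier G" "z \<in> carrier G" for x y z
  proof -
    have "\<pi> (vec z (\<xi> (x \<otimes> y))) = \<pi> (vec z (\<lambda>q. \<xi> x q + \<xi> y q))"
      using that \<xi> h by (intro indep) (simp_all add: lc_add)
    then show ?thesis unfolding \<psi>_def prod.case
      by (simp only: vec_add[OF that(3)] hom_mult[OF \<pi>hom vecP[OF that(3)] vecP[OF that(3)]])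
  qed
  have \<psi>2: "\<psi> (z, x \<otimes> y) = \<psi> (z, x) \<otimes>\<^bsub>?Q\<^esub> \<psi> (z, y)" if "x \<in> carrier G" "y \<in> carrier G" "z \<in> carrier G" for x y z
    unfolding \<psi>_def prod.case
    by (simp only: vec_mult[OF that(1,2)] hom_mult[OF \<pi>hom vecP[OF that(1)] vecP[OF that(2)]])
  have \<psi>3: "\<psi> (x, y) = \<psi> (y, x)" if "x \<in> carrier G" "y \<in> carrier G" for x y
    using swap[of "\<xi> y" "\<xi> x"] \<xi> that by (simp add: \<psi>_def)
  have \<psi>Q: "\<psi> (x, y) \<in> carrier ?Q" if "x \<in> carrier G" "y \<in> carrier G" for x y
    using \<pi>Q vecP that by (simp add: \<psi>_def)
  have rF: "Sym2_rels G \<subseteq> carrier ?F"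
  proof -
    have d: "a - b \<in> carrier ?F" if "a \<in> carrier ?F" "b \<in> carrier ?F" for a b
      using that F.m_closed[OF that(1) F.inv_closed[OF that(2)]] by simp
    show ?thesis unfolding Sym2_rels_def using d fragF by (auto simp del: carrier_free_Abelian_group_iff frag_of_in_free_Abelian_group)
  qed
  have rker: "Sym2_rels G \<subseteq> kernel ?F ?Q \<Psi>"
  proof
    fix r assume r: "r \<in> Sym2_rels G"
    have d: "a - b \<in> carrier ?F" if "a \<in> carrier ?F" "b \<in> carrier ?F" for a b
      using that F.m_closed[OF that(1) F.inv_closed[OF that(2)]] by simp
    have triv: "\<Psi> (frag_of u - frag_of v - frag_of w) = \<one>\<^bsub>?Q\<^esub>"
      if "u \<in> carrier G \<times> carrier G" "v \<in> carrier G \<times> carrier G" "w \<in> carrier G \<times> carrier G"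
        "\<psi> u = \<psi> v \<otimes>\<^bsub>?Q\<^esub> \<psi> w" for u v w
    proof -
      have c: "frag_of u \<in> carrier ?F" "frag_of v \<in> carrier ?F" "frag_of w \<in> carrier ?F"
        using that by simp_all
      have cQ: "\<psi> v \<in> carrier ?Q" "\<psi> w \<in> carrier ?Q" using that \<psi>Q by auto
      have "\<Psi> (frag_of u - frag_of v - frag_of w) = (\<psi> v \<otimes>\<^bsub>?Q\<^esub> \<psi> w) \<otimes>\<^bsub>?Q\<^esub> inv\<^bsub>?Q\<^esub> \<psi> v \<otimes>\<^bsub>?Q\<^esub> inv\<^bsub>?Q\<^esub> \<psi> w"
        using \<Psi>diff[OF d[OF c(1,2)] c(3)] \<Psi>diff[OF c(1,2)] that \<Psi>(2) by simp
      also have "\<dots> = \<one>\<^bsub>?Q\<^esub>"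
      proof -
        have "(\<psi> v \<otimes>\<^bsub>?Q\<^esub> \<psi> w) \<otimes>\<^bsub>?Q\<^esub> inv\<^bsub>?Q\<^esub> \<psi> v = \<psi> w"
          using cQ by (metis Q.inv_closed Q.inv_solve_right' Q.m_closed Q.m_comm)
        then show ?thesis using cQ by (simp del: mult_FactGroup)
      qed
      finally show ?thesis .
    qed
    have triv2: "\<Psi> (frag_of u - frag_of v) = \<one>\<^bsub>?Q\<^esub>"
      if "u \<in> carrier G \<times> carrier G" "v \<in> carrier G \<times> carrier G" "\<psi> u = \<psi> v" for u v
    proof -
      have c: "frag_of u \<in> carrier ?F" "frag_of v \<in> carrier ?F" "\<psi> v \<in> carrier ?Q"
        using that \<psi>Q by auto
      show ?thesis using \<Psi>diff[OF c(1,2)] c(3) that \<Psi>(2) by (simp del: mult_FactGroup)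
    qed
    have "\<Psi> r = \<one>\<^bsub>?Q\<^esub>"
      using r unfolding Sym2_rels_def
    proof (elim UnE CollectE exE conjE)
      fix x y z assume "r = frag_of (x \<otimes> y, z) - frag_of (x, z) - frag_of (y, z)"
        "x \<in> carrier G" "y \<in> carrier G" "z \<in> carrier G"
      then show ?thesis using triv[of "(x \<otimes> y, z)" "(x, z)" "(y, z)"] \<psi>1[of x y z] by simp
    next
      fix x y z assume "r = frag_of (z, x \<otimes> y) - frag_of (z, x) - frag_of (z, y)"
        "x \<in> carrier G" "y \<in> carrier G" "z \<in> carrier G"
      then show ?thesis using triv[of "(z, x \<otimes> y)" "(z, x)" "(z, y)"] \<psi>2[of x y z] by simp
    next
      fix x y assume "r = frag_of (x, y) - frag_of (y, x)" "x \<in> carrier G" "y \<in> carrier G"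
      then show ?thesis using triv2[of "(x, y)" "(y, x)"] \<psi>3[of x y] by simp
    qed
    then show "r \<in> kernel ?F ?Q \<Psi>" using r rF by (auto simp: kernel_def simp del: carrier_free_Abelian_group_iff)
  qed
  have N: "subgroup ?N ?F" using rF by (rule F.generate_is_subgroup)
  have nN: "?N \<lhd> ?F" using N F.normal_iff_subgroup by blast
  have Nker: "?N \<subseteq> kernel ?F ?Q \<Psi>"
    using rker \<Psi>.subgroup_kernel by (rule F.generate_subgroup_incl)
  let ?S = "?F Mod ?N"
  interpret S: comm_group ?S using N by (rule F.abelian_FactGroup)
  from \<Psi>.FactGroup_universal_kernel[OF nN Nker] obtain \<Psi>' where
    \<Psi>': "\<Psi>' \<in> hom ?S ?Q" "\<And>x. x \<in> carrier ?F \<Longrightarrow> \<Psi>' (?N #>\<^bsub>?F\<^esub> x) = \<Psi> x" by blast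
  define cos where "cos = (\<lambda>c. ?N #>\<^bsub>?F\<^esub> c)"
  have coshom: "cos \<in> hom ?F ?S" unfolding cos_def using nN by (rule normal.r_coset_hom_Mod)
  interpret cos: group_hom ?F ?S cos using coshom by unfold_locales
  have cosdiff: "cos (a - b) = cos a \<otimes>\<^bsub>?S\<^esub> inv\<^bsub>?S\<^esub> cos b" if "a \<in> carrier ?F" "b \<in> carrier ?F" for a b
  proof -
    have "a - b = a \<otimes>\<^bsub>?F\<^esub> inv\<^bsub>?F\<^esub> b" using that by simp
    then show ?thesis using that by (simp only: cos.hom_mult cos.hom_inv F.inv_closed)
  qed
  have cos1: "cos c = \<one>\<^bsub>?S\<^esub>" if "c \<in> Sym2_rels G" for c
  proof -
    have "c \<in> ?N" using that by (rule generate.incl)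
    moreover have "c \<in> carrier ?F" using that rF by blast
    ultimately have "?N #>\<^bsub>?F\<^esub> c = ?N" using F.coset_join2 N by blast
    then show ?thesis by (simp add: cos_def FactGroup_def)
  qed
  define \<sigma> where "\<sigma> x y = cos (frag_of (x, y))" for x y
  have \<sigma>S: "\<sigma> x y \<in> carrier ?S" if "x \<in> carrier G" "y \<in> carrier G" for x y
    using hom_in_carrier[OF coshom fragF[OF that]] by (simp add: \<sigma>_def)
  have solve3: "cos u = cos v \<otimes>\<^bsub>?S\<^esub> cos w"
    if "u \<in> carrier ?F" "v \<in> carrier ?F" "w \<in> carrier ?F" "u - v - w \<in> Sym2_rels G" for u v w
  proof -
    have c: "cos u \<in> carrier ?S" "cos v \<in> carrier ?S" "cos w \<in> carrier ?S"
      using that hom_in_carrier[OF coshom] by blast+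
    have "u - v \<in> carrier ?F" using that F.m_closed[OF that(1) F.inv_closed[OF that(2)]] by simp
    then have "cos u \<otimes>\<^bsub>?S\<^esub> inv\<^bsub>?S\<^esub> cos v \<otimes>\<^bsub>?S\<^esub> inv\<^bsub>?S\<^esub> cos w = \<one>\<^bsub>?S\<^esub>"
      using cos1[OF that(4)] that(1-3) cosdiff by metis
    then have "cos u \<otimes>\<^bsub>?S\<^esub> inv\<^bsub>?S\<^esub> cos v = cos w"
      using c by (metis S.inv_closed S.m_closed S.inv_equality S.inv_inv)
    then show ?thesis using c by (metis S.inv_solve_right' S.m_comm)
  qed
  have \<sigma>1: "\<sigma> (x \<otimes> y) z = \<sigma> x z \<otimes>\<^bsub>?S\<^esub> \<sigma> y z" if "x \<in> carrier G" "y \<in> carrier G" "z \<in> carrier G" for x y z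
  proof -
    have "frag_of (x \<otimes> y, z) - frag_of (x, z) - frag_of (y, z) \<in> Sym2_rels G"
      unfolding Sym2_rels_def using that by blast
    then show ?thesis unfolding \<sigma>_def by (rule solve3[OF fragF fragF fragF, rotated -1]) (use that in simp_all)
  qed
  have \<sigma>2: "\<sigma> z (x \<otimes> y) = \<sigma> z x \<otimes>\<^bsub>?S\<^esub> \<sigma> z y" if "x \<in> carrier G" "y \<in> carrier G" "z \<in> carrier G" for x y z
  proof -
    have "frag_of (z, x \<otimes> y) - frag_of (z, x) - frag_of (z, y) \<in> Sym2_rels G"
      unfolding Sym2_rels_def using that by blast
    then show ?thesis unfolding \<sigma>_def by (rule solve3[OF fragF fragF fragF, rotated -1]) (use that in simp_all)
  qed
  have \<sigma>3: "\<sigma> x y = \<sigma> y x" if "x \<in> carrier G" "y \<in> carrier G" for x y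
  proof -
    have "frag_of (x, y) - frag_of (y, x) \<in> Sym2_rels G" unfolding Sym2_rels_def using that by blast
    then have "\<sigma> x y \<otimes>\<^bsub>?S\<^esub> inv\<^bsub>?S\<^esub> \<sigma> y x = \<one>\<^bsub>?S\<^esub>"
      using cos1 cosdiff[OF fragF fragF] that unfolding \<sigma>_def by metis
    then show ?thesis using \<sigma>S that by (metis S.inv_closed S.inv_equality S.inv_inv)
  qed
  have hom1: "(\<lambda>x. \<sigma> x z) \<in> hom G ?S" if "z \<in> carrier G" for z
    using that \<sigma>1 \<sigma>S by (intro homI) auto
  have hom2: "\<sigma> z \<in> hom G ?S" if "z \<in> carrier G" for z
    using that \<sigma>2 \<sigma>S by (intro homI) auto
  define \<theta> where "\<theta> g = finprod ?S (\<lambda>j. \<sigma> (h j) (g j)) I" for g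
  have \<theta>hom: "\<theta> \<in> hom ?P ?S"
  proof (rule homI)
    show "\<theta> g \<in> carrier ?S" if "g \<in> carrier ?P" for g
      unfolding \<theta>_def using that \<sigma>S hp by (intro S.finprod_closed) auto
    show "\<theta> (g \<otimes>\<^bsub>?P\<^esub> g') = \<theta> g \<otimes>\<^bsub>?S\<^esub> \<theta> g'" if g: "g \<in> carrier ?P" "g' \<in> carrier ?P" for g g'
    proof -
      have gc: "g j \<in> carrier G" "g' j \<in> carrier G" if "j \<in> I" for j using g that by auto
      have "\<theta> (g \<otimes>\<^bsub>?P\<^esub> g') = finprod ?S (\<lambda>j. \<sigma> (h j) (g j) \<otimes>\<^bsub>?S\<^esub> \<sigma> (h j) (g' j)) I"
        unfolding \<theta>_def using gc \<sigma>S hp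
        by (intro S.finprod_cong') (auto simp: \<sigma>2 simp del: mult_FactGroup intro!: S.m_closed)
      also have "\<dots> = \<theta> g \<otimes>\<^bsub>?S\<^esub> \<theta> g'"
        unfolding \<theta>_def using gc \<sigma>S hp by (intro S.finprod_multf) auto
      finally show ?thesis .
    qed
  qed
  interpret \<theta>: group_hom ?P ?S \<theta> using \<theta>hom by unfold_locales
  have \<sigma>\<theta>: "\<sigma> x y = \<theta> (vec y (\<xi> x))" if xy: "x \<in> carrier G" "y \<in> carrier G" for x y
  proof -
    have "\<sigma> x y = \<sigma> (finprod G (\<lambda>p. h p [^] \<xi> x p) I) y" using \<xi>[OF xy(1)] by (simp add: lc_def)
    also have "\<dots> = finprod ?S (\<lambda>p. \<sigma> (h p [^] \<xi> x p) y) I"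
      using hp by (intro nat_finprod_hom[OF S.comm_group_axioms hom1[OF xy(2)] I]) auto
    also have "\<dots> = \<theta> (vec y (\<xi> x))"
      unfolding \<theta>_def
    proof (rule S.finprod_cong')
      show "(\<lambda>j. \<sigma> (h j) (vec y (\<xi> x) j)) \<in> I \<rightarrow> carrier ?S" using \<sigma>S hp xy(2) by (auto simp: vec_def)
      show "\<sigma> (h p [^] \<xi> x p) y = \<sigma> (h p) (vec y (\<xi> x) p)" if "p \<in> I" for p
        using hom_int_pow[OF hom1[OF xy(2)] hp[OF that] is_group S.is_group, of "\<xi> x p"]
          hom_int_pow[OF hom2[OF hp[OF that]] xy(2) is_group S.is_group, of "\<xi> x p"] that
        by (simp add: vec_def)
    qed simp
    finally show ?thesis .
  qed
  have surj: "\<theta> ` carrier ?P = carrier ?S"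
  proof (rule antisym)
    show "\<theta> ` carrier ?P \<subseteq> carrier ?S" using \<theta>.hom_closed by blast
    show "carrier ?S \<subseteq> \<theta> ` carrier ?P"
    proof
      fix X assume "X \<in> carrier ?S"
      then obtain c where c: "c \<in> carrier ?F" "X = cos c" by (auto simp: FactGroup_def RCOSETS_def cos_def)
      have sub: "subgroup (\<theta> ` carrier ?P) ?S" by (rule \<theta>.img_is_subgroup)
      have keys: "Poly_Mapping.keys c \<subseteq> carrier G \<times> carrier G" using c(1) by simp
      have "cos c \<in> \<theta> ` carrier ?P"
      proof (rule free_Abelian_group_induct[OF keys, where P = "\<lambda>c. cos c \<in> \<theta> ` carrier ?P"])
        have "cos \<one>\<^bsub>?F\<^esub> = \<one>\<^bsub>?S\<^esub>" by (rule cos.hom_one)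
        then show "cos 0 \<in> \<theta> ` carrier ?P" using subgroup.one_closed[OF sub] by simp
        show "cos (a - b) \<in> \<theta> ` carrier ?P"
          if "Poly_Mapping.keys a \<subseteq> carrier G \<times> carrier G" "Poly_Mapping.keys b \<subseteq> carrier G \<times> carrier G"
            "cos a \<in> \<theta> ` carrier ?P" "cos b \<in> \<theta> ` carrier ?P" for a b
        proof -
          have "cos (a - b) = cos a \<otimes>\<^bsub>?S\<^esub> inv\<^bsub>?S\<^esub> cos b" using that by (intro cosdiff) auto
          then show ?thesis using sub that(3,4) by (metis subgroup.m_closed subgroup.m_inv_closed)
        qed
        show "cos (frag_of a) \<in> \<theta> ` carrier ?P" if "a \<in> carrier G \<times> carrier G" for a
        proof -
          obtain x y where a: "a = (x, y)" "x \<in> carrier G" "y \<in> carrier G" using \<open>a \<in> carrier G \<times> carrier G\<close> by blast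
          show ?thesis using \<sigma>\<theta>[OF a(2,3)] vecP[OF a(3)] unfolding \<sigma>_def a(1) by blast
        qed
      qed
      then show "X \<in> \<theta> ` carrier ?P" using c by simp
    qed
  qed
  have ker: "kernel ?P ?S \<theta> = ?Im"
  proof (rule antisym)
    show "kernel ?P ?S \<theta> \<subseteq> ?Im"
    proof
      fix g assume "g \<in> kernel ?P ?S \<theta>"
      then have g: "g \<in> carrier ?P" "\<theta> g = \<one>\<^bsub>?S\<^esub>" by (auto simp: kernel_def)
      have gc: "g j \<in> carrier G" if "j \<in> I" for j using g(1) that by auto
      \<comment> \<open>\<open>e j\<close> carries \<open>g j\<close> in position \<open>j\<close>
        and is trivial elsewhere, so \<open>g\<close> is the product of the \<open>e j\<close>. The
        map back sends the symbol \<open>(h j, g j)\<close> to the class of \<open>e j\<close>;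
        hence \<open>\<Psi>'\<close> after \<open>\<theta>\<close> is the projection
        \<open>\<pi>\<close>, and whatever \<open>\<theta>\<close> kills lies in
        \<open>?Im\<close>.\<close>
      define e where "e j = vec (g j) (\<lambda>q. if q = j then 1 else 0)" for j
      have eP: "e j \<in> carrier ?P" if "j \<in> I" for j unfolding e_def using vecP gc that by blast
      have "\<one>\<^bsub>?Q\<^esub> = \<Psi>' (\<theta> g)" unfolding g(2) using hom_one[OF \<Psi>'(1) S.is_group Q.is_group] by simp
      also have "\<dots> = finprod ?Q (\<lambda>j. \<Psi>' (\<sigma> (h j) (g j))) I"
        unfolding \<theta>_def using \<sigma>S hp gc
        by (intro S.nat_finprod_hom[OF Q.comm_group_axioms \<Psi>'(1) I]) auto
      also have "\<dots> = finprod ?Q (\<lambda>j. \<pi> (e j)) I"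
      proof (rule Q.finprod_cong')
        show "(\<lambda>j. \<pi> (e j)) \<in> I \<rightarrow> carrier ?Q" using \<pi>Q eP by blast
        show "\<Psi>' (\<sigma> (h j) (g j)) = \<pi> (e j)" if j: "j \<in> I" for j
        proof -
          have "\<Psi>' (\<sigma> (h j) (g j)) = \<psi> (h j, g j)"
            using \<Psi>'(2)[OF fragF[OF hp[OF j] gc[OF j]]] \<Psi>(2) hp[OF j] gc[OF j] by (simp add: \<sigma>_def cos_def)
          also have "\<dots> = \<pi> (e j)"
            unfolding \<psi>_def e_def using \<xi>[OF hp[OF j]] lc_single[OF I j h, of 1] gc[OF j] hp[OF j]
            by (auto intro!: indep)
          finally show ?thesis .
        qed
      qed simp
      also have "\<dots> = \<pi> (finprod ?P e I)"
        using eP by (intro P.nat_finprod_hom[OF Q.comm_group_axioms \<pi>hom I, symmetric]) auto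
      also have "finprod ?P e I = g"
      proof -
        have step: "finprod ?P e J = (\<lambda>q\<in>I. if q \<in> J then g q else \<one>)" if "J \<subseteq> I" for J
          using finite_subset[OF that I] that
        proof (induction J rule: finite_induct)
          case (insert j J)
          then have "finprod ?P e (insert j J) = e j \<otimes>\<^bsub>?P\<^esub> finprod ?P e J"
            using eP by (intro P.finprod_insert) auto
          also have "finprod ?P e J = (\<lambda>q\<in>I. if q \<in> J then g q else \<one>)"
            using insert.IH insert.prems by blast
          also have "e j \<otimes>\<^bsub>?P\<^esub> (\<lambda>q\<in>I. if q \<in> J then g q else \<one>) = (\<lambda>q\<in>I. if q \<in> insert j J then g q else \<one>)"
            using insert.hyps insert.prems gc by (auto simp: e_def vec_def subset_iff intro!: restrict_ext)
          finally show ?case .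
        qed simp
        have "finprod ?P e I = (\<lambda>q\<in>I. g q)" unfolding step[OF subset_refl] by (auto intro: restrict_ext)
        also have "\<dots> = g" using g(1) carP by (intro extensional_restrict) (auto simp: PiE_def)
        finally show ?thesis .
      qed
      finally show "g \<in> ?Im" using \<pi>1[OF g(1)] by simp
    qed
    show "?Im \<subseteq> kernel ?P ?S \<theta>"
    proof
      fix g assume "g \<in> ?Im"
      then obtain A where A: "alt_int I A" "g = rel_vec G I h A" by (auto simp: alt_image_def)
      have "\<theta> g = finprod ?S (\<lambda>q. finprod ?S (\<lambda>p. \<sigma> (h q) (h p) [^]\<^bsub>?S\<^esub> A p q) I) I"
        unfolding \<theta>_def
      proof (rule S.finprod_cong')
        show "(\<lambda>q. finprod ?S (\<lambda>p. \<sigma> (h q) (h p) [^]\<^bsub>?S\<^esub> A p q) I) \<in> I \<rightarrow> carrier ?S"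
          using \<sigma>S hp by (auto intro!: S.finprod_closed S.int_pow_closed)
        fix q assume q: "q \<in> I"
        have "\<sigma> (h q) (g q) = \<sigma> (h q) (finprod G (\<lambda>p. h p [^] A p q) I)"
          using q by (simp add: A(2) rel_vec_def lc_def)
        also have "\<dots> = finprod ?S (\<lambda>p. \<sigma> (h q) (h p [^] A p q)) I"
          using hp by (intro nat_finprod_hom[OF S.comm_group_axioms hom2[OF hp[OF q]] I]) auto
        also have "\<dots> = finprod ?S (\<lambda>p. \<sigma> (h q) (h p) [^]\<^bsub>?S\<^esub> A p q) I"
        proof (rule S.finprod_cong')
          show "\<sigma> (h q) (h p [^] A p q) = \<sigma> (h q) (h p) [^]\<^bsub>?S\<^esub> A p q" if "p \<in> I" for p
            using hom_int_pow[OF hom2[OF hp[OF q]] hp[OF that] is_group S.is_group] .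
        qed (use \<sigma>S hp q in \<open>auto intro!: S.int_pow_closed\<close>)
        finally show "\<sigma> (h q) (g q) = finprod ?S (\<lambda>p. \<sigma> (h q) (h p) [^]\<^bsub>?S\<^esub> A p q) I" .
      qed simp
      also have "\<dots> = \<one>\<^bsub>?S\<^esub>"
        using \<sigma>S \<sigma>3 hp by (intro S.alternating_double_product I A(1)) auto
      finally show "g \<in> kernel ?P ?S \<theta>" using rvP A(2) by (simp add: kernel_def)
    qed
  qed
  have "?P Mod ?Im \<cong> ?S" using \<theta>.FactGroup_iso[OF surj] ker by simp
  then have "card (carrier (?P Mod ?Im)) = card (carrier ?S)" by (auto simp: is_iso_def iso_def dest: bij_betw_same_card)
  moreover have "card (rcosets\<^bsub>?P\<^esub> ?Im) * card ?Im = Coset.order ?P" by (rule P.lagrange[OF Im])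
  moreover have "Coset.order ?P = card (carrier G) ^ card I" using I by (simp add: Coset.order_def card_PiE)
  moreover have "carrier (Sym2 G) = carrier ?S" by (simp add: Sym2_def Let_def)
  ultimately show ?thesis by (simp add: FactGroup_def)
qed

end

section \<open>Counting alternating matrices modulo N\<close>

definition upper :: "nat set \<Rightarrow> (nat \<times> nat) set" where
  "upper I = {(i, j). i \<in> I \<and> j \<in> I \<and> i < j}"

text \<open>The integer lift is alternating exactly and not just modulo \<open>N\<close>, so it can
  serve as a constant sequence in the elimination.\<close>

definition skew :: "(nat \<times> nat \<Rightarrow> int) \<Rightarrow> nat \<Rightarrow> nat \<Rightarrow> int" where
  "skew x i j = (if i < j then x (i, j) else if j < i then - x (j, i) else 0)"

definition residues_mat :: "nat set \<Rightarrow> int \<Rightarrow> (nat \<times> nat \<Rightarrow> int) set" where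
  "residues_mat I N = upper I \<rightarrow>\<^sub>E {0..<N}"

definition gens :: "('a, 'b) monoid_scheme \<Rightarrow> nat set \<Rightarrow> (nat \<Rightarrow> 'a) set" where
  "gens G I = {h \<in> I \<rightarrow>\<^sub>E carrier G. generate G (h ` I) = carrier G}"

lemma finite_upper [simp]: "finite I \<Longrightarrow> finite (upper I)"
  by (rule finite_subset[of _ "I \<times> I"]) (auto simp: upper_def)

lemma finite_residues_mat [simp]: "finite I \<Longrightarrow> finite (residues_mat I N)"
  by (simp add: residues_mat_def finite_PiE)

lemma card_residues_mat: "finite I \<Longrightarrow> card (residues_mat I N) = nat N ^ card (upper I)"
  by (simp add: residues_mat_def card_PiE)

lemma alt_int_skew [simp]: "alt_int I (skew x)"
  by (auto simp: alt_int_def skew_def)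

lemma alt_seq_skew [simp]: "alt_seq l I (\<lambda>i j e. skew x i j)"
  by (auto simp: alt_seq_def skew_def)

lemma skew_cong:
  assumes "\<And>ij. ij \<in> upper I \<Longrightarrow> [x ij = y ij] (mod N)" "i \<in> I" "j \<in> I"
  shows "[skew x i j = skew y i j] (mod N)"
  using assms(1)[of "(i, j)"] assms(1)[of "(j, i)"] assms(2,3)
  by (auto simp: skew_def upper_def cong_minus_minus_iff)

lemma skew_mod_restrict:
  assumes "alt_int I A" "i \<in> I" "j \<in> I"
  shows "[skew (\<lambda>(i, j)\<in>upper I. A i j mod N) i j = A i j] (mod N)"
proof -
  have "A i j + A j i = 0" "A i i = 0" using assms by (auto simp: alt_int_def)
  then have "A i j = - A j i" by simp
  then show ?thesis using assms(2,3) \<open>A i i = 0\<close>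
    by (cases i j rule: linorder_cases) (auto simp: skew_def upper_def cong_def mod_minus_eq)
qed

lemma sum_card_swap:
  assumes "finite A" "finite B"
  shows "(\<Sum>a\<in>A. card {b \<in> B. P a b}) = (\<Sum>b\<in>B. card {a \<in> A. P a b})"
proof -
  have "(\<Sum>a\<in>A. card {b \<in> B. P a b}) = (\<Sum>a\<in>A. \<Sum>b\<in>B. if P a b then 1 else 0)"
    using assms by (simp add: sum.If_cases Int_def)
  also have "\<dots> = (\<Sum>b\<in>B. \<Sum>a\<in>A. if P a b then 1 else 0)" by (rule sum.swap)
  also have "\<dots> = (\<Sum>b\<in>B. card {a \<in> A. P a b})"
    using assms by (simp add: sum.If_cases Int_def)
  finally show ?thesis .
qed

context comm_group
begin

lemma rel_vec_cong:
  assumes "expo G N" "h \<in> I \<rightarrow> carrier G" "\<And>i j. i \<in> I \<Longrightarrow> j \<in> I \<Longrightarrow> [A i j = B i j] (mod N)"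
  shows "rel_vec G I h A = rel_vec G I h B"
  unfolding rel_vec_def using assms by (intro restrict_ext lc_cong) auto

text \<open>In a group killed by \<open>N\<close> the relations do not notice a reduction of the
  entries modulo \<open>N\<close>, so the finitely many residue matrices already sweep out the whole
  image.\<close>

lemma rel_vec_image:
  assumes "expo G N" "h \<in> I \<rightarrow> carrier G" "N > 0"
  shows "(\<lambda>x. rel_vec G I h (skew x)) ` residues_mat I N = alt_image G I h"
proof
  show "(\<lambda>x. rel_vec G I h (skew x)) ` residues_mat I N \<subseteq> alt_image G I h"
    using alt_int_skew by (auto simp: alt_image_def)
  show "alt_image G I h \<subseteq> (\<lambda>x. rel_vec G I h (skew x)) ` residues_mat I N"
  proof
    fix v assume "v \<in> alt_image G I h"
    then obtain A where A: "alt_int I A" "v = rel_vec G I h A" by (auto simp: alt_image_def)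
    define x where "x = (\<lambda>(i, j)\<in>upper I. A i j mod N)"
    have "[A i j = skew x i j] (mod N)" if "i \<in> I" "j \<in> I" for i j
      unfolding x_def by (rule cong_sym) (rule skew_mod_restrict[OF A(1) that])
    then have "v = rel_vec G I h (skew x)" unfolding A(2) by (intro rel_vec_cong[OF assms(1,2)])
    moreover have "x \<in> residues_mat I N" using assms(3) by (auto simp: x_def residues_mat_def)
    ultimately show "v \<in> (\<lambda>x. rel_vec G I h (skew x)) ` residues_mat I N" by blast
  qed
qed

text \<open>Evaluation at \<open>h\<close> is additive in the matrix modulo \<open>N\<close>, so its
  fibres are translates of the fibre over the unit and have equal size.\<close>

lemma card_rel:
  assumes "finite I" "expo G N" "h \<in> I \<rightarrow> carrier G" "N > 0"
  shows "card {x \<in> residues_mat I N. rel G I (skew x) h} * card (alt_image G I h) = card (residues_mat I N)"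
proof -
  let ?X = "residues_mat I N" and ?f = "\<lambda>x. rel_vec G I h (skew x)"
  let ?K = "{x \<in> ?X. rel G I (skew x) h}"
  interpret P: comm_group "product_group I (\<lambda>_. G)" by (intro comm_group_product_group) unfold_locales
  have f_add: "?f x = ?f y \<otimes>\<^bsub>product_group I (\<lambda>_. G)\<^esub> ?f z"
    if "\<And>ij. ij \<in> upper I \<Longrightarrow> [x ij = y ij + z ij] (mod N)" for x y z
  proof -
    have "?f x = ?f (\<lambda>ij. y ij + z ij)"
      by (intro rel_vec_cong[OF assms(2,3)] skew_cong[of I] that)
    also have "\<dots> = rel_vec G I h (\<lambda>i j. skew y i j + skew z i j)"
      by (intro rel_vec_cong[OF assms(2,3)]) (auto simp: skew_def)
    also have "\<dots> = ?f y \<otimes>\<^bsub>product_group I (\<lambda>_. G)\<^esub> ?f z"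
      using assms(3) by (auto simp: rel_vec_def lc_add intro!: restrict_ext)
    finally show ?thesis .
  qed
  have fP: "?f x \<in> carrier (product_group I (\<lambda>_. G))" for x using assms(3) by (auto simp: rel_vec_def)
  have "card {x \<in> ?X. ?f x = v} = card ?K" if "v \<in> ?f ` ?X" for v
  proof -
    obtain x0 where x0: "x0 \<in> ?X" "v = ?f x0" using \<open>v \<in> ?f ` ?X\<close> by blast
    define t where "t x = (\<lambda>ij\<in>upper I. (x ij + x0 ij) mod N)" for x
    define t' where "t' x = (\<lambda>ij\<in>upper I. (x ij - x0 ij) mod N)" for x
    have 1: "?f (t x) = ?f x \<otimes>\<^bsub>product_group I (\<lambda>_. G)\<^esub> v" for x
      unfolding x0(2) by (rule f_add) (simp add: t_def)
    have 2: "?f x = ?f (t' x) \<otimes>\<^bsub>product_group I (\<lambda>_. G)\<^esub> v" for x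
      unfolding x0(2) by (rule f_add) (simp add: t'_def cong_def mod_simps)
    have "bij_betw t ?K {x \<in> ?X. ?f x = v}"
    proof (rule bij_betwI[of _ _ _ t'])
      show "t \<in> ?K \<rightarrow> {x \<in> ?X. ?f x = v}"
      proof
        fix x assume x: "x \<in> ?K"
        then have "?f (t x) = v" unfolding 1 using fP[of x0] x0(2) by (simp only: rel_iff_rel_vec P.l_one mem_Collect_eq)
        moreover have "t x \<in> ?X" using assms(4) by (auto simp: t_def residues_mat_def)
        ultimately show "t x \<in> {x \<in> ?X. ?f x = v}" by simp
      qed
      show "t' \<in> {x \<in> ?X. ?f x = v} \<rightarrow> ?K"
      proof
        fix x assume x: "x \<in> {x \<in> ?X. ?f x = v}"
        then have "v = ?f (t' x) \<otimes>\<^bsub>product_group I (\<lambda>_. G)\<^esub> v" using 2[of x] by (simp only: mem_Collect_eq)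
        then have "?f (t' x) = \<one>\<^bsub>product_group I (\<lambda>_. G)\<^esub>"
          using fP[of "t' x"] fP[of x0] x0(2) P.l_cancel_one' P.r_cancel_one' by metis
        moreover have "t' x \<in> ?X" using assms(4) by (auto simp: t'_def residues_mat_def)
        ultimately show "t' x \<in> ?K" by (simp only: rel_iff_rel_vec mem_Collect_eq)
      qed
      show "t' (t x) = x" if x: "x \<in> ?K" for x
      proof (rule PiE_ext[of _ "upper I" "\<lambda>_. {0..<N}"])
        show "t' (t x) \<in> upper I \<rightarrow>\<^sub>E {0..<N}" using assms(4) by (auto simp: t'_def)
        show xX: "x \<in> upper I \<rightarrow>\<^sub>E {0..<N}" using x by (simp add: residues_mat_def)
        show "t' (t x) ij = x ij" if "ij \<in> upper I" for ij
          using PiE_mem[OF xX that] that by (simp add: t_def t'_def mod_simps)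
      qed
      show "t (t' x) = x" if x: "x \<in> {x \<in> ?X. ?f x = v}" for x
      proof (rule PiE_ext[of _ "upper I" "\<lambda>_. {0..<N}"])
        show "t (t' x) \<in> upper I \<rightarrow>\<^sub>E {0..<N}" using assms(4) by (auto simp: t_def)
        show xX: "x \<in> upper I \<rightarrow>\<^sub>E {0..<N}" using x by (simp add: residues_mat_def)
        show "t (t' x) ij = x ij" if "ij \<in> upper I" for ij
          using PiE_mem[OF xX that] that by (simp add: t_def t'_def mod_simps)
      qed
    qed
    then show ?thesis by (simp add: bij_betw_same_card)
  qed
  moreover have "card ?X = (\<Sum>v\<in>?f ` ?X. card {x \<in> ?X. ?f x = v})"
    using sum.image_gen[of ?X "\<lambda>_. 1::nat" ?f] assms(1) by simp
  ultimately have "card ?X = card (?f ` ?X) * card ?K" by simp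
  then show ?thesis using rel_vec_image[OF assms(2,3,4)] by (simp add: mult.commute)
qed

lemma alt_image_nonempty: "alt_image G I h \<noteq> {}"
proof -
  have "alt_int I (\<lambda>_ _. 0)" by (simp add: alt_int_def)
  then show ?thesis by (auto simp: alt_image_def)
qed

lemma finite_alt_image:
  assumes "finite I" "finite (carrier G)" "h \<in> I \<rightarrow> carrier G"
  shows "finite (alt_image G I h)"
proof (rule finite_subset)
  show "alt_image G I h \<subseteq> I \<rightarrow>\<^sub>E carrier G"
    using assms(3) by (auto simp: alt_image_def rel_vec_def)
qed (use assms in \<open>simp add: finite_PiE\<close>)

lemma finite_gens: "finite I \<Longrightarrow> finite (carrier G) \<Longrightarrow> finite (gens G I)"
  by (simp add: gens_def finite_PiE)

text \<open>Double counting of pairs of a matrix and a tuple: by \<open>card_rel\<close> and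
  \<open>card_Sym2\<close> every generating tuple satisfies the relations of the same number of
  matrices. The statement is multiplied out to stay in the natural numbers.\<close>

lemma moment:
  assumes "finite I" "finite (carrier G)" "expo G N" "N > 0"
  shows "(\<Sum>x\<in>residues_mat I N. card {h \<in> gens G I. rel G I (skew x) h}) * card (carrier G) ^ card I
    = card (gens G I) * card (carrier (Sym2 G)) * card (residues_mat I N)"
proof -
  let ?X = "residues_mat I N"
  have "(\<Sum>x\<in>?X. card {h \<in> gens G I. rel G I (skew x) h}) = (\<Sum>h\<in>gens G I. card {x \<in> ?X. rel G I (skew x) h})"
    using assms finite_gens by (intro sum_card_swap) auto
  moreover have "card {x \<in> ?X. rel G I (skew x) h} * card (carrier G) ^ card I = card (carrier (Sym2 G)) * card ?X"
    if "h \<in> gens G I" for h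
  proof -
    have h: "h \<in> I \<rightarrow> carrier G" "generate G (h ` I) = carrier G" using that by (auto simp: gens_def)
    have "card {x \<in> ?X. rel G I (skew x) h} * card (carrier G) ^ card I
       = card {x \<in> ?X. rel G I (skew x) h} * (card (carrier (Sym2 G)) * card (alt_image G I h))"
      using card_Sym2[OF assms(2,1) h] by simp
    also have "\<dots> = card (carrier (Sym2 G)) * card ?X"
      using card_rel[OF assms(1,3) h(1) assms(4)] by (simp add: ac_simps)
    finally show ?thesis .
  qed
  ultimately show ?thesis by (simp add: sum_distrib_right)
qed

text \<open>Matrices supported in row and column \<open>i0\<close> suffice: away from position
  \<open>i0\<close> they realize every family of powers of \<open>h i0\<close>.\<close>

lemma card_alt_image_ge:
  assumes "finite I" "finite (carrier G)" "h \<in> I \<rightarrow> carrier G" "i0 \<in> I" "h ` I \<subseteq> generate G {h i0}"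
  shows "card (generate G {h i0}) ^ (card I - 1) \<le> card (alt_image G I h)"
proof -
  let ?K = "generate G {h i0}" and ?J = "I - {i0}"
  have hi: "h i0 \<in> carrier G" using assms by auto
  have K: "?K = range (\<lambda>k::int. h i0 [^] k)" using generate_pow[OF hi] by auto
  have "?J \<rightarrow>\<^sub>E ?K \<subseteq> (\<lambda>v. restrict v ?J) ` alt_image G I h"
  proof
    fix f assume f: "f \<in> ?J \<rightarrow>\<^sub>E ?K"
    have "\<exists>k::int. f q = h i0 [^] k" if "q \<in> ?J" for q
    proof -
      have "f q \<in> ?K" using PiE_mem[OF f that] .
      then show ?thesis unfolding K by blast
    qed
    then obtain a :: "nat \<Rightarrow> int" where a: "\<And>q. q \<in> ?J \<Longrightarrow> f q = h i0 [^] a q" by metis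
    \<comment> \<open>In a column \<open>q \<noteq> i0\<close> only the entry at row
      \<open>i0\<close> is nonzero, so the relation there is the power \<open>a q\<close> of
      \<open>h i0\<close>, which is \<open>f q\<close>.\<close>
    define A where "A p q = (if p = i0 \<and> q \<noteq> i0 then a q else if q = i0 \<and> p \<noteq> i0 then - a p else 0)" for p q
    have "alt_int I A" by (auto simp: alt_int_def A_def)
    have "restrict (rel_vec G I h A) ?J = f"
    proof (rule extensionalityI[of _ ?J])
      show "f \<in> extensional ?J" using f by (simp add: PiE_def)
      show "restrict (rel_vec G I h A) ?J q = f q" if q: "q \<in> ?J" for q
      proof -
        have "rel_vec G I h A q = lc G h (\<lambda>p. A p q) I" using q by (simp add: rel_vec_def)
        also have "\<dots> = lc G h (\<lambda>p. if p = i0 then a q else 0) I"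
          using q assms(3) by (intro lc_cong') (auto simp: A_def)
        also have "\<dots> = f q" using lc_single[OF assms(1,4,3)] a[OF q] by simp
        finally show ?thesis using q by simp
      qed
    qed simp
    then show "f \<in> (\<lambda>v. restrict v ?J) ` alt_image G I h"
      using \<open>alt_int I A\<close> by (auto simp: alt_image_def)
  qed
  then have "card (?J \<rightarrow>\<^sub>E ?K) \<le> card (alt_image G I h)"
    using finite_alt_image[OF assms(1-3)] by (meson card_image_le card_mono finite_imageI le_trans)
  then show ?thesis using assms(1,4) by (simp add: card_PiE)
qed

end

text \<open>The subgroups of a cyclic group of prime power order form a chain, so some entry already
  generates the subgroup of the whole tuple, namely that of \<open>l^c\<close>. Thus at most
  \<open>e + 1\<close> subgroups arise.\<close>

lemma cyclic_tuple_generator: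
  assumes l: "prime l" and h: "h \<in> I \<rightarrow>\<^sub>E carrier (integer_mod_group (l ^ e))" and I: "finite I" "I \<noteq> {}"
  shows "\<exists>c\<le>e. \<exists>i0\<in>I. generate (integer_mod_group (l ^ e)) {h i0} = generate (integer_mod_group (l ^ e)) {int l ^ c mod int l ^ e}
    \<and> h ` I \<subseteq> generate (integer_mod_group (l ^ e)) {h i0}"
proof -
  let ?Z = "integer_mod_group (l ^ e)"
  interpret Z: comm_group ?Z by simp
  have l0: "l > 0" using l by (simp add: prime_gt_0_nat)
  have car: "carrier ?Z = {0..<int l ^ e}" using l0 by (simp add: carrier_integer_mod_group)
  have hZ: "h i \<in> carrier ?Z" if "i \<in> I" for i using h that by auto
  have gen: "generate ?Z {z} = range (\<lambda>k. (k * z) mod int l ^ e)" if "z \<in> carrier ?Z" for z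
    using Z.generate_pow[OF that] by (auto simp: int_pow_integer_mod_group)
  \<comment> \<open>The least valuation occurring in the tuple, capped at \<open>e\<close>; for
    \<open>c < e\<close> an entry attaining it is a unit times \<open>l^c\<close>.\<close>
  define c where "c = Max {c. c \<le> e \<and> (\<forall>i\<in>I. int l ^ c dvd h i)}"
  have fin: "finite {c. c \<le> e \<and> (\<forall>i\<in>I. int l ^ c dvd h i)}" by simp
  have "0 \<in> {c. c \<le> e \<and> (\<forall>i\<in>I. int l ^ c dvd h i)}" by simp
  then have c: "c \<le> e" "\<And>i. i \<in> I \<Longrightarrow> int l ^ c dvd h i"
    using Max_in[OF fin] unfolding c_def by blast+
  have wZ: "int l ^ c mod int l ^ e \<in> carrier ?Z" using l0 by (simp add: car)
  have "\<exists>i0\<in>I. \<exists>v. [int l ^ c = v * h i0] (mod int l ^ e)"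
  proof (cases "c = e")
    case True
    obtain i0 where "i0 \<in> I" using I by blast
    moreover have "[int l ^ c = 0 * h i0] (mod int l ^ e)" by (simp add: True cong_0_iff)
    ultimately show ?thesis by blast
  next
    case False
    have "\<exists>i0\<in>I. \<not> int l ^ Suc c dvd h i0"
    proof (rule ccontr)
      assume "\<not> ?thesis"
      then have "Suc c \<in> {c. c \<le> e \<and> (\<forall>i\<in>I. int l ^ c dvd h i)}" using False c(1) by auto
      then have "Suc c \<le> c" unfolding c_def using fin by (rule Max_ge[rotated])
      then show False by simp
    qed
    then obtain i0 where i0: "i0 \<in> I" "\<not> int l ^ Suc c dvd h i0" by blast
    obtain u where u: "h i0 = int l ^ c * u" using c(2)[OF i0(1)] by (auto elim: dvdE)
    have "\<not> int l dvd u" using i0(2) u by (auto simp: mult.commute)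
    then have "coprime u (int l ^ e)"
      using l prime_imp_coprime[of "int l" u] by (simp add: coprime_commute)
    then obtain v where v: "[u * v = 1] (mod int l ^ e)" using cong_solve_coprime_int by blast
    have "[int l ^ c * (u * v) = int l ^ c * 1] (mod int l ^ e)" using v by (rule cong_scalar_left)
    then have "[int l ^ c = v * h i0] (mod int l ^ e)" by (simp add: u ac_simps cong_sym_eq)
    then show ?thesis using i0(1) by blast
  qed
  then obtain i0 v where i0: "i0 \<in> I" "[int l ^ c = v * h i0] (mod int l ^ e)" by blast
  have sub: "generate ?Z {a} \<subseteq> generate ?Z {b}" if "a \<in> generate ?Z {b}" "b \<in> carrier ?Z" for a b
    using that Z.generate_is_subgroup[of "{b}"] by (intro Z.generate_subgroup_incl) auto
  have hin: "h i \<in> generate ?Z {int l ^ c mod int l ^ e}" if i: "i \<in> I" for i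
  proof -
    obtain k where "h i = int l ^ c * k" using c(2)[OF i] by (auto elim: dvdE)
    then have "h i = (k * (int l ^ c mod int l ^ e)) mod int l ^ e"
      using hZ[OF i] by (simp add: car mod_simps mult.commute)
    then show ?thesis unfolding gen[OF wZ] by blast
  qed
  have win: "int l ^ c mod int l ^ e \<in> generate ?Z {h i0}"
    unfolding gen[OF hZ[OF i0(1)]] using i0(2) by (auto simp: cong_def)
  have eq: "generate ?Z {h i0} = generate ?Z {int l ^ c mod int l ^ e}"
    using sub[OF hin[OF i0(1)] wZ] sub[OF win hZ[OF i0(1)]] by blast
  then have "h ` I \<subseteq> generate ?Z {h i0}" using hin by blast
  then show ?thesis using c(1) i0(1) eq by blast
qed

lemma sum_UN_le_nat:
  fixes f :: "'b \<Rightarrow> nat"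
  assumes "finite A" "\<And>a. a \<in> A \<Longrightarrow> finite (B a)"
  shows "sum f (\<Union>a\<in>A. B a) \<le> (\<Sum>a\<in>A. sum f (B a))"
  using assms
proof (induction A rule: finite_induct)
  case (insert a A)
  have "sum f (B a \<union> (\<Union>a\<in>A. B a)) \<le> sum f (B a) + sum f (\<Union>a\<in>A. B a)"
    using insert by (subst sum_Un_nat) auto
  then show ?case using insert by simp
qed simp

text \<open>Sort the tuples by the subgroup they generate. If it has order \<open>k\<close>, there
  are at most \<open>k^n\<close> of them with \<open>n = card I\<close>, and each satisfies the
  relations of at most the proportion \<open>k^(1 - n)\<close> of the matrices. So each of the
  \<open>e + 1\<close> subgroups contributes at most \<open>k \<le> l^e\<close> times the number of
  matrices.\<close>

lemma cyclic_moment_bound: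
  assumes l: "prime l" and I: "finite I" "I \<noteq> {}"
  shows "(\<Sum>x\<in>residues_mat I (int l ^ e).
      card {h \<in> I \<rightarrow>\<^sub>E carrier (integer_mod_group (l ^ e)). rel (integer_mod_group (l ^ e)) I (skew x) h})
    \<le> (e + 1) * l ^ e * card (residues_mat I (int l ^ e))"
proof -
  let ?Z = "integer_mod_group (l ^ e)" and ?X = "residues_mat I (int l ^ e)"
  interpret Z: comm_group ?Z by simp
  have l0: "l > 0" using l by (simp add: prime_gt_0_nat)
  have car: "carrier ?Z = {0..<int l ^ e}" using l0 by (simp add: carrier_integer_mod_group)
  have fZ: "finite (carrier ?Z)" by (simp add: car)
  have ex: "expo ?Z (int l ^ e)" by (simp add: expo_def int_pow_integer_mod_group)
  let ?w = "\<lambda>c. int l ^ c mod int l ^ e"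
  let ?K = "\<lambda>c. generate ?Z {?w c}"
  define D where "D c = {h \<in> I \<rightarrow>\<^sub>E carrier ?Z. h ` I \<subseteq> ?K c \<and> (\<exists>i0\<in>I. generate ?Z {h i0} = ?K c)}" for c
  let ?n = "\<lambda>h. card {x \<in> ?X. rel ?Z I (skew x) h}"
  have fH: "finite (I \<rightarrow>\<^sub>E carrier ?Z)" using I fZ by (simp add: finite_PiE)
  have KZ: "?K c \<subseteq> carrier ?Z" for c using l0 by (intro Z.generate_incl) (simp add: car)
  have fK: "finite (?K c)" for c using KZ fZ finite_subset by blast
  have cK: "card (?K c) \<le> l ^ e" for c
  proof -
    have "card (?K c) \<le> card (carrier ?Z)" using KZ fZ by (rule card_mono[rotated])
    then show ?thesis by (simp add: car nat_power_eq)
  qed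
  have cKpos: "card (?K c) > 0" for c using fK generate.one by (auto simp: card_gt_0_iff)
  have "(\<Sum>x\<in>?X. card {h \<in> I \<rightarrow>\<^sub>E carrier ?Z. rel ?Z I (skew x) h}) = (\<Sum>h\<in>I \<rightarrow>\<^sub>E carrier ?Z. ?n h)"
    using I fH by (intro sum_card_swap) auto
  also have "\<dots> \<le> (\<Sum>h\<in>(\<Union>c\<in>{..e}. D c). ?n h)"
  proof (rule sum_mono2)
    show "finite (\<Union>c\<in>{..e}. D c)" using fH by (auto simp: D_def)
    show "I \<rightarrow>\<^sub>E carrier ?Z \<subseteq> (\<Union>c\<in>{..e}. D c)"
    proof
      fix h assume h: "h \<in> I \<rightarrow>\<^sub>E carrier ?Z"
      obtain c i0 where "c \<le> e" "i0 \<in> I" "generate ?Z {h i0} = ?K c" "h ` I \<subseteq> generate ?Z {h i0}"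
        using cyclic_tuple_generator[OF l h I] by metis
      then have "h \<in> D c" using h by (auto simp: D_def)
      then show "h \<in> (\<Union>c\<in>{..e}. D c)" using \<open>c \<le> e\<close> by blast
    qed
  qed simp
  also have "\<dots> \<le> (\<Sum>c\<in>{..e}. \<Sum>h\<in>D c. ?n h)"
    using fH by (intro sum_UN_le_nat) (auto simp: D_def)
  also have "\<dots> \<le> (\<Sum>c\<in>{..e}. l ^ e * card ?X)"
  proof (rule sum_mono)
    fix c assume "c \<in> {..e}"
    let ?k = "card (?K c)"
    have bound: "?n h * ?k ^ (card I - 1) \<le> card ?X" if h: "h \<in> D c" for h
    proof -
      have hI: "h \<in> I \<rightarrow> carrier ?Z" using h by (auto simp: D_def)
      obtain i0 where i0: "i0 \<in> I" "generate ?Z {h i0} = ?K c" "h ` I \<subseteq> ?K c" using h by (auto simp: D_def)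
      have "?k ^ (card I - 1) \<le> card (alt_image ?Z I h)"
        using Z.card_alt_image_ge[OF I(1) fZ hI i0(1)] i0(2,3) by simp
      then have "?n h * ?k ^ (card I - 1) \<le> ?n h * card (alt_image ?Z I h)" by simp
      also have "\<dots> = card ?X" using Z.card_rel[OF I(1) ex hI] l0 by simp
      finally show ?thesis .
    qed
    have "card (D c) \<le> card (I \<rightarrow>\<^sub>E ?K c)"
    proof (rule card_mono)
      show "finite (I \<rightarrow>\<^sub>E ?K c)" using I fK by (simp add: finite_PiE)
      show "D c \<subseteq> I \<rightarrow>\<^sub>E ?K c" by (auto simp: D_def PiE_iff extensional_def)
    qed
    also have "\<dots> = ?k * ?k ^ (card I - 1)"
    proof -
      have "card I = Suc (card I - 1)" using I by (simp add: card_gt_0_iff)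
      then have "?k ^ card I = ?k * ?k ^ (card I - 1)" by (metis power_Suc)
      then show ?thesis using I by (simp add: card_PiE)
    qed
    finally have cD: "card (D c) \<le> ?k * ?k ^ (card I - 1)" .
    have "(\<Sum>h\<in>D c. ?n h) * ?k ^ (card I - 1) \<le> card (D c) * card ?X"
      using sum_mono[of "D c" "\<lambda>h. ?n h * ?k ^ (card I - 1)" "\<lambda>_. card ?X"] bound
      by (simp add: sum_distrib_right)
    also have "\<dots> \<le> (?k * ?k ^ (card I - 1)) * card ?X" using cD by simp
    finally have "(\<Sum>h\<in>D c. ?n h) * ?k ^ (card I - 1) \<le> (?k * card ?X) * ?k ^ (card I - 1)"
      by (simp add: ac_simps)
    then have "(\<Sum>h\<in>D c. ?n h) \<le> ?k * card ?X" using cKpos[of c] by simp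
    also have "\<dots> \<le> l ^ e * card ?X" using cK by simp
    finally show "(\<Sum>h\<in>D c. ?n h) \<le> l ^ e * card ?X" .
  qed
  also have "\<dots> = (e + 1) * l ^ e * card ?X" by (simp add: algebra_simps)
  finally show ?thesis .
qed

section \<open>The distribution of the torsion of the cokernel\<close>

lemma iso_rep_cong:
  assumes "group G" "G \<cong> G'"
  shows "iso_rep G = iso_rep G'"
proof -
  have "G' \<cong> G" using assms by (rule group.iso_sym)
  then have "G \<cong> K \<longleftrightarrow> G' \<cong> K" for K :: "nat monoid" using iso_trans[OF \<open>G' \<cong> G\<close>, of K] iso_trans[OF assms(2), of K] by blast
  then show ?thesis by (simp add: iso_rep_def)
qed

text \<open>
  A residue matrix modulo \<open>l^e\<close> is regarded as the constant sequence of its integral lift; the bound on \<open>\<kappa>\<close>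
  makes the type independent of the lift.
\<close>

definition has_type :: "nat \<Rightarrow> nat set \<Rightarrow> nat \<Rightarrow> (nat \<times> nat \<Rightarrow> int) \<Rightarrow> nat set \<Rightarrow> (nat \<Rightarrow> nat) \<Rightarrow> bool" where
  "has_type l I e x R \<kappa> \<longleftrightarrow> sympl l I R (\<lambda>i j e. skew x i j) \<kappa> \<and> (\<forall>s\<in>I - R. \<kappa> s < e)"

definition good :: "nat \<Rightarrow> nat set \<Rightarrow> nat \<Rightarrow> (nat \<times> nat \<Rightarrow> int) \<Rightarrow> bool" where
  "good l I e x \<longleftrightarrow> (\<exists>R \<kappa>. has_type l I e x R \<kappa>)"

definition type_mats :: "nat \<Rightarrow> nat set \<Rightarrow> nat \<Rightarrow> nat monoid \<Rightarrow> (nat \<times> nat \<Rightarrow> int) set" where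
  "type_mats l I e K = {x \<in> residues_mat I (int l ^ e). \<exists>R \<kappa>. has_type l I e x R \<kappa> \<and> iso_rep (diag_group l (I - R) \<kappa>) = K}"

definition bad_mats :: "nat \<Rightarrow> nat set \<Rightarrow> nat \<Rightarrow> (nat \<times> nat \<Rightarrow> int) set" where
  "bad_mats l I e = {x \<in> residues_mat I (int l ^ e). \<not> good l I e x}"

definition level :: "nat \<Rightarrow> nat \<Rightarrow> lmat \<Rightarrow> nat \<times> nat \<Rightarrow> int" where
  "level m e M = (\<lambda>ij\<in>upper {..<m}. M ij e)"

text \<open>\<open>sympl_cong\<close> for constant sequences: a type survives both a change of lift
  and the passage to a higher level.\<close>

lemma has_type_cong:
  assumes "prime l" "has_type l I e x R \<kappa>" "e \<le> e'"
    "\<And>ij. ij \<in> upper I \<Longrightarrow> [x ij = y ij] (mod int l ^ e)"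
  shows "has_type l I e' y R \<kappa>"
proof -
  have "sympl l I R (\<lambda>i j e. skew y i j) \<kappa>"
  proof (rule sympl_cong[where e = e])
    show "sympl l I R (\<lambda>i j e. skew x i j) \<kappa>" using assms(2) by (simp add: has_type_def)
    show "\<kappa> s < e" if "s \<in> I - R" for s using assms(2) that by (simp add: has_type_def)
    show "[skew x p q = skew y p q] (mod int l ^ e)" if "p \<in> I" "q \<in> I" for p q
      using assms(4) that by (intro skew_cong[of I])
  qed (use assms(1) in auto)
  then show ?thesis using assms(2,3) by (auto simp: has_type_def intro: less_le_trans)
qed

section \<open>Residues of l-adic alternating matrices\<close>

lemma alt_mats_PiE: "M \<in> alt_mats l m \<Longrightarrow> M \<in> ({..<m} \<times> {..<m}) \<rightarrow>\<^sub>E carrier (Zl l)"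
  unfolding alt_mats_def by (drule CollectD) (erule conjunct1)

lemma alt_mats_lower:
  assumes "l > 0" "M \<in> alt_mats l m" "i < m" "j < m"
  shows "M (i, j) e = (- M (j, i) e) mod int l ^ e" "M (i, i) e = 0"
proof -
  have A: "(\<forall>i<m. M (i, i) = \<zero>\<^bsub>Zl l\<^esub>) \<and> (\<forall>i<m. \<forall>j<m. M (i, j) = \<ominus>\<^bsub>Zl l\<^esub> M (j, i))"
    using assms(2) unfolding alt_mats_def by blast
  have "M (i, j) = \<ominus>\<^bsub>Zl l\<^esub> M (j, i)" using A assms by blast
  also have "\<dots> = red l (\<lambda>e. - M (j, i) e)"
    by (rule Zl_minus[OF assms(1) alt_mats_carrier[OF assms(2,4,3)]])
  finally show "M (i, j) e = (- M (j, i) e) mod int l ^ e" by (rule ssubst) (simp add: red_def)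
  have "M (i, i) = \<zero>\<^bsub>Zl l\<^esub>" using A assms by blast
  then show "M (i, i) e = 0" by simp
qed

lemma level_in_residues:
  assumes "M \<in> alt_mats l m"
  shows "level m e M \<in> residues_mat {..<m} (int l ^ e)"
proof -
  have "M (i, j) e \<in> {0..<int l ^ e}" if "i < m" "j < m" for i j
    using alt_mats_carrier[OF assms that] by (simp add: carrier_Zl)
  then show ?thesis by (auto simp: level_def residues_mat_def upper_def)
qed

lemma level_skew:
  assumes "l > 0" "M \<in> alt_mats l m" "i < m" "j < m"
  shows "[skew (level m e M) i j = M (i, j) e] (mod int l ^ e)"
proof (cases i j rule: linorder_cases)
  case less
  then show ?thesis using assms by (simp add: skew_def level_def upper_def)
next
  case equal
  then show ?thesis using alt_mats_lower(2)[OF assms] by (simp add: skew_def)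
next
  case greater
  then have "skew (level m e M) i j = - M (j, i) e" using assms by (simp add: skew_def level_def upper_def)
  then show ?thesis using alt_mats_lower(1)[OF assms, of e] by (simp add: cong_def)
qed

text \<open>\<open>sympl_cong\<close> again, now comparing the constant sequence of the lifted
  residues with the l-adic matrix; they agree at level \<open>e\<close>, where the type is
  visible.\<close>

lemma has_type_level:
  assumes "prime l" "M \<in> alt_mats l m" "has_type l {..<m} e (level m e M) R \<kappa>"
  shows "sympl l {..<m} R (\<lambda>i j. M (i, j)) \<kappa>"
proof (rule sympl_cong[where e = e])
  have l0: "l > 0" using assms(1) by (simp add: prime_gt_0_nat)
  show "sympl l {..<m} R (\<lambda>i j e'. skew (level m e M) i j) \<kappa>" using assms(3) by (simp add: has_type_def)
  show "alt_seq l {..<m} (\<lambda>i j. M (i, j))" by (rule alt_mats_alt_seq[OF l0 assms(2)])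
  show "\<kappa> s < e" if "s \<in> {..<m} - R" for s using assms(3) that by (simp add: has_type_def)
  show "[skew (level m e M) p q = M (p, q) e] (mod int l ^ e)" if "p \<in> {..<m}" "q \<in> {..<m}" for p q
    using level_skew[OF l0 assms(2)] that by simp
qed (use assms in auto)

text \<open>The integer lift of the residues, taken as a constant sequence in every entry, is such a
  matrix.\<close>

lemma level_surj:
  assumes "l > 0" "x \<in> residues_mat {..<m} (int l ^ e)"
  obtains M where "M \<in> alt_mats l m" "level m e M = x"
proof
  let ?M = "\<lambda>(i, j)\<in>{..<m} \<times> {..<m}. red l (\<lambda>e. skew x i j)"
  have c: "red l (\<lambda>e. skew x i j) \<in> carrier (Zl l)" for i j using assms(1) by simp
  have anti: "red l (\<lambda>e. skew x i j) = \<ominus>\<^bsub>Zl l\<^esub> red l (\<lambda>e. skew x j i)" for i j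
  proof -
    have "skew x i j = - skew x j i" by (simp add: skew_def)
    then show ?thesis unfolding Zl_minus[OF assms(1) c] by (simp add: red_def mod_minus_eq)
  qed
  show "?M \<in> alt_mats l m"
    unfolding alt_mats_def
  proof (intro CollectI conjI allI impI)
    show "?M \<in> {..<m} \<times> {..<m} \<rightarrow>\<^sub>E carrier (Zl l)" using c by auto
    show "?M (i, i) = \<zero>\<^bsub>Zl l\<^esub>" if "i < m" for i using that by (simp add: skew_def red_def)
    show "?M (i, j) = \<ominus>\<^bsub>Zl l\<^esub> ?M (j, i)" if "i < m" "j < m" for i j
    proof -
      have "?M (i, j) = red l (\<lambda>e. skew x i j)" using that by simp
      also have "\<dots> = \<ominus>\<^bsub>Zl l\<^esub> red l (\<lambda>e. skew x j i)" by (rule anti)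
      also have "red l (\<lambda>e. skew x j i) = ?M (j, i)" using that by simp
      finally show ?thesis .
    qed
  qed
  show "level m e ?M = x"
  proof (rule PiE_ext)
    show "level m e ?M \<in> upper {..<m} \<rightarrow>\<^sub>E UNIV" by (simp add: level_def)
    show "x \<in> upper {..<m} \<rightarrow>\<^sub>E UNIV" using assms(2) by (auto simp: residues_mat_def PiE_iff)
    show "level m e ?M ij = x ij" if ij: "ij \<in> upper {..<m}" for ij
    proof -
      have "x ij \<in> {0..<int l ^ e}" using assms(2) ij unfolding residues_mat_def by (rule PiE_mem)
      then show ?thesis using ij by (auto simp: level_def upper_def red_def skew_def)
    qed
  qed
qed

text \<open>Keeping only the entries above the diagonal loses nothing: alternation determines the
  rest of the square, and outside it all matrices take the same default value.\<close>

lemma card_mat_mod: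
  assumes "l > 0" "S \<subseteq> alt_mats l m"
  shows "card (mat_mod e S) = card (level m e ` S)"
proof -
  let ?f = "\<lambda>y. restrict y (upper {..<m})"
  have "level m e ` S = ?f ` mat_mod e S"
    by (auto simp: level_def mat_mod_def image_iff)
  moreover have "inj_on ?f (mat_mod e S)"
  proof (rule inj_onI)
    fix y y' assume "y \<in> mat_mod e S" "y' \<in> mat_mod e S" and eq: "?f y = ?f y'"
    then obtain M M' where M: "M \<in> alt_mats l m" "y = (\<lambda>ij. M ij e)" "M' \<in> alt_mats l m" "y' = (\<lambda>ij. M' ij e)"
      using assms(2) by (auto simp: mat_mod_def)
    have up: "M (i, j) e = M' (i, j) e" if "i < j" "j < m" for i j
      using fun_cong[OF eq, of "(i, j)"] that M(2,4) by (simp add: upper_def)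
    have "M (i, j) e = M' (i, j) e" if "i < m" "j < m" for i j
    proof (cases i j rule: linorder_cases)
      case less
      then show ?thesis using up that by blast
    next
      case equal
      then show ?thesis using alt_mats_lower(2)[OF assms(1) M(1) that, of e] alt_mats_lower(2)[OF assms(1) M(3) that, of e] by simp
    next
      case greater
      then show ?thesis
        using alt_mats_lower(1)[OF assms(1) M(1) that, of e] alt_mats_lower(1)[OF assms(1) M(3) that, of e] up[of j i] that by simp
    qed
    moreover have "M ij = M' ij" if "ij \<notin> {..<m} \<times> {..<m}" for ij
    proof -
      show ?thesis
        using PiE_arb[OF alt_mats_PiE[OF M(1)] that] PiE_arb[OF alt_mats_PiE[OF M(3)] that] by simp
    qed
    ultimately have "M ij e = M' ij e" for ij by (cases "ij \<in> {..<m} \<times> {..<m}") auto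
    then show "y = y'" using M(2,4) by blast
  qed
  ultimately show ?thesis by (simp add: card_image)
qed

text \<open>Every entry modulo \<open>l^e\<close> has \<open>l\<close> lifts modulo
  \<open>l^(e + 1)\<close>, chosen independently for the entries above the diagonal.\<close>

lemma card_residues_fiber:
  assumes "l > 0" "finite I" "Y \<subseteq> residues_mat I (int l ^ e)"
  shows "card {x \<in> residues_mat I (int l ^ Suc e). (\<lambda>ij\<in>upper I. x ij mod int l ^ e) \<in> Y} = l ^ card (upper I) * card Y"
proof -
  let ?X = "residues_mat I (int l ^ Suc e)" and ?r = "\<lambda>x. \<lambda>ij\<in>upper I. x ij mod int l ^ e"
  have lp: "int l ^ e > 0" using assms(1) by simp
  have fib: "card {x \<in> ?X. ?r x = y} = l ^ card (upper I)" if y: "y \<in> residues_mat I (int l ^ e)" for y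
  proof -
    have yb: "y ij \<in> {0..<int l ^ e}" if "ij \<in> upper I" for ij
      using y that unfolding residues_mat_def by (rule PiE_mem)
    let ?T = "\<lambda>ij. (\<lambda>t. y ij + int l ^ e * t) ` {0..<int l}"
    have "{x \<in> ?X. ?r x = y} = (\<Pi>\<^sub>E ij\<in>upper I. ?T ij)"
    proof (intro antisym subsetI)
      fix x assume x: "x \<in> {x \<in> ?X. ?r x = y}"
      then have xP: "x \<in> upper I \<rightarrow>\<^sub>E {0..<int l ^ Suc e}" by (simp add: residues_mat_def)
      have "x ij \<in> ?T ij" if ij: "ij \<in> upper I" for ij
      proof -
        have "?r x ij = y ij" using x by simp
        then have "x ij mod int l ^ e = y ij" using ij by simp
        then have "x ij = y ij + int l ^ e * (x ij div int l ^ e)" by (metis add.commute div_mult_mod_eq mult.commute)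
        moreover have "0 \<le> x ij" "x ij < int l ^ e * int l" using PiE_mem[OF xP ij] by (simp_all add: mult.commute)
        then have "x ij div int l ^ e \<in> {0..<int l}"
        proof -
          assume b: "0 \<le> x ij" "x ij < int l ^ e * int l"
          have "int l ^ e * (x ij div int l ^ e) + x ij mod int l ^ e = x ij" by simp
          moreover have "0 \<le> x ij mod int l ^ e" using lp by simp
          ultimately have "int l ^ e * (x ij div int l ^ e) < int l ^ e * int l" using b(2) by linarith
          then have "x ij div int l ^ e < int l" using lp by (simp add: mult_less_cancel_left_pos)
          then show ?thesis using b(1) lp by (simp add: pos_imp_zdiv_nonneg_iff)
        qed
        ultimately show ?thesis by blast
      qed
      then show "x \<in> (\<Pi>\<^sub>E ij\<in>upper I. ?T ij)" using xP by (auto simp: PiE_iff)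
    next
      fix x assume x: "x \<in> (\<Pi>\<^sub>E ij\<in>upper I. ?T ij)"
      have xe: "\<exists>t\<in>{0..<int l}. x ij = y ij + int l ^ e * t" if "ij \<in> upper I" for ij
        using PiE_mem[OF x that] by auto
      have "x ij \<in> {0..<int l ^ Suc e}" "x ij mod int l ^ e = y ij" if ij: "ij \<in> upper I" for ij
      proof -
        obtain t where t: "0 \<le> t" "t + 1 \<le> int l" "x ij = y ij + int l ^ e * t" using xe[OF ij] by auto
        have "int l ^ e * (t + 1) \<le> int l ^ e * int l" using t(2) lp by (intro mult_left_mono) auto
        then show "x ij \<in> {0..<int l ^ Suc e}" using yb[OF ij] t lp by (auto simp: algebra_simps)
        show "x ij mod int l ^ e = y ij" using yb[OF ij] t(3) by simp
      qed
      then have "x \<in> ?X" "?r x = y"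
        using x y unfolding residues_mat_def
        by (auto simp: PiE_iff extensional_def fun_eq_iff restrict_def)
      then show "x \<in> {x \<in> ?X. ?r x = y}" by blast
    qed
    moreover have "card (?T ij) = l" for ij using lp by (subst card_image) (auto intro!: inj_onI)
    ultimately show ?thesis using assms(2) by (simp add: card_PiE)
  qed
  have fY: "finite Y" using assms(2,3) finite_subset by (metis finite_residues_mat)
  have "{x \<in> ?X. ?r x \<in> Y} = (\<Union>y\<in>Y. {x \<in> ?X. ?r x = y})" by blast
  also have "card \<dots> = (\<Sum>y\<in>Y. card {x \<in> ?X. ?r x = y})"
    using fY assms(2) by (intro card_UN_disjoint) auto
  also have "\<dots> = (\<Sum>y\<in>Y. l ^ card (upper I))" using fib assms(3) by (intro sum.cong) auto
  finally show ?thesis by simp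
qed

lemma card_upper: "finite I \<Longrightarrow> card (upper I) = card I * (card I - 1) div 2"
proof (induction "card I" arbitrary: I)
  case 0
  then show ?case by (simp add: upper_def)
next
  case (Suc n)
  then have ne: "I \<noteq> {}" by auto
  let ?t = "Max I" and ?J = "I - {Max I}"
  have t: "?t \<in> I" using Suc.prems ne by simp
  have lt: "i < ?t" if "i \<in> ?J" for i using Max_ge[OF Suc.prems, of i] that by (simp add: order_less_le)
  have cJ: "card ?J = n" using Suc.hyps(2) t Suc.prems by (simp add: card_Diff_singleton)
  have "upper I = upper ?J \<union> (\<lambda>i. (i, ?t)) ` ?J"
  proof (rule Set.set_eqI)
    fix p :: "nat \<times> nat"
    obtain a b where p: "p = (a, b)" by (cases p)
    show "p \<in> upper I \<longleftrightarrow> p \<in> upper ?J \<union> (\<lambda>i. (i, ?t)) ` ?J"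
    proof (cases "b = ?t")
      case True
      then show ?thesis using t lt[of a] p by (auto simp: upper_def)
    next
      case False
      then have "a \<in> I \<and> b \<in> I \<and> a < b \<longleftrightarrow> a \<in> ?J \<and> b \<in> ?J \<and> a < b" using lt[of b] by auto
      then show ?thesis using False p unfolding upper_def by blast
    qed
  qed
  moreover have "upper ?J \<inter> (\<lambda>i. (i, ?t)) ` ?J = {}" by (auto simp: upper_def)
  ultimately have "card (upper I) = card (upper ?J) + card ((\<lambda>i. (i, ?t)) ` ?J)"
    using Suc.prems by (simp add: card_Un_disjoint)
  also have "card ((\<lambda>i. (i, ?t)) ` ?J) = n" using cJ by (subst card_image) (auto intro: inj_onI)
  also have "card (upper ?J) = n * (n - 1) div 2" using Suc.hyps(1)[of ?J] cJ Suc.prems by simp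
  finally show ?case using Suc.hyps(2)[symmetric] by (cases n) (auto simp: algebra_simps)
qed

text \<open>Elimination chains are not unique, but both diagonal groups are the torsion of the
  cokernel of one common l-adic lift of \<open>x\<close>.\<close>

lemma has_type_unique:
  assumes "prime l" "x \<in> residues_mat {..<m} (int l ^ e)"
    "has_type l {..<m} e x R \<kappa>" "has_type l {..<m} e x R' \<kappa>'"
  shows "iso_rep (diag_group l ({..<m} - R) \<kappa>) = iso_rep (diag_group l ({..<m} - R') \<kappa>')"
proof -
  have l0: "l > 0" using assms(1) by (simp add: prime_gt_0_nat)
  obtain M where M: "M \<in> alt_mats l m" "level m e M = x" using level_surj[OF l0 assms(2)] .
  have S: "sympl l {..<m} R (\<lambda>i j. M (i, j)) \<kappa>" "sympl l {..<m} R' (\<lambda>i j. M (i, j)) \<kappa>'"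
    using has_type_level[OF assms(1) M(1)] assms(3,4) M(2) by auto
  show ?thesis
    using iso_rep_cong[OF tors_coker_iso(2,1)[OF assms(1) M(1) S(1)]]
      iso_rep_cong[OF tors_coker_iso(2,1)[OF assms(1) M(1) S(2)]] by simp
qed

lemma sympl_card_R:
  assumes "sympl l I R M \<kappa>" "card I = r + 2 * k" "r \<le> 1"
  shows "card R = r"
proof -
  obtain k' where "card I = card R + 2 * k'" "card R \<le> 1" using sympl_finite[OF assms(1)] by blast
  then show ?thesis using assms(2,3) by presburger
qed

lemma bad_mats_bound:
  assumes l: "prime l" and I: "finite I" "card I = r + 2 * k" "r \<le> 1"
  shows "card (bad_mats l I e) * (l ^ e) ^ (r + 2) \<le> (e + 1) * l ^ e * card (residues_mat I (int l ^ e))"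
\<comment> \<open>The moment bound for cyclic groups requires a nonempty index set; on the empty one
  the empty chain shows that no matrix is exceptional.\<close>
proof (cases "I = {}")
  case True
  then have "has_type l I e x {} (\<lambda>_. 0)" for x by (simp add: has_type_def sympl.base)
  then have "bad_mats l I e = {}" by (auto simp: bad_mats_def good_def)
  then show ?thesis by simp
next
  case False
  let ?Z = "integer_mod_group (l ^ e)"
  interpret Z: comm_group ?Z by simp
  have l0: "l > 0" using l by (simp add: prime_gt_0_nat)
  have car: "carrier ?Z = {0..<int l ^ e}" using l0 by (simp add: carrier_integer_mod_group)
  have fZ: "finite (carrier ?Z)" by (simp add: car)
  have cZ: "card (carrier ?Z) = l ^ e" by (simp add: car nat_power_eq)
  have ex: "expo ?Z (int l ^ e)" by (simp add: expo_def int_pow_integer_mod_group)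
  let ?c = "\<lambda>x. card {h \<in> I \<rightarrow>\<^sub>E carrier ?Z. rel ?Z I (skew x) h}"
  have "(l ^ e) ^ (r + 2) \<le> ?c x" if "x \<in> bad_mats l I e" for x
  proof -
    have "\<not> (\<exists>R \<kappa>. sympl l I R (\<lambda>i j e. skew x i j) \<kappa> \<and> (\<forall>s\<in>I - R. \<kappa> s < e))"
      using that unfolding bad_mats_def good_def has_type_def by blast
    then show ?thesis
      using Z.sympl_or_many_solutions[OF l alt_seq_skew I fZ ex, of x] unfolding cZ by blast
  qed
  then have "card (bad_mats l I e) * (l ^ e) ^ (r + 2) \<le> (\<Sum>x\<in>bad_mats l I e. ?c x)"
    using sum_mono[of "bad_mats l I e" "\<lambda>_. (l ^ e) ^ (r + 2)" ?c] by simp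
  also have "\<dots> \<le> (\<Sum>x\<in>residues_mat I (int l ^ e). ?c x)"
    using I(1) by (intro sum_mono2) (auto simp: bad_mats_def)
  also have "\<dots> \<le> (e + 1) * l ^ e * card (residues_mat I (int l ^ e))"
    by (rule cyclic_moment_bound[OF l I(1) False])
  finally show ?thesis .
qed

section \<open>Proportions of residue matrices and their limits over the level\<close>

definition num_res :: "nat \<Rightarrow> nat set \<Rightarrow> nat \<Rightarrow> real" where
  "num_res l I e = real (card (residues_mat I (int l ^ e)))"

definition type_frac :: "nat \<Rightarrow> nat set \<Rightarrow> nat \<Rightarrow> nat monoid \<Rightarrow> real" where
  "type_frac l I e K = real (card (type_mats l I e K)) / num_res l I e"

definition bad_frac :: "nat \<Rightarrow> nat set \<Rightarrow> nat \<Rightarrow> real" where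
  "bad_frac l I e = real (card (bad_mats l I e)) / num_res l I e"

definition type_prob :: "nat \<Rightarrow> nat \<Rightarrow> nat monoid \<Rightarrow> real" where
  "type_prob l m K = lim (\<lambda>e. type_frac l {..<m} e K)"

lemma num_res: "l > 0 \<Longrightarrow> finite I \<Longrightarrow> num_res l I e = real l ^ (card (upper I) * e)"
  by (simp add: num_res_def card_residues_mat nat_power_eq power_mult mult.commute flip: of_nat_power)

lemma num_res_pos: "l > 0 \<Longrightarrow> finite I \<Longrightarrow> num_res l I e > 0"
  by (simp add: num_res)

text \<open>Markov's inequality gives \<open>(e + 1) l^e / l^((r + 2) e)\<close>, which is at most
  \<open>(e + 1) / l^e\<close>; weakening \<open>l\<close> to 2 makes the bound independent of the
  prime.\<close>

lemma bad_frac_bound: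
  assumes l: "prime l" and I: "finite I" "card I = r + 2 * k" "r \<le> 1"
  shows "bad_frac l I e \<le> (real e + 1) / 2 ^ e"
proof -
  have l2: "l \<ge> 2" using l by (simp add: prime_ge_2_nat)
  then have l0: "l > 0" by simp
  let ?b = "real (card (bad_mats l I e))" and ?q = "real (l ^ e)"
  have q: "?q \<ge> 2 ^ e" using l2 by (simp add: power_mono)
  have q1: "?q \<ge> 1" "?q > 0" using l0 by (simp_all add: Suc_leI)
  have "real (card (bad_mats l I e) * (l ^ e) ^ (r + 2)) \<le> real ((e + 1) * l ^ e * card (residues_mat I (int l ^ e)))"
    using bad_mats_bound[OF l I, of e] by (simp only: of_nat_le_iff)
  then have 1: "?b * ?q ^ (r + 2) \<le> (real e + 1) * ?q * num_res l I e"
    by (simp add: num_res_def algebra_simps)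
  have "?b * ?q ^ 2 \<le> ?b * ?q ^ (r + 2)" using q1 by (intro mult_left_mono power_increasing) auto
  then have "(?b * ?q) * ?q \<le> ((real e + 1) * num_res l I e) * ?q" using 1 by (simp add: power2_eq_square ac_simps)
  then have "?b * ?q \<le> (real e + 1) * num_res l I e" using q1(2) by simp
  moreover have "?b * 2 ^ e \<le> ?b * ?q" using q by (intro mult_left_mono) auto
  ultimately have "?b * 2 ^ e \<le> (real e + 1) * num_res l I e" by linarith
  then show ?thesis using num_res_pos[OF l0 I(1), of e] by (simp add: bad_frac_def field_simps)
qed

lemma bad_frac_tendsto:
  assumes "prime l" "finite I" "card I = r + 2 * k" "r \<le> 1"
  shows "bad_frac l I \<longlonglongrightarrow> 0"
proof (rule tendsto_sandwich[OF _ _ tendsto_const])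
  show "(\<lambda>e. (real e + 1) / 2 ^ e) \<longlonglongrightarrow> 0" by real_asymp
  show "\<forall>\<^sub>F e in sequentially. bad_frac l I e \<le> (real e + 1) / 2 ^ e"
    using bad_frac_bound[OF assms] by simp
  show "\<forall>\<^sub>F e in sequentially. 0 \<le> bad_frac l I e" by (simp add: bad_frac_def num_res_def)
qed

lemma type_mats_subset: "type_mats l I e K \<subseteq> residues_mat I (int l ^ e)"
  by (auto simp: type_mats_def)

lemma finite_type_mats [simp]: "finite I \<Longrightarrow> finite (type_mats l I e K)"
  using type_mats_subset finite_subset by (metis finite_residues_mat)

text \<open>All lifts of a matrix of type \<open>K\<close> have type \<open>K\<close> again, so the
  proportion can grow only by exceptional matrices whose type becomes visible at the next
  level.\<close>

lemma type_frac_mono: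
  assumes "prime l" "finite I"
  shows "type_frac l I e K \<le> type_frac l I (Suc e) K"
proof -
  have l0: "l > 0" using assms(1) by (simp add: prime_gt_0_nat)
  let ?D = "card (upper I)"
  have "{x \<in> residues_mat I (int l ^ Suc e). (\<lambda>ij\<in>upper I. x ij mod int l ^ e) \<in> type_mats l I e K} \<subseteq> type_mats l I (Suc e) K"
  proof
    fix x assume x: "x \<in> {x \<in> residues_mat I (int l ^ Suc e). (\<lambda>ij\<in>upper I. x ij mod int l ^ e) \<in> type_mats l I e K}"
    then obtain R \<kappa> where R: "has_type l I e (\<lambda>ij\<in>upper I. x ij mod int l ^ e) R \<kappa>" "iso_rep (diag_group l (I - R) \<kappa>) = K"
      by (auto simp: type_mats_def)
    have "has_type l I (Suc e) x R \<kappa>"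
      by (rule has_type_cong[OF assms(1) R(1)]) (auto simp: cong_def)
    then show "x \<in> type_mats l I (Suc e) K" using x R(2) by (auto simp: type_mats_def)
  qed
  then have "l ^ ?D * card (type_mats l I e K) \<le> card (type_mats l I (Suc e) K)"
    unfolding card_residues_fiber[OF l0 assms(2) type_mats_subset, symmetric]
    by (rule card_mono[OF finite_type_mats[OF assms(2)]])
  then have "real (l ^ ?D * card (type_mats l I e K)) \<le> real (card (type_mats l I (Suc e) K))"
    by (simp only: of_nat_le_iff)
  then have "real (l ^ ?D) * real (card (type_mats l I e K)) / num_res l I (Suc e) \<le> type_frac l I (Suc e) K"
    unfolding type_frac_def using num_res_pos[OF l0 assms(2), of "Suc e"] by (intro divide_right_mono) auto
  moreover have "num_res l I (Suc e) = real (l ^ ?D) * num_res l I e"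
    using l0 assms(2) by (simp add: num_res power_add)
  ultimately show ?thesis using l0 by (simp add: type_frac_def)
qed

lemma type_frac_bounds:
  assumes "l > 0" "finite I"
  shows "0 \<le> type_frac l I e K" "type_frac l I e K \<le> 1"
proof -
  show "0 \<le> type_frac l I e K" by (simp add: type_frac_def num_res_def)
  have "card (type_mats l I e K) \<le> card (residues_mat I (int l ^ e))"
    using assms(2) type_mats_subset by (intro card_mono) auto
  then show "type_frac l I e K \<le> 1"
    using num_res_pos[OF assms, of e] by (simp add: type_frac_def num_res_def divide_le_eq)
qed

lemma type_frac_tendsto:
  assumes "prime l"
  shows "(\<lambda>e. type_frac l {..<m} e K) \<longlonglongrightarrow> type_prob l m K"
proof -
  have l0: "l > 0" using assms by (simp add: prime_gt_0_nat)
  have "incseq (\<lambda>e. type_frac l {..<m} e K)" using type_frac_mono[OF assms] by (intro incseq_SucI) auto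
  moreover have "type_frac l {..<m} e K \<le> 1" for e using type_frac_bounds[OF l0] by simp
  ultimately have "convergent (\<lambda>e. type_frac l {..<m} e K)" by (metis incseq_convergent convergent_def)
  then show ?thesis by (simp add: type_prob_def convergent_LIMSEQ_iff)
qed

lemma type_prob_nonneg: "prime l \<Longrightarrow> 0 \<le> type_prob l m K"
  using type_frac_bounds(1)[of l "{..<m}"] by (intro LIMSEQ_le_const[OF type_frac_tendsto]) (auto simp: prime_gt_0_nat)

lemma type_mats_disjoint:
  assumes "prime l" "x \<in> type_mats l {..<m} e K" "x \<in> type_mats l {..<m} e K'"
  shows "K = K'"
  using assms has_type_unique[OF assms(1)] unfolding type_mats_def by blast

text \<open>At a fixed level only finitely many groups occur, and the matrices that are not
  exceptional are partitioned by their type; the integral over groups is a regrouped finite sum over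
  matrices.\<close>

lemma type_frac_integral:
  fixes f :: "nat monoid \<Rightarrow> nat" and w :: "(nat \<times> nat \<Rightarrow> int) \<Rightarrow> nat"
  assumes l: "prime l" and w: "\<And>K x. x \<in> type_mats l {..<m} e K \<Longrightarrow> w x = f K"
  shows "(\<integral>\<^sup>+K. ennreal (type_frac l {..<m} e K) * ennreal (real (f K)) \<partial>count_space UNIV) =
    ennreal ((\<Sum>x\<in>residues_mat {..<m} (int l ^ e) - bad_mats l {..<m} e. real (w x)) / num_res l {..<m} e)"
proof -
  let ?X = "residues_mat {..<m} (int l ^ e)" and ?T = "type_mats l {..<m} e" and ?n = "num_res l {..<m} e"
  define C where "C = {K. ?T K \<noteq> {}}"
  have n: "?n > 0" using l by (simp add: num_res_pos prime_gt_0_nat)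
  have un: "?X - bad_mats l {..<m} e = (\<Union>K\<in>C. ?T K)"
    by (auto simp: C_def bad_mats_def type_mats_def good_def)
  have "\<exists>K. \<forall>K'. x \<in> ?T K' \<longrightarrow> K' = K" for x using type_mats_disjoint[OF l] by blast
  then obtain ty where ty: "\<And>x K. x \<in> ?T K \<Longrightarrow> K = ty x" by metis
  have "C \<subseteq> ty ` ?X"
  proof
    fix K assume "K \<in> C"
    then obtain x where x: "x \<in> ?T K" by (auto simp: C_def)
    then have "x \<in> ?X" using type_mats_subset by blast
    then show "K \<in> ty ` ?X" using ty[OF x] by blast
  qed
  then have fC: "finite C" by (rule finite_subset) simp
  have "(\<integral>\<^sup>+K. ennreal (type_frac l {..<m} e K) * ennreal (real (f K)) \<partial>count_space UNIV)
      = (\<Sum>K\<in>C. ennreal (type_frac l {..<m} e K) * ennreal (real (f K)))"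
    using fC by (intro nn_integral_count_space') (auto simp: C_def type_frac_def)
  also have "\<dots> = (\<Sum>K\<in>C. ennreal (type_frac l {..<m} e K * real (f K)))"
    by (intro sum.cong refl ennreal_mult[symmetric]) (simp_all add: type_frac_def num_res_def)
  also have "\<dots> = ennreal (\<Sum>K\<in>C. type_frac l {..<m} e K * real (f K))"
    by (intro sum_ennreal) (simp add: type_frac_def num_res_def)
  also have "(\<Sum>K\<in>C. type_frac l {..<m} e K * real (f K)) = (\<Sum>K\<in>C. (\<Sum>x\<in>?T K. real (w x))) / ?n"
  proof (subst sum_divide_distrib, rule sum.cong)
    fix K assume "K \<in> C"
    have "(\<Sum>x\<in>?T K. real (w x)) = (\<Sum>x\<in>?T K. real (f K))" using w by (intro sum.cong) auto
    then show "type_frac l {..<m} e K * real (f K) = (\<Sum>x\<in>?T K. real (w x)) / ?n"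
      by (simp add: type_frac_def)
  qed simp
  also have "(\<Sum>K\<in>C. (\<Sum>x\<in>?T K. real (w x))) = (\<Sum>x\<in>(\<Union>K\<in>C. ?T K). real (w x))"
    using fC type_mats_disjoint[OF l] by (intro sum.UNION_disjoint[symmetric]) auto
  finally show ?thesis unfolding un .
qed

text \<open>The proportions increase with the level, so monotone convergence exchanges limit and
  integral. Agreement of \<open>w\<close> with \<open>f\<close> is asked only from level
  \<open>a\<close> on, since for moments the power \<open>l^e\<close> has to kill the target group
  first.\<close>

lemma type_prob_integral:
  fixes f :: "nat monoid \<Rightarrow> nat"
  assumes l: "prime l"
    and w: "\<And>e K x. e \<ge> a \<Longrightarrow> x \<in> type_mats l {..<m} e K \<Longrightarrow> w e x = f K"
    and lim: "(\<lambda>e. (\<Sum>x\<in>residues_mat {..<m} (int l ^ e) - bad_mats l {..<m} e. real (w e x)) / num_res l {..<m} e) \<longlonglongrightarrow> c"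
  shows "(\<integral>\<^sup>+K. ennreal (type_prob l m K) * ennreal (real (f K)) \<partial>count_space UNIV) = ennreal c"
proof -
  let ?F = "\<lambda>e K. ennreal (type_frac l {..<m} e K) * ennreal (real (f K))"
  have inc: "incseq ?F"
    using type_frac_mono[OF l] by (intro incseq_SucI le_funI mult_right_mono ennreal_leI) auto
  have sup: "(SUP e. ?F e K) = ennreal (type_prob l m K) * ennreal (real (f K))" for K
  proof (rule LIMSEQ_unique[OF LIMSEQ_SUP])
    show "incseq (\<lambda>e. ?F e K)" using inc by (auto simp: incseq_def le_fun_def)
    show "(\<lambda>e. ?F e K) \<longlonglongrightarrow> ennreal (type_prob l m K) * ennreal (real (f K))"
      by (intro tendsto_mult_ennreal tendsto_ennrealI type_frac_tendsto[OF l] tendsto_const) auto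
  qed
  have "(\<integral>\<^sup>+K. (SUP e. ?F e K) \<partial>count_space UNIV) = (SUP e. (\<integral>\<^sup>+K. ?F e K \<partial>count_space UNIV))"
    by (intro nn_integral_monotone_convergence_SUP inc) simp
  also have "\<dots> = ennreal c"
  proof (rule LIMSEQ_unique[OF LIMSEQ_SUP])
    show "incseq (\<lambda>e. \<integral>\<^sup>+K. ?F e K \<partial>count_space UNIV)"
      using inc by (auto simp: incseq_def le_fun_def intro!: nn_integral_mono)
    have "\<forall>\<^sub>F e in sequentially. ennreal ((\<Sum>x\<in>residues_mat {..<m} (int l ^ e) - bad_mats l {..<m} e. real (w e x)) / num_res l {..<m} e)
       = (\<integral>\<^sup>+K. ?F e K \<partial>count_space UNIV)"
      using eventually_ge_at_top[of a]
      by eventually_elim (subst type_frac_integral[OF l w], auto)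
    moreover have "(\<lambda>e. ennreal ((\<Sum>x\<in>residues_mat {..<m} (int l ^ e) - bad_mats l {..<m} e. real (w e x)) / num_res l {..<m} e)) \<longlonglongrightarrow> ennreal c"
      using lim by (rule tendsto_ennrealI)
    ultimately show "(\<lambda>e. \<integral>\<^sup>+K. ?F e K \<partial>count_space UNIV) \<longlonglongrightarrow> ennreal c"
      by (rule Lim_transform_eventually[rotated])
  qed
  finally show ?thesis unfolding sup .
qed

lemma card_residues_minus_bad:
  assumes "l > 0" "finite I"
  shows "real (card (residues_mat I (int l ^ e) - bad_mats l I e)) / num_res l I e = 1 - bad_frac l I e"
proof -
  have "bad_mats l I e \<subseteq> residues_mat I (int l ^ e)" by (auto simp: bad_mats_def)
  then have "card (residues_mat I (int l ^ e) - bad_mats l I e) = card (residues_mat I (int l ^ e)) - card (bad_mats l I e)"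
    "card (bad_mats l I e) \<le> card (residues_mat I (int l ^ e))"
    using assms by (auto intro!: card_Diff_subset card_mono intro: finite_subset)
  then show ?thesis
    using num_res_pos[OF assms, of e] by (simp add: num_res_def bad_frac_def of_nat_diff field_simps)
qed

text \<open>No mass is lost, because the proportion still undecided at level \<open>e\<close> is
  \<open>bad_frac\<close>, which tends to 0.\<close>

lemma type_prob_total:
  assumes "prime l" "m = r + 2 * k" "r \<le> 1"
  shows "(\<integral>\<^sup>+K. ennreal (type_prob l m K) \<partial>count_space UNIV) = 1"
proof -
  have l0: "l > 0" using assms(1) by (simp add: prime_gt_0_nat)
  have "(\<lambda>e. 1 - bad_frac l {..<m} e) \<longlonglongrightarrow> 1 - 0"
    using assms by (intro tendsto_intros bad_frac_tendsto[of l _ r k]) auto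
  then have "(\<lambda>e. (\<Sum>x\<in>residues_mat {..<m} (int l ^ e) - bad_mats l {..<m} e. real 1) / num_res l {..<m} e) \<longlonglongrightarrow> 1"
    using card_residues_minus_bad[OF l0, of "{..<m}"] by simp
  from type_prob_integral[OF assms(1) _ this, of 0 "\<lambda>_. 1"] show ?thesis by simp
qed

text \<open>\<open>f\<close> stands for a function of groups that counts generating solutions of a
  diagonal system whose coordinates in \<open>R\<close> are unconstrained; \<open>sympl_rel\<close>
  identifies this with the count for the matrix itself. \<open>moment\<close> gives the average over
  all residue matrices, and the exceptional ones change it by a vanishing amount.\<close>

lemma type_prob_moment:
  fixes H :: "('a, 'b) monoid_scheme" and f :: "nat monoid \<Rightarrow> nat"
  assumes l: "prime l" and m: "m = r + 2 * k" "r \<le> 1"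
    and H: "comm_group H" "finite (carrier H)" "expo H (int l ^ a)"
    and f: "\<And>R \<kappa>. R \<subseteq> {..<m} \<Longrightarrow> card R = r \<Longrightarrow> f (iso_rep (diag_group l ({..<m} - R) \<kappa>)) =
      card {h \<in> gens H {..<m}. \<forall>s\<in>{..<m} - R. h s [^]\<^bsub>H\<^esub> (int l ^ \<kappa> s) = \<one>\<^bsub>H\<^esub>}"
  shows "(\<integral>\<^sup>+K. ennreal (type_prob l m K) * ennreal (real (f K)) \<partial>count_space UNIV) =
    ennreal (real (card (gens H {..<m})) * real (card (carrier (Sym2 H))) / real (card (carrier H)) ^ m)"
proof -
  interpret H: comm_group H by fact
  let ?I = "{..<m}"
  have l0: "l > 0" using l by (simp add: prime_gt_0_nat)
  define w where "w x = card {h \<in> gens H ?I. rel H ?I (skew x) h}" for x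
  let ?c = "real (card (gens H ?I)) * real (card (carrier (Sym2 H))) / real (card (carrier H)) ^ m"
  have cH: "card (carrier H) > 0" using H(2) H.one_closed by (auto simp: card_gt_0_iff)
  have ex: "expo H (int l ^ e)" if "e \<ge> a" for e
  proof -
    have "int l ^ a dvd int l ^ e" using that by (rule le_imp_power_dvd)
    then have "[int l ^ e = 0] (mod int l ^ a)" by (simp add: cong_0_iff)
    then have "g [^]\<^bsub>H\<^esub> (int l ^ e) = g [^]\<^bsub>H\<^esub> (0::int)" if "g \<in> carrier H" for g
      using H.expo_cong[OF H(3) that] by blast
    then show ?thesis by (simp add: expo_def)
  qed
  show ?thesis
  proof (rule type_prob_integral[OF l, where a = a and w = "\<lambda>e. w"])
    fix e K x assume e: "e \<ge> a" and x: "x \<in> type_mats l ?I e K"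
    then obtain R \<kappa> where R: "has_type l ?I e x R \<kappa>" "iso_rep (diag_group l (?I - R) \<kappa>) = K"
      by (auto simp: type_mats_def)
    have S: "sympl l ?I R (\<lambda>i j e. skew x i j) \<kappa>" using R(1) by (simp add: has_type_def)
    have cR: "R \<subseteq> ?I" "card R = r" using sympl_finite[OF S] sympl_card_R[OF S _ m(2)] m(1) by auto
    obtain \<tau> where bij: "bij_betw \<tau> (?I \<rightarrow>\<^sub>E carrier H) (?I \<rightarrow>\<^sub>E carrier H)"
      and \<tau>0: "\<forall>h\<in>?I \<rightarrow>\<^sub>E carrier H. (\<forall>B. subgroup B H \<longrightarrow> h ` ?I \<subseteq> B \<longleftrightarrow> \<tau> h ` ?I \<subseteq> B) \<and>
        (rel H ?I (\<lambda>p q. skew x p q) h \<longleftrightarrow> (\<forall>s\<in>?I - R. \<tau> h s [^]\<^bsub>H\<^esub> (int l ^ \<kappa> s) = \<one>\<^bsub>H\<^esub>))"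
      using H.sympl_rel[OF S alt_seq_skew l H(2) ex[OF e]]
      by (elim exE conjE) (rule that)
    note \<tau> = bspec[OF \<tau>0]
    \<comment> \<open>The generated subgroup is the intersection of all subgroups containing the
      tuple, so the clause on subgroups transfers generation.\<close>
    have \<tau>g: "\<tau> h \<in> gens H ?I \<longleftrightarrow> h \<in> gens H ?I" if h: "h \<in> ?I \<rightarrow>\<^sub>E carrier H" for h
    proof -
      have \<tau>h: "\<tau> h \<in> ?I \<rightarrow>\<^sub>E carrier H" using bij h by (rule bij_betw_apply)
      have "h ` ?I \<subseteq> carrier H" "\<tau> h ` ?I \<subseteq> carrier H" using h \<tau>h by auto
      then have "generate H (h ` ?I) = generate H (\<tau> h ` ?I)"
        using \<tau>[OF h] by (simp add: H.generate_minimal cong: conj_cong)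
      then show ?thesis using h \<tau>h by (simp add: gens_def)
    qed
    have "bij_betw \<tau> {h \<in> gens H ?I. rel H ?I (skew x) h} {h \<in> gens H ?I. \<forall>s\<in>?I - R. h s [^]\<^bsub>H\<^esub> (int l ^ \<kappa> s) = \<one>\<^bsub>H\<^esub>}"
    proof (rule bij_betw_imageI)
      show "inj_on \<tau> {h \<in> gens H ?I. rel H ?I (skew x) h}"
        using bij_betw_imp_inj_on[OF bij] by (rule inj_on_subset) (auto simp: gens_def)
      show "\<tau> ` {h \<in> gens H ?I. rel H ?I (skew x) h} = {h \<in> gens H ?I. \<forall>s\<in>?I - R. h s [^]\<^bsub>H\<^esub> (int l ^ \<kappa> s) = \<one>\<^bsub>H\<^esub>}"
      proof (intro antisym subsetI)
        fix g assume "g \<in> \<tau> ` {h \<in> gens H ?I. rel H ?I (skew x) h}"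
        then obtain h where h: "h \<in> gens H ?I" "rel H ?I (skew x) h" "g = \<tau> h" by blast
        then have hP: "h \<in> ?I \<rightarrow>\<^sub>E carrier H" by (simp add: gens_def)
        have "\<tau> h \<in> gens H ?I" using \<tau>g[OF hP] h(1) by (rule iffD2)
        moreover have "\<forall>s\<in>?I - R. \<tau> h s [^]\<^bsub>H\<^esub> (int l ^ \<kappa> s) = \<one>\<^bsub>H\<^esub>"
          using conjunct2[OF \<tau>[OF hP]] h(2) by (rule iffD1)
        ultimately show "g \<in> {h \<in> gens H ?I. \<forall>s\<in>?I - R. h s [^]\<^bsub>H\<^esub> (int l ^ \<kappa> s) = \<one>\<^bsub>H\<^esub>}"
          using h(3) by (intro CollectI) (simp only:)
      next
        fix g assume g: "g \<in> {h \<in> gens H ?I. \<forall>s\<in>?I - R. h s [^]\<^bsub>H\<^esub> (int l ^ \<kappa> s) = \<one>\<^bsub>H\<^esub>}"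
        then have "g \<in> ?I \<rightarrow>\<^sub>E carrier H" by (simp add: gens_def)
        then have "g \<in> \<tau> ` (?I \<rightarrow>\<^sub>E carrier H)" unfolding bij_betw_imp_surj_on[OF bij] .
        then obtain h where h: "h \<in> ?I \<rightarrow>\<^sub>E carrier H" "g = \<tau> h" by (elim imageE)
        have "h \<in> gens H ?I" using \<tau>g[OF h(1)] g h(2) by simp
        moreover have "rel H ?I (skew x) h"
          using conjunct2[OF \<tau>[OF h(1)]] g h(2) by simp
        ultimately show "g \<in> \<tau> ` {h \<in> gens H ?I. rel H ?I (skew x) h}" using h(2) by (intro image_eqI CollectI conjI)
      qed
    qed
    then show "w x = f K" using f[OF cR, of \<kappa>] R(2) by (simp add: w_def bij_betw_same_card)
  next
    let ?X = "\<lambda>e. residues_mat ?I (int l ^ e)" and ?B = "bad_mats l ?I" and ?n = "num_res l ?I"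
    have split: "(\<Sum>x\<in>?X e - ?B e. real (w x)) / ?n e = (\<Sum>x\<in>?X e. real (w x)) / ?n e - (\<Sum>x\<in>?B e. real (w x)) / ?n e" for e
    proof -
      have "?B e \<subseteq> ?X e" by (auto simp: bad_mats_def)
      then show ?thesis by (simp add: sum_diff diff_divide_distrib)
    qed
    have tot: "(\<Sum>x\<in>?X e. real (w x)) / ?n e = ?c" if "e \<ge> a" for e
    proof -
      have "(\<Sum>x\<in>?X e. w x) * card (carrier H) ^ m = card (gens H ?I) * card (carrier (Sym2 H)) * card (?X e)"
        using H.moment[OF _ H(2) ex[OF that], of ?I] l0 by (simp add: w_def)
      then have "real ((\<Sum>x\<in>?X e. w x) * card (carrier H) ^ m) = real (card (gens H ?I) * card (carrier (Sym2 H)) * card (?X e))"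
        by (simp only:)
      then have "(\<Sum>x\<in>?X e. real (w x)) * real (card (carrier H)) ^ m = real (card (gens H ?I)) * real (card (carrier (Sym2 H))) * ?n e"
        by (simp add: num_res_def)
      moreover have "?n e > 0" using num_res_pos[OF l0] by simp
      ultimately show ?thesis using cH by (simp add: field_simps)
    qed
    \<comment> \<open>A crude bound uniform in the matrix is enough, since it gets multiplied by the
      proportion of exceptional matrices.\<close>
    have wb: "w x \<le> card (carrier H) ^ m" for x
    proof -
      have "w x \<le> card (?I \<rightarrow>\<^sub>E carrier H)"
        unfolding w_def gens_def using H(2) by (intro card_mono finite_PiE) auto
      then show ?thesis by (simp add: card_PiE)
    qed
    have "(\<lambda>e. (\<Sum>x\<in>?B e. real (w x)) / ?n e) \<longlonglongrightarrow> 0"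
    proof (rule tendsto_sandwich[OF _ _ tendsto_const])
      show "\<forall>\<^sub>F e in sequentially. 0 \<le> (\<Sum>x\<in>?B e. real (w x)) / ?n e"
        by (simp add: num_res_def sum_nonneg)
      show "\<forall>\<^sub>F e in sequentially. (\<Sum>x\<in>?B e. real (w x)) / ?n e \<le> real (card (carrier H) ^ m) * bad_frac l ?I e"
      proof (rule always_eventually, rule allI)
        fix e
        have "(\<Sum>x\<in>?B e. real (w x)) \<le> (\<Sum>x\<in>?B e. real (card (carrier H) ^ m))"
          using wb by (intro sum_mono) (simp only: of_nat_le_iff)
        then have "(\<Sum>x\<in>?B e. real (w x)) / ?n e \<le> (\<Sum>x\<in>?B e. real (card (carrier H) ^ m)) / ?n e"
          by (intro divide_right_mono) (simp_all add: num_res_def)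
        then show "(\<Sum>x\<in>?B e. real (w x)) / ?n e \<le> real (card (carrier H) ^ m) * bad_frac l ?I e"
          by (simp add: bad_frac_def mult.commute)
      qed
      show "(\<lambda>e. real (card (carrier H) ^ m) * bad_frac l ?I e) \<longlonglongrightarrow> 0"
        using l m by (intro tendsto_mult_right_zero bad_frac_tendsto[of l _ r k]) auto
    qed
    then have "(\<lambda>e. ?c - (\<Sum>x\<in>?B e. real (w x)) / ?n e) \<longlonglongrightarrow> ?c - 0" by (intro tendsto_intros)
    moreover have "\<forall>\<^sub>F e in sequentially. ?c - (\<Sum>x\<in>?B e. real (w x)) / ?n e = (\<Sum>x\<in>?X e - ?B e. real (w x)) / ?n e"
      using eventually_ge_at_top[of a] by eventually_elim (simp only: split tot)
    ultimately show "(\<lambda>e. (\<Sum>x\<in>?X e - ?B e. real (w x)) / ?n e) \<longlonglongrightarrow> ?c"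
      using Lim_transform_eventually by fastforce
  qed
qed

section \<open>Comparison with the volumes that define the distribution\<close>

lemma alt_dim_upper: "r \<le> 1 \<Longrightarrow> m \<ge> r \<Longrightarrow> alt_dim m r = card (upper {..<m})"
proof -
  assume r: "r \<le> 1" "m \<ge> r"
  have "alt_dim m r = m * (m - 1) div 2"
  proof (cases "r = 0")
    case True
    then show ?thesis by (simp add: alt_dim_def)
  next
    case False
    then have "r = 1" using r by simp
    moreover obtain n where "m = Suc n" using r False by (cases m) auto
    moreover have "n * 2 + n * (n - 1) = Suc n * n" by (cases n) (auto simp: algebra_simps)
    moreover have "(n * 2 + n * (n - 1)) div 2 = n + n * (n - 1) div 2" by simp
    ultimately show ?thesis by (simp add: alt_dim_def)
  qed
  then show ?thesis by (simp add: card_upper)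
qed

text \<open>The residues of the matrices in question lie between \<open>type_mats\<close> and its
  union with \<open>bad_mats\<close>: a residue with a visible type determines rank and cokernel
  torsion of all its lifts, and the proportion of the others vanishes in the limit.\<close>

lemma alt_vol_type:
  assumes l: "prime l" and m: "m = r + 2 * k" "r \<le> 1"
  shows "alt_vol l m r {M \<in> alt_mats_corank l m r. iso_rep (tors (coker l m M)) = K} = type_prob l m K"
    and "alt_vol l m r (alt_mats_corank l m r) = 1"
proof -
  let ?I = "{..<m}" and ?S = "{M \<in> alt_mats_corank l m r. iso_rep (tors (coker l m M)) = K}"
  let ?C = "alt_mats_corank l m r"
  have l0: "l > 0" using l by (simp add: prime_gt_0_nat)
  have n: "real l ^ (alt_dim m r * e) = num_res l ?I e" for e
    using num_res[OF l0, of ?I e] alt_dim_upper[of r m] m by simp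
  have sub: "?S \<subseteq> alt_mats l m" "?C \<subseteq> alt_mats l m" by (auto simp: alt_mats_corank_def)
  have typed: "M \<in> ?C" "iso_rep (tors (coker l m M)) = iso_rep (diag_group l (?I - R) \<kappa>)"
    if "M \<in> alt_mats l m" "has_type l ?I e (level m e M) R \<kappa>" for M e R \<kappa>
  proof -
    have S: "sympl l ?I R (\<lambda>i j. M (i, j)) \<kappa>" using has_type_level[OF l that] .
    have "card R = r" using sympl_card_R[OF S _ m(2)] m(1) by auto
    then show "M \<in> ?C" using sympl_mat_rank[OF l that(1) S] that(1) by (simp add: alt_mats_corank_def)
    show "iso_rep (tors (coker l m M)) = iso_rep (diag_group l (?I - R) \<kappa>)"
      using iso_rep_cong[OF tors_coker_iso(2,1)[OF l that(1) S]] .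
  qed
  have lower: "type_mats l ?I e K' \<subseteq> level m e ` {M \<in> ?C. iso_rep (tors (coker l m M)) = K'}" for e K'
  proof
    fix x assume x: "x \<in> type_mats l ?I e K'"
    then obtain R \<kappa> where R: "has_type l ?I e x R \<kappa>" "iso_rep (diag_group l (?I - R) \<kappa>) = K'"
      by (auto simp: type_mats_def)
    obtain M where M: "M \<in> alt_mats l m" "level m e M = x"
      using level_surj[OF l0] x type_mats_subset by blast
    then show "x \<in> level m e ` {M \<in> ?C. iso_rep (tors (coker l m M)) = K'}"
      using typed[OF M(1)] R by blast
  qed
  have upper: "level m e ` ?S \<subseteq> type_mats l ?I e K \<union> bad_mats l ?I e" for e
  proof
    fix x assume "x \<in> level m e ` ?S"
    then obtain M where M: "M \<in> ?S" "x = level m e M" by blast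
    have Ma: "M \<in> alt_mats l m" using M sub by blast
    have xr: "x \<in> residues_mat ?I (int l ^ e)" using level_in_residues[OF Ma] M(2) by simp
    show "x \<in> type_mats l ?I e K \<union> bad_mats l ?I e"
    proof (cases "good l ?I e x")
      case True
      then obtain R \<kappa> where R: "has_type l ?I e x R \<kappa>" by (auto simp: good_def)
      then have "iso_rep (diag_group l (?I - R) \<kappa>) = K" using typed(2)[OF Ma] M by auto
      then show ?thesis using R xr by (auto simp: type_mats_def)
    qed (use xr in \<open>auto simp: bad_mats_def\<close>)
  qed
  have fin: "finite (type_mats l ?I e K)" "finite (bad_mats l ?I e)" for e
    by (auto simp: bad_mats_def)
  have "(\<lambda>e. real (card (mat_mod e ?S)) / num_res l ?I e) \<longlonglongrightarrow> type_prob l m K"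
  proof (rule tendsto_sandwich)
    have b: "type_frac l ?I e K \<le> real (card (mat_mod e ?S)) / num_res l ?I e \<and>
      real (card (mat_mod e ?S)) / num_res l ?I e \<le> type_frac l ?I e K + bad_frac l ?I e" for e
    proof -
      have fl: "finite (level m e ` ?S)" using upper fin by (meson finite_UnI finite_subset)
      have "card (type_mats l ?I e K) \<le> card (level m e ` ?S)" using lower fl by (rule card_mono[rotated])
      moreover have "card (level m e ` ?S) \<le> card (type_mats l ?I e K \<union> bad_mats l ?I e)"
        using upper fin by (intro card_mono) auto
      then have "card (level m e ` ?S) \<le> card (type_mats l ?I e K) + card (bad_mats l ?I e)"
        using card_Un_le le_trans by blast
      ultimately show ?thesis
        unfolding card_mat_mod[OF l0 sub(1)] type_frac_def bad_frac_def add_divide_distrib[symmetric]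
        using num_res_pos[OF l0, of ?I e] by (intro conjI divide_right_mono) auto
    qed
    show "\<forall>\<^sub>F e in sequentially. type_frac l ?I e K \<le> real (card (mat_mod e ?S)) / num_res l ?I e"
      "\<forall>\<^sub>F e in sequentially. real (card (mat_mod e ?S)) / num_res l ?I e \<le> type_frac l ?I e K + bad_frac l ?I e"
      using b by simp_all
    show "(\<lambda>e. type_frac l ?I e K) \<longlonglongrightarrow> type_prob l m K" by (rule type_frac_tendsto[OF l])
    have "(\<lambda>e. type_frac l ?I e K + bad_frac l ?I e) \<longlonglongrightarrow> type_prob l m K + 0"
      using l m by (intro tendsto_add type_frac_tendsto bad_frac_tendsto[of l _ r k]) auto
    then show "(\<lambda>e. type_frac l ?I e K + bad_frac l ?I e) \<longlonglongrightarrow> type_prob l m K" by simp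
  qed
  then show "alt_vol l m r ?S = type_prob l m K" unfolding alt_vol_def n by (rule limI)
  have "(\<lambda>e. real (card (mat_mod e ?C)) / num_res l ?I e) \<longlonglongrightarrow> 1"
  proof (rule tendsto_sandwich)
    have b: "1 - bad_frac l ?I e \<le> real (card (mat_mod e ?C)) / num_res l ?I e \<and>
      real (card (mat_mod e ?C)) / num_res l ?I e \<le> 1" for e
    proof -
      have lr: "level m e ` ?C \<subseteq> residues_mat ?I (int l ^ e)" using level_in_residues sub(2) by blast
      have "residues_mat ?I (int l ^ e) - bad_mats l ?I e \<subseteq> level m e ` ?C"
      proof
        fix x assume "x \<in> residues_mat ?I (int l ^ e) - bad_mats l ?I e"
        then obtain R \<kappa> where "x \<in> residues_mat ?I (int l ^ e)" "has_type l ?I e x R \<kappa>"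
          by (auto simp: bad_mats_def good_def)
        then have "x \<in> type_mats l ?I e (iso_rep (diag_group l (?I - R) \<kappa>))" by (auto simp: type_mats_def)
        then show "x \<in> level m e ` ?C" using lower by blast
      qed
      then have 1: "card (residues_mat ?I (int l ^ e) - bad_mats l ?I e) \<le> card (level m e ` ?C)"
        using finite_subset[OF lr] by (intro card_mono) simp_all
      have 2: "card (level m e ` ?C) \<le> card (residues_mat ?I (int l ^ e))"
        using lr by (intro card_mono) auto
      have np: "num_res l ?I e > 0" using num_res_pos[OF l0] by simp
      have "1 - bad_frac l ?I e = real (card (residues_mat ?I (int l ^ e) - bad_mats l ?I e)) / num_res l ?I e"
        using card_residues_minus_bad[OF l0, of ?I e] by simp
      also have "\<dots> \<le> real (card (level m e ` ?C)) / num_res l ?I e"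
        using 1 np by (intro divide_right_mono) auto
      finally show ?thesis unfolding card_mat_mod[OF l0 sub(2)] using 2 np
        by (simp add: num_res_def divide_le_eq)
    qed
    show "\<forall>\<^sub>F e in sequentially. 1 - bad_frac l ?I e \<le> real (card (mat_mod e ?C)) / num_res l ?I e"
      "\<forall>\<^sub>F e in sequentially. real (card (mat_mod e ?C)) / num_res l ?I e \<le> 1"
      using b by simp_all
    have "(\<lambda>e. 1 - bad_frac l ?I e) \<longlonglongrightarrow> 1 - 0"
      using l m by (intro tendsto_intros bad_frac_tendsto[of l _ r k]) auto
    then show "(\<lambda>e. 1 - bad_frac l ?I e) \<longlonglongrightarrow> 1" by simp
  qed (rule tendsto_const)
  then show "alt_vol l m r ?C = 1" unfolding alt_vol_def n by (rule limI)
qed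

text \<open>The normalizing volume is 1, and nonnegativity with total mass 1 lets
  \<open>embed_pmf\<close> return exactly the given weights.\<close>

lemma pmf_T_mat:
  assumes "prime l" "m = r + 2 * k" "r \<le> 1"
  shows "pmf (T_mat m r l) K = type_prob l m K"
proof -
  have "T_mat m r l = embed_pmf (type_prob l m)"
    unfolding T_mat_def alt_prob_def using alt_vol_type[OF assms] by simp
  moreover have "pmf (embed_pmf (type_prob l m)) K = type_prob l m K"
    using type_prob_nonneg[OF assms(1)] type_prob_total[OF assms] by (intro pmf_embed_pmf) auto
  ultimately show ?thesis by simp
qed

section \<open>Growing the matrix\<close>

text \<open>Deleting the pivot leaves a gap in the index range; a chain has to be carried across the
  renumbering that closes it.\<close>

lemma sympl_reindex:
  assumes "sympl l I R M \<kappa>" "bij_betw \<rho> J I"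
  shows "sympl l J {s \<in> J. \<rho> s \<in> R} (\<lambda>p q. M (\<rho> p) (\<rho> q)) (\<lambda>s. \<kappa> (\<rho> s))"
  using assms
proof (induction arbitrary: J rule: sympl.induct)
  case (base I M \<kappa>)
  have "finite J" "card J \<le> 1" using base bij_betw_finite bij_betw_same_card by metis+
  moreover have "{s \<in> J. \<rho> s \<in> I} = J" using base(3) by (auto simp: bij_betw_def)
  ultimately show ?case by (simp add: sympl.base)
next
  case (step I i j \<kappa> a M \<alpha> \<beta> R)
  have RI: "R \<subseteq> I" using sympl_finite[OF step.hyps(8)] by auto
  have inj: "inj_on \<rho> J" and img: "\<rho> ` J = insert i (insert j I)" using step.prems by (auto simp: bij_betw_def)
  obtain i' where i': "i' \<in> J" "\<rho> i' = i" using img by (metis image_iff insertI1)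
  obtain j' where j': "j' \<in> J" "\<rho> j' = j" using img by (metis image_iff insertI1 insertI2)
  define J' where "J' = J - {i', j'}"
  have ij: "i' \<noteq> j'" using i' j' step.hyps(4) by auto
  have J: "J = insert i' (insert j' J')" using i' j' by (auto simp: J'_def)
  have "\<rho> ` J' = I"
  proof -
    have "\<rho> ` J' = \<rho> ` J - \<rho> ` {i', j'}" unfolding J'_def using inj i' j' by (intro inj_on_image_set_diff) auto
    then show ?thesis using img i' j' step.hyps(2,3) by auto
  qed
  then have bij: "bij_betw \<rho> J' I" using inj by (auto simp: bij_betw_def J'_def intro: inj_on_subset)
  have R: "{s \<in> J. \<rho> s \<in> R} = {s \<in> J'. \<rho> s \<in> R}" using i' j' RI step.hyps(2,3) by (auto simp: J'_def)
  have \<rho>I: "\<rho> p \<in> I" if "p \<in> J'" for p using bij that by (auto simp: bij_betw_def)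
  have "sympl l (insert i' (insert j' J')) {s \<in> J'. \<rho> s \<in> R} (\<lambda>p q. M (\<rho> p) (\<rho> q)) (\<lambda>s. \<kappa> (\<rho> s))"
  proof (rule sympl.step[where a = a and \<alpha> = "\<lambda>p. \<alpha> (\<rho> p)" and \<beta> = "\<lambda>p. \<beta> (\<rho> p)"])
    show "finite J'" using bij step.hyps(1) bij_betw_finite by blast
    show "pivot l J' (\<lambda>p q. M (\<rho> p) (\<rho> q)) i' j' a (\<lambda>p. \<alpha> (\<rho> p)) (\<lambda>p. \<beta> (\<rho> p))"
      using step.hyps(7) \<rho>I i' j' by (auto simp: pivot_def)
    have "schur (\<lambda>p q. M (\<rho> p) (\<rho> q)) i' j' (\<lambda>p. \<alpha> (\<rho> p)) (\<lambda>p. \<beta> (\<rho> p)) = (\<lambda>p q. schur M i j \<alpha> \<beta> (\<rho> p) (\<rho> q))"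
      using i' j' by (simp add: schur_def)
    then show "sympl l J' {s \<in> J'. \<rho> s \<in> R} (schur (\<lambda>p q. M (\<rho> p) (\<rho> q)) i' j' (\<lambda>p. \<alpha> (\<rho> p)) (\<lambda>p. \<beta> (\<rho> p))) (\<lambda>s. \<kappa> (\<rho> s))"
      using step.IH[OF bij] by simp
  qed (use ij i' j' step.hyps(5,6) in \<open>auto simp: J'_def\<close>)
  then show ?case using J R by simp
qed

text \<open>Indices of \<open>A'\<close> outside \<open>A\<close> have modulus
  \<open>l^0 = 1\<close> and contribute trivial factors. This serves a unit pivot, which enlarges
  the index set without changing the group.\<close>

lemma diag_group_iso:
  assumes l: "l > 0" and \<sigma>: "bij_betw \<sigma> A B" and A: "A \<subseteq> A'"
    and k: "\<And>s. s \<in> A \<Longrightarrow> \<kappa> s = \<kappa>' (\<sigma> s)" "\<And>s. s \<in> A' - A \<Longrightarrow> \<kappa> s = 0"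
  shows "diag_group l B \<kappa>' \<cong> diag_group l A' \<kappa>"
proof -
  define \<phi> where "\<phi> f = (\<lambda>s\<in>A'. if s \<in> A then f (\<sigma> s) else (0::int))" for f
  define \<theta> where "\<theta> g = (\<lambda>t\<in>B. (g (inv_into A \<sigma> t) :: int))" for g
  have carr: "carrier (diag_group l J \<kappa>) = (\<Pi>\<^sub>E s\<in>J. {0..<int l ^ \<kappa> s})" for J \<kappa>
    using l by (simp add: diag_group_def carrier_integer_mod_group)
  have mul: "x \<otimes>\<^bsub>diag_group l J \<kappa>\<^esub> y = (\<lambda>s\<in>J. (x s + y s) mod int l ^ \<kappa> s)" for x y J \<kappa>
    by (simp add: diag_group_def)
  have \<sigma>B: "\<sigma> s \<in> B" if "s \<in> A" for s using \<sigma> that by (auto simp: bij_betw_def)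
  have iA: "inv_into A \<sigma> t \<in> A" "\<sigma> (inv_into A \<sigma> t) = t" if "t \<in> B" for t
    using \<sigma> that by (auto simp: bij_betw_def inv_into_into f_inv_into_f)
  have iB: "inv_into A \<sigma> (\<sigma> s) = s" if "s \<in> A" for s
    using \<sigma> that by (auto simp: bij_betw_def)
  have hom: "\<phi> \<in> hom (diag_group l B \<kappa>') (diag_group l A' \<kappa>)"
  proof (rule homI)
    fix f assume f: "f \<in> carrier (diag_group l B \<kappa>')"
    have "f (\<sigma> s) \<in> {0..<int l ^ \<kappa> s}" if "s \<in> A" for s
      using PiE_mem[OF f[unfolded carr] \<sigma>B[OF that]] k(1)[OF that] by simp
    then show "\<phi> f \<in> carrier (diag_group l A' \<kappa>)"
      using l by (auto simp: carr \<phi>_def)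
  next
    fix f g
    show "\<phi> (f \<otimes>\<^bsub>diag_group l B \<kappa>'\<^esub> g) = \<phi> f \<otimes>\<^bsub>diag_group l A' \<kappa>\<^esub> \<phi> g"
      unfolding mul \<phi>_def using \<sigma>B k(1) by (auto intro!: restrict_ext)
  qed
  have "bij_betw \<phi> (carrier (diag_group l B \<kappa>')) (carrier (diag_group l A' \<kappa>))"
  proof (rule bij_betwI[where g = \<theta>])
    show \<phi>f: "\<phi> \<in> carrier (diag_group l B \<kappa>') \<rightarrow> carrier (diag_group l A' \<kappa>)" using hom by (auto simp: hom_def)
    show \<theta>f: "\<theta> \<in> carrier (diag_group l A' \<kappa>) \<rightarrow> carrier (diag_group l B \<kappa>')"
    proof
      fix g assume g: "g \<in> carrier (diag_group l A' \<kappa>)"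
      have "g (inv_into A \<sigma> t) \<in> {0..<int l ^ \<kappa>' t}" if "t \<in> B" for t
        using PiE_mem[OF g[unfolded carr], of "inv_into A \<sigma> t"] iA[OF that] A k(1)[OF iA(1)[OF that]] by auto
      then show "\<theta> g \<in> carrier (diag_group l B \<kappa>')" unfolding carr \<theta>_def by (intro PiE_I) simp_all
    qed
    show "\<theta> (\<phi> f) = f" if f: "f \<in> carrier (diag_group l B \<kappa>')" for f
    proof (rule PiE_ext[OF _ f[unfolded carr]])
      show "\<theta> (\<phi> f) \<in> (\<Pi>\<^sub>E s\<in>B. {0..<int l ^ \<kappa>' s})"
        using funcset_mem[OF \<theta>f funcset_mem[OF \<phi>f f]] unfolding carr .
      show "\<theta> (\<phi> f) t = f t" if "t \<in> B" for t
        using that iA[OF that] A by (auto simp: \<theta>_def \<phi>_def)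
    qed
    show "\<phi> (\<theta> g) = g" if g: "g \<in> carrier (diag_group l A' \<kappa>)" for g
    proof (rule PiE_ext[OF _ g[unfolded carr]])
      show "\<phi> (\<theta> g) \<in> (\<Pi>\<^sub>E s\<in>A'. {0..<int l ^ \<kappa> s})"
        using funcset_mem[OF \<phi>f funcset_mem[OF \<theta>f g]] unfolding carr .
      show "\<phi> (\<theta> g) s = g s" if s: "s \<in> A'" for s
      proof (cases "s \<in> A")
        case True
        then show ?thesis using s \<sigma>B[OF True] iB[OF True] by (simp add: \<theta>_def \<phi>_def)
      next
        case False
        then have "g s \<in> {0..<1}" using PiE_mem[OF g[unfolded carr] s] k(2) s by simp
        then show ?thesis using False s by (simp add: \<phi>_def)
      qed
    qed
  qed
  then show ?thesis using hom unfolding is_iso_def iso_def by blast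
qed

definition skip :: "nat \<Rightarrow> nat \<Rightarrow> nat" where
  "skip j p = (if p < j then p else p - 1)"

lemma bij_skip: "j < Suc m \<Longrightarrow> bij_betw (skip j) ({..<Suc m} - {j}) {..<m}"
  by (rule bij_betwI[where g = "\<lambda>p. if p < j then p else Suc p"]) (auto simp: skip_def split: if_splits)

text \<open>The pivot position is a function of \<open>w\<close> alone: once \<open>w\<close> is
  read off a grown matrix, the position is known and the rest can be decoded.\<close>

definition first_unit :: "nat \<Rightarrow> (nat \<Rightarrow> int) \<Rightarrow> nat" where
  "first_unit l w = (LEAST p. \<not> int l dvd w p)"

text \<open>
  Undoes one elimination step: the matrix has \<open>w\<close> and \<open>v\<close> in the positions \<open>i\<close> and \<open>j\<close>, and \<open>y\<close> as its
  Schur complement when \<open>u\<close> inverts the pivot \<open>- w j\<close>.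
\<close>

definition grow :: "nat \<Rightarrow> nat \<Rightarrow> int \<Rightarrow> (nat \<Rightarrow> int) \<Rightarrow> (nat \<Rightarrow> int) \<Rightarrow> (nat \<times> nat \<Rightarrow> int) \<Rightarrow> nat \<Rightarrow> nat \<Rightarrow> int" where
  "grow i j u w v y p q =
     (if p = i then (if q = i then 0 else - w q)
      else if q = i then w p
      else if p = j then (if q = j then 0 else - v (skip j q))
      else if q = j then v (skip j p)
      else skew y (skip j p) (skip j q) - u * v (skip j p) * w q + u * w p * v (skip j q))"

lemma alt_int_grow: "alt_int I (grow i j u w v y)"
proof -
  have "skew y p p = 0" "skew y p q + skew y q p = 0" for p q by (simp_all add: skew_def)
  then show ?thesis by (auto simp: alt_int_def grow_def algebra_simps)
qed

text \<open>The unit pivot at \<open>(i, j)\<close> is eliminated first. What remains is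
  \<open>y\<close> modulo \<open>l^e\<close> up to renumbering, and \<open>sympl_cong\<close> lets
  the chain of \<open>y\<close> continue there. Both new indices have valuation 0 and add nothing to
  the group.\<close>

lemma has_type_grow:
  fixes m :: nat
  defines "I \<equiv> {..<Suc (Suc m)}" and "i \<equiv> Suc m"
  assumes l: "prime l" and e: "e > 0" and j: "j < Suc m" "\<not> int l dvd w j"
    and u: "[u * (- w j) = 1] (mod int l ^ e)" and y: "has_type l {..<m} e y R \<kappa>"
    and x: "x = (\<lambda>(p, q)\<in>upper I. grow i j u w v y p q mod int l ^ e)"
  shows "\<exists>R' \<kappa>'. has_type l I e x R' \<kappa>' \<and> diag_group l ({..<m} - R) \<kappa> \<cong> diag_group l (I - R') \<kappa>'"
proof -
  have l0: "l > 0" using l by (simp add: prime_gt_0_nat)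
  let ?A = "grow i j u w v y" and ?J = "{..<Suc m} - {j}" and ?M = "\<lambda>p q (e::nat). skew x p q"
  have I: "I = insert i (insert j ?J)" using j(1) by (auto simp: I_def i_def)
  have ij: "i \<notin> ?J" "j \<notin> ?J" "i \<noteq> j" using j(1) by (auto simp: i_def)
  have xA: "[skew x p q = ?A p q] (mod int l ^ e)" if "p \<in> I" "q \<in> I" for p q
    unfolding x using alt_int_grow that by (rule skew_mod_restrict)
  have M: "alt_seq l (insert i (insert j ?J)) ?M" by simp
  have dl: "int l dvd int l ^ e" using e by (simp add: dvd_power)
  have Aij: "?A i j = - w j" using ij by (simp add: grow_def)
  have vd: "val_eq l (?M i j) 0"
  proof -
    have "[skew x i j = - w j] (mod int l)"
      using xA[of i j] Aij dl I by (metis cong_dvd_modulus insertI1 insertI2)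
    then have "int l dvd skew x i j \<longleftrightarrow> int l dvd - w j" by (rule cong_dvd_iff)
    then show ?thesis using j(2) by (simp add: val_eq_def)
  qed
  have "\<exists>q. compat l q \<and> (\<forall>e. [q e * ?M i j e = ?M p t e] (mod int l ^ e))" for p t
    by (rule compat_quotient[OF l _ vd, of "?M p t"]) auto
  then obtain Q where Q: "\<And>p t. compat l (Q p t)" "\<And>p t e. [Q p t e * ?M i j e = ?M p t e] (mod int l ^ e)"
    by metis
  have P: "pivot l ?J ?M i j 0 (\<lambda>p. Q p j) (\<lambda>p. Q p i)"
    using vd Q by (auto simp: pivot_def)
  let ?S = "schur ?M i j (\<lambda>p. Q p j) (\<lambda>p. Q p i)"
  \<comment> \<open>\<open>Q\<close> holds the true l-adic quotients by the pivot of the integer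
    lift, whereas \<open>u\<close> inverts the pivot only modulo \<open>l^e\<close>; at level
    \<open>e\<close> the two agree.\<close>
  have Qe: "[Q p t e = u * ?A p t] (mod int l ^ e)" if "p \<in> I" "t \<in> I" for p t
  proof -
    have "[u * (Q p t e * skew x i j) = u * skew x p t] (mod int l ^ e)" using Q(2) by (rule cong_scalar_left)
    moreover have "[u * skew x p t = u * ?A p t] (mod int l ^ e)" using xA[OF that] by (rule cong_scalar_left)
    moreover have "[u * (Q p t e * skew x i j) = Q p t e] (mod int l ^ e)"
    proof -
      have "[Q p t e * u * skew x i j = Q p t e * u * (- w j)] (mod int l ^ e)"
        using xA[of i j] Aij I by (intro cong_scalar_left) auto
      moreover have "[Q p t e * (u * (- w j)) = Q p t e * 1] (mod int l ^ e)" using u by (rule cong_scalar_left)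
      ultimately have "[Q p t e * u * skew x i j = Q p t e * 1] (mod int l ^ e)"
        by (simp add: mult.assoc cong_def)
      then show ?thesis by (simp add: ac_simps)
    qed
    ultimately show ?thesis by (meson cong_sym cong_trans)
  qed
  have S: "[skew y (skip j p) (skip j q) = ?S p q e] (mod int l ^ e)" if pq: "p \<in> ?J" "q \<in> ?J" for p q
  proof -
    have pI: "p \<in> I" "q \<in> I" "i \<in> I" "j \<in> I" using pq I by auto
    have ne: "p \<noteq> i" "q \<noteq> i" "p \<noteq> j" "q \<noteq> j" using pq ij by auto
    have "[?S p q e = ?A p q - (u * ?A p j) * ?A i q + (u * ?A p i) * ?A j q] (mod int l ^ e)"
      unfolding schur_def using xA Qe pI by (intro cong_add cong_diff cong_mult) auto
    moreover have "?A p q - (u * ?A p j) * ?A i q + (u * ?A p i) * ?A j q = skew y (skip j p) (skip j q)"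
      using ne ij by (simp add: grow_def algebra_simps)
    ultimately show ?thesis by (simp add: cong_sym_eq)
  qed
  have bij: "bij_betw (skip j) ?J {..<m}" using j(1) by (rule bij_skip)
  let ?R = "{s \<in> ?J. skip j s \<in> R}"
  have "sympl l {..<m} R (\<lambda>p q e. skew y p q) \<kappa>" using y by (simp add: has_type_def)
  then have 1: "sympl l ?J ?R (\<lambda>p q e. skew y (skip j p) (skip j q)) (\<lambda>s. \<kappa> (skip j s))"
    using bij by (rule sympl_reindex)
  have \<kappa>e: "\<kappa> (skip j s) < e" if "s \<in> ?J - ?R" for s
    using y that bij by (auto simp: has_type_def bij_betw_def)
  have 2: "sympl l ?J ?R ?S (\<lambda>s. \<kappa> (skip j s))"
  proof (rule sympl_cong[OF 1 l])
    show "alt_seq l ?J (\<lambda>p q e. skew y (skip j p) (skip j q))"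
      by (auto simp: alt_seq_def skew_def)
    show "alt_seq l ?J ?S" using M P by (rule alt_seq_schur)
  qed (use \<kappa>e S in auto)
  define \<kappa>' where "\<kappa>' = (\<lambda>s. \<kappa> (skip j s))(i := 0, j := 0)"
  have \<kappa>'J: "\<kappa>' s = \<kappa> (skip j s)" if "s \<in> ?J" for s using that ij by (auto simp: \<kappa>'_def)
  have "sympl l ?J ?R ?S \<kappa>'" by (rule sympl_kappa_cong[OF 2]) (simp only: \<kappa>'J)
  then have "sympl l I ?R ?M \<kappa>'"
    unfolding I by (intro sympl.step[OF _ ij _ _ P]) (auto simp: \<kappa>'_def)
  moreover have "\<kappa>' s < e" if "s \<in> I - ?R" for s
  proof (cases "s \<in> ?J")
    case True
    then show ?thesis using that \<kappa>'J[OF True] \<kappa>e[of s] by auto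
  next
    case False
    then show ?thesis using that e I by (auto simp: \<kappa>'_def)
  qed
  ultimately have "has_type l I e x ?R \<kappa>'" by (simp add: has_type_def)
  moreover have "diag_group l ({..<m} - R) \<kappa> \<cong> diag_group l (I - ?R) \<kappa>'"
  proof (rule diag_group_iso[OF l0, of "skip j" "?J - ?R"])
    show "bij_betw (skip j) (?J - ?R) ({..<m} - R)"
      using bij by (auto simp: bij_betw_def inj_on_def)
    show "?J - ?R \<subseteq> I - ?R" using I by auto
    show "\<kappa>' s = \<kappa> (skip j s)" if "s \<in> ?J - ?R" for s using \<kappa>'J that by blast
    show "\<kappa>' s = 0" if "s \<in> I - ?R - (?J - ?R)" for s using that I by (auto simp: \<kappa>'_def)
  qed
  ultimately show ?thesis by blast
qed

text \<open>Counts the complement: rows all of whose entries are multiples of \<open>l\<close>, each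
  entry having \<open>l^(e - 1)\<close> possible values.\<close>

lemma card_unit_rows:
  assumes "prime l" "e > 0"
  shows "card {w \<in> {..<n} \<rightarrow>\<^sub>E {0..<int l ^ e}. \<exists>p<n. \<not> int l dvd w p} = l ^ (e * n) - l ^ ((e - 1) * n)"
proof -
  have l0: "l > 0" using assms(1) by (simp add: prime_gt_0_nat)
  let ?W = "{..<n} \<rightarrow>\<^sub>E {0..<int l ^ e}" and ?D = "(*) (int l) ` {0..<int l ^ (e - 1)}"
  have pe: "int l ^ e = int l * int l ^ (e - 1)" using assms(2) by (metis power_eq_if neq0_conv)
  have D: "t \<in> ?D \<longleftrightarrow> t \<in> {0..<int l ^ e} \<and> int l dvd t" for t
  proof
    assume "t \<in> ?D"
    then obtain s where "s \<in> {0..<int l ^ (e - 1)}" "t = int l * s" by blast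
    then show "t \<in> {0..<int l ^ e} \<and> int l dvd t" using l0 by (simp add: pe)
  next
    assume t: "t \<in> {0..<int l ^ e} \<and> int l dvd t"
    then obtain s where s: "t = int l * s" by (auto elim: dvdE)
    then have "0 \<le> s" "s < int l ^ (e - 1)" using t l0 by (simp_all add: pe zero_le_mult_iff)
    then show "t \<in> ?D" using s by (intro image_eqI[of _ _ s]) simp_all
  qed
  have "w \<in> {..<n} \<rightarrow>\<^sub>E ?D \<longleftrightarrow> (\<forall>p<n. int l dvd w p)" if w: "w \<in> ?W" for w
  proof -
    have "w \<in> {..<n} \<rightarrow>\<^sub>E ?D \<longleftrightarrow> (\<forall>p\<in>{..<n}. w p \<in> ?D)"
      unfolding PiE_iff using w[unfolded PiE_iff] by blast
    also have "\<dots> \<longleftrightarrow> (\<forall>p\<in>{..<n}. int l dvd w p)"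
      unfolding D using PiE_mem[OF w] by blast
    finally show ?thesis by auto
  qed
  then have "w \<in> {w \<in> ?W. \<exists>p<n. \<not> int l dvd w p} \<longleftrightarrow> w \<in> ?W - ({..<n} \<rightarrow>\<^sub>E ?D)" for w
    by (cases "w \<in> ?W") simp_all
  then have "{w \<in> ?W. \<exists>p<n. \<not> int l dvd w p} = ?W - ({..<n} \<rightarrow>\<^sub>E ?D)" by (rule Set.set_eqI)
  moreover have "({..<n} \<rightarrow>\<^sub>E ?D) \<subseteq> ?W" using D by (intro PiE_mono) blast
  moreover have "finite ({..<n} \<rightarrow>\<^sub>E ?D)" by (intro finite_PiE) auto
  ultimately have "card {w \<in> ?W. \<exists>p<n. \<not> int l dvd w p} = card ?W - card ({..<n} \<rightarrow>\<^sub>E ?D)"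
    by (simp add: card_Diff_subset)
  moreover have "card ?D = l ^ (e - 1)" using l0 by (subst card_image) (auto intro!: inj_onI simp: nat_power_eq)
  ultimately show ?thesis by (simp add: card_PiE nat_power_eq power_mult)
qed

text \<open>\<open>\<Phi>\<close> is injective: the last column of the grown matrix returns
  \<open>w\<close> and with it the pivot position \<open>j\<close>, column \<open>j\<close> then
  returns \<open>v\<close>, and removing the correction returns \<open>y\<close>. The factors on the
  left count the \<open>w\<close> with a unit entry, the \<open>v\<close> and the
  \<open>y\<close>.\<close>

lemma card_type_mats_grow:
  fixes m :: nat
  assumes l: "prime l" and e: "e > 0"
  shows "(l ^ (e * Suc m) - l ^ ((e - 1) * Suc m)) * (l ^ e) ^ m * card (type_mats l {..<m} e K)
     \<le> card (type_mats l {..<Suc (Suc m)} e K)"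
proof -
  have l0: "l > 0" using l by (simp add: prime_gt_0_nat)
  let ?I = "{..<Suc (Suc m)}" and ?N = "int l ^ e" and ?i = "Suc m"
  let ?W = "{w \<in> {..<Suc m} \<rightarrow>\<^sub>E {0..<?N}. \<exists>p<Suc m. \<not> int l dvd w p}"
  let ?V = "{..<m} \<rightarrow>\<^sub>E {0..<?N}" and ?T = "type_mats l {..<m} e K"
  let ?j = "first_unit l"
  have j: "?j w < Suc m" "\<not> int l dvd w (?j w)" if w: "w \<in> ?W" for w
  proof -
    obtain p where p: "p < Suc m" "\<not> int l dvd w p" using w by blast
    show "\<not> int l dvd w (?j w)" unfolding first_unit_def using p(2) by (rule LeastI)
    show "?j w < Suc m" using Least_le[of "\<lambda>p. \<not> int l dvd w p", OF p(2)] p(1) by (simp add: first_unit_def)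
  qed
  define u where "u w = (SOME u. [u * (- w (?j w)) = 1] (mod ?N))" for w
  have u: "[u w * (- w (?j w)) = 1] (mod ?N)" if "w \<in> ?W" for w
    unfolding u_def
  proof (rule someI_ex)
    have "coprime (- w (?j w)) ?N"
      using j(2)[OF that] l prime_imp_coprime[of "int l" "w (?j w)"] by (simp add: coprime_commute)
    then obtain c where "[- w (?j w) * c = 1] (mod ?N)" using cong_solve_coprime_int by blast
    then show "\<exists>u. [u * (- w (?j w)) = 1] (mod ?N)" by (intro exI[of _ c]) (simp add: mult.commute)
  qed
  define A where "A = (\<lambda>(w, v, y). grow ?i (?j w) (u w) w v y)"
  define \<Phi> where "\<Phi> t = (\<lambda>(p, q)\<in>upper ?I. A t p q mod ?N)" for t
  have maps: "\<Phi> ` (?W \<times> ?V \<times> ?T) \<subseteq> type_mats l ?I e K"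
  proof
    fix x assume "x \<in> \<Phi> ` (?W \<times> ?V \<times> ?T)"
    then obtain w v y where t: "w \<in> ?W" "y \<in> ?T" "x = \<Phi> (w, v, y)" by auto
    obtain R \<kappa> where R: "has_type l {..<m} e y R \<kappa>" "iso_rep (diag_group l ({..<m} - R) \<kappa>) = K"
      using t(2) by (auto simp: type_mats_def)
    have "x = (\<lambda>(p, q)\<in>upper ?I. grow ?i (?j w) (u w) w v y p q mod ?N)"
      by (simp add: t(3) \<Phi>_def A_def)
    then obtain R' \<kappa>' where R': "has_type l ?I e x R' \<kappa>'" "diag_group l ({..<m} - R) \<kappa> \<cong> diag_group l (?I - R') \<kappa>'"
      using has_type_grow[where w = w and v = v and j = "?j w", OF l e j[OF t(1)] u[OF t(1)] R(1)] by blast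
    have "group (diag_group l ({..<m} - R) \<kappa>)" by (simp add: diag_group_def)
    then have "iso_rep (diag_group l (?I - R') \<kappa>') = K" using iso_rep_cong R'(2) R(2) by metis
    moreover have "x \<in> residues_mat ?I ?N" using l0 by (auto simp: t(3) \<Phi>_def residues_mat_def)
    ultimately show "x \<in> type_mats l ?I e K" using R'(1) by (auto simp: type_mats_def)
  qed
  have inj: "inj_on \<Phi> (?W \<times> ?V \<times> ?T)"
  proof (rule inj_onI)
    fix t t' assume t: "t \<in> ?W \<times> ?V \<times> ?T" "t' \<in> ?W \<times> ?V \<times> ?T" and eq: "\<Phi> t = \<Phi> t'"
    obtain w v y where wvy: "t = (w, v, y)" "w \<in> ?W" "v \<in> ?V" "y \<in> ?T" using t(1) by auto
    obtain w' v' y' where wvy': "t' = (w', v', y')" "w' \<in> ?W" "v' \<in> ?V" "y' \<in> ?T" using t(2) by auto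
    have wP: "w \<in> {..<Suc m} \<rightarrow>\<^sub>E {0..<?N}" "w' \<in> {..<Suc m} \<rightarrow>\<^sub>E {0..<?N}" using wvy wvy' by auto
    have cA: "[A t p q = A t' p q] (mod ?N)" if "p \<in> ?I" "q \<in> ?I" for p q
    proof -
      have "[skew (\<Phi> t) p q = A t p q] (mod ?N)" "[skew (\<Phi> t') p q = A t' p q] (mod ?N)"
        unfolding \<Phi>_def A_def wvy(1) wvy'(1) prod.case using alt_int_grow that by (intro skew_mod_restrict; simp)+
      then show ?thesis unfolding eq by (meson cong_sym cong_trans)
    qed
    have "w p = w' p" if p: "p \<in> {..<Suc m}" for p
    proof -
      have "[w p = w' p] (mod ?N)"
        using cA[of p ?i] p by (simp add: A_def wvy(1) wvy'(1) grow_def)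
      then show ?thesis using PiE_mem[OF wP(1) p] PiE_mem[OF wP(2) p] by (simp add: cong_def)
    qed
    then have w: "w = w'" by (rule PiE_ext[OF wP])
    define k where "k = ?j w"
    have k: "k < Suc m" using j[OF wvy(2)] by (simp add: k_def)
    have bij: "bij_betw (skip k) ({..<Suc m} - {k}) {..<m}" using k by (rule bij_skip)
    have pre: thesis if "p \<in> {..<m}" "\<And>q. q \<in> {..<Suc m} - {k} \<Longrightarrow> skip k q = p \<Longrightarrow> thesis" for p thesis
    proof -
      have "p \<in> skip k ` ({..<Suc m} - {k})" using that(1) unfolding bij_betw_imp_surj_on[OF bij] .
      then show thesis by (elim imageE) (rule that(2), simp_all)
    qed
    have "v p = v' p" if p: "p \<in> {..<m}" for p
    proof -
      obtain q where q: "q \<in> {..<Suc m} - {k}" "skip k q = p" by (rule pre[OF p])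
      have "[v p = v' p] (mod ?N)"
        using cA[of q k] q k by (simp add: A_def wvy(1) wvy'(1) grow_def k_def w)
      then show ?thesis using PiE_mem[OF wvy(3) p] PiE_mem[OF wvy'(3) p] by (simp add: cong_def)
    qed
    then have v: "v = v'" by (rule PiE_ext[OF wvy(3) wvy'(3)])
    have yP: "y \<in> upper {..<m} \<rightarrow>\<^sub>E {0..<?N}" "y' \<in> upper {..<m} \<rightarrow>\<^sub>E {0..<?N}"
      using wvy(4) wvy'(4) type_mats_subset unfolding residues_mat_def by blast+
    have "y ab = y' ab" if ab: "ab \<in> upper {..<m}" for ab
    proof -
      obtain a b where ab': "ab = (a, b)" "a < b" "b < m" using ab by (auto simp: upper_def)
      have am: "a \<in> {..<m}" "b \<in> {..<m}" using ab' by auto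
      obtain p where p: "p \<in> {..<Suc m} - {k}" "skip k p = a" by (rule pre[OF am(1)])
      obtain q where q: "q \<in> {..<Suc m} - {k}" "skip k q = b" by (rule pre[OF am(2)])
      \<comment> \<open>The correction depends only on \<open>w\<close> and \<open>v\<close>, which
        are already known to agree.\<close>
      have "A t p q = skew y a b + (- u w * v a * w q + u w * w p * v b)"
        "A t' p q = skew y' a b + (- u w * v a * w q + u w * w p * v b)"
        using p q by (auto simp: A_def wvy(1) wvy'(1) grow_def k_def w v)
      then have "[skew y a b + (- u w * v a * w q + u w * w p * v b) = skew y' a b + (- u w * v a * w q + u w * w p * v b)] (mod ?N)"
        using cA[of p q] p q by auto
      then have "[skew y a b = skew y' a b] (mod ?N)" by (simp only: cong_add_rcancel)
      then have "[y ab = y' ab] (mod ?N)" using ab' by (simp add: skew_def)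
      then show ?thesis using PiE_mem[OF yP(1) ab] PiE_mem[OF yP(2) ab] by (simp add: cong_def)
    qed
    then have "y = y'" by (rule PiE_ext[OF yP])
    then show "t = t'" using w v wvy(1) wvy'(1) by simp
  qed
  have "card (?W \<times> ?V \<times> ?T) \<le> card (type_mats l ?I e K)"
    using inj maps by (rule card_inj_on_le) simp
  then show ?thesis using card_unit_rows[OF l e, of "Suc m"]
    by (simp add: card_cartesian_product card_PiE nat_power_eq mult.assoc)
qed

text \<open>Sizes \<open>m + 2\<close> and \<open>m\<close> differ by \<open>(m + 1) + m\<close>
  free entries, those of \<open>w\<close> and \<open>v\<close>, and at every positive level the
  proportion of \<open>w\<close> with a unit entry is \<open>1 - l^(-(m + 1))\<close>. Matrices
  without such an entry are dropped, hence only an inequality.\<close>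

lemma type_prob_grow:
  assumes l: "prime l"
  shows "(1 - 1 / real l ^ Suc m) * type_prob l m K \<le> type_prob l (Suc (Suc m)) K"
proof (rule LIMSEQ_le)
  have l0: "l > 0" using l by (simp add: prime_gt_0_nat)
  show "(\<lambda>e. (1 - 1 / real l ^ Suc m) * type_frac l {..<m} e K) \<longlonglongrightarrow> (1 - 1 / real l ^ Suc m) * type_prob l m K"
    by (intro tendsto_mult_left type_frac_tendsto l)
  show "(\<lambda>e. type_frac l {..<Suc (Suc m)} e K) \<longlonglongrightarrow> type_prob l (Suc (Suc m)) K"
    by (intro type_frac_tendsto l)
  have "(1 - 1 / real l ^ Suc m) * type_frac l {..<m} e K \<le> type_frac l {..<Suc (Suc m)} e K" if e: "e > 0" for e
  proof -
    let ?n = "num_res l {..<m} e" and ?c = "real (card (type_mats l {..<m} e K))"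
    have np: "?n > 0" using num_res_pos[OF l0] by simp
    have le: "l ^ ((e - 1) * Suc m) \<le> l ^ (e * Suc m)" using l0 by (intro power_increasing mult_le_mono1) auto
    have ee: "e * Suc m = (e - 1) * Suc m + Suc m" using e by (cases e) auto
    have pw: "real l ^ (e * Suc m) = real l ^ ((e - 1) * Suc m) * real l ^ Suc m"
      by (simp only: ee power_add)
    have a1: "real ((l ^ (e * Suc m) - l ^ ((e - 1) * Suc m)) * (l ^ e) ^ m * card (type_mats l {..<m} e K))
        \<le> real (card (type_mats l {..<Suc (Suc m)} e K))"
      using card_type_mats_grow[OF l e] by (simp only: of_nat_le_iff)
    have a2: "real ((l ^ (e * Suc m) - l ^ ((e - 1) * Suc m)) * (l ^ e) ^ m * card (type_mats l {..<m} e K))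
        = (1 - 1 / real l ^ Suc m) * real l ^ (e * Suc m) * (real l ^ e) ^ m * ?c"
      using le l0 pw by (simp add: of_nat_diff left_diff_distrib right_diff_distrib)
    have a3: "num_res l {..<Suc (Suc m)} e = real l ^ (e * Suc m) * (real l ^ e) ^ m * ?n"
    proof -
      have "card (upper {..<Suc (Suc m)}) = Suc m + m + card (upper {..<m})"
      proof -
        have "Suc (Suc m) * Suc m = 2 * (Suc m + m) + m * (m - 1)" by (cases m) (auto simp: algebra_simps)
        then show ?thesis by (simp add: card_upper)
      qed
      then show ?thesis using l0
        by (simp add: num_res power_add power_mult ac_simps flip: power_mult_distrib)
    qed
    define Q where "Q = real l ^ (e * Suc m) * (real l ^ e) ^ m"
    have le1: "(1 - 1 / real l ^ Suc m) * ?c * Q \<le> real (card (type_mats l {..<Suc (Suc m)} e K))"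
      using a1[unfolded a2] by (simp only: Q_def ac_simps)
    have n: "num_res l {..<Suc (Suc m)} e = ?n * Q"
      using a3 by (simp only: Q_def ac_simps)
    have Q: "Q > 0" using l0 by (simp add: Q_def)
    have "(1 - 1 / real l ^ Suc m) * type_frac l {..<m} e K = ((1 - 1 / real l ^ Suc m) * ?c * Q) / (?n * Q)"
      using Q by (simp add: type_frac_def)
    also have "\<dots> \<le> type_frac l {..<Suc (Suc m)} e K"
      unfolding type_frac_def n by (rule divide_right_mono[OF le1]) (use np Q in simp)
    finally show ?thesis .
  qed
  then show "\<exists>N. \<forall>n\<ge>N. (1 - 1 / real l ^ Suc m) * type_frac l {..<m} n K \<le> type_frac l {..<Suc (Suc m)} n K"
    by (intro exI[of _ 1]) auto
qed

section \<open>The limit distribution\<close>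

text \<open>The factor guaranteed to survive \<open>k\<close> growth steps from size
  \<open>r\<close>, two rows and columns at a time.\<close>

definition grow_const :: "nat \<Rightarrow> nat \<Rightarrow> nat \<Rightarrow> real" where
  "grow_const l r k = (\<Prod>j<k. 1 - 1 / real l ^ Suc (r + 2 * j))"

lemma grow_factor_bounds:
  assumes "l \<ge> 2"
  shows "1 - 1 / 2 * (1 / 4) ^ k \<le> 1 - 1 / real l ^ Suc (r + 2 * k)" "1 - 1 / real l ^ Suc (r + 2 * k) \<le> 1"
proof -
  have "(2::real) ^ Suc (2 * k) \<le> 2 ^ Suc (r + 2 * k)" by (intro power_increasing) auto
  also have "\<dots> \<le> real l ^ Suc (r + 2 * k)" using assms by (intro power_mono) auto
  finally have "1 / real l ^ Suc (r + 2 * k) \<le> 1 / 2 ^ Suc (2 * k)"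
    using assms by (intro divide_left_mono) auto
  also have "1 / 2 ^ Suc (2 * k) = 1 / 2 * (1 / 4 :: real) ^ k"
    by (simp add: power_mult power_divide)
  finally show "1 - 1 / 2 * (1 / 4) ^ k \<le> 1 - 1 / real l ^ Suc (r + 2 * k)" by simp
  show "1 - 1 / real l ^ Suc (r + 2 * k) \<le> 1" using assms by simp
qed

text \<open>The term \<open>1 / 2 * x\<close> with \<open>x = (1 / 4) ^ k\<close> is added to make
  the induction close: \<open>(1 / 4 + x / 2) * (1 - x / 2)\<close> exceeds
  \<open>1 / 4 + x / 8\<close> by \<open>(x - x * x) / 4\<close>, which is nonnegative as
  \<open>0 < x \<le> 1\<close>.\<close>

lemma grow_const_lower:
  assumes "l \<ge> 2"
  shows "grow_const l r k \<ge> 1 / 4 + 1 / 2 * (1 / 4) ^ k"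
proof (induction k)
  case 0
  then show ?case by (simp add: grow_const_def)
next
  case (Suc k)
  let ?x = "(1 / 4 :: real) ^ k"
  have x: "0 < ?x" "?x \<le> 1" by (auto intro: power_le_one)
  have "1 / 4 + 1 / 2 * (1 / 4) ^ Suc k \<le> (1 / 4 + 1 / 2 * ?x) * (1 - 1 / 2 * ?x)"
  proof -
    have "?x * ?x \<le> ?x" using x by (simp add: mult_left_le)
    then show ?thesis by (simp add: field_simps)
  qed
  also have "\<dots> \<le> grow_const l r k * (1 - 1 / real l ^ Suc (r + 2 * k))"
    using Suc x by (intro mult_mono grow_factor_bounds(1)[OF assms]) linarith+
  finally show ?case by (simp add: grow_const_def)
qed

lemma grow_const_ge: "l \<ge> 2 \<Longrightarrow> grow_const l r k \<ge> 1 / 4"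
  using grow_const_lower[of l k r] by (smt (verit) zero_le_power mult_nonneg_nonneg divide_nonneg_nonneg)

lemma grow_const_limit:
  assumes "l \<ge> 2"
  obtains C where "grow_const l r \<longlonglongrightarrow> C" "C \<ge> 1 / 4"
proof -
  have "decseq (grow_const l r)"
  proof (rule decseq_SucI)
    fix k
    have "grow_const l r (Suc k) = grow_const l r k * (1 - 1 / real l ^ Suc (r + 2 * k))"
      by (simp add: grow_const_def)
    also have "\<dots> \<le> grow_const l r k"
      using grow_factor_bounds(2)[OF assms, of r k] grow_const_ge[OF assms, of r k] by (intro mult_left_le) auto
    finally show "grow_const l r (Suc k) \<le> grow_const l r k" .
  qed
  then obtain C where C: "grow_const l r \<longlonglongrightarrow> C"
    using grow_const_ge[OF assms] decseq_convergent by metis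
  moreover have "C \<ge> 1 / 4" using grow_const_ge[OF assms] by (intro LIMSEQ_le_const[OF C]) auto
  ultimately show thesis by (rule that)
qed

lemma type_prob_le_1: "prime l \<Longrightarrow> type_prob l m K \<le> 1"
  using type_frac_bounds(2)[of l "{..<m}"] by (intro LIMSEQ_le_const2[OF type_frac_tendsto]) (auto simp: prime_gt_0_nat)

definition limit_prob :: "nat \<Rightarrow> nat \<Rightarrow> nat monoid \<Rightarrow> real" where
  "limit_prob l r K = lim (\<lambda>k. type_prob l (r + 2 * k) K)"

text \<open>A growth step shrinks the probability at most by the factor that
  \<open>grow_const\<close> picks up, so the quotient cannot decrease.\<close>

lemma scaled_type_prob_mono:
  assumes "prime l"
  shows "incseq (\<lambda>k. type_prob l (r + 2 * k) K / grow_const l r k)"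
proof (rule incseq_SucI)
  fix k
  have l2: "l \<ge> 2" using assms by (simp add: prime_ge_2_nat)
  let ?c = "1 - 1 / real l ^ Suc (r + 2 * k)"
  have g: "grow_const l r k > 0" "grow_const l r (Suc k) > 0"
    using grow_const_ge[OF l2, of r k] grow_const_ge[OF l2, of r "Suc k"] by auto
  have e: "grow_const l r (Suc k) = grow_const l r k * ?c" by (simp add: grow_const_def)
  then have c: "?c > 0" using g by (simp add: zero_less_mult_iff)
  have "type_prob l (r + 2 * k) K / grow_const l r k = (?c * type_prob l (r + 2 * k) K) / grow_const l r (Suc k)"
  proof -
    have "P / q = (c * P) / (q * c)" if "c > 0" for c P q :: real using that by simp
    then show ?thesis unfolding e using c by blast
  qed
  also have "\<dots> \<le> type_prob l (r + 2 * Suc k) K / grow_const l r (Suc k)"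
    using type_prob_grow[OF assms, of "r + 2 * k" K] g by (intro divide_right_mono) auto
  finally show "type_prob l (r + 2 * k) K / grow_const l r k \<le> type_prob l (r + 2 * Suc k) K / grow_const l r (Suc k)" .
qed

lemma scaled_type_prob_convergent:
  assumes "prime l"
  shows "convergent (\<lambda>k. type_prob l (r + 2 * k) K / grow_const l r k)"
proof -
  have l2: "l \<ge> 2" using assms by (simp add: prime_ge_2_nat)
  have "\<forall>k. type_prob l (r + 2 * k) K / grow_const l r k \<le> 4"
  proof
    fix k
    have "type_prob l (r + 2 * k) K / grow_const l r k \<le> 1 / (1 / 4)"
      using type_prob_le_1[OF assms] type_prob_nonneg[OF assms] grow_const_ge[OF l2] by (intro frac_le) auto
    then show "type_prob l (r + 2 * k) K / grow_const l r k \<le> 4" by simp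
  qed
  from incseq_convergent[OF scaled_type_prob_mono[OF assms] this]
  obtain L where "(\<lambda>k. type_prob l (r + 2 * k) K / grow_const l r k) \<longlonglongrightarrow> L" .
  then show ?thesis by (rule convergentI)
qed

lemma limit_prob_tendsto:
  assumes "prime l"
  shows "(\<lambda>k. type_prob l (r + 2 * k) K) \<longlonglongrightarrow> limit_prob l r K"
proof -
  have l2: "l \<ge> 2" using assms by (simp add: prime_ge_2_nat)
  obtain C where C: "grow_const l r \<longlonglongrightarrow> C" using grow_const_limit[OF l2] .
  obtain V where "(\<lambda>k. type_prob l (r + 2 * k) K / grow_const l r k) \<longlonglongrightarrow> V"
    using scaled_type_prob_convergent[OF assms] by (auto simp: convergent_def)
  then have "(\<lambda>k. type_prob l (r + 2 * k) K / grow_const l r k * grow_const l r k) \<longlonglongrightarrow> V * C"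
    using C by (rule tendsto_mult)
  moreover have "grow_const l r k \<noteq> 0" for k using grow_const_ge[OF l2, of r k] by auto
  ultimately have "convergent (\<lambda>k. type_prob l (r + 2 * k) K)" by (auto simp: convergent_def)
  then show ?thesis by (simp add: limit_prob_def convergent_LIMSEQ_iff)
qed

lemma limit_prob_nonneg: "prime l \<Longrightarrow> 0 \<le> limit_prob l r K"
  using type_prob_nonneg by (intro LIMSEQ_le_const[OF limit_prob_tendsto]) auto

text \<open>Convergence for each \<open>K\<close> alone would not prevent mass from escaping as the
  size grows. The quotients by \<open>grow_const\<close> increase, so monotone convergence applies
  to them; since the limit \<open>C\<close> of \<open>grow_const\<close> is positive, multiplying by
  it recovers the claim.\<close>

lemma limit_prob_integral:
  fixes f :: "nat monoid \<Rightarrow> nat"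
  assumes l: "prime l"
    and E: "\<And>k. (\<integral>\<^sup>+K. ennreal (type_prob l (r + 2 * k) K) * ennreal (real (f K)) \<partial>count_space UNIV) = ennreal (E k)"
    and E0: "\<And>k. E k \<ge> 0" and lim: "E \<longlonglongrightarrow> c"
  shows "(\<integral>\<^sup>+K. ennreal (limit_prob l r K) * ennreal (real (f K)) \<partial>count_space UNIV) = ennreal c"
proof -
  have l2: "l \<ge> 2" using l by (simp add: prime_ge_2_nat)
  obtain C where C: "grow_const l r \<longlonglongrightarrow> C" "C \<ge> 1 / 4" using grow_const_limit[OF l2] .
  define v where "v k K = type_prob l (r + 2 * k) K / grow_const l r k" for k K
  have g: "grow_const l r k > 0" for k using grow_const_ge[OF l2, of r k] by auto
  have v0: "v k K \<ge> 0" for k K using g type_prob_nonneg[OF l] by (simp add: v_def less_imp_le)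
  have vl: "(\<lambda>k. v k K) \<longlonglongrightarrow> limit_prob l r K / C" for K
    unfolding v_def using C(2) by (intro tendsto_divide limit_prob_tendsto[OF l] C(1)) auto
  let ?F = "\<lambda>k K. ennreal (v k K) * ennreal (real (f K))"
  have inc: "incseq ?F"
    using scaled_type_prob_mono[OF l, of r] unfolding v_def
    by (intro incseq_SucI le_funI mult_right_mono ennreal_leI) (auto simp: incseq_Suc_iff)
  have sup: "(SUP k. ?F k K) = ennreal (limit_prob l r K / C) * ennreal (real (f K))" for K
  proof (rule LIMSEQ_unique[OF LIMSEQ_SUP])
    show "incseq (\<lambda>k. ?F k K)" using inc by (auto simp: incseq_def le_fun_def)
    show "(\<lambda>k. ?F k K) \<longlonglongrightarrow> ennreal (limit_prob l r K / C) * ennreal (real (f K))"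
      by (intro tendsto_mult_ennreal tendsto_ennrealI vl tendsto_const) auto
  qed
  have Fk: "(\<integral>\<^sup>+K. ?F k K \<partial>count_space UNIV) = ennreal (E k / grow_const l r k)" for k
  proof -
    have "?F k K = ennreal (1 / grow_const l r k) * (ennreal (type_prob l (r + 2 * k) K) * ennreal (real (f K)))" for K
      using g[of k] type_prob_nonneg[OF l, of "r + 2 * k" K]
      by (simp add: v_def less_imp_le flip: ennreal_mult)
    then have "(\<integral>\<^sup>+K. ?F k K \<partial>count_space UNIV) = ennreal (1 / grow_const l r k) * ennreal (E k)"
      using E[of k] by (simp add: nn_integral_cmult)
    then show ?thesis using g[of k] E0[of k] by (simp add: less_imp_le flip: ennreal_mult)
  qed
  have "(\<integral>\<^sup>+K. (SUP k. ?F k K) \<partial>count_space UNIV) = (SUP k. (\<integral>\<^sup>+K. ?F k K \<partial>count_space UNIV))"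
    by (intro nn_integral_monotone_convergence_SUP inc) simp
  also have "\<dots> = ennreal (c / C)"
  proof (rule LIMSEQ_unique[OF LIMSEQ_SUP])
    show "incseq (\<lambda>k. \<integral>\<^sup>+K. ?F k K \<partial>count_space UNIV)"
      using inc by (auto simp: incseq_def le_fun_def intro!: nn_integral_mono)
    show "(\<lambda>k. \<integral>\<^sup>+K. ?F k K \<partial>count_space UNIV) \<longlonglongrightarrow> ennreal (c / C)"
      unfolding Fk using C lim by (intro tendsto_ennrealI tendsto_divide) auto
  qed
  finally have 1: "(\<integral>\<^sup>+K. ennreal (limit_prob l r K / C) * ennreal (real (f K)) \<partial>count_space UNIV) = ennreal (c / C)"
    unfolding sup .
  have "ennreal (limit_prob l r K) * ennreal (real (f K)) = ennreal C * (ennreal (limit_prob l r K / C) * ennreal (real (f K)))" for K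
    using C(2) limit_prob_nonneg[OF l, of r K] by (simp flip: ennreal_mult)
  then have "(\<integral>\<^sup>+K. ennreal (limit_prob l r K) * ennreal (real (f K)) \<partial>count_space UNIV) = ennreal C * ennreal (c / C)"
    using 1 by (simp add: nn_integral_cmult)
  moreover have "c \<ge> 0" using E0 by (intro LIMSEQ_le_const[OF lim]) auto
  ultimately show ?thesis using C(2) by (simp flip: ennreal_mult)
qed

text \<open>Weight 1 in \<open>limit_prob_integral\<close> gives total mass 1, so
  \<open>embed_pmf\<close> takes the intended values.\<close>

lemma pmf_T_lim:
  assumes "prime l" "r \<le> 1"
  shows "pmf (T_lim r l) K = limit_prob l r K"
proof -
  have "T_lim r l = embed_pmf (limit_prob l r)"
    unfolding T_lim_def limit_prob_def using pmf_T_mat[OF assms(1) refl assms(2)] by simp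
  moreover have "(\<integral>\<^sup>+K. ennreal (limit_prob l r K) \<partial>count_space UNIV) = 1"
    using limit_prob_integral[OF assms(1), of r "\<lambda>_. 1" "\<lambda>_. 1" 1] type_prob_total[OF assms(1) refl assms(2)] by simp
  ultimately show ?thesis using limit_prob_nonneg[OF assms(1)] by (simp add: pmf_embed_pmf)
qed

text \<open>A nonzero limit has a nonzero term, so some residue matrix actually has type
  \<open>K\<close>; this supplies the structure of the groups that occur.\<close>

lemma T_lim_support:
  assumes "prime l" "r \<le> 1" "K \<in> set_pmf (T_lim r l)"
  obtains J \<kappa> where "finite J" "K = iso_rep (diag_group l J \<kappa>)"
proof -
  have "limit_prob l r K \<noteq> 0" using assms pmf_T_lim by (simp add: set_pmf_iff)
  have "\<exists>k. type_prob l (r + 2 * k) K \<noteq> 0"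
  proof (rule ccontr)
    assume "\<not> ?thesis"
    then have "(\<lambda>k. 0) \<longlonglongrightarrow> limit_prob l r K" using limit_prob_tendsto[OF assms(1), of r K] by simp
    then show False using \<open>limit_prob l r K \<noteq> 0\<close> by (simp add: LIMSEQ_const_iff)
  qed
  then obtain k where k: "type_prob l (r + 2 * k) K \<noteq> 0" by blast
  have "\<exists>e. type_frac l {..<r + 2 * k} e K \<noteq> 0"
  proof (rule ccontr)
    assume "\<not> ?thesis"
    then have "(\<lambda>e. 0) \<longlonglongrightarrow> type_prob l (r + 2 * k) K" using type_frac_tendsto[OF assms(1), of "r + 2 * k" K] by simp
    then show False using k by (simp add: LIMSEQ_const_iff)
  qed
  then obtain e where "type_frac l {..<r + 2 * k} e K \<noteq> 0" by blast
  then have "type_mats l {..<r + 2 * k} e K \<noteq> {}" by (auto simp: type_frac_def)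
  then obtain R \<kappa> where "iso_rep (diag_group l ({..<r + 2 * k} - R) \<kappa>) = K" by (auto simp: type_mats_def)
  then show thesis using that[of "{..<r + 2 * k} - R" \<kappa>] by simp
qed

section \<open>Almost all long tuples generate a finite group\<close>

context comm_group
begin

lemma proper_subgroup_card:
  assumes "finite (carrier G)" "subgroup B G" "B \<noteq> carrier G"
  shows "2 * card B \<le> card (carrier G)"
proof -
  have "card (rcosets B) * card B = card (carrier G)" using lagrange[OF assms(2)] by (simp add: Coset.order_def)
  moreover have "card (rcosets B) \<noteq> 0"
    using calculation assms(1) one_closed by (metis card_gt_0_iff empty_iff mult_is_0 not_gr_zero)
  moreover have "card (rcosets B) \<noteq> 1"
    using calculation(1) assms subgroup.subset[OF assms(2)] by (metis card_subset_eq mult_1)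
  ultimately show ?thesis by (metis One_nat_def Suc_1 Suc_leI le_neq_implies_less less_one linorder_not_le mult_le_mono1)
qed

text \<open>A tuple that does not generate lies in a proper subgroup, whose order is at most half
  that of \<open>G\<close>, and there are at most \<open>2 ^ card (carrier G)\<close> subgroups. The
  factor \<open>2 ^ m\<close> keeps the estimate in the natural numbers.\<close>

lemma card_gens_lower:
  assumes "finite (carrier G)"
  shows "card (carrier G) ^ m * 2 ^ m \<le> card (gens G {..<m}) * 2 ^ m + 2 ^ card (carrier G) * card (carrier G) ^ m"
proof -
  let ?H = "{..<m} \<rightarrow>\<^sub>E carrier G" and ?n = "card (carrier G)"
  let ?S = "{B. subgroup B G \<and> B \<noteq> carrier G}"
  have sub: "?S \<subseteq> Pow (carrier G)" by (auto dest: subgroup.subset)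
  then have fS: "finite ?S" using assms finite_subset by blast
  have "card ?S \<le> card (Pow (carrier G))" using sub assms by (intro card_mono) auto
  then have cS: "card ?S \<le> 2 ^ ?n" using assms by (simp add: card_Pow)
  have fH: "finite ?H" using assms by (simp add: finite_PiE)
  have "?H \<subseteq> gens G {..<m} \<union> (\<Union>B\<in>?S. {..<m} \<rightarrow>\<^sub>E B)"
  proof
    fix h assume h: "h \<in> ?H"
    have hc: "h ` {..<m} \<subseteq> carrier G" using h by auto
    show "h \<in> gens G {..<m} \<union> (\<Union>B\<in>?S. {..<m} \<rightarrow>\<^sub>E B)"
    proof (cases "generate G (h ` {..<m}) = carrier G")
      case True
      then show ?thesis using h by (simp add: gens_def)
    next
      case False
      have "h \<in> {..<m} \<rightarrow>\<^sub>E generate G (h ` {..<m})" using h by (auto simp: PiE_iff intro: generate.incl)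
      then show ?thesis using False generate_is_subgroup[OF hc] by blast
    qed
  qed
  then have "card ?H \<le> card (gens G {..<m} \<union> (\<Union>B\<in>?S. {..<m} \<rightarrow>\<^sub>E B))"
    using fS assms finite_gens[OF _ assms, of "{..<m}"] finite_subset[OF subgroup.subset assms]
    by (intro card_mono) (auto intro!: finite_PiE)
  also have "\<dots> \<le> card (gens G {..<m}) + card (\<Union>B\<in>?S. {..<m} \<rightarrow>\<^sub>E B)" by (rule card_Un_le)
  also have "card (\<Union>B\<in>?S. {..<m} \<rightarrow>\<^sub>E B) \<le> (\<Sum>B\<in>?S. card ({..<m} \<rightarrow>\<^sub>E B))" by (rule card_UN_le[OF fS])
  finally have "?n ^ m \<le> card (gens G {..<m}) + (\<Sum>B\<in>?S. card B ^ m)" by (simp add: card_PiE)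
  then have "?n ^ m * 2 ^ m \<le> (card (gens G {..<m}) + (\<Sum>B\<in>?S. card B ^ m)) * 2 ^ m" by simp
  also have "\<dots> = card (gens G {..<m}) * 2 ^ m + (\<Sum>B\<in>?S. (2 * card B) ^ m)"
    by (simp add: algebra_simps sum_distrib_left power_mult_distrib)
  also have "(\<Sum>B\<in>?S. (2 * card B) ^ m) \<le> (\<Sum>B\<in>?S. ?n ^ m)"
    using proper_subgroup_card[OF assms] by (intro sum_mono power_mono) auto
  also have "\<dots> \<le> 2 ^ ?n * ?n ^ m" using cS by simp
  finally show ?thesis by simp
qed

lemma gens_ratio_tendsto:
  assumes "finite (carrier G)"
  shows "(\<lambda>m. real (card (gens G {..<m})) / real (card (carrier G)) ^ m) \<longlonglongrightarrow> 1"
proof (rule tendsto_sandwich)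
  let ?n = "card (carrier G)"
  have n: "real ?n > 0" using assms one_closed by (auto simp: card_gt_0_iff)
  have "1 - 2 ^ ?n * (1 / 2) ^ m \<le> real (card (gens G {..<m})) / real ?n ^ m" for m
  proof -
    have "real (?n ^ m * 2 ^ m) \<le> real (card (gens G {..<m}) * 2 ^ m + 2 ^ ?n * ?n ^ m)"
      using card_gens_lower[OF assms] by (simp only: of_nat_le_iff)
    then have "real ?n ^ m * 2 ^ m \<le> real (card (gens G {..<m})) * 2 ^ m + 2 ^ ?n * real ?n ^ m" by simp
    then show ?thesis using n by (simp add: field_simps power_divide)
  qed
  then show "\<forall>\<^sub>F m in sequentially. 1 - 2 ^ ?n * (1 / 2) ^ m \<le> real (card (gens G {..<m})) / real ?n ^ m" by simp
  have "real (card (gens G {..<m})) / real ?n ^ m \<le> 1" for m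
  proof -
    have "card (gens G {..<m}) \<le> card ({..<m} \<rightarrow>\<^sub>E carrier G)"
      using assms by (intro card_mono) (auto simp: gens_def finite_PiE)
    then have "real (card (gens G {..<m})) \<le> real ?n ^ m" by (simp add: card_PiE flip: of_nat_power)
    then show ?thesis using n by simp
  qed
  then show "\<forall>\<^sub>F m in sequentially. real (card (gens G {..<m})) / real ?n ^ m \<le> 1" by simp
  have "(\<lambda>m. 1 - 2 ^ ?n * (1 / 2 :: real) ^ m) \<longlonglongrightarrow> 1 - 2 ^ ?n * 0"
    by (intro tendsto_intros) auto
  then show "(\<lambda>m. 1 - 2 ^ ?n * (1 / 2 :: real) ^ m) \<longlonglongrightarrow> 1" by simp
qed (rule tendsto_const)

end

text \<open>At each size the moment is the target times the proportion of generating tuples, and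
  \<open>gens_ratio_tendsto\<close> removes this proportion in the limit.\<close>

lemma T_lim_moment:
  fixes H :: "('a, 'b) monoid_scheme" and f :: "nat monoid \<Rightarrow> nat"
  assumes l: "prime l" and r: "r \<le> 1"
    and H: "comm_group H" "finite (carrier H)" "expo H (int l ^ a)"
    and f: "\<And>m R \<kappa>. R \<subseteq> {..<m} \<Longrightarrow> card R = r \<Longrightarrow> f (iso_rep (diag_group l ({..<m} - R) \<kappa>)) =
      card {h \<in> gens H {..<m}. \<forall>s\<in>{..<m} - R. h s [^]\<^bsub>H\<^esub> (int l ^ \<kappa> s) = \<one>\<^bsub>H\<^esub>}"
  shows "(\<integral>\<^sup>+K. ennreal (real (f K)) \<partial>measure_pmf (T_lim r l)) = ennreal (real (card (carrier (Sym2 H))))"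
proof -
  interpret H: comm_group H by fact
  let ?E = "\<lambda>m. real (card (gens H {..<m})) * real (card (carrier (Sym2 H))) / real (card (carrier H)) ^ m"
  have "(\<lambda>m. real (card (gens H {..<m})) / real (card (carrier H)) ^ m * real (card (carrier (Sym2 H)))) \<longlonglongrightarrow> 1 * real (card (carrier (Sym2 H)))"
    by (intro tendsto_mult H.gens_ratio_tendsto H(2) tendsto_const)
  then have "?E \<longlonglongrightarrow> real (card (carrier (Sym2 H)))" by simp
  moreover have "filterlim (\<lambda>k. r + 2 * k) at_top sequentially"
    by (rule filterlim_subseq) (simp add: strict_mono_def)
  ultimately have lim: "(\<lambda>k. ?E (r + 2 * k)) \<longlonglongrightarrow> real (card (carrier (Sym2 H)))"
    by (rule filterlim_compose)
  have "(\<integral>\<^sup>+K. ennreal (limit_prob l r K) * ennreal (real (f K)) \<partial>count_space UNIV) = ennreal (real (card (carrier (Sym2 H))))"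
    by (rule limit_prob_integral[OF l _ _ lim]) (use type_prob_moment[OF l refl r H f] in auto)
  then show ?thesis by (simp add: nn_integral_measure_pmf pmf_T_lim[OF l r])
qed

section \<open>Counting surjections\<close>

lemma isomorphic_by_inverse:
  assumes "f \<in> hom G H" "\<And>y. y \<in> carrier H \<Longrightarrow> g y \<in> carrier G"
    "\<And>x. x \<in> carrier G \<Longrightarrow> g (f x) = x" "\<And>y. y \<in> carrier H \<Longrightarrow> f (g y) = y"
  shows "G \<cong> H"
proof -
  have "bij_betw f (carrier G) (carrier H)"
    by (rule bij_betwI[where g = g]) (use assms in \<open>auto simp: hom_def\<close>)
  then show ?thesis using assms(1) unfolding is_iso_def iso_def by blast
qed

text \<open>The choice in \<open>iso_rep\<close> needs a witness on natural numbers: the group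
  structure is carried along a bijection of the carrier with an initial segment.\<close>

lemma iso_rep_finite:
  assumes "comm_group G" "finite (carrier G)"
  shows "comm_group (iso_rep G)" "G \<cong> iso_rep G"
proof -
  interpret G: comm_group G by fact
  obtain h where h: "bij_betw h (carrier G) {0..<card (carrier G)}"
    using ex_bij_betw_finite_nat[OF assms(2)] by blast
  let ?g = "inv_into (carrier G) h" and ?C = "{0..<card (carrier G)}"
  have g: "?g x \<in> carrier G" "h (?g x) = x" if "x \<in> ?C" for x
    using h that by (auto simp: bij_betw_def inv_into_into f_inv_into_f)
  have gh: "?g (h x) = x" "h x \<in> ?C" if "x \<in> carrier G" for x
    using h that by (auto simp: bij_betw_def)
  define K where "K = \<lparr>carrier = ?C, monoid.mult = (\<lambda>x y. h (?g x \<otimes>\<^bsub>G\<^esub> ?g y)), one = h \<one>\<^bsub>G\<^esub>\<rparr>"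
  have K: "carrier K = ?C" "\<And>x y. x \<otimes>\<^bsub>K\<^esub> y = h (?g x \<otimes>\<^bsub>G\<^esub> ?g y)" "\<one>\<^bsub>K\<^esub> = h \<one>\<^bsub>G\<^esub>"
    by (simp_all add: K_def)
  have "G \<cong> K"
    by (rule isomorphic_by_inverse[where f = h and g = ?g]) (auto intro!: homI simp: K gh g simp del: atLeastLessThan_iff)
  moreover have "monoid K"
    by (rule monoidI) (auto simp: K gh g G.m_assoc simp del: atLeastLessThan_iff)
  ultimately have "comm_group K \<and> G \<cong> K" using G.iso_imp_comm_group by blast
  then have "comm_group (iso_rep G) \<and> G \<cong> iso_rep G"
    unfolding iso_rep_def by (rule someI[where P = "\<lambda>K. comm_group K \<and> G \<cong> K"])
  then show "comm_group (iso_rep G)" "G \<cong> iso_rep G" by auto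
qed

lemma Surj_iff:
  "f \<in> Surj G H \<longleftrightarrow> f \<in> hom G H \<and> f ` carrier G = carrier H \<and> f \<in> extensional (carrier G)"
  by (auto simp: Surj_def epi_def)

lemma Surj_comp_iso:
  assumes "group G" "\<phi> \<in> iso G G'" "f \<in> Surj G' H"
  shows "restrict (\<lambda>x. f (\<phi> x)) (carrier G) \<in> Surj G H"
proof -
  interpret G: group G by fact
  have \<phi>: "\<phi> \<in> hom G G'" "\<phi> ` carrier G = carrier G'" using assms(2) by (auto simp: iso_def bij_betw_def)
  have f: "f \<in> hom G' H" "f ` carrier G' = carrier H" using assms(3) by (auto simp: Surj_iff)
  have "restrict (\<lambda>x. f (\<phi> x)) (carrier G) \<in> hom G H"
  proof (rule homI)
    show "restrict (\<lambda>x. f (\<phi> x)) (carrier G) x \<in> carrier H" if "x \<in> carrier G" for x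
      using that hom_in_carrier[OF f(1) hom_in_carrier[OF \<phi>(1) that]] by simp
    show "restrict (\<lambda>x. f (\<phi> x)) (carrier G) (x \<otimes>\<^bsub>G\<^esub> y) = restrict (\<lambda>x. f (\<phi> x)) (carrier G) x \<otimes>\<^bsub>H\<^esub> restrict (\<lambda>x. f (\<phi> x)) (carrier G) y"
      if "x \<in> carrier G" "y \<in> carrier G" for x y
      using that hom_mult[OF \<phi>(1) that] hom_mult[OF f(1)] hom_in_carrier[OF \<phi>(1)] by simp
  qed
  moreover have "restrict (\<lambda>x. f (\<phi> x)) (carrier G) ` carrier G = carrier H"
    unfolding f(2)[symmetric] \<phi>(2)[symmetric] by (simp add: image_image)
  ultimately show ?thesis by (simp add: Surj_iff)
qed

lemma card_Surj_iso:
  assumes "group G" "group G'" "G \<cong> G'"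
  shows "card (Surj G H) = card (Surj G' H)"
proof -
  obtain \<phi> where \<phi>: "\<phi> \<in> iso G G'" using assms(3) by (auto simp: is_iso_def)
  define \<psi> where "\<psi> = inv_into (carrier G) \<phi>"
  have \<psi>: "\<psi> \<in> iso G' G" unfolding \<psi>_def using assms(1) \<phi> by (rule group.iso_set_sym)
  have inv: "\<psi> (\<phi> x) = x" "\<phi> x \<in> carrier G'" if "x \<in> carrier G" for x
    using \<phi> that by (auto simp: \<psi>_def iso_def bij_betw_def)
  have inv': "\<phi> (\<psi> y) = y" "\<psi> y \<in> carrier G" if "y \<in> carrier G'" for y
    using \<phi> that by (auto simp: \<psi>_def iso_def bij_betw_def f_inv_into_f inv_into_into)
  have "bij_betw (\<lambda>f. restrict (\<lambda>x. f (\<psi> x)) (carrier G')) (Surj G H) (Surj G' H)"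
  proof (rule bij_betwI[where g = "\<lambda>f. restrict (\<lambda>x. f (\<phi> x)) (carrier G)"])
    show "(\<lambda>f. restrict (\<lambda>x. f (\<psi> x)) (carrier G')) \<in> Surj G H \<rightarrow> Surj G' H"
      using Surj_comp_iso[OF assms(2) \<psi>] by blast
    show "(\<lambda>f. restrict (\<lambda>x. f (\<phi> x)) (carrier G)) \<in> Surj G' H \<rightarrow> Surj G H"
      using Surj_comp_iso[OF assms(1) \<phi>] by blast
    show "restrict (\<lambda>x. restrict (\<lambda>x. f (\<psi> x)) (carrier G') (\<phi> x)) (carrier G) = f" if "f \<in> Surj G H" for f
      using that inv by (intro extensionalityI[of _ "carrier G"]) (auto simp: Surj_iff)
    show "restrict (\<lambda>x. restrict (\<lambda>x. f (\<phi> x)) (carrier G) (\<psi> x)) (carrier G') = f" if "f \<in> Surj G' H" for f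
      using that inv' by (intro extensionalityI[of _ "carrier G'"]) (auto simp: Surj_iff)
  qed
  then show ?thesis by (rule bij_betw_same_card)
qed

lemma carrier_diag_group: "l > 0 \<Longrightarrow> carrier (diag_group l I \<kappa>) = (\<Pi>\<^sub>E s\<in>I. {0..<int l ^ \<kappa> s})"
  by (simp add: diag_group_def carrier_integer_mod_group)

lemma mult_diag_group: "x \<otimes>\<^bsub>diag_group l I \<kappa>\<^esub> y = (\<lambda>s\<in>I. (x s + y s) mod int l ^ \<kappa> s)"
  by (simp add: diag_group_def)

lemma one_diag_group: "\<one>\<^bsub>diag_group l I \<kappa>\<^esub> = (\<lambda>s\<in>I. 0)"
  by (simp add: diag_group_def)

lemma comm_group_diag_group: "comm_group (diag_group l I \<kappa>)"
  unfolding diag_group_def by (intro comm_group_product_group) simp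

lemma pow_diag_group:
  "x \<in> carrier (diag_group l I \<kappa>) \<Longrightarrow> x [^]\<^bsub>diag_group l I \<kappa>\<^esub> (n::nat) = (\<lambda>s\<in>I. int n * x s mod int l ^ \<kappa> s)"
  unfolding diag_group_def by (subst product_group_nat_pow) simp_all

lemma finite_diag_group: "l > 0 \<Longrightarrow> finite I \<Longrightarrow> finite (carrier (diag_group l I \<kappa>))"
  by (simp add: carrier_diag_group finite_PiE)

context comm_group
begin

lemma pow_cong_single:
  assumes "g \<in> carrier G" "g [^] N = \<one>" "[a = b] (mod N)"
  shows "g [^] a = g [^] (b::int)"
proof -
  obtain k where "b = a + N * k" using assms(3) by (auto simp: cong_iff_lin)
  then show ?thesis using assms(1,2) by (simp add: int_pow_mult flip: int_pow_pow)
qed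

lemma lc_cong_single:
  assumes "h \<in> I \<rightarrow> carrier G" "\<And>p. p \<in> I \<Longrightarrow> h p [^] (N p :: int) = \<one>" "\<And>p. p \<in> I \<Longrightarrow> [x p = y p] (mod N p)"
  shows "lc G h x I = lc G h y I"
  unfolding lc_def using assms by (intro finprod_cong') (auto intro!: pow_cong_single simp: Pi_iff)

text \<open>A homomorphism is determined by the images of the unit vectors, which may be any
  elements killed by the respective \<open>l^(\<kappa> s)\<close>; its image is the subgroup that
  they generate.\<close>

lemma card_Surj_diag:
  assumes l: "l > 0" and I: "finite I"
  shows "card (Surj (diag_group l I \<kappa>) G) = card {h \<in> gens G I. \<forall>s\<in>I. h s [^] (int l ^ \<kappa> s) = \<one>}"
proof -
  let ?D = "diag_group l I \<kappa>" and ?N = "\<lambda>s. int l ^ \<kappa> s"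
  interpret D: comm_group ?D by (rule comm_group_diag_group)
  note car = carrier_diag_group[OF l, of I \<kappa>]
  have Np: "?N s > 0" for s using l by simp
  \<comment> \<open>The residue \<open>1 mod ?N s\<close> is taken because for
    \<open>\<kappa> s = 0\<close> the factor is trivial and \<open>1\<close> does not lie in its
    carrier.\<close>
  define E where "E s = (\<lambda>t\<in>I. if t = s then 1 mod ?N s else 0)" for s
  have E: "E s \<in> carrier ?D" for s using Np by (auto simp: E_def car)
  have Epow: "E s [^]\<^bsub>?D\<^esub> (n::nat) = (\<lambda>t\<in>I. if t = s then int n mod ?N s else 0)" for s n
    unfolding pow_diag_group[OF E] by (auto simp: E_def mod_mult_right_eq intro!: restrict_ext)
  have dec: "lc ?D E x I = x" if x: "x \<in> carrier ?D" for x
  proof -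
    have xb: "x t \<in> {0..<?N t}" if "t \<in> I" for t using PiE_mem[OF x[unfolded car] that] .
    have step: "finprod ?D (\<lambda>s. E s [^]\<^bsub>?D\<^esub> x s) J = (\<lambda>t\<in>I. if t \<in> J then x t else 0)" if "J \<subseteq> I" for J
      using finite_subset[OF that I] that
    proof (induction J rule: finite_induct)
      case empty
      then show ?case by (simp add: one_diag_group)
    next
      case (insert j J)
      have xj: "x j = int (nat (x j))" "x j mod ?N j = x j" using xb[of j] insert.prems by auto
      have "finprod ?D (\<lambda>s. E s [^]\<^bsub>?D\<^esub> x s) (insert j J) = E j [^]\<^bsub>?D\<^esub> x j \<otimes>\<^bsub>?D\<^esub> finprod ?D (\<lambda>s. E s [^]\<^bsub>?D\<^esub> x s) J"
        using insert E by (intro D.finprod_insert) auto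
      also have "finprod ?D (\<lambda>s. E s [^]\<^bsub>?D\<^esub> x s) J = (\<lambda>t\<in>I. if t \<in> J then x t else 0)"
        using insert.IH insert.prems by blast
      also have "E j [^]\<^bsub>?D\<^esub> x j = E j [^]\<^bsub>?D\<^esub> nat (x j)" using xj(1) int_pow_int by metis
      also have "\<dots> = (\<lambda>t\<in>I. if t = j then x j else 0)"
        unfolding Epow using xj by (auto intro!: restrict_ext)
      also have "(\<lambda>t\<in>I. if t = j then x j else 0) \<otimes>\<^bsub>?D\<^esub> (\<lambda>t\<in>I. if t \<in> J then x t else 0) = (\<lambda>t\<in>I. if t \<in> insert j J then x t else 0)"
        unfolding mult_diag_group using insert.hyps xb by (auto intro!: restrict_ext)
      finally show ?case .
    qed
    have "lc ?D E x I = (\<lambda>t\<in>I. if t \<in> I then x t else 0)" unfolding lc_def by (rule step) simp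
    also have "\<dots> = (\<lambda>t\<in>I. x t)" by (intro restrict_ext) simp
    also have "\<dots> = x" using x[unfolded car] by (intro extensional_restrict) (simp add: PiE_def)
    finally show ?thesis .
  qed
  define \<Phi> where "\<Phi> f = (\<lambda>s\<in>I. f (E s))" for f :: "(nat \<Rightarrow> int) \<Rightarrow> 'a"
  define \<Psi> where "\<Psi> h = (\<lambda>x\<in>carrier ?D. lc G h x I)" for h
  have f_lc: "f x = lc G (\<Phi> f) x I" if f: "f \<in> hom ?D G" and x: "x \<in> carrier ?D" for f x
  proof -
    have fE: "f (E s) \<in> carrier G" for s using hom_in_carrier[OF f E] .
    have "f x = f (finprod ?D (\<lambda>s. E s [^]\<^bsub>?D\<^esub> x s) I)" using dec[OF x] by (simp add: lc_def)
    also have "\<dots> = finprod G (\<lambda>s. f (E s [^]\<^bsub>?D\<^esub> x s)) I"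
      using E by (intro D.nat_finprod_hom[OF comm_group_axioms f I]) auto
    also have "\<dots> = lc G (\<Phi> f) x I"
      unfolding lc_def
      by (intro finprod_cong') (use hom_int_pow[OF f E D.is_group is_group] fE in \<open>auto simp: \<Phi>_def\<close>)
    finally show ?thesis .
  qed
  let ?S = "{h \<in> gens G I. \<forall>s\<in>I. h s [^] ?N s = \<one>}"
  have \<Psi>red: "\<exists>x'\<in>carrier ?D. lc G h x I = lc G h x' I"
    if "h \<in> I \<rightarrow> carrier G" "\<forall>s\<in>I. h s [^] ?N s = \<one>" for h x
  proof
    show "(\<lambda>t\<in>I. x t mod ?N t) \<in> carrier ?D" using Np by (auto simp: car)
    show "lc G h x I = lc G h (\<lambda>t\<in>I. x t mod ?N t) I"
      using that by (intro lc_cong_single[of h I ?N]) auto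
  qed
  have "bij_betw \<Phi> (Surj ?D G) ?S"
  proof (rule bij_betwI[where g = \<Psi>])
    show "\<Phi> \<in> Surj ?D G \<rightarrow> ?S"
    proof
      fix f assume "f \<in> Surj ?D G"
      then have f: "f \<in> hom ?D G" "f ` carrier ?D = carrier G" by (auto simp: Surj_iff)
      have P: "\<Phi> f \<in> I \<rightarrow>\<^sub>E carrier G" using hom_in_carrier[OF f(1) E] by (auto simp: \<Phi>_def)
      have pw: "\<Phi> f s [^] ?N s = \<one>" if s: "s \<in> I" for s
      proof -
        have "\<Phi> f s [^] ?N s = f (E s [^]\<^bsub>?D\<^esub> int (l ^ \<kappa> s))"
          using hom_int_pow[OF f(1) E D.is_group is_group] s by (simp add: \<Phi>_def)
        also have "E s [^]\<^bsub>?D\<^esub> int (l ^ \<kappa> s) = \<one>\<^bsub>?D\<^esub>"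
          unfolding int_pow_int Epow one_diag_group by (auto intro!: restrict_ext)
        finally show ?thesis using hom_one[OF f(1) D.is_group is_group] by simp
      qed
      have "carrier G \<subseteq> generate G (\<Phi> f ` I)"
      proof
        fix g assume "g \<in> carrier G"
        then obtain x where "x \<in> carrier ?D" "g = f x" using f(2) by blast
        then show "g \<in> generate G (\<Phi> f ` I)"
          using f_lc[OF f(1)] generate_eq_lc[OF I, of "\<Phi> f"] P by auto
      qed
      moreover have "generate G (\<Phi> f ` I) \<subseteq> carrier G" using P by (intro generate_incl) auto
      ultimately show "\<Phi> f \<in> ?S" using P pw by (auto simp: gens_def)
    qed
    show "\<Psi> \<in> ?S \<rightarrow> Surj ?D G"
    proof
      fix h assume h: "h \<in> ?S"
      then have hI: "h \<in> I \<rightarrow> carrier G" "\<forall>s\<in>I. h s [^] ?N s = \<one>" "generate G (h ` I) = carrier G"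
        by (auto simp: gens_def)
      have "\<Psi> h \<in> hom ?D G"
      proof (rule homI)
        show "\<Psi> h x \<in> carrier G" if "x \<in> carrier ?D" for x using that hI(1) by (simp add: \<Psi>_def lc_closed)
        show "\<Psi> h (x \<otimes>\<^bsub>?D\<^esub> y) = \<Psi> h x \<otimes> \<Psi> h y" if xy: "x \<in> carrier ?D" "y \<in> carrier ?D" for x y
        proof -
          have "lc G h (x \<otimes>\<^bsub>?D\<^esub> y) I = lc G h (\<lambda>t. x t + y t) I"
            using hI by (intro lc_cong_single[of h I ?N]) (auto simp: mult_diag_group)
          then show ?thesis using xy hI(1) by (simp add: \<Psi>_def lc_add)
        qed
      qed
      moreover have "\<Psi> h ` carrier ?D = carrier G"
      proof
        show "\<Psi> h ` carrier ?D \<subseteq> carrier G" using \<open>\<Psi> h \<in> hom ?D G\<close> by (auto simp: hom_def)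
        show "carrier G \<subseteq> \<Psi> h ` carrier ?D"
        proof
          fix g assume "g \<in> carrier G"
          then obtain x where "g = lc G h x I" using hI(3) generate_eq_lc[OF I hI(1)] by auto
          then obtain x' where "x' \<in> carrier ?D" "g = lc G h x' I" using \<Psi>red[OF hI(1,2)] by metis
          then show "g \<in> \<Psi> h ` carrier ?D" by (auto simp: \<Psi>_def)
        qed
      qed
      ultimately show "\<Psi> h \<in> Surj ?D G" by (simp add: Surj_iff \<Psi>_def)
    qed
    show "\<Psi> (\<Phi> f) = f" if "f \<in> Surj ?D G" for f
      using that f_lc by (intro extensionalityI[of _ "carrier ?D"]) (auto simp: \<Psi>_def Surj_iff)
    show "\<Phi> (\<Psi> h) = h" if h: "h \<in> ?S" for h
    proof (rule extensionalityI[of _ I])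
      have hI: "h \<in> I \<rightarrow> carrier G" "\<forall>s\<in>I. h s [^] ?N s = \<one>" using h by (auto simp: gens_def)
      show "h \<in> extensional I" using h by (auto simp: gens_def PiE_def)
      show "\<Phi> (\<Psi> h) s = h s" if s: "s \<in> I" for s
      proof -
        have "\<Phi> (\<Psi> h) s = lc G h (E s) I" using s E by (simp add: \<Phi>_def \<Psi>_def)
        also have "\<dots> = lc G h (\<lambda>p. if p = s then 1 else 0) I"
          using hI by (intro lc_cong_single[of h I ?N]) (auto simp: E_def)
        also have "\<dots> = h s" using lc_single[OF I s hI(1), of 1] int_pow_1[OF funcset_mem[OF hI(1) s]] by simp
        finally show ?thesis .
      qed
    qed (simp add: \<Phi>_def)
  qed
  then show ?thesis by (rule bij_betw_same_card)
qed

end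

section \<open>Torsion subgroups, in particular of diagonal groups\<close>

lemma carrier_ntors: "carrier (ntors n G) = {x \<in> carrier G. x [^]\<^bsub>G\<^esub> n = \<one>\<^bsub>G\<^esub>}"
  by (simp add: ntors_def)

lemma mult_ntors [simp]: "x \<otimes>\<^bsub>ntors n G\<^esub> y = x \<otimes>\<^bsub>G\<^esub> y" and one_ntors [simp]: "\<one>\<^bsub>ntors n G\<^esub> = \<one>\<^bsub>G\<^esub>"
  by (simp_all add: ntors_def)

lemma nat_pow_ntors [simp]: "x [^]\<^bsub>ntors n G\<^esub> (k::nat) = x [^]\<^bsub>G\<^esub> k"
  by (simp add: ntors_def nat_pow_def)

lemma (in comm_group) subgroup_ntors: "subgroup (carrier (ntors n G)) G"
proof (rule subgroupI)
  show "carrier (ntors n G) \<subseteq> carrier G" by (auto simp: carrier_ntors)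
  show "carrier (ntors n G) \<noteq> {}" using one_closed by (auto simp: carrier_ntors intro!: exI[of _ \<one>])
  show "inv a \<in> carrier (ntors n G)" if "a \<in> carrier (ntors n G)" for a
    using that by (simp add: carrier_ntors nat_pow_inv)
  show "a \<otimes> b \<in> carrier (ntors n G)" if "a \<in> carrier (ntors n G)" "b \<in> carrier (ntors n G)" for a b
    using that by (simp add: carrier_ntors nat_pow_distrib)
qed

lemma comm_group_ntors:
  assumes "comm_group G"
  shows "comm_group (ntors n G)"
proof -
  interpret G: comm_group G by fact
  have "ntors n G = G\<lparr>carrier := carrier (ntors n G)\<rparr>" by (simp add: ntors_def)
  then have "group (ntors n G)" using G.subgroup_imp_group[OF G.subgroup_ntors] by metis
  then show ?thesis by (rule group.group_comm_groupI) (auto simp: carrier_ntors G.m_comm)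
qed

lemma ntors_iso:
  assumes "group G" "group H" "G \<cong> H"
  shows "ntors n G \<cong> ntors n H"
proof -
  obtain \<phi> where \<phi>: "\<phi> \<in> iso G H" using assms(3) by (auto simp: is_iso_def)
  then have h: "\<phi> \<in> hom G H" and b: "bij_betw \<phi> (carrier G) (carrier H)" by (auto simp: iso_def)
  have pw: "\<phi> (x [^]\<^bsub>G\<^esub> n) = \<phi> x [^]\<^bsub>H\<^esub> n" if "x \<in> carrier G" for x
    using hom_nat_pow[OF h that assms(1,2)] .
  have one: "\<phi> \<one>\<^bsub>G\<^esub> = \<one>\<^bsub>H\<^esub>" using hom_one[OF h assms(1,2)] .
  interpret G: group G by fact
  have iff: "\<phi> x \<in> carrier (ntors n H) \<longleftrightarrow> x \<in> carrier (ntors n G)" if "x \<in> carrier G" for x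
  proof -
    have "\<phi> x [^]\<^bsub>H\<^esub> n = \<one>\<^bsub>H\<^esub> \<longleftrightarrow> x [^]\<^bsub>G\<^esub> n = \<one>\<^bsub>G\<^esub>"
      using inj_onD[OF bij_betw_imp_inj_on[OF b], of "x [^]\<^bsub>G\<^esub> n" "\<one>\<^bsub>G\<^esub>"] pw[OF that] one that by auto
    then show ?thesis using that bij_betw_apply[OF b that] by (simp add: carrier_ntors)
  qed
  have "\<phi> \<in> hom (ntors n G) (ntors n H)"
    using iff hom_mult[OF h] by (intro homI) (auto simp: carrier_ntors)
  moreover have "bij_betw \<phi> (carrier (ntors n G)) (carrier (ntors n H))"
  proof (rule bij_betw_imageI)
    show "inj_on \<phi> (carrier (ntors n G))"
      using bij_betw_imp_inj_on[OF b] by (rule inj_on_subset) (auto simp: carrier_ntors)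
    show "\<phi> ` carrier (ntors n G) = carrier (ntors n H)"
    proof (intro antisym subsetI)
      fix y assume "y \<in> \<phi> ` carrier (ntors n G)"
      then obtain x where x: "x \<in> carrier (ntors n G)" "y = \<phi> x" by blast
      then have "x \<in> carrier G" by (simp add: carrier_ntors)
      then show "y \<in> carrier (ntors n H)" using iff x by blast
    next
      fix y assume y: "y \<in> carrier (ntors n H)"
      then have "y \<in> \<phi> ` carrier G" unfolding bij_betw_imp_surj_on[OF b] by (simp add: carrier_ntors)
      then obtain x where "x \<in> carrier G" "y = \<phi> x" by blast
      then show "y \<in> \<phi> ` carrier (ntors n G)" using iff y by blast
    qed
  qed
  ultimately show ?thesis unfolding is_iso_def iso_def by blast
qed

text \<open>Among the residues modulo \<open>l^k\<close> those killed by \<open>l^a\<close> are the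
  multiples of \<open>l^(k - min k a)\<close>; dividing by this power identifies them with the
  residues modulo \<open>l^(min k a)\<close>.\<close>

lemma ntors_diag_group:
  assumes l: "l > 0"
  shows "diag_group l J (\<lambda>s. min (\<kappa> s) a) \<cong> ntors (l ^ a) (diag_group l J \<kappa>)"
proof -
  let ?A = "diag_group l J (\<lambda>s. min (\<kappa> s) a)" and ?D = "diag_group l J \<kappa>"
  let ?d = "\<lambda>s. int l ^ (\<kappa> s - min (\<kappa> s) a)" and ?m = "\<lambda>s. int l ^ min (\<kappa> s) a"
  have prod: "int l ^ \<kappa> s = ?d s * ?m s" for s by (simp flip: power_add)
  have dp: "?d s > 0" "?m s > 0" for s using l by auto
  define \<phi> where "\<phi> x = (\<lambda>s\<in>J. x s * ?d s)" for x :: "nat \<Rightarrow> int"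
  define \<psi> where "\<psi> y = (\<lambda>s\<in>J. y s div ?d s)" for y :: "nat \<Rightarrow> int"
  have dv: "int l ^ \<kappa> s dvd int (l ^ a) * t \<longleftrightarrow> ?d s dvd t" for s t
  proof (cases "\<kappa> s \<le> a")
    case True
    then have "int l ^ \<kappa> s dvd int (l ^ a)" by (simp add: le_imp_power_dvd)
    then show ?thesis using True by simp
  next
    case False
    then have "int l ^ \<kappa> s = int l ^ a * int l ^ (\<kappa> s - a)" by (simp flip: power_add)
    then show ?thesis using False l by simp
  qed
  have nt: "y \<in> carrier (ntors (l ^ a) ?D) \<longleftrightarrow> y \<in> carrier ?D \<and> (\<forall>s\<in>J. ?d s dvd y s)" for y
  proof -
    have "y [^]\<^bsub>?D\<^esub> (l ^ a) = \<one>\<^bsub>?D\<^esub> \<longleftrightarrow> (\<forall>s\<in>J. ?d s dvd y s)" if "y \<in> carrier ?D"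
    proof -
      have "y [^]\<^bsub>?D\<^esub> (l ^ a) = \<one>\<^bsub>?D\<^esub> \<longleftrightarrow> (\<forall>s\<in>J. int (l ^ a) * y s mod int l ^ \<kappa> s = 0)"
        unfolding pow_diag_group[OF that] one_diag_group by (auto simp: fun_eq_iff restrict_def)
      then show ?thesis using dv by (simp add: dvd_eq_mod_eq_0)
    qed
    then show ?thesis by (auto simp: carrier_ntors)
  qed
  show ?thesis
  proof (rule isomorphic_by_inverse[where f = \<phi> and g = \<psi>])
    have \<phi>c: "\<phi> x \<in> carrier ?D" if x: "x \<in> carrier ?A" for x
    proof -
      have "x s * ?d s \<in> {0..<int l ^ \<kappa> s}" if "s \<in> J" for s
      proof -
        have "x s \<in> {0..<?m s}" using x that by (simp add: carrier_diag_group[OF l] PiE_iff)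
        then show ?thesis using dp[of s] unfolding prod by (simp add: mult.commute)
      qed
      then show ?thesis unfolding carrier_diag_group[OF l] \<phi>_def by (intro PiE_I) simp_all
    qed
    show "\<phi> \<in> hom ?A (ntors (l ^ a) ?D)"
    proof (rule homI)
      show "\<phi> x \<in> carrier (ntors (l ^ a) ?D)" if "x \<in> carrier ?A" for x
        unfolding nt using \<phi>c[OF that] by (simp add: \<phi>_def)
      show "\<phi> (x \<otimes>\<^bsub>?A\<^esub> y) = \<phi> x \<otimes>\<^bsub>ntors (l ^ a) ?D\<^esub> \<phi> y" for x y
      proof -
        have "(t mod ?m s) * ?d s = (t * ?d s) mod int l ^ \<kappa> s" for t s
          unfolding prod by (simp add: mult_mod_right mult.commute)
        then show ?thesis by (auto simp: mult_diag_group \<phi>_def distrib_right intro!: restrict_ext)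
      qed
    qed
    show "\<psi> y \<in> carrier ?A" if y: "y \<in> carrier (ntors (l ^ a) ?D)" for y
    proof -
      have "y s div ?d s \<in> {0..<?m s}" if s: "s \<in> J" for s
      proof -
        obtain t where t: "y s = ?d s * t" using y s unfolding nt by (auto elim: dvdE)
        have "y s \<in> {0..<?d s * ?m s}" using y s unfolding nt carrier_diag_group[OF l] prod by (auto simp: PiE_iff)
        then have "0 \<le> t" "t < ?m s" using dp[of s] unfolding t by (simp_all add: zero_le_mult_iff)
        moreover have "y s div ?d s = t" unfolding t using l by (intro nonzero_mult_div_cancel_left) simp
        ultimately show ?thesis by simp
      qed
      then show ?thesis unfolding carrier_diag_group[OF l] \<psi>_def by (intro PiE_I) simp_all
    qed
    show "\<psi> (\<phi> x) = x" if "x \<in> carrier ?A" for x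
    proof (rule extensionalityI[of _ J])
      show "x \<in> extensional J" using that by (simp add: carrier_diag_group[OF l] PiE_def)
    qed (use l in \<open>simp_all add: \<psi>_def \<phi>_def\<close>)
    show "\<phi> (\<psi> y) = y" if y: "y \<in> carrier (ntors (l ^ a) ?D)" for y
    proof (rule extensionalityI[of _ J])
      show "y \<in> extensional J" using y unfolding nt by (simp add: carrier_diag_group[OF l] PiE_def)
      show "\<phi> (\<psi> y) s = y s" if "s \<in> J" for s using y that unfolding nt by (simp add: \<psi>_def \<phi>_def)
    qed (simp add: \<phi>_def)
  qed
qed

text \<open>Absorbs the extra cyclic summand of the odd case as one more coordinate, at the index
  that elimination leaves over.\<close>

lemma diag_group_insert:
  assumes l: "l > 0" and \<rho>: "\<rho> \<notin> J"
  shows "diag_group l J \<kappa> \<times>\<times> integer_mod_group (l ^ a) \<cong> diag_group l (insert \<rho> J) (\<kappa>(\<rho> := a))"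
proof (rule isomorphic_by_inverse[where f = "\<lambda>(x, t). \<lambda>s\<in>insert \<rho> J. if s = \<rho> then t else x s"
      and g = "\<lambda>y. (restrict y J, y \<rho>)"])
  let ?D = "diag_group l (insert \<rho> J) (\<kappa>(\<rho> := a))" and ?A = "diag_group l J \<kappa> \<times>\<times> integer_mod_group (l ^ a)"
  note car = carrier_diag_group[OF l]
  have carZ: "carrier (integer_mod_group (l ^ a)) = {0..<int l ^ a}" using l by (simp add: carrier_integer_mod_group)
  have ne: "s \<noteq> \<rho>" if "s \<in> J" for s using that \<rho> by auto
  show "(\<lambda>(x, t). \<lambda>s\<in>insert \<rho> J. if s = \<rho> then t else x s) \<in> hom ?A ?D"
  proof (rule homI)
    show "(case p of (x, t) \<Rightarrow> \<lambda>s\<in>insert \<rho> J. if s = \<rho> then t else x s) \<in> carrier ?D" if "p \<in> carrier ?A" for p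
      using that ne by (auto simp: car carZ PiE_iff split: if_splits)
    show "(case p \<otimes>\<^bsub>?A\<^esub> q of (x, t) \<Rightarrow> \<lambda>s\<in>insert \<rho> J. if s = \<rho> then t else x s)
      = (case p of (x, t) \<Rightarrow> \<lambda>s\<in>insert \<rho> J. if s = \<rho> then t else x s) \<otimes>\<^bsub>?D\<^esub>
        (case q of (x, t) \<Rightarrow> \<lambda>s\<in>insert \<rho> J. if s = \<rho> then t else x s)" for p q
      using ne by (cases p; cases q) (auto simp: mult_diag_group intro!: restrict_ext)
  qed
  show "(restrict y J, y \<rho>) \<in> carrier ?A" if y: "y \<in> carrier ?D" for y
  proof -
    have "y s \<in> {0..<int l ^ (\<kappa>(\<rho> := a)) s}" if "s \<in> insert \<rho> J" for s
      using PiE_mem[OF y[unfolded car] that] .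
    then have "y \<rho> \<in> {0..<int l ^ a}" "\<And>s. s \<in> J \<Longrightarrow> y s \<in> {0..<int l ^ \<kappa> s}" using ne by force+
    then show ?thesis by (simp add: car carZ)
  qed
  show "(restrict (case p of (x, t) \<Rightarrow> \<lambda>s\<in>insert \<rho> J. if s = \<rho> then t else x s) J,
      (case p of (x, t) \<Rightarrow> \<lambda>s\<in>insert \<rho> J. if s = \<rho> then t else x s) \<rho>) = p" if "p \<in> carrier ?A" for p
  proof -
    obtain x t where p: "p = (x, t)" by (cases p)
    have "restrict (\<lambda>s\<in>insert \<rho> J. if s = \<rho> then t else x s) J = x"
      using that ne p by (intro extensionalityI[of _ J]) (auto simp: car PiE_def)
    then show ?thesis by (simp add: p)
  qed
  show "(case (restrict y J, y \<rho>) of (x, t) \<Rightarrow> \<lambda>s\<in>insert \<rho> J. if s = \<rho> then t else x s) = y" if "y \<in> carrier ?D" for y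
    using that by (intro extensionalityI[of _ "insert \<rho> J"]) (auto simp: car PiE_def)
qed

section \<open>Primary decomposition\<close>

context comm_group
begin

lemma expo_nat_iff: "expo G (int n) \<longleftrightarrow> (\<forall>x\<in>carrier G. x [^] n = \<one>)"
  by (simp add: expo_def int_pow_int)

lemma in_ntors_iff: "x \<in> carrier (ntors n G) \<longleftrightarrow> x \<in> carrier G \<and> x [^] (int n) = \<one>"
  by (simp add: carrier_ntors int_pow_int)

lemma expo_dvd: "expo G N \<Longrightarrow> N dvd k \<Longrightarrow> x \<in> carrier G \<Longrightarrow> x [^] k = \<one>"
  using expo_cong[of N x k 0] by (simp add: cong_0_iff)

lemma pow_ntors_closed:
  assumes "expo G (int (a * b))" "x \<in> carrier G"
  shows "x [^] (k * int b) \<in> carrier (ntors a G)"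
proof -
  have "(x [^] (k * int b)) [^] int a = x [^] (k * int b * int a)" using assms(2) by (simp add: int_pow_pow)
  also have "\<dots> = \<one>" using assms by (intro expo_dvd[of "int (a * b)"]) auto
  finally show ?thesis using assms(2) by (simp add: in_ntors_iff)
qed

lemma pow_ntors_cong:
  "x \<in> carrier (ntors a G) \<Longrightarrow> [k = k'] (mod int a) \<Longrightarrow> x [^] k = x [^] (k'::int)"
  by (intro pow_cong_single[of x "int a"]) (simp_all add: in_ntors_iff)

lemma pow_split:
  assumes "s * int a + t * int b = 1" "x \<in> carrier G"
  shows "x [^] (t * int b) \<otimes> x [^] (s * int a) = x"
proof -
  have "x [^] (t * int b) \<otimes> x [^] (s * int a) = x [^] (t * int b + s * int a)"
    using assms(2) by (simp add: int_pow_mult)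
  then show ?thesis using assms by (simp add: add.commute int_pow_1)
qed

end

lemma bezout_cong:
  fixes a b s t :: int
  assumes "s * a + t * b = 1"
  shows "[t * b = 1] (mod a)" "[s * a = 0] (mod a)" "[s * a = 1] (mod b)" "[t * b = 0] (mod b)"
proof -
  have "t * b - 1 = a * (- s)" "s * a - 1 = b * (- t)" using assms by (auto simp: algebra_simps)
  then show "[t * b = 1] (mod a)" "[s * a = 1] (mod b)" by (metis cong_iff_dvd_diff dvd_triv_left)+
  show "[s * a = 0] (mod a)" "[t * b = 0] (mod b)" by (simp_all add: cong_0_iff)
qed

text \<open>Taking powers by \<open>t * b\<close> and \<open>s * a\<close>, from a Bezout identity,
  projects onto the \<open>a\<close>-torsion and the \<open>b\<close>-torsion. A surjection amounts
  to its two restrictions; each of these is onto because projecting a preimage gives a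
  preimage.\<close>

lemma card_Surj_coprime:
  assumes "comm_group G" "comm_group H" "expo G (int (a * b))" "expo H (int (a * b))" "coprime a b"
  shows "card (Surj G H) = card (Surj (ntors a G) (ntors a H)) * card (Surj (ntors b G) (ntors b H))"
proof -
  interpret G: comm_group G by fact
  interpret H: comm_group H by fact
  obtain s t where st: "s * int a + t * int b = 1"
    using bezout_int[of "int a" "int b"] assms(5) by auto
  note bc = bezout_cong[OF st]
  have exG: "expo G (int (b * a))" "expo H (int (b * a))" using assms(3,4) by (simp_all add: mult.commute)
  let ?i = "t * int b" and ?j = "s * int a"
  have Ga: "x [^]\<^bsub>G\<^esub> ?i \<in> carrier (ntors a G)" "x [^]\<^bsub>G\<^esub> ?j \<in> carrier (ntors b G)" if "x \<in> carrier G" for x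
    using G.pow_ntors_closed assms(3) exG that by blast+
  have Ha: "x [^]\<^bsub>H\<^esub> ?i \<in> carrier (ntors a H)" "x [^]\<^bsub>H\<^esub> ?j \<in> carrier (ntors b H)" if "x \<in> carrier H" for x
    using H.pow_ntors_closed assms(4) exG that by blast+
  have Gid: "x [^]\<^bsub>G\<^esub> ?i = x" "x [^]\<^bsub>G\<^esub> ?j = \<one>\<^bsub>G\<^esub>" if "x \<in> carrier (ntors a G)" for x
    using G.pow_ntors_cong[OF that bc(1)] G.pow_ntors_cong[OF that bc(2)] that by (simp_all add: carrier_ntors G.int_pow_1)
  have Gid': "x [^]\<^bsub>G\<^esub> ?j = x" "x [^]\<^bsub>G\<^esub> ?i = \<one>\<^bsub>G\<^esub>" if "x \<in> carrier (ntors b G)" for x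
    using G.pow_ntors_cong[OF that bc(3)] G.pow_ntors_cong[OF that bc(4)] that by (simp_all add: carrier_ntors G.int_pow_1)
  have Hid: "x [^]\<^bsub>H\<^esub> ?i = x" "x [^]\<^bsub>H\<^esub> ?j = \<one>\<^bsub>H\<^esub>" if "x \<in> carrier (ntors a H)" for x
    using H.pow_ntors_cong[OF that bc(1)] H.pow_ntors_cong[OF that bc(2)] that by (simp_all add: carrier_ntors H.int_pow_1)
  have Hid': "x [^]\<^bsub>H\<^esub> ?j = x" "x [^]\<^bsub>H\<^esub> ?i = \<one>\<^bsub>H\<^esub>" if "x \<in> carrier (ntors b H)" for x
    using H.pow_ntors_cong[OF that bc(3)] H.pow_ntors_cong[OF that bc(4)] that by (simp_all add: carrier_ntors H.int_pow_1)
  have sub: "carrier (ntors n G) \<subseteq> carrier G" "carrier (ntors n H) \<subseteq> carrier H" for n by (auto simp: carrier_ntors)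
  have restr: "restrict f (carrier (ntors n G)) \<in> Surj (ntors n G) (ntors n H)"
    if f: "f \<in> Surj G H" and n: "\<And>y. y \<in> carrier (ntors n H) \<Longrightarrow> y [^]\<^bsub>H\<^esub> k = y" "\<And>x. x \<in> carrier G \<Longrightarrow> x [^]\<^bsub>G\<^esub> k \<in> carrier (ntors n G)"
    for f n and k :: int
  proof -
    have fh: "f \<in> hom G H" "f ` carrier G = carrier H" using f by (auto simp: Surj_iff)
    have mem: "f x \<in> carrier (ntors n H)" if "x \<in> carrier (ntors n G)" for x
      using that hom_in_carrier[OF fh(1), of x] hom_nat_pow[OF fh(1) _ G.is_group H.is_group, of x n]
        hom_one[OF fh(1) G.is_group H.is_group] by (simp add: carrier_ntors)
    have "restrict f (carrier (ntors n G)) \<in> hom (ntors n G) (ntors n H)"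
    proof (rule homI)
      show "restrict f (carrier (ntors n G)) x \<in> carrier (ntors n H)" if "x \<in> carrier (ntors n G)" for x
        using mem[OF that] that by simp
      show "restrict f (carrier (ntors n G)) (x \<otimes>\<^bsub>ntors n G\<^esub> y)
          = restrict f (carrier (ntors n G)) x \<otimes>\<^bsub>ntors n H\<^esub> restrict f (carrier (ntors n G)) y"
        if xy: "x \<in> carrier (ntors n G)" "y \<in> carrier (ntors n G)" for x y
        using xy sub hom_mult[OF fh(1), of x y] subgroup.m_closed[OF G.subgroup_ntors xy] by auto
    qed
    moreover have "restrict f (carrier (ntors n G)) ` carrier (ntors n G) = carrier (ntors n H)"
    proof
      show "restrict f (carrier (ntors n G)) ` carrier (ntors n G) \<subseteq> carrier (ntors n H)" using mem by auto
      show "carrier (ntors n H) \<subseteq> restrict f (carrier (ntors n G)) ` carrier (ntors n G)"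
      proof
        fix y assume y: "y \<in> carrier (ntors n H)"
        then have "y \<in> f ` carrier G" using fh(2) sub by blast
        then obtain x where x: "x \<in> carrier G" "y = f x" by blast
        have "f (x [^]\<^bsub>G\<^esub> k) = y" using hom_int_pow[OF fh(1) x(1) G.is_group H.is_group] x(2) n(1)[OF y] by simp
        then show "y \<in> restrict f (carrier (ntors n G)) ` carrier (ntors n G)"
          using n(2)[OF x(1)] by (intro image_eqI[of _ _ "x [^]\<^bsub>G\<^esub> k"]) simp_all
      qed
    qed
    ultimately show ?thesis by (simp add: Surj_iff)
  qed
  define F where "F f = (restrict f (carrier (ntors a G)), restrict f (carrier (ntors b G)))" for f :: "'a \<Rightarrow> 'c"
  define E where "E p = (\<lambda>x\<in>carrier G. fst p (x [^]\<^bsub>G\<^esub> ?i) \<otimes>\<^bsub>H\<^esub> snd p (x [^]\<^bsub>G\<^esub> ?j))" for p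
  have "bij_betw F (Surj G H) (Surj (ntors a G) (ntors a H) \<times> Surj (ntors b G) (ntors b H))"
  proof (rule bij_betwI[where g = E])
    show "F \<in> Surj G H \<rightarrow> Surj (ntors a G) (ntors a H) \<times> Surj (ntors b G) (ntors b H)"
    proof
      fix f assume f: "f \<in> Surj G H"
      have "restrict f (carrier (ntors a G)) \<in> Surj (ntors a G) (ntors a H)"
        by (rule restr[OF f Hid(1) Ga(1)])
      moreover have "restrict f (carrier (ntors b G)) \<in> Surj (ntors b G) (ntors b H)"
        by (rule restr[OF f Hid'(1) Ga(2)])
      ultimately show "F f \<in> Surj (ntors a G) (ntors a H) \<times> Surj (ntors b G) (ntors b H)" by (simp add: F_def)
    qed
    show "E \<in> Surj (ntors a G) (ntors a H) \<times> Surj (ntors b G) (ntors b H) \<rightarrow> Surj G H"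
    proof
      fix p assume "p \<in> Surj (ntors a G) (ntors a H) \<times> Surj (ntors b G) (ntors b H)"
      then obtain f g where p: "p = (f, g)" "f \<in> Surj (ntors a G) (ntors a H)" "g \<in> Surj (ntors b G) (ntors b H)" by auto
      then have f: "f \<in> hom (ntors a G) (ntors a H)" "f ` carrier (ntors a G) = carrier (ntors a H)"
        and g: "g \<in> hom (ntors b G) (ntors b H)" "g ` carrier (ntors b G) = carrier (ntors b H)"
        by (auto simp: Surj_iff)
      have f1: "f \<one>\<^bsub>G\<^esub> = \<one>\<^bsub>H\<^esub>" "g \<one>\<^bsub>G\<^esub> = \<one>\<^bsub>H\<^esub>"
        using hom_one[OF f(1)] hom_one[OF g(1)] comm_group_ntors[OF assms(1)] comm_group_ntors[OF assms(2)]
        by (simp_all add: comm_group.axioms(2))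
      have fc: "f (x [^]\<^bsub>G\<^esub> ?i) \<in> carrier H" "g (x [^]\<^bsub>G\<^esub> ?j) \<in> carrier H" if "x \<in> carrier G" for x
        using hom_in_carrier[OF f(1) Ga(1)[OF that]] hom_in_carrier[OF g(1) Ga(2)[OF that]] sub by blast+
      have "E p \<in> hom G H"
      proof (rule homI)
        show "E p x \<in> carrier H" if "x \<in> carrier G" for x using fc[OF that] that by (simp add: E_def p(1))
        show "E p (x \<otimes>\<^bsub>G\<^esub> y) = E p x \<otimes>\<^bsub>H\<^esub> E p y" if xy: "x \<in> carrier G" "y \<in> carrier G" for x y
        proof -
          have "f ((x \<otimes>\<^bsub>G\<^esub> y) [^]\<^bsub>G\<^esub> ?i) = f (x [^]\<^bsub>G\<^esub> ?i) \<otimes>\<^bsub>H\<^esub> f (y [^]\<^bsub>G\<^esub> ?i)"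
            using hom_mult[OF f(1) Ga(1)[OF xy(1)] Ga(1)[OF xy(2)]] xy by (simp add: G.int_pow_distrib)
          moreover have "g ((x \<otimes>\<^bsub>G\<^esub> y) [^]\<^bsub>G\<^esub> ?j) = g (x [^]\<^bsub>G\<^esub> ?j) \<otimes>\<^bsub>H\<^esub> g (y [^]\<^bsub>G\<^esub> ?j)"
            using hom_mult[OF g(1) Ga(2)[OF xy(1)] Ga(2)[OF xy(2)]] xy by (simp add: G.int_pow_distrib)
          ultimately show ?thesis using fc[OF xy(1)] fc[OF xy(2)] xy by (simp add: E_def p(1) H.m_ac)
        qed
      qed
      moreover have "E p ` carrier G = carrier H"
      proof
        show "E p ` carrier G \<subseteq> carrier H" using \<open>E p \<in> hom G H\<close> by (auto simp: hom_def)
        show "carrier H \<subseteq> E p ` carrier G"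
        proof
          fix y assume y: "y \<in> carrier H"
          have "y [^]\<^bsub>H\<^esub> ?i \<in> f ` carrier (ntors a G)" unfolding f(2) by (rule Ha(1)[OF y])
          then obtain x1 where x1: "x1 \<in> carrier (ntors a G)" "y [^]\<^bsub>H\<^esub> ?i = f x1" by blast
          have "y [^]\<^bsub>H\<^esub> ?j \<in> g ` carrier (ntors b G)" unfolding g(2) by (rule Ha(2)[OF y])
          then obtain x2 where x2: "x2 \<in> carrier (ntors b G)" "y [^]\<^bsub>H\<^esub> ?j = g x2" by blast
          have xc: "x1 \<in> carrier G" "x2 \<in> carrier G" using x1 x2 sub by blast+
          have "(x1 \<otimes>\<^bsub>G\<^esub> x2) [^]\<^bsub>G\<^esub> ?i = x1" "(x1 \<otimes>\<^bsub>G\<^esub> x2) [^]\<^bsub>G\<^esub> ?j = x2"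
            using xc Gid[OF x1(1)] Gid'[OF x2(1)] by (simp_all add: G.int_pow_distrib)
          then have "E p (x1 \<otimes>\<^bsub>G\<^esub> x2) = y"
            using xc x1(2) x2(2) H.pow_split[OF st y] by (simp add: E_def p(1))
          then show "y \<in> E p ` carrier G" using xc by (intro image_eqI[of _ _ "x1 \<otimes>\<^bsub>G\<^esub> x2"]) simp_all
        qed
      qed
      ultimately show "E p \<in> Surj G H" by (simp add: Surj_iff E_def)
    qed
    show "E (F f) = f" if f: "f \<in> Surj G H" for f
    proof (rule extensionalityI[of _ "carrier G"])
      have fh: "f \<in> hom G H" using f by (simp add: Surj_iff)
      show "f \<in> extensional (carrier G)" using f by (simp add: Surj_iff)
      show "E (F f) x = f x" if x: "x \<in> carrier G" for x
        using hom_mult[OF fh, of "x [^]\<^bsub>G\<^esub> ?i" "x [^]\<^bsub>G\<^esub> ?j"] Ga[OF x] G.pow_split[OF st x] x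
        by (simp add: E_def F_def)
    qed (simp add: E_def)
    show "F (E p) = p" if p: "p \<in> Surj (ntors a G) (ntors a H) \<times> Surj (ntors b G) (ntors b H)" for p
    proof -
      obtain f g where fg: "p = (f, g)" "f \<in> Surj (ntors a G) (ntors a H)" "g \<in> Surj (ntors b G) (ntors b H)" using p by auto
      then have f: "f \<in> hom (ntors a G) (ntors a H)" "f \<in> extensional (carrier (ntors a G))"
        and g: "g \<in> hom (ntors b G) (ntors b H)" "g \<in> extensional (carrier (ntors b G))"
        by (auto simp: Surj_iff)
      have f1: "f \<one>\<^bsub>G\<^esub> = \<one>\<^bsub>H\<^esub>" "g \<one>\<^bsub>G\<^esub> = \<one>\<^bsub>H\<^esub>"
        using hom_one[OF f(1)] hom_one[OF g(1)] comm_group_ntors[OF assms(1)] comm_group_ntors[OF assms(2)]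
        by (simp_all add: comm_group.axioms(2))
      have "restrict (E p) (carrier (ntors a G)) = f"
      proof (rule extensionalityI[OF _ f(2)])
        show "restrict (E p) (carrier (ntors a G)) x = f x" if x: "x \<in> carrier (ntors a G)" for x
          using x sub hom_in_carrier[OF f(1) x] Gid[OF x] f1 by (auto simp: E_def fg(1) carrier_ntors)
      qed simp
      moreover have "restrict (E p) (carrier (ntors b G)) = g"
      proof (rule extensionalityI[OF _ g(2)])
        show "restrict (E p) (carrier (ntors b G)) x = g x" if x: "x \<in> carrier (ntors b G)" for x
          using x sub hom_in_carrier[OF g(1) x] Gid'[OF x] f1 by (auto simp: E_def fg(1) carrier_ntors)
      qed simp
      ultimately show ?thesis by (simp add: F_def fg(1))
    qed
  qed
  then have "card (Surj G H) = card (Surj (ntors a G) (ntors a H) \<times> Surj (ntors b G) (ntors b H))"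
    by (rule bij_betw_same_card)
  then show ?thesis by (simp add: card_cartesian_product)
qed

context comm_group
begin

lemma lc_ntors:
  assumes "finite I" "h \<in> I \<rightarrow> carrier (ntors a G)"
  shows "lc (ntors a G) h x I = lc G h x I"
  using assms
proof (induction I rule: finite_induct)
  interpret N: comm_group "ntors a G" by (rule comm_group_ntors) unfold_locales
  case empty
  then show ?case by (simp add: lc_def)
next
  interpret N: comm_group "ntors a G" by (rule comm_group_ntors) unfold_locales
  case (insert i I)
  have hG: "h \<in> insert i I \<rightarrow> carrier G" using insert.prems by (auto simp: carrier_ntors)
  have eq: "ntors a G = G\<lparr>carrier := carrier (ntors a G)\<rparr>" by (simp add: ntors_def)
  have "h i [^]\<^bsub>ntors a G\<^esub> x i = h i [^] x i"
    using int_pow_consistent[OF subgroup_ntors, of "h i" a "x i"] insert.prems eq by auto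
  moreover have "lc (ntors a G) h x I = lc G h x I" using insert by auto
  ultimately show ?case
    using N.lc_insert[OF insert.hyps insert.prems, of x] lc_insert[OF insert.hyps hG, of x] by simp
qed

lemma lc_pow: "finite I \<Longrightarrow> h \<in> I \<rightarrow> carrier G \<Longrightarrow> lc G (\<lambda>p. h p [^] (k::int)) x I = lc G h x I [^] k"
proof -
  assume I: "finite I" and h: "h \<in> I \<rightarrow> carrier G"
  have "lc G (\<lambda>p. h p [^] k) x I = lc G h (\<lambda>p. k * x p) I"
    unfolding lc_def using h by (intro finprod_cong') (auto simp: Pi_iff int_pow_pow)
  then show ?thesis using lc_scale[OF I h] by simp
qed

text \<open>Rather than decomposing the symmetric square, this compares the counts of
  \<open>card_Sym2\<close> for one tuple and for its two projections. The ambient groups split as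
  products, and so do the images of the alternating matrices, by the Chinese remainder theorem for
  their entries.\<close>

lemma card_Sym2_coprime:
  assumes fin: "finite (carrier G)" and ex: "expo G (int (a * b))" and ab: "coprime a b"
  shows "card (carrier (Sym2 G)) = card (carrier (Sym2 (ntors a G))) * card (carrier (Sym2 (ntors b G)))"
proof -
  obtain s t where st: "s * int a + t * int b = 1"
    using bezout_int[of "int a" "int b"] ab by auto
  note bc = bezout_cong[OF st]
  have ex': "expo G (int (b * a))" using ex by (simp add: mult.commute)
  let ?i = "t * int b" and ?j = "s * int a" and ?A = "ntors a G" and ?B = "ntors b G"
  interpret A: comm_group ?A by (rule comm_group_ntors) unfold_locales
  interpret B: comm_group ?B by (rule comm_group_ntors) unfold_locales
  have subA: "carrier ?A \<subseteq> carrier G" and subB: "carrier ?B \<subseteq> carrier G" by (auto simp: carrier_ntors)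
  have pa: "x [^] ?i \<in> carrier ?A" "x [^] ?j \<in> carrier ?B" if "x \<in> carrier G" for x
    using pow_ntors_closed ex ex' that by blast+
  have ida: "x [^] ?i = x" "x [^] ?j = \<one>" if "x \<in> carrier ?A" for x
    using pow_ntors_cong[OF that bc(1)] pow_ntors_cong[OF that bc(2)] that by (simp_all add: carrier_ntors int_pow_1)
  have idb: "x [^] ?j = x" "x [^] ?i = \<one>" if "x \<in> carrier ?B" for x
    using pow_ntors_cong[OF that bc(3)] pow_ntors_cong[OF that bc(4)] that by (simp_all add: carrier_ntors int_pow_1)
  let ?n = "card (carrier G)"
  \<comment> \<open>The tuple enumerates all of \<open>G\<close>, so its projections run through
    both torsion subgroups and all three tuples generate.\<close>
  obtain h where h: "bij_betw h {0..<?n} (carrier G)" using ex_bij_betw_nat_finite[OF fin] by blast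
  let ?I = "{0..<?n}"
  have hI: "h \<in> ?I \<rightarrow> carrier G" and him: "h ` ?I = carrier G" using h by (auto simp: bij_betw_def)
  define ha where "ha = (\<lambda>p. h p [^] ?i)"
  define hb where "hb = (\<lambda>p. h p [^] ?j)"
  have haI: "ha \<in> ?I \<rightarrow> carrier ?A" and hbI: "hb \<in> ?I \<rightarrow> carrier ?B"
    using pa hI by (auto simp: ha_def hb_def)
  have ima: "ha ` ?I = carrier ?A"
  proof
    show "ha ` ?I \<subseteq> carrier ?A" using haI by blast
    show "carrier ?A \<subseteq> ha ` ?I"
    proof
      fix y assume y: "y \<in> carrier ?A"
      then have "y \<in> h ` ?I" unfolding him using subA by blast
      then obtain p where "p \<in> ?I" "y = h p" by blast
      then show "y \<in> ha ` ?I" using ida(1)[OF y] by (intro image_eqI[of _ _ p]) (simp_all add: ha_def)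
    qed
  qed
  have imb: "hb ` ?I = carrier ?B"
  proof
    show "hb ` ?I \<subseteq> carrier ?B" using hbI by blast
    show "carrier ?B \<subseteq> hb ` ?I"
    proof
      fix y assume y: "y \<in> carrier ?B"
      then have "y \<in> h ` ?I" unfolding him using subB by blast
      then obtain p where "p \<in> ?I" "y = h p" by blast
      then show "y \<in> hb ` ?I" using idb(1)[OF y] by (intro image_eqI[of _ _ p]) (simp_all add: hb_def)
    qed
  qed
  have gen: "generate G (h ` ?I) = carrier G"
    unfolding him by (intro antisym generate_incl) (auto intro: generate.incl)
  have gena: "generate ?A (ha ` ?I) = carrier ?A"
    unfolding ima by (intro antisym A.generate_incl) (auto intro: generate.incl)
  have genb: "generate ?B (hb ` ?I) = carrier ?B"
    unfolding imb by (intro antisym B.generate_incl) (auto intro: generate.incl)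
  have finA: "finite (carrier ?A)" "finite (carrier ?B)" using fin subA subB finite_subset by blast+
  have rva: "rel_vec ?A ?I ha C q = rel_vec G ?I h C q [^] ?i" "rel_vec ?B ?I hb C q = rel_vec G ?I h C q [^] ?j"
    if "q \<in> ?I" for C q
    using that lc_ntors[OF _ haI] lc_ntors[OF _ hbI] lc_pow[OF _ hI]
    by (simp_all add: rel_vec_def ha_def hb_def)
  have rvc: "rel_vec G ?I h C q \<in> carrier G" if "q \<in> ?I" for C q using that hI by (simp add: rel_vec_def lc_closed)
  define \<Theta> where "\<Theta> w = (\<lambda>q\<in>?I. w q [^] ?i, \<lambda>q\<in>?I. w q [^] ?j)" for w
  have \<Theta>rv: "\<Theta> (rel_vec G ?I h C) = (rel_vec ?A ?I ha C, rel_vec ?B ?I hb C)" for C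
  proof -
    have "(\<lambda>q\<in>?I. rel_vec G ?I h C q [^] ?i) = rel_vec ?A ?I ha C"
      by (rule extensionalityI[of _ ?I]) (use rva in \<open>simp_all add: rel_vec_def\<close>)
    moreover have "(\<lambda>q\<in>?I. rel_vec G ?I h C q [^] ?j) = rel_vec ?B ?I hb C"
      by (rule extensionalityI[of _ ?I]) (use rva in \<open>simp_all add: rel_vec_def\<close>)
    ultimately show ?thesis by (simp add: \<Theta>_def)
  qed
  have exA: "expo ?A (int a)" "expo ?B (int b)"
    by (simp_all add: A.expo_nat_iff B.expo_nat_iff carrier_ntors)
  have "bij_betw \<Theta> (alt_image G ?I h) (alt_image ?A ?I ha \<times> alt_image ?B ?I hb)"
  proof (rule bij_betw_imageI)
    show "inj_on \<Theta> (alt_image G ?I h)"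
    proof (rule inj_onI)
      fix v w assume vw: "v \<in> alt_image G ?I h" "w \<in> alt_image G ?I h" "\<Theta> v = \<Theta> w"
      have e1: "(\<lambda>q\<in>?I. v q [^] ?i) = (\<lambda>q\<in>?I. w q [^] ?i)" "(\<lambda>q\<in>?I. v q [^] ?j) = (\<lambda>q\<in>?I. w q [^] ?j)"
        using vw(3) by (simp_all add: \<Theta>_def)
      obtain C C' where C: "v = rel_vec G ?I h C" "w = rel_vec G ?I h C'" using vw by (auto simp: alt_image_def)
      show "v = w"
      proof (rule extensionalityI[of _ ?I])
        show "v q = w q" if q: "q \<in> ?I" for q
        proof -
          have eq: "v q [^] ?i = w q [^] ?i" "v q [^] ?j = w q [^] ?j"
            using fun_cong[OF e1(1), of q] fun_cong[OF e1(2), of q] q by simp_all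
          have c: "v q \<in> carrier G" "w q \<in> carrier G" unfolding C by (rule rvc[OF q])+
          have "v q = v q [^] ?i \<otimes> v q [^] ?j" by (rule pow_split[OF st c(1), symmetric])
          also have "\<dots> = w q [^] ?i \<otimes> w q [^] ?j" by (rule arg_cong2[OF eq])
          also have "\<dots> = w q" by (rule pow_split[OF st c(2)])
          finally show ?thesis .
        qed
      qed (simp_all add: C rel_vec_def)
    qed
    show "\<Theta> ` alt_image G ?I h = alt_image ?A ?I ha \<times> alt_image ?B ?I hb"
    proof (intro antisym subsetI)
      fix p assume "p \<in> \<Theta> ` alt_image G ?I h"
      then show "p \<in> alt_image ?A ?I ha \<times> alt_image ?B ?I hb"
        using \<Theta>rv by (auto simp: alt_image_def)
    next
      fix p assume "p \<in> alt_image ?A ?I ha \<times> alt_image ?B ?I hb"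
      then obtain C D where CD: "alt_int ?I C" "alt_int ?I D" "p = (rel_vec ?A ?I ha C, rel_vec ?B ?I hb D)"
        by (auto simp: alt_image_def)
      \<comment> \<open>Congruent to \<open>C\<close> modulo \<open>a\<close> and to
        \<open>D\<close> modulo \<open>b\<close>, and still alternating.\<close>
      define F where "F p q = ?i * C p q + ?j * D p q" for p q
      have "alt_int ?I F"
      proof -
        have "F p q + F q p = ?i * (C p q + C q p) + ?j * (D p q + D q p)" for p q
          by (simp add: F_def algebra_simps)
        then show ?thesis using CD(1,2) by (simp add: alt_int_def F_def)
      qed
      have ca: "[?i * c + ?j * d = c] (mod int a)" "[?i * c + ?j * d = d] (mod int b)" for c d
      proof -
        have "[?i * c + ?j * d = 1 * c + 0 * d] (mod int a)" using bc by (intro cong_add cong_scalar_right)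
        then show "[?i * c + ?j * d = c] (mod int a)" by simp
        have "[?i * c + ?j * d = 0 * c + 1 * d] (mod int b)" using bc by (intro cong_add cong_scalar_right)
        then show "[?i * c + ?j * d = d] (mod int b)" by simp
      qed
      have "rel_vec ?A ?I ha F = rel_vec ?A ?I ha C"
        by (rule A.rel_vec_cong[OF exA(1) haI]) (simp add: F_def ca)
      moreover have "rel_vec ?B ?I hb F = rel_vec ?B ?I hb D"
        by (rule B.rel_vec_cong[OF exA(2) hbI]) (simp add: F_def ca)
      ultimately have "p = \<Theta> (rel_vec G ?I h F)" by (simp add: \<Theta>rv CD(3))
      then show "p \<in> \<Theta> ` alt_image G ?I h" using \<open>alt_int ?I F\<close> by (auto simp: alt_image_def)
    qed
  qed
  then have im: "card (alt_image G ?I h) = card (alt_image ?A ?I ha) * card (alt_image ?B ?I hb)"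
    by (simp add: bij_betw_same_card card_cartesian_product)
  have "bij_betw (\<lambda>x. (x [^] ?i, x [^] ?j)) (carrier G) (carrier ?A \<times> carrier ?B)"
  proof (rule bij_betwI[where g = "\<lambda>(x, y). x \<otimes> y"])
    show "(case (x [^] ?i, x [^] ?j) of (x, y) \<Rightarrow> x \<otimes> y) = x" if "x \<in> carrier G" for x
      using pow_split[OF st that] by simp
    show "((case p of (x, y) \<Rightarrow> x \<otimes> y) [^] ?i, (case p of (x, y) \<Rightarrow> x \<otimes> y) [^] ?j) = p"
      if pc: "p \<in> carrier ?A \<times> carrier ?B" for p
    proof -
      obtain x y where p: "p = (x, y)" "x \<in> carrier ?A" "y \<in> carrier ?B" using pc by blast
      then have "x \<in> carrier G" "y \<in> carrier G" using subA subB by blast+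
      then show ?thesis using p ida[OF p(2)] idb[OF p(3)] by (simp add: int_pow_distrib)
    qed
    show "(\<lambda>x. (x [^] ?i, x [^] ?j)) \<in> carrier G \<rightarrow> carrier ?A \<times> carrier ?B" by (intro funcsetI SigmaI pa)
    show "(\<lambda>(x, y). x \<otimes> y) \<in> carrier ?A \<times> carrier ?B \<rightarrow> carrier G"
      by (intro funcsetI) (clarify, intro m_closed subsetD[OF subA] subsetD[OF subB])
  qed
  then have n: "?n = card (carrier ?A) * card (carrier ?B)"
    by (simp add: bij_betw_same_card card_cartesian_product)
  have "card (carrier (Sym2 G)) * card (alt_image G ?I h) = ?n ^ ?n"
    using card_Sym2[OF fin _ hI gen] by simp
  also have "\<dots> = card (carrier ?A) ^ ?n * card (carrier ?B) ^ ?n"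
    using n by (metis power_mult_distrib)
  also have "\<dots> = (card (carrier (Sym2 ?A)) * card (alt_image ?A ?I ha)) * (card (carrier (Sym2 ?B)) * card (alt_image ?B ?I hb))"
    using A.card_Sym2[OF finA(1) _ haI gena] B.card_Sym2[OF finA(2) _ hbI genb] by simp
  also have "\<dots> = card (carrier (Sym2 ?A)) * card (carrier (Sym2 ?B)) * card (alt_image G ?I h)"
    by (simp add: im)
  finally show ?thesis
    using finite_alt_image[OF _ fin hI] alt_image_nonempty[of ?I h] by (simp add: card_gt_0_iff)
qed

end

text \<open>An equality of records and not only an isomorphism, so it can be used for rewriting
  inside the primary components.\<close>

lemma ntors_ntors: "n dvd k \<Longrightarrow> comm_group G \<Longrightarrow> ntors n (ntors k G) = ntors n G"
proof -
  assume nk: "n dvd k" and G: "comm_group G"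
  interpret G: comm_group G by fact
  obtain j where "k = n * j" using nk by (auto elim: dvdE)
  then have "x [^]\<^bsub>G\<^esub> k = \<one>\<^bsub>G\<^esub>" if "x \<in> carrier G" "x [^]\<^bsub>G\<^esub> n = \<one>\<^bsub>G\<^esub>" for x
    using that G.nat_pow_pow[of x n j] by simp
  then have "carrier (ntors n (ntors k G)) = carrier (ntors n G)" by (auto simp: carrier_ntors)
  then show ?thesis by (simp add: ntors_def)
qed

text \<open>Prime powers are split off one at a time; by \<open>ntors_ntors\<close> the components
  of the remaining part are those of the original group. The empty product forces exponent 1, hence
  trivial groups and the value 1 everywhere.\<close>

lemma primary_decomposition:
  fixes e :: "nat \<Rightarrow> nat"
  assumes "finite P" "\<And>l. l \<in> P \<Longrightarrow> prime l"
    and "comm_group G" "comm_group H" "expo G (int (\<Prod>l\<in>P. l ^ e l))" "expo H (int (\<Prod>l\<in>P. l ^ e l))" "finite (carrier H)"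
  shows "card (Surj G H) = (\<Prod>l\<in>P. card (Surj (ntors (l ^ e l) G) (ntors (l ^ e l) H)))"
    and "card (carrier (Sym2 H)) = (\<Prod>l\<in>P. card (carrier (Sym2 (ntors (l ^ e l) H))))"
proof -
  have "card (Surj G H) = (\<Prod>l\<in>P. card (Surj (ntors (l ^ e l) G) (ntors (l ^ e l) H))) \<and>
    card (carrier (Sym2 H)) = (\<Prod>l\<in>P. card (carrier (Sym2 (ntors (l ^ e l) H))))"
    using assms
  proof (induction P arbitrary: G H rule: finite_induct)
    case empty
    interpret G: comm_group G by fact
    interpret H: comm_group H by fact
    have G1: "carrier G = {\<one>\<^bsub>G\<^esub>}" and H1: "carrier H = {\<one>\<^bsub>H\<^esub>}"
      using empty by (auto simp: expo_def G.int_pow_1 H.int_pow_1)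
    have "Surj G H = {\<lambda>x\<in>carrier G. \<one>\<^bsub>H\<^esub>}"
    proof (intro antisym subsetI)
      fix f assume "f \<in> Surj G H"
      then have f: "f ` carrier G = carrier H" "f \<in> extensional (carrier G)" by (auto simp: Surj_iff)
      have "f x = \<one>\<^bsub>H\<^esub>" if "x \<in> carrier G" for x using f(1) that H1 by blast
      then have "f = (\<lambda>x\<in>carrier G. \<one>\<^bsub>H\<^esub>)" using f(2) by (intro extensionalityI[of _ "carrier G"]) auto
      then show "f \<in> {\<lambda>x\<in>carrier G. \<one>\<^bsub>H\<^esub>}" by simp
    next
      fix f assume "f \<in> {\<lambda>x\<in>carrier G. \<one>\<^bsub>H\<^esub>}"
      then show "f \<in> Surj G H" using G1 H1 by (auto simp: Surj_iff hom_def)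
    qed
    \<comment> \<open>The empty tuple generates the trivial group, so \<open>card_Sym2\<close>
      applies with an empty index set.\<close>
    moreover have "card (carrier (Sym2 H)) = 1"
    proof -
      have "generate H ({} :: 'c set) = carrier H" using H1 by (simp add: H.generate_empty)
      then have "card (carrier (Sym2 H)) * card (alt_image H {} (\<lambda>_. \<one>\<^bsub>H\<^esub>)) = 1"
        using H.card_Sym2[of "{}" "\<lambda>_. \<one>\<^bsub>H\<^esub>"] empty by simp
      then show ?thesis by simp
    qed
    ultimately show ?case by simp
  next
    case (insert p P)
    interpret G: comm_group G by fact
    interpret H: comm_group H by fact
    let ?a = "p ^ e p" and ?b = "\<Prod>l\<in>P. l ^ e l"
    have pp: "prime p" using insert.prems by simp
    have co: "coprime ?a ?b"
    proof (rule prod_coprime_right)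
      fix l assume l: "l \<in> P"
      then have "p \<noteq> l" "prime l" using insert by auto
      then show "coprime ?a (l ^ e l)" using pp primes_coprime[of p l] by simp
    qed
    have ex: "expo G (int (?a * ?b))" "expo H (int (?a * ?b))" using insert.prems(4,5) insert.hyps by simp_all
    have dv: "l ^ e l dvd ?b" if "l \<in> P" for l using that insert.hyps(1) by (rule dvd_prodI[rotated])
    have IH: "card (Surj (ntors ?b G) (ntors ?b H)) = (\<Prod>l\<in>P. card (Surj (ntors (l ^ e l) (ntors ?b G)) (ntors (l ^ e l) (ntors ?b H)))) \<and>
      card (carrier (Sym2 (ntors ?b H))) = (\<Prod>l\<in>P. card (carrier (Sym2 (ntors (l ^ e l) (ntors ?b H)))))"
    proof (rule insert.IH)
      show cG: "comm_group (ntors ?b G)" and cH: "comm_group (ntors ?b H)" using comm_group_ntors insert.prems by blast+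
      show "expo (ntors ?b G) (int ?b)" "expo (ntors ?b H) (int ?b)"
        by (simp_all add: comm_group.expo_nat_iff[OF cG] comm_group.expo_nat_iff[OF cH] carrier_ntors del: of_nat_prod of_nat_power)
      show "finite (carrier (ntors ?b H))" using insert.prems by (simp add: carrier_ntors)
    qed (use insert.prems in auto)
    have nn: "ntors (l ^ e l) (ntors ?b G) = ntors (l ^ e l) G" "ntors (l ^ e l) (ntors ?b H) = ntors (l ^ e l) H" if "l \<in> P" for l
      using ntors_ntors[OF dv[OF that]] insert.prems(2,3) by blast+
    have "card (Surj G H) = card (Surj (ntors ?a G) (ntors ?a H)) * card (Surj (ntors ?b G) (ntors ?b H))"
      by (rule card_Surj_coprime[OF insert.prems(2,3) ex co])
    moreover have "card (carrier (Sym2 H)) = card (carrier (Sym2 (ntors ?a H))) * card (carrier (Sym2 (ntors ?b H)))"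
      by (rule H.card_Sym2_coprime[OF insert.prems(6) ex(2) co])
    ultimately show ?case using IH insert.hyps nn by (simp cong: prod.cong)
  qed
  then show "card (Surj G H) = (\<Prod>l\<in>P. card (Surj (ntors (l ^ e l) G) (ntors (l ^ e l) H)))"
    "card (carrier (Sym2 H)) = (\<Prod>l\<in>P. card (carrier (Sym2 (ntors (l ^ e l) H))))" by auto
qed

section \<open>The moments of the Selmer distributions\<close>

lemma pow_min_iff:
  assumes "comm_group H" "expo H (int l ^ a)" "g \<in> carrier H"
  shows "g [^]\<^bsub>H\<^esub> (int l ^ min k a) = \<one>\<^bsub>H\<^esub> \<longleftrightarrow> g [^]\<^bsub>H\<^esub> (int l ^ k) = \<one>\<^bsub>H\<^esub>"
proof (cases "k \<le> a")
  case False
  interpret H: comm_group H by fact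
  have "int l ^ a dvd int l ^ min k a" "int l ^ a dvd int l ^ k" using False by (auto intro: le_imp_power_dvd)
  then show ?thesis using H.expo_dvd[OF assms(2) _ assms(3)] by simp
qed (simp add: min_def)

text \<open>The component at \<open>l\<close> of the random group for both parities. For
  \<open>r = 0\<close> the second factor is the trivial group of residues modulo 1 (modulus 0 would
  give the integers), so that both cases share one type and one proof.\<close>

definition Sel_comp :: "nat \<Rightarrow> nat \<Rightarrow> nat \<Rightarrow> nat monoid \<Rightarrow> (nat \<times> int) monoid" where
  "Sel_comp r l a K = ntors (l ^ a) K \<times>\<times> integer_mod_group (if r = 0 then 1 else l ^ a)"

lemma comm_group_DirProd:
  assumes "comm_group G" "comm_group H"
  shows "comm_group (G \<times>\<times> H)"
proof (rule group.group_comm_groupI)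
  interpret G: comm_group G by fact
  interpret H: comm_group H by fact
  show "group (G \<times>\<times> H)" by (intro DirProd_group G.is_group H.is_group)
  show "x \<otimes>\<^bsub>G \<times>\<times> H\<^esub> y = y \<otimes>\<^bsub>G \<times>\<times> H\<^esub> x" if "x \<in> carrier (G \<times>\<times> H)" "y \<in> carrier (G \<times>\<times> H)" for x y
    using that by (auto simp: G.m_comm H.m_comm)
qed

lemma DirProd_iso:
  assumes "group G" "G \<cong> G'" "H \<cong> H'"
  shows "G \<times>\<times> H \<cong> G' \<times>\<times> H'"
proof -
  obtain f g where "f \<in> iso G G'" "g \<in> iso H H'" using assms(2,3) by (auto simp: is_iso_def)
  then show ?thesis using group.DirProd_iso_set_trans[OF assms(1)] unfolding is_iso_def by blast
qed

lemma DirProd_trivial_iso: "group G \<Longrightarrow> G \<times>\<times> integer_mod_group 1 \<cong> G"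
proof (rule isomorphic_by_inverse[where f = fst and g = "\<lambda>x. (x, 0)"])
  have c: "carrier (integer_mod_group 1) = {0}" by (auto simp: carrier_integer_mod_group)
  show "fst \<in> hom (G \<times>\<times> integer_mod_group 1) G" by (auto simp: hom_def)
  show "(y, 0) \<in> carrier (G \<times>\<times> integer_mod_group 1)" if "y \<in> carrier G" for y using that by simp
  show "(fst x, 0) = x" if "x \<in> carrier (G \<times>\<times> integer_mod_group 1)" for x
    using that c by (cases x) simp
qed simp

text \<open>Truncating at \<open>l^a\<close> does not affect maps to a group killed by
  \<open>l^a\<close>, so \<open>min (\<kappa> s) a\<close> may be replaced by
  \<open>\<kappa> s\<close>. For \<open>r = 1\<close> the summand of order \<open>l^a\<close> stands
  in for the free part of the cokernel: a coordinate at \<open>\<rho>\<close> whose condition holds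
  automatically in \<open>H\<close>.\<close>

lemma card_Surj_Sel_comp:
  assumes l: "prime l" and r: "r \<le> 1"
    and H: "comm_group H" "expo H (int l ^ a)" and R: "R \<subseteq> {..<m}" "card R = r"
  shows "card (Surj (Sel_comp r l a (iso_rep (diag_group l ({..<m} - R) \<kappa>))) H) =
    card {h \<in> gens H {..<m}. \<forall>s\<in>{..<m} - R. h s [^]\<^bsub>H\<^esub> (int l ^ \<kappa> s) = \<one>\<^bsub>H\<^esub>}"
proof -
  interpret H: comm_group H by fact
  have l0: "l > 0" using l by (simp add: prime_gt_0_nat)
  let ?J = "{..<m} - R" and ?D = "diag_group l ({..<m} - R) \<kappa>"
  let ?K = "iso_rep ?D" and ?A = "diag_group l ({..<m} - R) (\<lambda>s. min (\<kappa> s) a)"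
  have K: "comm_group ?K" "?D \<cong> ?K"
    using iso_rep_finite[OF comm_group_diag_group finite_diag_group[OF l0]] by auto
  have gr: "group ?D" "group ?K" "group ?A" "group (ntors (l ^ a) ?D)" "group (ntors (l ^ a) ?K)"
    using comm_group_diag_group K(1) by (simp_all add: comm_group.axioms(2) comm_group_ntors)
  have "?A \<cong> ntors (l ^ a) ?K"
    using ntors_diag_group[OF l0] ntors_iso[OF gr(1,2) K(2)] by (rule iso_trans)
  then have iso: "ntors (l ^ a) ?K \<cong> ?A" using gr(3) by (rule group.iso_sym[rotated])
  have gZ: "group (integer_mod_group n)" for n by simp
  have gS: "group (Sel_comp r l a ?K)" unfolding Sel_comp_def by (intro DirProd_group gr gZ)
  have gens: "h s \<in> carrier H" if "h \<in> gens H {..<m}" "s < m" for h s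
    using that by (auto simp: gens_def)
  show ?thesis
  proof (cases "r = 0")
    case True
    then have R0: "R = {}" using R finite_subset by fastforce
    have "Sel_comp r l a ?K \<cong> ntors (l ^ a) ?K"
      unfolding Sel_comp_def using True DirProd_trivial_iso[OF gr(5)] by simp
    then have "Sel_comp r l a ?K \<cong> ?A" using iso iso_trans by blast
    then have "card (Surj (Sel_comp r l a ?K) H) = card (Surj ?A H)" by (rule card_Surj_iso[OF gS gr(3)])
    also have "\<dots> = card {h \<in> gens H ?J. \<forall>s\<in>?J. h s [^]\<^bsub>H\<^esub> (int l ^ min (\<kappa> s) a) = \<one>\<^bsub>H\<^esub>}"
      by (rule H.card_Surj_diag[OF l0]) simp
    also have "{h \<in> gens H ?J. \<forall>s\<in>?J. h s [^]\<^bsub>H\<^esub> (int l ^ min (\<kappa> s) a) = \<one>\<^bsub>H\<^esub>}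
        = {h \<in> gens H {..<m}. \<forall>s\<in>?J. h s [^]\<^bsub>H\<^esub> (int l ^ \<kappa> s) = \<one>\<^bsub>H\<^esub>}"
      using gens pow_min_iff[OF H] by (auto simp: R0)
    finally show ?thesis .
  next
    case False
    then have "card R = 1" using r R by simp
    then obtain \<rho> where \<rho>: "R = {\<rho>}" by (auto simp: card_1_singleton_iff)
    have J: "insert \<rho> ?J = {..<m}" "\<rho> \<notin> ?J" using R \<rho> by auto
    let ?k = "(\<lambda>s. min (\<kappa> s) a)(\<rho> := a)"
    let ?B = "diag_group l (insert \<rho> ?J) ?k"
    have "Sel_comp r l a ?K \<cong> ?A \<times>\<times> integer_mod_group (l ^ a)"
      unfolding Sel_comp_def using False by (simp add: DirProd_iso[OF gr(5) iso] iso_refl)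
    also have "?A \<times>\<times> integer_mod_group (l ^ a) \<cong> ?B" by (rule diag_group_insert[OF l0 J(2)])
    finally have "Sel_comp r l a ?K \<cong> ?B" .
    moreover have "group ?B" using comm_group_diag_group by (auto intro: comm_group.axioms(2))
    ultimately have "card (Surj (Sel_comp r l a ?K) H) = card (Surj ?B H)" using card_Surj_iso[OF gS] by blast
    also have "\<dots> = card {h \<in> gens H (insert \<rho> ?J). \<forall>s\<in>insert \<rho> ?J. h s [^]\<^bsub>H\<^esub> (int l ^ ?k s) = \<one>\<^bsub>H\<^esub>}"
      by (rule H.card_Surj_diag[OF l0]) simp
    also have "{h \<in> gens H (insert \<rho> ?J). \<forall>s\<in>insert \<rho> ?J. h s [^]\<^bsub>H\<^esub> (int l ^ ?k s) = \<one>\<^bsub>H\<^esub>}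
        = {h \<in> gens H {..<m}. \<forall>s\<in>?J. h s [^]\<^bsub>H\<^esub> (int l ^ \<kappa> s) = \<one>\<^bsub>H\<^esub>}"
    proof -
      have "(\<forall>s\<in>insert \<rho> ?J. h s [^]\<^bsub>H\<^esub> (int l ^ ?k s) = \<one>\<^bsub>H\<^esub>) \<longleftrightarrow> (\<forall>s\<in>?J. h s [^]\<^bsub>H\<^esub> (int l ^ \<kappa> s) = \<one>\<^bsub>H\<^esub>)"
        if h: "h \<in> gens H {..<m}" for h
      proof -
        have "\<rho> < m" using J(1) by blast
        then have "h \<rho> [^]\<^bsub>H\<^esub> (int l ^ a) = \<one>\<^bsub>H\<^esub>" using H(2) gens[OF h] by (simp add: expo_def)
        moreover have "h s [^]\<^bsub>H\<^esub> (int l ^ ?k s) = \<one>\<^bsub>H\<^esub> \<longleftrightarrow> h s [^]\<^bsub>H\<^esub> (int l ^ \<kappa> s) = \<one>\<^bsub>H\<^esub>" if "s \<in> ?J" for s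
        proof -
          have "s \<noteq> \<rho>" using J(2) that by blast
          then show ?thesis using pow_min_iff[OF H gens[OF h]] that by simp
        qed
        then have "(\<forall>s\<in>?J. h s [^]\<^bsub>H\<^esub> (int l ^ ?k s) = \<one>\<^bsub>H\<^esub>) \<longleftrightarrow> (\<forall>s\<in>?J. h s [^]\<^bsub>H\<^esub> (int l ^ \<kappa> s) = \<one>\<^bsub>H\<^esub>)"
          by (intro ball_cong refl)
        ultimately show ?thesis unfolding ball_simps(7) by simp
      qed
      then show ?thesis unfolding J(1) by blast
    qed
    finally show ?thesis .
  qed
qed

lemma T_lim_Sel_comp:
  assumes "prime l" "r \<le> 1" "comm_group H" "finite (carrier H)" "expo H (int l ^ a)"
  shows "(\<integral>\<^sup>+K. ennreal (real (card (Surj (Sel_comp r l a K) H))) \<partial>measure_pmf (T_lim r l))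
     = ennreal (real (card (carrier (Sym2 H))))"
  by (rule T_lim_moment[OF assms]) (rule card_Surj_Sel_comp[OF assms(1-3,5)])

lemma T_lim_support_group:
  assumes "prime l" "r \<le> 1" "K \<in> set_pmf (T_lim r l)"
  shows "comm_group K" "finite (carrier K)" "\<exists>N. \<forall>x\<in>carrier K. x [^]\<^bsub>K\<^esub> (l ^ N) = \<one>\<^bsub>K\<^esub>"
proof -
  have l0: "l > 0" using assms(1) by (simp add: prime_gt_0_nat)
  obtain J \<kappa> where J: "finite J" "K = iso_rep (diag_group l J \<kappa>)" by (rule T_lim_support[OF assms])
  let ?D = "diag_group l J \<kappa>"
  have K: "comm_group K" "?D \<cong> K"
    using iso_rep_finite[OF comm_group_diag_group finite_diag_group[OF l0 J(1)]] J(2) by auto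
  then obtain \<phi> where \<phi>: "\<phi> \<in> iso ?D K" by (auto simp: is_iso_def)
  then have h: "\<phi> \<in> hom ?D K" and im: "\<phi> ` carrier ?D = carrier K" by (auto simp: iso_def bij_betw_def)
  show "comm_group K" by fact
  show "finite (carrier K)" unfolding im[symmetric] using finite_diag_group[OF l0 J(1)] by simp
  let ?N = "\<Sum>s\<in>J. \<kappa> s"
  have gr: "group ?D" "group K" using comm_group_diag_group K(1) by (auto intro: comm_group.axioms(2))
  have "y [^]\<^bsub>?D\<^esub> (l ^ ?N) = \<one>\<^bsub>?D\<^esub>" if "y \<in> carrier ?D" for y
  proof -
    have "int l ^ \<kappa> s dvd int (l ^ ?N)" if "s \<in> J" for s
      using member_le_sum[OF that, of \<kappa>] J(1) by (simp add: le_imp_power_dvd)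
    then have "int l ^ \<kappa> s dvd int (l ^ ?N) * y s" if "s \<in> J" for s using that by (meson dvd_mult2)
    then show ?thesis unfolding pow_diag_group[OF that] one_diag_group by (intro restrict_ext) (simp add: dvd_eq_mod_eq_0)
  qed
  then have "\<phi> y [^]\<^bsub>K\<^esub> (l ^ ?N) = \<one>\<^bsub>K\<^esub>" if "y \<in> carrier ?D" for y
    using hom_nat_pow[OF h that gr, of "l ^ ?N"] hom_one[OF h gr] that by simp
  then show "\<exists>N. \<forall>x\<in>carrier K. x [^]\<^bsub>K\<^esub> (l ^ N) = \<one>\<^bsub>K\<^esub>" unfolding im[symmetric] by blast
qed

lemma (in group) coprime_pow_eq_one:
  assumes "x \<in> carrier G" "x [^] (a::nat) = \<one>" "x [^] (b::nat) = \<one>" "coprime a b"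
  shows "x = \<one>"
proof -
  obtain s t where "s * int a + t * int b = 1"
    using bezout_int[of "int a" "int b"] assms(4) by auto
  then have "x = x [^] (int a * s + int b * t)" using assms(1) by (simp add: int_pow_1 mult.commute)
  also have "\<dots> = (x [^] int a) [^] s \<otimes> (x [^] int b) [^] t"
    using assms(1) by (simp add: int_pow_mult int_pow_pow)
  also have "\<dots> = \<one>" using assms(2,3) by (simp add: int_pow_int)
  finally show ?thesis .
qed

text \<open>The factors at primes other than \<open>p\<close> contain no element killed by
  \<open>p^a\<close> except the unit, since their elements are killed by powers of another prime. In
  the factor at \<open>p\<close>, being killed by \<open>\<nu>\<close> follows from being killed by
  \<open>p^a\<close>.\<close>

lemma ntors_product_iso:
  assumes P: "finite P" "p \<in> P" "\<And>l. l \<in> P \<Longrightarrow> prime l" and \<nu>: "p ^ a dvd \<nu>"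
    and T: "\<And>l. l \<in> P \<Longrightarrow> comm_group (T l)"
      "\<And>l. l \<in> P \<Longrightarrow> \<exists>N. \<forall>x\<in>carrier (T l). x [^]\<^bsub>T l\<^esub> (l ^ N) = \<one>\<^bsub>T l\<^esub>"
  shows "ntors (p ^ a) (product_group P (\<lambda>l. ntors \<nu> (T l))) \<cong> ntors (p ^ a) (T p)"
proof (rule isomorphic_by_inverse[where f = "\<lambda>x. x p" and g = "\<lambda>t. \<lambda>l\<in>P. if l = p then t else \<one>\<^bsub>T l\<^esub>"])
  let ?X = "product_group P (\<lambda>l. ntors \<nu> (T l))"
  have pow: "x [^]\<^bsub>?X\<^esub> (n::nat) = (\<lambda>l\<in>P. x l [^]\<^bsub>T l\<^esub> n)" if "x \<in> carrier ?X" for x n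
    unfolding product_group_nat_pow[OF that] by simp
  have memX: "x \<in> carrier (ntors (p ^ a) ?X) \<longleftrightarrow> x \<in> carrier ?X \<and> (\<forall>l\<in>P. x l [^]\<^bsub>T l\<^esub> (p ^ a) = \<one>\<^bsub>T l\<^esub>)" for x
  proof -
    have "x [^]\<^bsub>?X\<^esub> (p ^ a) = \<one>\<^bsub>?X\<^esub> \<longleftrightarrow> (\<forall>l\<in>P. x l [^]\<^bsub>T l\<^esub> (p ^ a) = \<one>\<^bsub>T l\<^esub>)" if "x \<in> carrier ?X"
      unfolding pow[OF that] by (auto simp: fun_eq_iff restrict_def)
    then show ?thesis by (auto simp: carrier_ntors)
  qed
  have memc: "x l \<in> carrier (T l)" if "x \<in> carrier ?X" "l \<in> P" for x l
    using that by (auto simp: PiE_iff carrier_ntors)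
  have xp: "x p \<in> carrier (ntors (p ^ a) (T p))" if "x \<in> carrier (ntors (p ^ a) ?X)" for x
    using that memX memc P(2) by (auto simp: carrier_ntors[of _ "T p"])
  show "(\<lambda>x. x p) \<in> hom (ntors (p ^ a) ?X) (ntors (p ^ a) (T p))"
    using xp P(2) by (intro homI) auto
  show "(\<lambda>l\<in>P. if l = p then t else \<one>\<^bsub>T l\<^esub>) \<in> carrier (ntors (p ^ a) ?X)" if t: "t \<in> carrier (ntors (p ^ a) (T p))" for t
  proof -
    interpret Tp: comm_group "T p" using T(1) P(2) .
    obtain j where j: "\<nu> = p ^ a * j" using \<nu> by (auto elim: dvdE)
    have tp: "t \<in> carrier (T p)" "t [^]\<^bsub>T p\<^esub> (p ^ a) = \<one>\<^bsub>T p\<^esub>" using t by (auto simp: carrier_ntors)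
    then have tn: "t [^]\<^bsub>T p\<^esub> \<nu> = \<one>\<^bsub>T p\<^esub>" using Tp.nat_pow_pow[OF tp(1), of "p ^ a" j] j by simp
    have one: "\<one>\<^bsub>T l\<^esub> \<in> carrier (T l)" "\<one>\<^bsub>T l\<^esub> [^]\<^bsub>T l\<^esub> (n::nat) = \<one>\<^bsub>T l\<^esub>" if "l \<in> P" for l n
    proof -
      interpret Tl: comm_group "T l" using T(1) that .
      show "\<one>\<^bsub>T l\<^esub> \<in> carrier (T l)" "\<one>\<^bsub>T l\<^esub> [^]\<^bsub>T l\<^esub> (n::nat) = \<one>\<^bsub>T l\<^esub>" by simp_all
    qed
    have "(\<lambda>l\<in>P. if l = p then t else \<one>\<^bsub>T l\<^esub>) \<in> carrier ?X"
      using tp tn one by (auto simp: carrier_ntors)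
    then show ?thesis unfolding memX using tp one by auto
  qed
  show "(\<lambda>l\<in>P. if l = p then x p else \<one>\<^bsub>T l\<^esub>) = x" if x: "x \<in> carrier (ntors (p ^ a) ?X)" for x
  proof (rule extensionalityI[of _ P])
    have xX: "x \<in> carrier ?X" using x memX by blast
    then show "x \<in> extensional P" by (auto simp: PiE_def)
    show "(\<lambda>l\<in>P. if l = p then x p else \<one>\<^bsub>T l\<^esub>) l = x l" if l: "l \<in> P" for l
    proof (cases "l = p")
      case False
      interpret Tl: comm_group "T l" using T(1) l .
      obtain N where "x l [^]\<^bsub>T l\<^esub> (l ^ N) = \<one>\<^bsub>T l\<^esub>" using T(2)[OF l] memc[OF xX l] by blast
      moreover have "x l [^]\<^bsub>T l\<^esub> (p ^ a) = \<one>\<^bsub>T l\<^esub>" using x memX l by blast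
      moreover have "coprime (l ^ N) (p ^ a)" using primes_coprime[OF P(3)[OF l] P(3)[OF P(2)] False] by simp
      ultimately have "x l = \<one>\<^bsub>T l\<^esub>" using Tl.coprime_pow_eq_one[OF memc[OF xX l]] by blast
      then show ?thesis using False l by simp
    qed (use l in simp)
  qed simp
  show "(\<lambda>l\<in>P. if l = p then t else \<one>\<^bsub>T l\<^esub>) p = t" for t using P(2) by simp
qed

lemma ntors_integer_mod_group:
  assumes "n > 0" "n dvd \<nu>" "\<nu> > 0"
  shows "ntors n (integer_mod_group \<nu>) \<cong> integer_mod_group n"
proof -
  obtain q where q: "\<nu> = n * q" using assms(2) by (auto elim: dvdE)
  have q0: "q > 0" using q assms(3) by (cases q) auto
  have car: "carrier (integer_mod_group n) = {0..<int n}" "carrier (integer_mod_group \<nu>) = {0..<int \<nu>}"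
    using assms by (simp_all add: carrier_integer_mod_group)
  have cn: "x \<in> carrier (ntors n (integer_mod_group \<nu>)) \<longleftrightarrow> x \<in> {0..<int \<nu>} \<and> int q dvd x" for x
  proof -
    have "int n * x mod int \<nu> = 0 \<longleftrightarrow> int q dvd x"
      using assms(1) by (simp add: q flip: dvd_eq_mod_eq_0)
    then show ?thesis by (simp add: carrier_ntors car)
  qed
  have "integer_mod_group n \<cong> ntors n (integer_mod_group \<nu>)"
  proof (rule isomorphic_by_inverse[where f = "\<lambda>x. x * int q" and g = "\<lambda>y. y div int q"])
    have "x * int q \<in> carrier (ntors n (integer_mod_group \<nu>))" if "x \<in> carrier (integer_mod_group n)" for x
      unfolding cn using that q0 by (simp add: car q)
    moreover have "((x + y) mod int n) * int q = (x * int q + y * int q) mod int \<nu>" for x y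
      by (simp add: q mult_mod_right mult.commute distrib_left)
    ultimately show "(\<lambda>x. x * int q) \<in> hom (integer_mod_group n) (ntors n (integer_mod_group \<nu>))"
      by (intro homI) simp_all
    show "y div int q \<in> carrier (integer_mod_group n)" if "y \<in> carrier (ntors n (integer_mod_group \<nu>))" for y
    proof -
      have y: "int q dvd y" "0 \<le> y" "y < int \<nu>" using that by (simp_all add: cn)
      then obtain t where "y = int q * t" by (elim dvdE)
      note t = this y(2,3)
      then have "0 \<le> t" "t < int n" using q0 by (simp_all add: q zero_le_mult_iff mult.commute)
      then show ?thesis using q0 t(1) by (simp add: car)
    qed
    show "x * int q div int q = x" for x using q0 by simp
    show "y div int q * int q = y" if "y \<in> carrier (ntors n (integer_mod_group \<nu>))" for y
      using that unfolding cn by simp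
  qed
  then show ?thesis by (rule group.iso_sym[rotated]) simp
qed

lemma ntors_DirProd: "ntors n (G \<times>\<times> K) = ntors n G \<times>\<times> ntors n K"
proof -
  have pow: "(x, y) [^]\<^bsub>G \<times>\<times> K\<^esub> k = (x [^]\<^bsub>G\<^esub> k, y [^]\<^bsub>K\<^esub> k)" for x y and k :: nat
    by (induction k) simp_all
  have "carrier (ntors n (G \<times>\<times> K)) = carrier (ntors n G \<times>\<times> ntors n K)"
    by (auto simp: carrier_ntors pow)
  then show ?thesis by (simp add: ntors_def DirProd_def)
qed

definition Sel_group :: "nat \<Rightarrow> nat \<Rightarrow> nat monoid \<Rightarrow> (nat \<times> int) monoid" where
  "Sel_group r \<nu> X = X \<times>\<times> integer_mod_group (if r = 0 then 1 else \<nu>)"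

text \<open>On the support the components are finite groups of prime power exponent, so the number
  of surjections is a product of numbers each depending on one component. Independence turns the
  expectation of this product into a product of expectations, and the symmetric square of
  \<open>H\<close> factors in the same way.\<close>

lemma T_mod_moment:
  assumes \<nu>: "\<nu> > 0" and r: "r \<le> 1"
    and H: "comm_group H" "finite (carrier H)" "expo H (int \<nu>)"
  shows "(\<integral>\<^sup>+X. ennreal (real (card (Surj (Sel_group r \<nu> X) H))) \<partial>measure_pmf (T_mod r \<nu>))
     = ennreal (real (card (carrier (Sym2 H))))"
    and "X \<in> set_pmf (T_mod r \<nu>) \<Longrightarrow> comm_group X \<and> finite (carrier X)"
proof -
  let ?P = "{l. prime l \<and> l dvd \<nu>}"
  define e where "e l = multiplicity l \<nu>" for l
  have P: "?P = prime_factors \<nu>" using \<nu> by (auto simp: prime_factors_dvd)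
  have fP: "finite ?P" unfolding P by simp
  have prod: "(\<Prod>l\<in>?P. l ^ e l) = \<nu>"
    unfolding P e_def using \<nu> by (simp add: prod_prime_factors)
  have dv: "l ^ e l dvd \<nu>" for l by (simp add: e_def multiplicity_dvd)
  let ?PM = "Pi_pmf ?P undefined (\<lambda>l. T_lim r l)"
  let ?X = "\<lambda>T. product_group ?P (\<lambda>l. ntors \<nu> (T l))"
  have supp: "T l \<in> set_pmf (T_lim r l)" if "T \<in> set_pmf ?PM" "l \<in> ?P" for T l
    using that set_Pi_pmf_subset'[OF fP, of undefined "\<lambda>l. T_lim r l"] by (auto simp: PiE_dflt_def)
  have TG: "comm_group (T l)" "finite (carrier (T l))" "\<exists>N. \<forall>x\<in>carrier (T l). x [^]\<^bsub>T l\<^esub> (l ^ N) = \<one>\<^bsub>T l\<^esub>"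
    if "T \<in> set_pmf ?PM" "l \<in> ?P" for T l
    using T_lim_support_group[OF _ r supp[OF that]] that by auto
  have XG: "comm_group (?X T)" "finite (carrier (?X T))" if "T \<in> set_pmf ?PM" for T
  proof -
    show "comm_group (?X T)" using TG(1)[OF that] by (intro comm_group_product_group comm_group_ntors) auto
    have "finite (carrier (ntors \<nu> (T l)))" if "l \<in> ?P" for l
      using TG(2)[OF \<open>T \<in> set_pmf ?PM\<close> that] by (simp add: carrier_ntors)
    then show "finite (carrier (?X T))" using fP by (auto intro: finite_PiE)
  qed
  have Y: "comm_group (iso_rep (?X T))" "?X T \<cong> iso_rep (?X T)" if "T \<in> set_pmf ?PM" for T
    using iso_rep_finite[OF XG[OF that]] by auto
  have exX: "x [^]\<^bsub>?X T\<^esub> \<nu> = \<one>\<^bsub>?X T\<^esub>" if "x \<in> carrier (?X T)" for x T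
    unfolding product_group_nat_pow[OF that] using that by (auto simp: PiE_iff carrier_ntors intro!: restrict_ext)
  have key: "card (Surj (Sel_group r \<nu> (iso_rep (?X T))) H)
      = (\<Prod>l\<in>?P. card (Surj (Sel_comp r l (e l) (T l)) (ntors (l ^ e l) H)))" if T: "T \<in> set_pmf ?PM" for T
  proof -
    let ?Y = "iso_rep (?X T)"
    let ?n = "if r = 0 then 1 else \<nu>"
    let ?G = "Sel_group r \<nu> ?Y"
    have cG: "comm_group ?G" unfolding Sel_group_def by (intro comm_group_DirProd Y(1)[OF T]) simp
    have exG: "expo ?G (int \<nu>)"
    proof -
      have gr: "group (?X T)" "group ?Y" using XG(1)[OF T] Y(1)[OF T] by (auto intro: comm_group.axioms(2))
      obtain \<phi> where "\<phi> \<in> iso (?X T) ?Y" using Y(2)[OF T] by (auto simp: is_iso_def)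
      then have h: "\<phi> \<in> hom (?X T) ?Y" and im: "\<phi> ` carrier (?X T) = carrier ?Y" by (auto simp: iso_def bij_betw_def)
      have "y [^]\<^bsub>?Y\<^esub> \<nu> = \<one>\<^bsub>?Y\<^esub>" if "y \<in> carrier ?Y" for y
      proof -
        have "y \<in> \<phi> ` carrier (?X T)" using that unfolding im .
        then obtain x where x: "x \<in> carrier (?X T)" "y = \<phi> x" by blast
        then show ?thesis using hom_nat_pow[OF h x(1) gr, of \<nu>] exX[OF x(1)] hom_one[OF h gr] by simp
      qed
      then have 1: "carrier (ntors \<nu> ?Y) = carrier ?Y" by (auto simp: carrier_ntors)
      have "z [^]\<^bsub>integer_mod_group ?n\<^esub> \<nu> = \<one>\<^bsub>integer_mod_group ?n\<^esub>" for z by simp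
      then have 2: "carrier (ntors \<nu> (integer_mod_group ?n)) = carrier (integer_mod_group ?n)"
        by (auto simp: carrier_ntors)
      have "carrier (ntors \<nu> ?G) = carrier ?G"
        unfolding Sel_group_def ntors_DirProd carrier_DirProd 1 2 ..
      then show ?thesis unfolding comm_group.expo_nat_iff[OF cG] by (auto simp: carrier_ntors)
    qed
    have "card (Surj ?G H) = (\<Prod>l\<in>?P. card (Surj (ntors (l ^ e l) ?G) (ntors (l ^ e l) H)))"
      using exG H by (intro primary_decomposition(1)[OF fP _ cG]) (auto simp: prod)
    also have "\<dots> = (\<Prod>l\<in>?P. card (Surj (Sel_comp r l (e l) (T l)) (ntors (l ^ e l) H)))"
    proof (rule prod.cong)
      fix l assume l: "l \<in> ?P"
      have lp: "l > 0" using l by (auto simp: prime_gt_0_nat)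
      have gr: "group (?X T)" "group ?Y" "group (ntors (l ^ e l) (T l))" "group (ntors (l ^ e l) ?Y)"
        using XG(1)[OF T] Y(1)[OF T] TG(1)[OF T l] comm_group_ntors by (auto intro: comm_group.axioms(2))
      have gX: "group (ntors (l ^ e l) (?X T))" using comm_group_ntors[OF XG(1)[OF T]] by (rule comm_group.axioms(2))
      have "ntors (l ^ e l) (?X T) \<cong> ntors (l ^ e l) ?Y" by (rule ntors_iso[OF gr(1,2) Y(2)[OF T]])
      then have "ntors (l ^ e l) ?Y \<cong> ntors (l ^ e l) (?X T)" by (rule group.iso_sym[OF gX])
      moreover have "ntors (l ^ e l) (?X T) \<cong> ntors (l ^ e l) (T l)"
        using fP l dv TG(1,3)[OF T] by (intro ntors_product_iso) auto
      ultimately have i1: "ntors (l ^ e l) ?Y \<cong> ntors (l ^ e l) (T l)" using iso_trans by blast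
      let ?k = "if r = 0 then 1 else l ^ e l"
      have i2: "ntors (l ^ e l) (integer_mod_group ?n) \<cong> integer_mod_group ?k"
      proof (cases "r = 0")
        case True
        have "carrier (ntors (l ^ e l) (integer_mod_group 1)) = carrier (integer_mod_group 1)"
          by (auto simp: carrier_ntors)
        then have "ntors (l ^ e l) (integer_mod_group 1) = integer_mod_group 1" by (simp add: ntors_def)
        then show ?thesis using True by (simp add: iso_refl)
      next
        case False
        then show ?thesis using ntors_integer_mod_group[OF _ dv \<nu>] lp by simp
      qed
      have "ntors (l ^ e l) ?G \<cong> Sel_comp r l (e l) (T l)"
        unfolding Sel_group_def Sel_comp_def ntors_DirProd by (rule DirProd_iso[OF gr(4) i1 i2])
      moreover have "group (ntors (l ^ e l) ?G)" using comm_group_ntors[OF cG] by (rule comm_group.axioms(2))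
      moreover have "group (Sel_comp r l (e l) (T l))" unfolding Sel_comp_def by (intro DirProd_group gr) simp
      ultimately show "card (Surj (ntors (l ^ e l) ?G) (ntors (l ^ e l) H)) = card (Surj (Sel_comp r l (e l) (T l)) (ntors (l ^ e l) H))"
        using card_Surj_iso by blast
    qed simp
    finally show ?thesis .
  qed
  have "(\<integral>\<^sup>+X. ennreal (real (card (Surj (Sel_group r \<nu> X) H))) \<partial>measure_pmf (T_mod r \<nu>))
      = (\<integral>\<^sup>+T. ennreal (real (card (Surj (Sel_group r \<nu> (iso_rep (?X T))) H))) \<partial>measure_pmf ?PM)"
    by (simp add: T_mod_def nn_integral_map_pmf)
  also have "\<dots> = (\<integral>\<^sup>+T. (\<Prod>l\<in>?P. ennreal (real (card (Surj (Sel_comp r l (e l) (T l)) (ntors (l ^ e l) H))))) \<partial>measure_pmf ?PM)"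
    by (intro nn_integral_cong_AE AE_pmfI) (simp add: key prod_ennreal)
  also have "\<dots> = (\<Prod>l\<in>?P. \<integral>\<^sup>+K. ennreal (real (card (Surj (Sel_comp r l (e l) K) (ntors (l ^ e l) H)))) \<partial>measure_pmf (T_lim r l))"
    by (rule nn_integral_prod_Pi_pmf[OF fP])
  also have "\<dots> = (\<Prod>l\<in>?P. ennreal (real (card (carrier (Sym2 (ntors (l ^ e l) H))))))"
  proof (rule prod.cong)
    fix l assume l: "l \<in> ?P"
    have cl: "comm_group (ntors (l ^ e l) H)" using H(1) by (rule comm_group_ntors)
    have "expo (ntors (l ^ e l) H) (int (l ^ e l))"
      unfolding comm_group.expo_nat_iff[OF cl] by (simp add: carrier_ntors)
    then show "(\<integral>\<^sup>+K. ennreal (real (card (Surj (Sel_comp r l (e l) K) (ntors (l ^ e l) H)))) \<partial>measure_pmf (T_lim r l))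
        = ennreal (real (card (carrier (Sym2 (ntors (l ^ e l) H)))))"
      using l H(2) by (intro T_lim_Sel_comp r cl) (auto simp: carrier_ntors)
  qed simp
  also have "\<dots> = ennreal (real (card (carrier (Sym2 H))))"
  proof -
    have "card (carrier (Sym2 H)) = (\<Prod>l\<in>?P. card (carrier (Sym2 (ntors (l ^ e l) H))))"
      using H by (intro primary_decomposition(2)[OF fP _ H(1,1)]) (auto simp: prod)
    then show ?thesis by (simp add: prod_ennreal)
  qed
  finally show "(\<integral>\<^sup>+X. ennreal (real (card (Surj (Sel_group r \<nu> X) H))) \<partial>measure_pmf (T_mod r \<nu>))
     = ennreal (real (card (carrier (Sym2 H))))" .
  show "comm_group X \<and> finite (carrier X)" if "X \<in> set_pmf (T_mod r \<nu>)"
  proof -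
    obtain T where T: "T \<in> set_pmf ?PM" "X = iso_rep (?X T)" using \<open>X \<in> set_pmf (T_mod r \<nu>)\<close> by (auto simp: T_mod_def)
    have "finite (carrier (iso_rep (?X T)))"
      using Y(2)[OF T(1)] XG(2)[OF T(1)] by (auto simp: is_iso_def iso_def dest: bij_betw_finite)
    then show ?thesis using Y(1)[OF T(1)] T(2) by simp
  qed
qed

lemma Sel0_moment:
  assumes "\<nu> > 0" "comm_group H" "finite (carrier H)" "expo H (int \<nu>)"
  shows "(\<integral>\<^sup>+G. ennreal (real (card (Surj G H))) \<partial>measure_pmf (Sel0 \<nu>)) = ennreal (real (card (carrier (Sym2 H))))"
proof -
  have "card (Surj (Sel_group 0 \<nu> X) H) = card (Surj X H)" if "X \<in> set_pmf (T_mod 0 \<nu>)" for X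
  proof -
    have "group X" using T_mod_moment(2)[OF assms(1) _ assms(2-4) that] by (auto intro: comm_group.axioms(2))
    then show ?thesis
      using card_Surj_iso[OF DirProd_group _ DirProd_trivial_iso, of X H] by (simp add: Sel_group_def)
  qed
  then have "(\<integral>\<^sup>+G. ennreal (real (card (Surj G H))) \<partial>measure_pmf (T_mod 0 \<nu>))
      = (\<integral>\<^sup>+X. ennreal (real (card (Surj (Sel_group 0 \<nu> X) H))) \<partial>measure_pmf (T_mod 0 \<nu>))"
    by (intro nn_integral_cong_AE AE_pmfI) simp
  then show ?thesis using T_mod_moment(1)[OF assms(1) _ assms(2-4), of 0] by (simp add: Sel0_def)
qed

lemma Sel1_moment:
  assumes "\<nu> > 0" "comm_group H" "finite (carrier H)" "expo H (int \<nu>)"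
  shows "(\<integral>\<^sup>+G. ennreal (real (card (Surj G H))) \<partial>measure_pmf (Sel1 \<nu>)) = ennreal (real (card (carrier (Sym2 H))))"
proof -
  have "card (Surj (Sel_group 1 \<nu> X) H) = card (Surj (iso_rep (X \<times>\<times> integer_mod_group \<nu>)) H)" if "X \<in> set_pmf (T_mod 1 \<nu>)" for X
  proof -
    have X: "comm_group X" "finite (carrier X)" using T_mod_moment(2)[OF assms(1) _ assms(2-4) that] by auto
    have c: "comm_group (X \<times>\<times> integer_mod_group \<nu>)" by (intro comm_group_DirProd X) simp
    moreover have "finite (carrier (X \<times>\<times> integer_mod_group \<nu>))"
      using X assms(1) by (simp add: carrier_integer_mod_group)
    ultimately have "comm_group (iso_rep (X \<times>\<times> integer_mod_group \<nu>))" "X \<times>\<times> integer_mod_group \<nu> \<cong> iso_rep (X \<times>\<times> integer_mod_group \<nu>)"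
      using iso_rep_finite by blast+
    then show ?thesis using card_Surj_iso[OF comm_group.axioms(2)[OF c] comm_group.axioms(2)] by (simp add: Sel_group_def)
  qed
  then have "(\<integral>\<^sup>+X. ennreal (real (card (Surj (iso_rep (X \<times>\<times> integer_mod_group \<nu>)) H))) \<partial>measure_pmf (T_mod 1 \<nu>))
      = (\<integral>\<^sup>+X. ennreal (real (card (Surj (Sel_group 1 \<nu> X) H))) \<partial>measure_pmf (T_mod 1 \<nu>))"
    by (intro nn_integral_cong_AE AE_pmfI) simp
  then show ?thesis
    using T_mod_moment(1)[OF assms(1) _ assms(2-4), of 1] by (simp add: Sel1_def nn_integral_map_pmf)
qed

text \<open>The \<open>n\<close>-fold sum of \<open>x\<close> is the action of the class of
  \<open>n\<close> on \<open>x\<close>, and the class of \<open>\<nu>\<close> is zero in the residue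
  ring.\<close>

lemma module_ZFact_exponent:
  assumes "Module.module (ZFact (int \<nu>)) H"
  shows "comm_group (add_monoid H)" "expo (add_monoid H) (int \<nu>)"
proof -
  interpret M: Module.module "ZFact (int \<nu>)" H by fact
  show cg: "comm_group (add_monoid H)" by (rule M.a_comm_group)
  define I where "I = Idl\<^bsub>\<Z>\<^esub> {int \<nu>}"
  define c where "c n = I +>\<^bsub>\<Z>\<^esub> int n" for n
  interpret I: ideal I \<Z> unfolding I_def by (rule int.genideal_ideal) simp
  have Z: "ZFact (int \<nu>) = \<Z> Quot I" by (simp add: ZFact_def I_def)
  note hom = I.rcos_ring_hom[folded Z]
  have c0: "c 0 = \<zero>\<^bsub>ZFact (int \<nu>)\<^esub>" "c \<nu> = \<zero>\<^bsub>ZFact (int \<nu>)\<^esub>"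
  proof -
    have "int \<nu> \<in> I" unfolding I_def by (rule int.genideal_self') simp
    then show "c 0 = \<zero>\<^bsub>ZFact (int \<nu>)\<^esub>" "c \<nu> = \<zero>\<^bsub>ZFact (int \<nu>)\<^esub>"
      using I.a_rcos_const[of "0"] I.a_rcos_const[of "int \<nu>"] I.zero_closed by (simp_all add: c_def Z FactRing_def)
  qed
  have cc: "c n \<in> carrier (ZFact (int \<nu>))" for n
    unfolding c_def by (rule ring_hom_closed[OF hom]) simp
  have cS: "c (Suc n) = \<one>\<^bsub>ZFact (int \<nu>)\<^esub> \<oplus>\<^bsub>ZFact (int \<nu>)\<^esub> c n" for n
    using ring_hom_add[OF hom, of 1 "int n"] ring_hom_one[OF hom] by (simp add: c_def)
  have "x [^]\<^bsub>add_monoid H\<^esub> n = c n \<odot>\<^bsub>H\<^esub> x" if x: "x \<in> carrier H" for x n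
  proof (induction n)
    case 0
    show ?case using x M.smult_l_null by (simp add: c0)
  next
    case (Suc n)
    then show ?case using x M.smult_l_distr[OF _ cc x, of "\<one>\<^bsub>ZFact (int \<nu>)\<^esub>" n] M.smult_one cc
      by (simp add: cS M.a_comm)
  qed
  then have "x [^]\<^bsub>add_monoid H\<^esub> \<nu> = \<zero>\<^bsub>H\<^esub>" if "x \<in> carrier H" for x
    using that M.smult_l_null by (simp add: c0)
  then show "expo (add_monoid H) (int \<nu>)"
    by (simp add: comm_group.expo_nat_iff[OF cg])
qed

lemma expectation_eq_of_nn_integral:
  assumes "(\<integral>\<^sup>+x. ennreal (f x) \<partial>measure_pmf p) = ennreal c" "c \<ge> 0" "\<And>x. f x \<ge> 0"
  shows "measure_pmf.expectation p f = c"
  using assms by (subst integral_eq_nn_integral) auto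

theorem proposition2p3p1:
  fixes \<nu> :: nat and H :: "(int set, 'a) module"
  assumes "\<nu> > 0"
    and "Module.module (ZFact (int \<nu>)) H"
    and "finite (carrier H)"
  shows "real (card (carrier (Sym2 (add_monoid H))))
           = measure_pmf.expectation (Sel \<nu>) (\<lambda>G. real (card (Surj G (add_monoid H))))
       \<and> measure_pmf.expectation (Sel \<nu>) (\<lambda>G. real (card (Surj G (add_monoid H))))
           = measure_pmf.expectation (Sel0 \<nu>) (\<lambda>G. real (card (Surj G (add_monoid H))))
       \<and> measure_pmf.expectation (Sel0 \<nu>) (\<lambda>G. real (card (Surj G (add_monoid H))))
           = measure_pmf.expectation (Sel1 \<nu>) (\<lambda>G. real (card (Surj G (add_monoid H))))"
proof -
  let ?H = "add_monoid H" and ?c = "real (card (carrier (Sym2 (add_monoid H))))"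
  note H = module_ZFact_exponent[OF assms(2)]
  have fH: "finite (carrier ?H)" using assms(3) by simp
  have 0: "(\<integral>\<^sup>+G. ennreal (real (card (Surj G ?H))) \<partial>measure_pmf (Sel0 \<nu>)) = ennreal ?c"
    by (rule Sel0_moment[OF assms(1) H(1) fH H(2)])
  have 1: "(\<integral>\<^sup>+G. ennreal (real (card (Surj G ?H))) \<partial>measure_pmf (Sel1 \<nu>)) = ennreal ?c"
    by (rule Sel1_moment[OF assms(1) H(1) fH H(2)])
  \<comment> \<open>Both components of the mixture give the value \<open>?c\<close>, so the
    integrand over the coin toss is constant.\<close>
  have "(\<integral>\<^sup>+G. ennreal (real (card (Surj G ?H))) \<partial>measure_pmf (Sel \<nu>)) =
      (\<integral>\<^sup>+b. ennreal ?c \<partial>measure_pmf (bernoulli_pmf (1 / 2)))"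
    unfolding Sel_def nn_integral_bind_pmf by (intro nn_integral_cong) (auto simp: 0 1)
  then have 2: "(\<integral>\<^sup>+G. ennreal (real (card (Surj G ?H))) \<partial>measure_pmf (Sel \<nu>)) = ennreal ?c" by simp
  show ?thesis using 0 1 2 by (simp add: expectation_eq_of_nn_integral)
qed

end
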